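(* Let $A,B$ be algebras over $k$, let $E$ be a bimodule over $A$ and $(\nabla^E,\varphi)$ a bimodule connection on $E$, let $F$ be a bimodule over $B$ and $(\nabla^F,\psi)$ a bimodule connection on $F$, and let $R:B\otimes A\to A\otimes B$ be an invertible twisting map. Let $\tau_{F,A}:F\otimes A\to A\otimes F$ be an invertible right module twisting map satisfying $$(A\otimes\nabla^F)\circ\tau_{F,A}=(\tau_{F,A}\otimes\Omega^1B)\circ(F\otimes\widetilde R)\circ(\nabla^F\otimes A)$$ and let $\tau_{B,E}:B\otimes E\to E\otimes B$ be a left module twisting map satisfying $$(\nabla^E\otimes B)\circ\tau_{B,E}=(E\otimes\widetilde R)\circ(\tau_{B,E}\otimes\Omega^1A)\circ(B\otimes\nabla^E),$$ and such that $(E\otimes B)\oplus(A\otimes F)$ is an $(A\otimes_RB)$-bimodule with the right action $(e\otimes b,a\otimes f)\cdot(\alpha\otimes\beta)=(e\alpha_R\otimes b_R\beta,\ a\alpha_\tau\otimes f_\tau\beta)$ and the left action $(\alpha\otimes\beta)\cdot(e\otimes b,a\otimes f)=(\alpha e_\tau\otimes\beta_\tau b,\ \alpha a_R\otimes\beta_Rf)$. Assume also that $$(\varphi\otimes B)\circ(\Omega^1A\otimes\tau_{B,E})\circ(\widetilde R\otimes E)=(E\otimes\widetilde R)\circ(\tau_{B,E}\otimes\Omega^1A)\circ(B\otimes\varphi)$$ on $B\otimes\Omega^1A\otimes E$, and $$(A\otimes\psi)\circ(\widetilde R\otimes F)\circ(\Omega^1B\otimes\tau_{F,A})=(\tau_{F,A}\otimes\Omega^1B)\circ(F\otimes\widetilde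 R)\circ(\psi\otimes A)$$ on $\Omega^1B\otimes F\otimes A$. Then the product connection $\nabla$ of $\nabla^E$ and $\nabla^F$ is a bimodule connection on the $(A\otimes_RB)$-bimodule $(E\otimes B)\oplus(A\otimes F)$ (for the differential calculus $\Omega A\otimes_{\widetilde R}\Omega B$) with respect to the morphism $\xi=\xi_{11}+\xi_{12}+\xi_{21}+\xi_{22}$ defined in the context.
   Context: All algebras are associative unital over a field $k$; $\otimes=\otimes_k$; an object's name also denotes its identity map; $\mu_D$ is the multiplication of an algebra $D$. $\Omega A=\bigoplus_p\Omega^pA$, with differential $d_A$, is the universal differential graded algebra of $A$ (similarly for $B$). Given a differential calculus $(\Omega D,d)$ over an algebra $D$ (a differential graded algebra generated, as such, by $\Omega^0D=D$), a right connection on a right $D$-module $M$ is a linear map $\nabla:M\to M\otimes_D\Omega^1D$ with $\nabla(m\cdot x)=(\nabla m)\cdot x+m\otimes dx$. A (right) bimodule connection on a $D$-bimodule $M$ is a right connection $\nabla$ on $M$ together with a bimodule homomorphism $\sigma:\Omega^1D\otimes_DM\to M\otimes_D\Omega^1D$ such that $\nabla(xm)=x\nabla(m)+\sigma(dx\otimes_Dm)$ for $x\in D$, $m\in M$; one says it is a bimodule connection with respect to $\sigma$. So $\varphi:\Omega^1A\otimes_AE\to E\otimes_A\Omega^1A$ and $\psi:\Omega^1B\otimes_BF\to F\otimes_B\Omega^1B$. A twisting map is a linear map $R:B\otimes A\to A\otimes B$ with $R(b\otimes1)=1\otimes b$, $R(1\otimes a)=a\otimes1$, $R\circ(B\otimes\mu_A)=(\mu_A\otimes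 B)\circ(A\otimes R)\circ(R\otimes A)$ and $R\circ(\mu_B\otimes A)=(A\otimes\mu_B)\circ(R\otimes B)\circ(B\otimes R)$. Write $R(b\otimes a)=a_R\otimes b_R$ (summation omitted). The twisted tensor product $A\otimes_RB$ is $A\otimes B$ with product $(a\otimes b)(a'\otimes b')=aa'_R\otimes b_Rb'$. Any twisting map $R$ extends uniquely to a twisting map $\widetilde R:\Omega B\otimes\Omega A\to\Omega A\otimes\Omega B$ with $\widetilde R\circ(d_B\otimes\Omega A)=(\varepsilon_A\otimes d_B)\circ\widetilde R$ and $\widetilde R\circ(\Omega B\otimes d_A)=(d_A\otimes\varepsilon_B)\circ\widetilde R$, where $\varepsilon(\omega)=(-1)^{|\omega|}\omega$. Then $\Omega A\otimes_{\widetilde R}\Omega B$, with differential $d(\varphi\otimes\omega)=d_A\varphi\otimes\omega+(-1)^{|\varphi|}\varphi\otimes d_B\omega$ (here $\varphi$ and $\omega$ denote forms), is a differential calculus over $A\otimes_RB$ whose module of 1-forms is $\Omega^1A\otimes B\oplus A\otimes\Omega^1B$. A right module twisting map for a right $B$-module $F$ with action $\rho:F\otimes B\to F$ is a linear map $\tau_{F,A}:F\otimes A\to A\otimes F$, written $\tau_{F,A}(f\otimes a)=a_\tau\otimes f_\tau$, with $\tau_{F,A}\circ(F\otimes\mu_A)=(\mu_A\otimes F)\circ(A\otimes\tau_{F,A})\circ(\tau_{F,A}\otimes A)$ and $\tau_{F,A}\circ(\rho\otimes A)=(A\otimes\rho)\circ(\tau_{F,A}\otimes B)\circ(F\otimes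 R)$. A left module twisting map for a left $A$-module $E$ with action $\lambda:A\otimes E\to E$ is a linear map $\tau_{B,E}:B\otimes E\to E\otimes B$, written $\tau_{B,E}(b\otimes e)=e_\tau\otimes b_\tau$, with $\tau_{B,E}\circ(\mu_B\otimes E)=(E\otimes\mu_B)\circ(\tau_{B,E}\otimes B)\circ(B\otimes\tau_{B,E})$ and $\tau_{B,E}\circ(B\otimes\lambda)=(\lambda\otimes B)\circ(A\otimes\tau_{B,E})\circ(R\otimes E)$. In the displayed compatibility conditions, composites involving $\widetilde R,\tau_{F,A},\tau_{B,E}$ on $F\otimes_B\Omega^1B\otimes A$ and $B\otimes E\otimes_A\Omega^1A$ are computed on representatives, with values in $A\otimes F\otimes_B\Omega^1B$ and $E\otimes_A\Omega^1A\otimes B$; $\varphi$ and $\psi$ are precomposed with the projections $\Omega^1A\otimes E\to\Omega^1A\otimes_AE$ and $\Omega^1B\otimes F\to\Omega^1B\otimes_BF$. Product connection. Let $\sigma_{A,F}=\tau_{F,A}^{-1}$, written $\sigma_{A,F}(a\otimes f)=f_\sigma\otimes a_\sigma$. The product connection is the right connection $\nabla$ on $E\otimes B\oplus A\otimes F$ given by $\nabla(e\otimes b,a\otimes f)=\nabla_1(e\otimes b)+\nabla_2(a\otimes f)$, with $$\nabla_1(e\otimes b)=\sum_i(e_i\otimes1)\otimes(d_Aa_i\otimes b)+(e\otimes1)\otimes(1\otimes d_Bb),\qquad \nabla^E(e)=\sum_ie_i\otimes_Ad_Aa_i,$$ $$\nabla_2(a\otimes f)=\sum_k(a\otimes f_k)\otimes(1\otimes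 d_Bb_k)+(1\otimes f_\sigma)\otimes(d_A(a_\sigma)\otimes1),\qquad \nabla^F(f)=\sum_kf_k\otimes_Bd_Bb_k,$$ middle tensor products being over $A\otimes_RB$. The map $\xi:(\Omega^1A\otimes B\oplus A\otimes\Omega^1B)\otimes_{A\otimes_RB}(E\otimes B\oplus A\otimes F)\to(E\otimes B\oplus A\otimes F)\otimes_{A\otimes_RB}(\Omega^1A\otimes B\oplus A\otimes\Omega^1B)$ is $\xi=\xi_{11}+\xi_{12}+\xi_{21}+\xi_{22}$, where each $\xi_{ij}$ is the linear map defined on the corresponding one of the four summands of the domain (and zero on the other three) by $$\xi_{11}\big((d_A\alpha\otimes\beta)\otimes(e\otimes b)\big)=((e_\tau)_\varphi\otimes1)\otimes((d_A\alpha)_\varphi\otimes\beta_\tau b),$$ $$\xi_{12}\big((\alpha\otimes d_B\beta)\otimes(e\otimes b)\big)=(\alpha e_\tau\otimes1)\otimes(1\otimes d_B(\beta_\tau)b),$$ $$\xi_{21}\big((d_A\alpha\otimes\beta)\otimes(a\otimes f)\big)=(1\otimes(\beta f_\sigma)_{\bar\sigma})\otimes(d_A(\alpha_{\bar\sigma})a_\sigma\otimes1),$$ $$\xi_{22}\big((\alpha\otimes d_B\beta)\otimes(a\otimes f)\big)=(\alpha a_R\otimes f_\psi)\otimes(1\otimes(d_B(\beta_R))_\psi),$$ with middle tensor products over $A\otimes_RB$, $\varphi(\omega\otimes_Ae)=e_\varphi\otimes_A\omega_\varphi$, $\psi(\eta\otimes_Bf)=f_\psi\otimes_B\eta_\psi$,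 and $\bar\sigma$ another copy of $\sigma_{A,F}$. (The displayed elements span the respective summands over $k$.) *)

theory Defs
  imports "HOL-Algebra.Module" "HOL-Library.Poly_Mapping"
begin

section \<open>Algebras, bimodules, linear maps\<close>

text \<open>
  Vector spaces over the field \<open>k\<close> are HOL-Algebra modules over \<open>k\<close>; only their additive structure
  and scalar multiplication are meaningful, the inherited ring fields \<open>mult\<close> and \<open>one\<close> are left
  \<open>undefined\<close>.  The zero algebra is allowed.
\<close>

definition k_algebra :: "'k ring \<Rightarrow> ('k, 'a, 'z) module_scheme \<Rightarrow> bool" where
  "k_algebra k A \<longleftrightarrow> ring A \<and> Module.module k A \<and>
     (\<forall>c \<in> carrier k. \<forall>a \<in> carrier A. \<forall>b \<in> carrier A.
        (c \<odot>\<^bsub>A\<^esub> a) \<otimes>\<^bsub>A\<^esub> b = c \<odot>\<^bsub>A\<^esub> (a \<otimes>\<^bsub>A\<^esub> b) \<and>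
        a \<otimes>\<^bsub>A\<^esub> (c \<odot>\<^bsub>A\<^esub> b) = c \<odot>\<^bsub>A\<^esub> (a \<otimes>\<^bsub>A\<^esub> b))"

record ('k, 'd, 'm) bimod = "('k, 'm) module" +
  lact :: "'d \<Rightarrow> 'm \<Rightarrow> 'm"
  ract :: "'m \<Rightarrow> 'd \<Rightarrow> 'm"

definition bimodule ::
  "'k ring \<Rightarrow> ('k, 'd, 'y) module_scheme \<Rightarrow> ('k, 'd, 'm, 'z) bimod_scheme \<Rightarrow> bool" where
  "bimodule k D M \<longleftrightarrow> Module.module k M \<and>
     (\<forall>x \<in> carrier D. \<forall>m \<in> carrier M. lact M x m \<in> carrier M \<and> ract M m x \<in> carrier M) \<and>
     (\<forall>x \<in> carrier D. \<forall>m \<in> carrier M. \<forall>n \<in> carrier M.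
        lact M x (m \<oplus>\<^bsub>M\<^esub> n) = lact M x m \<oplus>\<^bsub>M\<^esub> lact M x n \<and>
        ract M (m \<oplus>\<^bsub>M\<^esub> n) x = ract M m x \<oplus>\<^bsub>M\<^esub> ract M n x) \<and>
     (\<forall>x \<in> carrier D. \<forall>y \<in> carrier D. \<forall>m \<in> carrier M.
        lact M (x \<oplus>\<^bsub>D\<^esub> y) m = lact M x m \<oplus>\<^bsub>M\<^esub> lact M y m \<and>
        ract M m (x \<oplus>\<^bsub>D\<^esub> y) = ract M m x \<oplus>\<^bsub>M\<^esub> ract M m y \<and>
        lact M (x \<otimes>\<^bsub>D\<^esub> y) m = lact M x (lact M y m) \<and>
        ract M m (x \<otimes>\<^bsub>D\<^esub> y) = ract M (ract M m x) y \<and>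
        ract M (lact M x m) y = lact M x (ract M m y)) \<and>
     (\<forall>m \<in> carrier M. lact M \<one>\<^bsub>D\<^esub> m = m \<and> ract M m \<one>\<^bsub>D\<^esub> = m) \<and>
     (\<forall>c \<in> carrier k. \<forall>x \<in> carrier D. \<forall>m \<in> carrier M.
        lact M (c \<odot>\<^bsub>D\<^esub> x) m = c \<odot>\<^bsub>M\<^esub> lact M x m \<and>
        lact M x (c \<odot>\<^bsub>M\<^esub> m) = c \<odot>\<^bsub>M\<^esub> lact M x m \<and>
        ract M m (c \<odot>\<^bsub>D\<^esub> x) = c \<odot>\<^bsub>M\<^esub> ract M m x \<and>
        ract M (c \<odot>\<^bsub>M\<^esub> m) x = c \<odot>\<^bsub>M\<^esub> ract M m x)"

definition linear_map ::
  "'k ring \<Rightarrow> ('k, 'm, 'y) module_scheme \<Rightarrow> ('k, 'n, 'z) module_scheme \<Rightarrow> ('m \<Rightarrow> 'n) \<Rightarrow> bool" where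
  "linear_map k M N f \<longleftrightarrow> f \<in> carrier M \<rightarrow> carrier N \<and>
     (\<forall>x \<in> carrier M. \<forall>y \<in> carrier M. f (x \<oplus>\<^bsub>M\<^esub> y) = f x \<oplus>\<^bsub>N\<^esub> f y) \<and>
     (\<forall>c \<in> carrier k. \<forall>x \<in> carrier M. f (c \<odot>\<^bsub>M\<^esub> x) = c \<odot>\<^bsub>N\<^esub> f x)"

definition bimodule_hom ::
  "'k ring \<Rightarrow> ('k, 'd, 'x) module_scheme \<Rightarrow> ('k, 'd, 'm, 'y) bimod_scheme \<Rightarrow>
   ('k, 'd, 'n, 'z) bimod_scheme \<Rightarrow> ('m \<Rightarrow> 'n) \<Rightarrow> bool" where
  "bimodule_hom k D M N f \<longleftrightarrow> linear_map k M N f \<and>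
     (\<forall>x \<in> carrier D. \<forall>m \<in> carrier M.
        f (lact M x m) = lact N x (f m) \<and> f (ract M m x) = ract N (f m) x)"

definition dsum ::
  "('k, 'm, 'y) module_scheme \<Rightarrow> ('k, 'n, 'z) module_scheme \<Rightarrow> ('k, 'm \<times> 'n) module" where
  "dsum M N = \<lparr>carrier = carrier M \<times> carrier N, mult = undefined, one = undefined,
     zero = (\<zero>\<^bsub>M\<^esub>, \<zero>\<^bsub>N\<^esub>),
     add = (\<lambda>(m, n) (m', n'). (m \<oplus>\<^bsub>M\<^esub> m', n \<oplus>\<^bsub>N\<^esub> n')),
     smult = (\<lambda>c (m, n). (c \<odot>\<^bsub>M\<^esub> m, c \<odot>\<^bsub>N\<^esub> n))\<rparr>"


section \<open>Tensor products\<close>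

text \<open>
  \<open>'x \<Rightarrow>\<^sub>0 int\<close> is the free abelian group on \<open>'x\<close>, with generators \<open>frag_of x\<close>.  Both the universal
  differential graded algebra and the tensor products are quotients of such groups by a subgroup
  \<open>K\<close>; their elements are the cosets.
\<close>

definition coset :: "('x \<Rightarrow>\<^sub>0 int) set \<Rightarrow> ('x \<Rightarrow>\<^sub>0 int) \<Rightarrow> ('x \<Rightarrow>\<^sub>0 int) set" where
  "coset K x = {y. y - x \<in> K}"

definition coset_add ::
  "('x \<Rightarrow>\<^sub>0 int) set \<Rightarrow> ('x \<Rightarrow>\<^sub>0 int) set \<Rightarrow> ('x \<Rightarrow>\<^sub>0 int) set" where
  "coset_add X Y = {x + y | x y. x \<in> X \<and> y \<in> Y}"

text \<open>The map induced on the quotient by the additive map that sends the generator \<open>p\<close> to \<open>f p\<close>.\<close>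

definition coset_map ::
  "('x \<Rightarrow>\<^sub>0 int) set \<Rightarrow> ('x \<Rightarrow> 'x \<Rightarrow>\<^sub>0 int) \<Rightarrow> ('x \<Rightarrow>\<^sub>0 int) set \<Rightarrow> ('x \<Rightarrow>\<^sub>0 int) set" where
  "coset_map K f X = (\<Union>x \<in> X. coset K (frag_extend f x))"

type_synonym ('m, 'n) tens = "(('m \<times> 'n) \<Rightarrow>\<^sub>0 int) set"

text \<open>
  \<open>tens_null M N S r l\<close> is generated by the relations of biadditivity and
  \<open>m s \<otimes> n = m \<otimes> s n\<close> for \<open>s \<in> S\<close>, where \<open>m s = r m s\<close> and \<open>s n = l s n\<close>.
\<close>

inductive_set tens_null ::
  "('k, 'm, 'y) module_scheme \<Rightarrow> ('k, 'n, 'z) module_scheme \<Rightarrow> 's set \<Rightarrow>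
   ('m \<Rightarrow> 's \<Rightarrow> 'm) \<Rightarrow> ('s \<Rightarrow> 'n \<Rightarrow> 'n) \<Rightarrow> (('m \<times> 'n) \<Rightarrow>\<^sub>0 int) set"
  for M N S r l where
  zero: "0 \<in> tens_null M N S r l"
| diff: "\<lbrakk>x \<in> tens_null M N S r l; y \<in> tens_null M N S r l\<rbrakk> \<Longrightarrow> x - y \<in> tens_null M N S r l"
| add_left: "\<lbrakk>m \<in> carrier M; m' \<in> carrier M; n \<in> carrier N\<rbrakk> \<Longrightarrow>
    frag_of (m \<oplus>\<^bsub>M\<^esub> m', n) - frag_of (m, n) - frag_of (m', n) \<in> tens_null M N S r l"
| add_right: "\<lbrakk>m \<in> carrier M; n \<in> carrier N; n' \<in> carrier N\<rbrakk> \<Longrightarrow>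
    frag_of (m, n \<oplus>\<^bsub>N\<^esub> n') - frag_of (m, n) - frag_of (m, n') \<in> tens_null M N S r l"
| balanced: "\<lbrakk>m \<in> carrier M; s \<in> S; n \<in> carrier N\<rbrakk> \<Longrightarrow>
    frag_of (r m s, n) - frag_of (m, l s n) \<in> tens_null M N S r l"

definition tens_space ::
  "('k, 'm, 'y) module_scheme \<Rightarrow> ('k, 'n, 'z) module_scheme \<Rightarrow> (('m \<times> 'n) \<Rightarrow>\<^sub>0 int) set \<Rightarrow>
   ('k, ('m, 'n) tens) module" where
  "tens_space M N K = \<lparr>
     carrier = coset K ` {x. Poly_Mapping.keys x \<subseteq> carrier M \<times> carrier N},
     mult = undefined, one = undefined,
     zero = K, add = coset_add,
     smult = (\<lambda>c. coset_map K (\<lambda>(m, n). frag_of (c \<odot>\<^bsub>M\<^esub> m, n)))\<rparr>"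

text \<open>Tensor product \<open>M \<otimes> N\<close> over the field \<open>k\<close>, with pure tensors \<open>tns k M N m n\<close>.\<close>

definition tnull ::
  "'k ring \<Rightarrow> ('k, 'm, 'y) module_scheme \<Rightarrow> ('k, 'n, 'z) module_scheme \<Rightarrow> (('m \<times> 'n) \<Rightarrow>\<^sub>0 int) set" where
  "tnull k M N = tens_null M N (carrier k) (\<lambda>m c. c \<odot>\<^bsub>M\<^esub> m) (\<lambda>c n. c \<odot>\<^bsub>N\<^esub> n)"

definition tensor ::
  "'k ring \<Rightarrow> ('k, 'm, 'y) module_scheme \<Rightarrow> ('k, 'n, 'z) module_scheme \<Rightarrow> ('k, ('m, 'n) tens) module" where
  "tensor k M N = tens_space M N (tnull k M N)"

definition tns ::
  "'k ring \<Rightarrow> ('k, 'm, 'y) module_scheme \<Rightarrow> ('k, 'n, 'z) module_scheme \<Rightarrow> 'm \<Rightarrow> 'n \<Rightarrow> ('m, 'n) tens" where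
  "tns k M N m n = coset (tnull k M N) (frag_of (m, n))"

text \<open>
  Tensor product \<open>M \<otimes>\<^sub>D N\<close> of \<open>D\<close>-bimodules, with pure tensors \<open>tns_over D M N m n\<close>.  As \<open>D\<close> is a
  unital algebra, \<open>D\<close>-balanced implies \<open>k\<close>-balanced.
\<close>

definition tnull_over ::
  "('k, 'd, 'x) module_scheme \<Rightarrow> ('k, 'd, 'm, 'y) bimod_scheme \<Rightarrow> ('k, 'd, 'n, 'z) bimod_scheme \<Rightarrow>
   (('m \<times> 'n) \<Rightarrow>\<^sub>0 int) set" where
  "tnull_over D M N = tens_null M N (carrier D) (ract M) (lact N)"

definition tensor_over ::
  "('k, 'd, 'x) module_scheme \<Rightarrow> ('k, 'd, 'm, 'y) bimod_scheme \<Rightarrow> ('k, 'd, 'n, 'z) bimod_scheme \<Rightarrow>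
   ('k, 'd, ('m, 'n) tens) bimod" where
  "tensor_over D M N = module.extend (tens_space M N (tnull_over D M N))
     \<lparr>lact = (\<lambda>x. coset_map (tnull_over D M N) (\<lambda>(m, n). frag_of (lact M x m, n))),
      ract = (\<lambda>X x. coset_map (tnull_over D M N) (\<lambda>(m, n). frag_of (m, ract N n x)) X)\<rparr>"

definition tns_over ::
  "('k, 'd, 'x) module_scheme \<Rightarrow> ('k, 'd, 'm, 'y) bimod_scheme \<Rightarrow> ('k, 'd, 'n, 'z) bimod_scheme \<Rightarrow>
   'm \<Rightarrow> 'n \<Rightarrow> ('m, 'n) tens" where
  "tns_over D M N m n = coset (tnull_over D M N) (frag_of (m, n))"

text \<open>
  \<open>tbind W X f\<close> is \<open>\<Sum>\<^sub>i f m\<^sub>i n\<^sub>i \<in> W\<close>, where \<open>X = \<Sum>\<^sub>i m\<^sub>i \<otimes> n\<^sub>i\<close>: the image of \<open>X\<close> under the additive map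
  induced by the balanced map \<open>f\<close>, computed on representatives (the value common to all of them).
  It renders Sweedler-type notation: \<open>a\<^sub>R \<otimes> b\<^sub>R\<close> for \<open>R(b \<otimes> a)\<close> becomes
  \<open>tbind W (R (b \<otimes> a)) (\<lambda>a\<^sub>R b\<^sub>R. \<dots>)\<close>.  Identities between composites of maps on iterated tensor
  products are stated below in this form, on pure tensors.
\<close>

definition frag_eval ::
  "('k, 'w, 'z) module_scheme \<Rightarrow> ('m \<Rightarrow> 'n \<Rightarrow> 'w) \<Rightarrow> (('m \<times> 'n) \<Rightarrow>\<^sub>0 int) \<Rightarrow> 'w" where
  "frag_eval W f x =
     finsum W (\<lambda>(m, n). add_pow W (Poly_Mapping.lookup x (m, n)) (f m n)) (Poly_Mapping.keys x)"

definition tbind ::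
  "('k, 'w, 'z) module_scheme \<Rightarrow> ('m, 'n) tens \<Rightarrow> ('m \<Rightarrow> 'n \<Rightarrow> 'w) \<Rightarrow> 'w" where
  "tbind W X f = (THE w. \<forall>x \<in> X. frag_eval W f x = w)"


section \<open>The universal differential graded algebra\<close>

text \<open>
  A graded algebra with differential; \<open>dga_deg \<Gamma> p\<close> is the homogeneous component of degree \<open>p\<close>.
\<close>

record ('k, 'w) dga = "('k, 'w) module" +
  dga_deg :: "nat \<Rightarrow> 'w set"
  dga_diff :: "'w \<Rightarrow> 'w"

text \<open>
  \<open>\<Omega>A\<close> is presented by generators \<open>a\<close> (\<open>Fn a\<close>) and \<open>d a\<close> (\<open>Df a\<close>) for \<open>a \<in> A\<close>, subject to the relations
  saying that \<open>a \<mapsto> Fn a\<close> is a unital ring homomorphism and that \<open>a \<mapsto> Df a\<close> is a \<open>k\<close>-linear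
  derivation; elements of the free ring on the generators are integer combinations of words.
\<close>

datatype 'a gen = Fn 'a | Df 'a

type_synonym 'a forms = "('a gen list \<Rightarrow>\<^sub>0 int) set"

definition words :: "('k, 'a, 'z) module_scheme \<Rightarrow> 'a gen list set" where
  "words A = lists (Fn ` carrier A \<union> Df ` carrier A)"

inductive_set Omega_null :: "'k ring \<Rightarrow> ('k, 'a, 'z) module_scheme \<Rightarrow> ('a gen list \<Rightarrow>\<^sub>0 int) set"
  for k A where
  zero: "0 \<in> Omega_null k A"
| diff: "\<lbrakk>x \<in> Omega_null k A; y \<in> Omega_null k A\<rbrakk> \<Longrightarrow> x - y \<in> Omega_null k A"
| fn_add: "\<lbrakk>u \<in> words A; v \<in> words A; a \<in> carrier A; b \<in> carrier A\<rbrakk> \<Longrightarrow>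
    frag_of (u @ [Fn (a \<oplus>\<^bsub>A\<^esub> b)] @ v) - frag_of (u @ [Fn a] @ v) - frag_of (u @ [Fn b] @ v)
      \<in> Omega_null k A"
| fn_mult: "\<lbrakk>u \<in> words A; v \<in> words A; a \<in> carrier A; b \<in> carrier A\<rbrakk> \<Longrightarrow>
    frag_of (u @ [Fn (a \<otimes>\<^bsub>A\<^esub> b)] @ v) - frag_of (u @ [Fn a, Fn b] @ v) \<in> Omega_null k A"
| fn_one: "\<lbrakk>u \<in> words A; v \<in> words A\<rbrakk> \<Longrightarrow>
    frag_of (u @ [Fn \<one>\<^bsub>A\<^esub>] @ v) - frag_of (u @ v) \<in> Omega_null k A"
| df_add: "\<lbrakk>u \<in> words A; v \<in> words A; a \<in> carrier A; b \<in> carrier A\<rbrakk> \<Longrightarrow>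
    frag_of (u @ [Df (a \<oplus>\<^bsub>A\<^esub> b)] @ v) - frag_of (u @ [Df a] @ v) - frag_of (u @ [Df b] @ v)
      \<in> Omega_null k A"
| df_smult: "\<lbrakk>u \<in> words A; v \<in> words A; c \<in> carrier k; a \<in> carrier A\<rbrakk> \<Longrightarrow>
    frag_of (u @ [Df (c \<odot>\<^bsub>A\<^esub> a)] @ v) - frag_of (u @ [Fn (c \<odot>\<^bsub>A\<^esub> \<one>\<^bsub>A\<^esub>), Df a] @ v)
      \<in> Omega_null k A"
| df_mult: "\<lbrakk>u \<in> words A; v \<in> words A; a \<in> carrier A; b \<in> carrier A\<rbrakk> \<Longrightarrow>
    frag_of (u @ [Df (a \<otimes>\<^bsub>A\<^esub> b)] @ v) - frag_of (u @ [Df a, Fn b] @ v)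
      - frag_of (u @ [Fn a, Df b] @ v) \<in> Omega_null k A"

fun wdeg :: "'a gen list \<Rightarrow> nat" where
  "wdeg [] = 0"
| "wdeg (Fn a # w) = wdeg w"
| "wdeg (Df a # w) = Suc (wdeg w)"

definition word_mult ::
  "('a gen list \<Rightarrow>\<^sub>0 int) \<Rightarrow> ('a gen list \<Rightarrow>\<^sub>0 int) \<Rightarrow> ('a gen list \<Rightarrow>\<^sub>0 int)" where
  "word_mult x y = frag_extend (\<lambda>u. frag_extend (\<lambda>v. frag_of (u @ v)) y) x"

text \<open>The graded derivation with \<open>Fn a \<mapsto> Df a\<close> and \<open>Df a \<mapsto> 0\<close>.\<close>

fun word_diff :: "'a gen list \<Rightarrow> ('a gen list \<Rightarrow>\<^sub>0 int)" where
  "word_diff [] = 0"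
| "word_diff (Fn a # w) = frag_of (Df a # w) + word_mult (frag_of [Fn a]) (word_diff w)"
| "word_diff (Df a # w) = - word_mult (frag_of [Df a]) (word_diff w)"

definition Omega :: "'k ring \<Rightarrow> ('k, 'a, 'z) module_scheme \<Rightarrow> ('k, 'a forms) dga" where
  "Omega k A = (let K = Omega_null k A in \<lparr>
     carrier = coset K ` {x. Poly_Mapping.keys x \<subseteq> words A},
     mult = (\<lambda>X Y. \<Union>x \<in> X. \<Union>y \<in> Y. coset K (word_mult x y)),
     one = coset K (frag_of []),
     zero = K, add = coset_add,
     smult = (\<lambda>c. coset_map K (\<lambda>w. frag_of (Fn (c \<odot>\<^bsub>A\<^esub> \<one>\<^bsub>A\<^esub>) # w))),
     dga_deg = (\<lambda>p. coset K ` {x. Poly_Mapping.keys x \<subseteq> {w \<in> words A. wdeg w = p}}),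
     dga_diff = coset_map K word_diff\<rparr>)"

text \<open>The canonical isomorphism \<open>A \<rightarrow> \<Omega>\<^sup>0A\<close>.\<close>

definition iota :: "'k ring \<Rightarrow> ('k, 'a, 'z) module_scheme \<Rightarrow> 'a \<Rightarrow> 'a forms" where
  "iota k A a = coset (Omega_null k A) (frag_of [Fn a])"

text \<open>\<open>\<epsilon> \<omega> = (-1)\<^bsup>|\<omega>|\<^esup> \<omega>\<close> for homogeneous \<open>\<omega>\<close>.\<close>

definition Omega_eps :: "'k ring \<Rightarrow> ('k, 'a, 'z) module_scheme \<Rightarrow> 'a forms \<Rightarrow> 'a forms" where
  "Omega_eps k A = coset_map (Omega_null k A) (\<lambda>w. frag_cmul ((-1) ^ wdeg w) (frag_of w))"

text \<open>The projection \<open>\<Omega>A \<rightarrow> \<Omega>\<^sup>pA\<close>, and the projection \<open>\<Omega>A \<rightarrow> \<Omega>\<^sup>0A = A\<close>.\<close>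

definition Omega_proj :: "'k ring \<Rightarrow> ('k, 'a, 'z) module_scheme \<Rightarrow> nat \<Rightarrow> 'a forms \<Rightarrow> 'a forms" where
  "Omega_proj k A p = coset_map (Omega_null k A) (\<lambda>w. if wdeg w = p then frag_of w else 0)"

definition Omega_base :: "'k ring \<Rightarrow> ('k, 'a, 'z) module_scheme \<Rightarrow> 'a forms \<Rightarrow> 'a" where
  "Omega_base k A X = inv_into (carrier A) (iota k A) (Omega_proj k A 0 X)"


section \<open>Connections\<close>

text \<open>
  A differential calculus over \<open>D\<close> is given by a differential graded algebra \<open>\<Gamma>\<close> and the map
  \<open>j\<close> identifying \<open>D\<close> with the component of degree \<open>0\<close>.  \<open>one_forms \<Gamma> j\<close> is its
  \<open>D\<close>-bimodule of forms of degree \<open>1\<close>.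
\<close>

definition one_forms :: "('k, 'w, 'z) dga_scheme \<Rightarrow> ('d \<Rightarrow> 'w) \<Rightarrow> ('k, 'd, 'w) bimod" where
  "one_forms \<Gamma> j = \<lparr>carrier = dga_deg \<Gamma> 1, mult = undefined, one = undefined,
     zero = \<zero>\<^bsub>\<Gamma>\<^esub>, add = add \<Gamma>, smult = smult \<Gamma>,
     lact = (\<lambda>x \<omega>. j x \<otimes>\<^bsub>\<Gamma>\<^esub> \<omega>), ract = (\<lambda>\<omega> x. \<omega> \<otimes>\<^bsub>\<Gamma>\<^esub> j x)\<rparr>"

definition right_connection ::
  "'k ring \<Rightarrow> ('k, 'd, 'x) module_scheme \<Rightarrow> ('k, 'w, 'y) dga_scheme \<Rightarrow> ('d \<Rightarrow> 'w) \<Rightarrow>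
   ('k, 'd, 'm, 'z) bimod_scheme \<Rightarrow> ('m \<Rightarrow> ('m, 'w) tens) \<Rightarrow> bool" where
  "right_connection k D \<Gamma> j M nab \<longleftrightarrow>
     linear_map k M (tensor_over D M (one_forms \<Gamma> j)) nab \<and>
     (\<forall>m \<in> carrier M. \<forall>x \<in> carrier D.
        nab (ract M m x) =
          ract (tensor_over D M (one_forms \<Gamma> j)) (nab m) x
            \<oplus>\<^bsub>tensor_over D M (one_forms \<Gamma> j)\<^esub>
          tns_over D M (one_forms \<Gamma> j) m (dga_diff \<Gamma> (j x)))"

definition bimodule_connection ::
  "'k ring \<Rightarrow> ('k, 'd, 'x) module_scheme \<Rightarrow> ('k, 'w, 'y) dga_scheme \<Rightarrow> ('d \<Rightarrow> 'w) \<Rightarrow>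
   ('k, 'd, 'm, 'z) bimod_scheme \<Rightarrow> ('m \<Rightarrow> ('m, 'w) tens) \<Rightarrow>
   (('w, 'm) tens \<Rightarrow> ('m, 'w) tens) \<Rightarrow> bool" where
  "bimodule_connection k D \<Gamma> j M nab \<sigma> \<longleftrightarrow>
     right_connection k D \<Gamma> j M nab \<and>
     bimodule_hom k D (tensor_over D (one_forms \<Gamma> j) M) (tensor_over D M (one_forms \<Gamma> j)) \<sigma> \<and>
     (\<forall>x \<in> carrier D. \<forall>m \<in> carrier M.
        nab (lact M x m) =
          lact (tensor_over D M (one_forms \<Gamma> j)) x (nab m)
            \<oplus>\<^bsub>tensor_over D M (one_forms \<Gamma> j)\<^esub>
          \<sigma> (tns_over D (one_forms \<Gamma> j) M (dga_diff \<Gamma> (j x)) m))"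


section \<open>Twisting maps and the twisted tensor product\<close>

definition twisting_map ::
  "'k ring \<Rightarrow> ('k, 'a, 'y) module_scheme \<Rightarrow> ('k, 'b, 'z) module_scheme \<Rightarrow>
   (('b, 'a) tens \<Rightarrow> ('a, 'b) tens) \<Rightarrow> bool" where
  "twisting_map k A B R \<longleftrightarrow>
     linear_map k (tensor k B A) (tensor k A B) R \<and>
     (\<forall>b \<in> carrier B. R (tns k B A b \<one>\<^bsub>A\<^esub>) = tns k A B \<one>\<^bsub>A\<^esub> b) \<and>
     (\<forall>a \<in> carrier A. R (tns k B A \<one>\<^bsub>B\<^esub> a) = tns k A B a \<one>\<^bsub>B\<^esub>) \<and>
     (\<forall>b \<in> carrier B. \<forall>a \<in> carrier A. \<forall>a' \<in> carrier A.
        R (tns k B A b (a \<otimes>\<^bsub>A\<^esub> a')) =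
          tbind (tensor k A B) (R (tns k B A b a)) (\<lambda>a1 b1.
          tbind (tensor k A B) (R (tns k B A b1 a')) (\<lambda>a2 b2.
            tns k A B (a1 \<otimes>\<^bsub>A\<^esub> a2) b2))) \<and>
     (\<forall>b \<in> carrier B. \<forall>b' \<in> carrier B. \<forall>a \<in> carrier A.
        R (tns k B A (b \<otimes>\<^bsub>B\<^esub> b') a) =
          tbind (tensor k A B) (R (tns k B A b' a)) (\<lambda>a1 b1.
          tbind (tensor k A B) (R (tns k B A b a1)) (\<lambda>a2 b2.
            tns k A B a2 (b2 \<otimes>\<^bsub>B\<^esub> b1))))"

definition twisted_tensor ::
  "'k ring \<Rightarrow> ('k, 'a, 'y) module_scheme \<Rightarrow> ('k, 'b, 'z) module_scheme \<Rightarrow>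
   (('b, 'a) tens \<Rightarrow> ('a, 'b) tens) \<Rightarrow> ('k, ('a, 'b) tens) module" where
  "twisted_tensor k A B R = (tensor k A B)\<lparr>
     mult := (\<lambda>X Y.
       tbind (tensor k A B) X (\<lambda>a b.
       tbind (tensor k A B) Y (\<lambda>a' b'.
       tbind (tensor k A B) (R (tns k B A b a')) (\<lambda>a'' b''.
         tns k A B (a \<otimes>\<^bsub>A\<^esub> a'') (b'' \<otimes>\<^bsub>B\<^esub> b'))))),
     one := tns k A B \<one>\<^bsub>A\<^esub> \<one>\<^bsub>B\<^esub>\<rparr>"

text \<open>\<open>Rt\<close> is the extension of \<open>R\<close> to a twisting map between the universal calculi.\<close>

definition extended_twisting_map ::
  "'k ring \<Rightarrow> ('k, 'a, 'y) module_scheme \<Rightarrow> ('k, 'b, 'z) module_scheme \<Rightarrow>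
   (('b, 'a) tens \<Rightarrow> ('a, 'b) tens) \<Rightarrow>
   (('b forms, 'a forms) tens \<Rightarrow> ('a forms, 'b forms) tens) \<Rightarrow> bool" where
  "extended_twisting_map k A B R Rt \<longleftrightarrow>
     (let \<Omega>A = Omega k A; \<Omega>B = Omega k B; W = tensor k \<Omega>A \<Omega>B in
     twisting_map k \<Omega>A \<Omega>B Rt \<and>
     (\<forall>b \<in> carrier B. \<forall>a \<in> carrier A.
        Rt (tns k \<Omega>B \<Omega>A (iota k B b) (iota k A a)) =
          tbind W (R (tns k B A b a)) (\<lambda>a' b'. tns k \<Omega>A \<Omega>B (iota k A a') (iota k B b'))) \<and>
     (\<forall>\<eta> \<in> carrier \<Omega>B. \<forall>\<omega> \<in> carrier \<Omega>A.
        Rt (tns k \<Omega>B \<Omega>A (dga_diff \<Omega>B \<eta>) \<omega>) =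
          tbind W (Rt (tns k \<Omega>B \<Omega>A \<eta> \<omega>))
            (\<lambda>\<omega>' \<eta>'. tns k \<Omega>A \<Omega>B (Omega_eps k A \<omega>') (dga_diff \<Omega>B \<eta>'))) \<and>
     (\<forall>\<eta> \<in> carrier \<Omega>B. \<forall>\<omega> \<in> carrier \<Omega>A.
        Rt (tns k \<Omega>B \<Omega>A \<eta> (dga_diff \<Omega>A \<omega>)) =
          tbind W (Rt (tns k \<Omega>B \<Omega>A \<eta> \<omega>))
            (\<lambda>\<omega>' \<eta>'. tns k \<Omega>A \<Omega>B (dga_diff \<Omega>A \<omega>') (Omega_eps k B \<eta>'))))"

text \<open>The calculus \<open>\<Omega>A \<otimes>\<^bsub>Rt\<^esub> \<Omega>B\<close> over \<open>A \<otimes>\<^sub>R B\<close>, and the identification of \<open>A \<otimes>\<^sub>R B\<close> with its forms of degree \<open>0\<close>.\<close>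

definition twisted_calculus ::
  "'k ring \<Rightarrow> ('k, 'a, 'y) module_scheme \<Rightarrow> ('k, 'b, 'z) module_scheme \<Rightarrow>
   (('b forms, 'a forms) tens \<Rightarrow> ('a forms, 'b forms) tens) \<Rightarrow>
   ('k, ('a forms, 'b forms) tens) dga" where
  "twisted_calculus k A B Rt =
     (let \<Omega>A = Omega k A; \<Omega>B = Omega k B in
     module.extend (twisted_tensor k \<Omega>A \<Omega>B Rt)
       \<lparr>dga_deg = (\<lambda>p. coset (tnull k \<Omega>A \<Omega>B) `
          {x. Poly_Mapping.keys x \<subseteq> (\<Union>i \<in> {..p}. dga_deg \<Omega>A i \<times> dga_deg \<Omega>B (p - i))}),
        dga_diff = (\<lambda>X. tbind (tensor k \<Omega>A \<Omega>B) X (\<lambda>\<omega> \<eta>.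
          tns k \<Omega>A \<Omega>B (dga_diff \<Omega>A \<omega>) \<eta> \<oplus>\<^bsub>tensor k \<Omega>A \<Omega>B\<^esub>
          tns k \<Omega>A \<Omega>B (Omega_eps k A \<omega>) (dga_diff \<Omega>B \<eta>)))\<rparr>)"

definition twisted_iota ::
  "'k ring \<Rightarrow> ('k, 'a, 'y) module_scheme \<Rightarrow> ('k, 'b, 'z) module_scheme \<Rightarrow>
   ('a, 'b) tens \<Rightarrow> ('a forms, 'b forms) tens" where
  "twisted_iota k A B X = tbind (tensor k (Omega k A) (Omega k B)) X
     (\<lambda>a b. tns k (Omega k A) (Omega k B) (iota k A a) (iota k B b))"

abbreviation Omega1 :: "'k ring \<Rightarrow> ('k, 'a, 'z) module_scheme \<Rightarrow> ('k, 'a, 'a forms) bimod" where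
  "Omega1 k A \<equiv> one_forms (Omega k A) (iota k A)"

text \<open>
  The restrictions \<open>B \<otimes> \<Omega>\<^sup>1A \<rightarrow> \<Omega>\<^sup>1A \<otimes> B\<close> and \<open>\<Omega>\<^sup>1B \<otimes> A \<rightarrow> A \<otimes> \<Omega>\<^sup>1B\<close> of \<open>Rt\<close>, on pure tensors.  \<open>Rt\<close> preserves
  the bidegree, so that the projections only serve to pass from \<open>\<Omega>A \<otimes> \<Omega>B\<close> to its
  summands \<open>\<Omega>\<^sup>1A \<otimes> \<Omega>\<^sup>0B\<close> and \<open>\<Omega>\<^sup>0A \<otimes> \<Omega>\<^sup>1B\<close>.
\<close>

definition Rt_left ::
  "'k ring \<Rightarrow> ('k, 'a, 'y) module_scheme \<Rightarrow> ('k, 'b, 'z) module_scheme \<Rightarrow>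
   (('b forms, 'a forms) tens \<Rightarrow> ('a forms, 'b forms) tens) \<Rightarrow>
   'b \<Rightarrow> 'a forms \<Rightarrow> ('a forms, 'b) tens" where
  "Rt_left k A B Rt b \<omega> =
     tbind (tensor k (Omega1 k A) B) (Rt (tns k (Omega k B) (Omega k A) (iota k B b) \<omega>))
       (\<lambda>\<omega>' \<eta>'. tns k (Omega1 k A) B (Omega_proj k A 1 \<omega>') (Omega_base k B \<eta>'))"

definition Rt_right ::
  "'k ring \<Rightarrow> ('k, 'a, 'y) module_scheme \<Rightarrow> ('k, 'b, 'z) module_scheme \<Rightarrow>
   (('b forms, 'a forms) tens \<Rightarrow> ('a forms, 'b forms) tens) \<Rightarrow>
   'b forms \<Rightarrow> 'a \<Rightarrow> ('a, 'b forms) tens" where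
  "Rt_right k A B Rt \<eta> a =
     tbind (tensor k A (Omega1 k B)) (Rt (tns k (Omega k B) (Omega k A) \<eta> (iota k A a)))
       (\<lambda>\<omega>' \<eta>'. tns k A (Omega1 k B) (Omega_base k A \<omega>') (Omega_proj k B 1 \<eta>'))"


section \<open>Module twisting maps\<close>

definition right_module_twisting_map ::
  "'k ring \<Rightarrow> ('k, 'a, 'x) module_scheme \<Rightarrow> ('k, 'b, 'y) module_scheme \<Rightarrow>
   (('b, 'a) tens \<Rightarrow> ('a, 'b) tens) \<Rightarrow> ('k, 'b, 'f, 'z) bimod_scheme \<Rightarrow>
   (('f, 'a) tens \<Rightarrow> ('a, 'f) tens) \<Rightarrow> bool" where
  "right_module_twisting_map k A B R F \<tau> \<longleftrightarrow>
     linear_map k (tensor k F A) (tensor k A F) \<tau> \<and>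
     (\<forall>f \<in> carrier F. \<forall>a \<in> carrier A. \<forall>a' \<in> carrier A.
        \<tau> (tns k F A f (a \<otimes>\<^bsub>A\<^esub> a')) =
          tbind (tensor k A F) (\<tau> (tns k F A f a)) (\<lambda>a1 f1.
          tbind (tensor k A F) (\<tau> (tns k F A f1 a')) (\<lambda>a2 f2.
            tns k A F (a1 \<otimes>\<^bsub>A\<^esub> a2) f2))) \<and>
     (\<forall>f \<in> carrier F. \<forall>b \<in> carrier B. \<forall>a \<in> carrier A.
        \<tau> (tns k F A (ract F f b) a) =
          tbind (tensor k A F) (R (tns k B A b a)) (\<lambda>a1 b1.
          tbind (tensor k A F) (\<tau> (tns k F A f a1)) (\<lambda>a2 f2.
            tns k A F a2 (ract F f2 b1))))"

definition left_module_twisting_map ::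
  "'k ring \<Rightarrow> ('k, 'a, 'x) module_scheme \<Rightarrow> ('k, 'b, 'y) module_scheme \<Rightarrow>
   (('b, 'a) tens \<Rightarrow> ('a, 'b) tens) \<Rightarrow> ('k, 'a, 'e, 'z) bimod_scheme \<Rightarrow>
   (('b, 'e) tens \<Rightarrow> ('e, 'b) tens) \<Rightarrow> bool" where
  "left_module_twisting_map k A B R E \<tau> \<longleftrightarrow>
     linear_map k (tensor k B E) (tensor k E B) \<tau> \<and>
     (\<forall>b \<in> carrier B. \<forall>b' \<in> carrier B. \<forall>e \<in> carrier E.
        \<tau> (tns k B E (b \<otimes>\<^bsub>B\<^esub> b') e) =
          tbind (tensor k E B) (\<tau> (tns k B E b' e)) (\<lambda>e1 b1.
          tbind (tensor k E B) (\<tau> (tns k B E b e1)) (\<lambda>e2 b2.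
            tns k E B e2 (b2 \<otimes>\<^bsub>B\<^esub> b1)))) \<and>
     (\<forall>b \<in> carrier B. \<forall>a \<in> carrier A. \<forall>e \<in> carrier E.
        \<tau> (tns k B E b (lact E a e)) =
          tbind (tensor k E B) (R (tns k B A b a)) (\<lambda>a1 b1.
          tbind (tensor k E B) (\<tau> (tns k B E b1 e)) (\<lambda>e2 b2.
            tns k E B (lact E a1 e2) b2)))"


section \<open>The product bimodule, the product connection and \<open>\<xi>\<close>\<close>

definition product_bimodule ::
  "'k ring \<Rightarrow> ('k, 'a) module \<Rightarrow> ('k, 'b) module \<Rightarrow> (('b, 'a) tens \<Rightarrow> ('a, 'b) tens) \<Rightarrow>
   ('k, 'a, 'e) bimod \<Rightarrow> ('k, 'b, 'f) bimod \<Rightarrow>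
   (('f, 'a) tens \<Rightarrow> ('a, 'f) tens) \<Rightarrow> (('b, 'e) tens \<Rightarrow> ('e, 'b) tens) \<Rightarrow>
   ('k, ('a, 'b) tens, ('e, 'b) tens \<times> ('a, 'f) tens) bimod" where
  "product_bimodule k A B R E F \<tau>FA \<tau>BE =
     (let EB = tensor k E B; AF = tensor k A F in
     module.extend (dsum EB AF)
       \<lparr>lact = (\<lambda>Z (X, Y).
          (tbind EB Z (\<lambda>\<alpha> \<beta>. tbind EB X (\<lambda>e b.
             tbind EB (\<tau>BE (tns k B E \<beta> e)) (\<lambda>e' \<beta>'. tns k E B (lact E \<alpha> e') (\<beta>' \<otimes>\<^bsub>B\<^esub> b)))),
           tbind AF Z (\<lambda>\<alpha> \<beta>. tbind AF Y (\<lambda>a f.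
             tbind AF (R (tns k B A \<beta> a)) (\<lambda>a' \<beta>'. tns k A F (\<alpha> \<otimes>\<^bsub>A\<^esub> a') (lact F \<beta>' f)))))),
        ract = (\<lambda>(X, Y) Z.
          (tbind EB X (\<lambda>e b. tbind EB Z (\<lambda>\<alpha> \<beta>.
             tbind EB (R (tns k B A b \<alpha>)) (\<lambda>\<alpha>' b'. tns k E B (ract E e \<alpha>') (b' \<otimes>\<^bsub>B\<^esub> \<beta>)))),
           tbind AF Y (\<lambda>a f. tbind AF Z (\<lambda>\<alpha> \<beta>.
             tbind AF (\<tau>FA (tns k F A f \<alpha>)) (\<lambda>\<alpha>' f'. tns k A F (a \<otimes>\<^bsub>A\<^esub> \<alpha>') (ract F f' \<beta>))))))\<rparr>)"

text \<open>
  The product connection.  The representatives \<open>\<Sum>\<^sub>i e\<^sub>i \<otimes> \<omega>\<^sub>i\<close> of \<open>\<nabla>\<^sup>E e\<close> may have arbitrary \<open>\<omega>\<^sub>i \<in> \<Omega>\<^sup>1A\<close>, not only \<open>\<omega>\<^sub>i = d a\<^sub>i\<close>: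
  \<open>e\<^sub>i \<otimes> \<omega>\<^sub>i \<mapsto> (e\<^sub>i \<otimes> 1) \<otimes> (\<omega>\<^sub>i \<otimes> b)\<close> is \<open>A\<close>-balanced.
\<close>

definition product_connection ::
  "'k ring \<Rightarrow> ('k, 'a) module \<Rightarrow> ('k, 'b) module \<Rightarrow> (('b, 'a) tens \<Rightarrow> ('a, 'b) tens) \<Rightarrow>
   (('b forms, 'a forms) tens \<Rightarrow> ('a forms, 'b forms) tens) \<Rightarrow>
   ('k, 'a, 'e) bimod \<Rightarrow> ('k, 'b, 'f) bimod \<Rightarrow>
   (('f, 'a) tens \<Rightarrow> ('a, 'f) tens) \<Rightarrow> (('b, 'e) tens \<Rightarrow> ('e, 'b) tens) \<Rightarrow>
   ('e \<Rightarrow> ('e, 'a forms) tens) \<Rightarrow> ('f \<Rightarrow> ('f, 'b forms) tens) \<Rightarrow>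
   ('e, 'b) tens \<times> ('a, 'f) tens \<Rightarrow>
   (('e, 'b) tens \<times> ('a, 'f) tens, ('a forms, 'b forms) tens) tens" where
  "product_connection k A B R Rt E F \<tau>FA \<tau>BE nabE nabF =
     (let D = twisted_tensor k A B R;
          M = product_bimodule k A B R E F \<tau>FA \<tau>BE;
          \<Omega>1 = one_forms (twisted_calculus k A B Rt) (twisted_iota k A B);
          W = tensor_over D M \<Omega>1;
          pure = tns_over D M \<Omega>1;
          form = tns k (Omega k A) (Omega k B);
          inE = (\<lambda>e b. (tns k E B e b, \<zero>\<^bsub>tensor k A F\<^esub>));
          inF = (\<lambda>a f. (\<zero>\<^bsub>tensor k E B\<^esub>, tns k A F a f));
          \<sigma> = inv_into (carrier (tensor k F A)) \<tau>FA;
          dA = (\<lambda>a. dga_diff (Omega k A) (iota k A a));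
          dB = (\<lambda>b. dga_diff (Omega k B) (iota k B b));
          nab1 = (\<lambda>X. tbind W X (\<lambda>e b.
             tbind W (nabE e) (\<lambda>e' \<omega>. pure (inE e' \<one>\<^bsub>B\<^esub>) (form \<omega> (iota k B b))) \<oplus>\<^bsub>W\<^esub>
             pure (inE e \<one>\<^bsub>B\<^esub>) (form \<one>\<^bsub>Omega k A\<^esub> (dB b))));
          nab2 = (\<lambda>Y. tbind W Y (\<lambda>a f.
             tbind W (nabF f) (\<lambda>f' \<eta>. pure (inF a f') (form \<one>\<^bsub>Omega k A\<^esub> \<eta>)) \<oplus>\<^bsub>W\<^esub>
             tbind W (\<sigma> (tns k A F a f)) (\<lambda>f' a'. pure (inF \<one>\<^bsub>A\<^esub> f') (form (dA a') \<one>\<^bsub>Omega k B\<^esub>))))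
      in (\<lambda>(X, Y). nab1 X \<oplus>\<^bsub>W\<^esub> nab2 Y))"

text \<open>
  The four formulas give \<open>\<xi>\<close> on spanning elements of the four summands of
  \<open>\<Omega>\<^sup>1 \<otimes>\<^sub>D (E \<otimes> B \<oplus> A \<otimes> F)\<close>; the components \<open>\<xi>\<^sub>i\<^sub>j\<close> vanish on the summands other than their own, so
  they determine \<open>\<xi> = \<xi>\<^sub>1\<^sub>1 + \<xi>\<^sub>1\<^sub>2 + \<xi>\<^sub>2\<^sub>1 + \<xi>\<^sub>2\<^sub>2\<close>.  That such a map exists is a separate claim.
\<close>

definition is_product_xi ::
  "'k ring \<Rightarrow> ('k, 'a) module \<Rightarrow> ('k, 'b) module \<Rightarrow> (('b, 'a) tens \<Rightarrow> ('a, 'b) tens) \<Rightarrow>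
   (('b forms, 'a forms) tens \<Rightarrow> ('a forms, 'b forms) tens) \<Rightarrow>
   ('k, 'a, 'e) bimod \<Rightarrow> ('k, 'b, 'f) bimod \<Rightarrow>
   (('f, 'a) tens \<Rightarrow> ('a, 'f) tens) \<Rightarrow> (('b, 'e) tens \<Rightarrow> ('e, 'b) tens) \<Rightarrow>
   (('a forms, 'e) tens \<Rightarrow> ('e, 'a forms) tens) \<Rightarrow>
   (('b forms, 'f) tens \<Rightarrow> ('f, 'b forms) tens) \<Rightarrow>
   ((('a forms, 'b forms) tens, ('e, 'b) tens \<times> ('a, 'f) tens) tens \<Rightarrow>
    (('e, 'b) tens \<times> ('a, 'f) tens, ('a forms, 'b forms) tens) tens) \<Rightarrow> bool" where
  "is_product_xi k A B R Rt E F \<tau>FA \<tau>BE \<phi> \<psi> \<xi> \<longleftrightarrow>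
     (let D = twisted_tensor k A B R;
          M = product_bimodule k A B R E F \<tau>FA \<tau>BE;
          \<Omega>1 = one_forms (twisted_calculus k A B Rt) (twisted_iota k A B);
          W = tensor_over D M \<Omega>1;
          dom = tns_over D \<Omega>1 M;
          pure = tns_over D M \<Omega>1;
          form = tns k (Omega k A) (Omega k B);
          inE = (\<lambda>e b. (tns k E B e b, \<zero>\<^bsub>tensor k A F\<^esub>));
          inF = (\<lambda>a f. (\<zero>\<^bsub>tensor k E B\<^esub>, tns k A F a f));
          \<sigma> = inv_into (carrier (tensor k F A)) \<tau>FA;
          dA = (\<lambda>a. dga_diff (Omega k A) (iota k A a));
          dB = (\<lambda>b. dga_diff (Omega k B) (iota k B b))
      in
      linear_map k (tensor_over D \<Omega>1 M) W \<xi> \<and>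
      (\<forall>\<alpha> \<in> carrier A. \<forall>\<beta> \<in> carrier B. \<forall>e \<in> carrier E. \<forall>b \<in> carrier B.
         \<xi> (dom (form (dA \<alpha>) (iota k B \<beta>)) (inE e b)) =
           tbind W (\<tau>BE (tns k B E \<beta> e)) (\<lambda>e' \<beta>'.
           tbind W (\<phi> (tns_over A (Omega1 k A) E (dA \<alpha>) e')) (\<lambda>e'' \<omega>.
             pure (inE e'' \<one>\<^bsub>B\<^esub>) (form \<omega> (iota k B (\<beta>' \<otimes>\<^bsub>B\<^esub> b))))) \<and>
         \<xi> (dom (form (iota k A \<alpha>) (dB \<beta>)) (inE e b)) =
           tbind W (\<tau>BE (tns k B E \<beta> e)) (\<lambda>e' \<beta>'.
             pure (inE (lact E \<alpha> e') \<one>\<^bsub>B\<^esub>) (form \<one>\<^bsub>Omega k A\<^esub> (dB \<beta>' \<otimes>\<^bsub>Omega k B\<^esub> iota k B b)))) \<and>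
      (\<forall>\<alpha> \<in> carrier A. \<forall>\<beta> \<in> carrier B. \<forall>a \<in> carrier A. \<forall>f \<in> carrier F.
         \<xi> (dom (form (dA \<alpha>) (iota k B \<beta>)) (inF a f)) =
           tbind W (\<sigma> (tns k A F a f)) (\<lambda>f' a'.
           tbind W (\<sigma> (tns k A F \<alpha> (lact F \<beta> f'))) (\<lambda>f'' \<alpha>'.
             pure (inF \<one>\<^bsub>A\<^esub> f'') (form (dA \<alpha>' \<otimes>\<^bsub>Omega k A\<^esub> iota k A a') \<one>\<^bsub>Omega k B\<^esub>))) \<and>
         \<xi> (dom (form (iota k A \<alpha>) (dB \<beta>)) (inF a f)) =
           tbind W (R (tns k B A \<beta> a)) (\<lambda>a' \<beta>'.
           tbind W (\<psi> (tns_over B (Omega1 k B) F (dB \<beta>') f)) (\<lambda>f' \<eta>.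
             pure (inF (\<alpha> \<otimes>\<^bsub>A\<^esub> a') f') (form \<one>\<^bsub>Omega k A\<^esub> \<eta>)))))"

end

theory Submission
  imports Defs
begin

text \<open>
  Write \<open>M = (E \<otimes> B) \<oplus> (A \<otimes> F)\<close>, \<open>D = A \<otimes>\<^sub>R B\<close> and \<open>W = M \<otimes>\<^sub>D \<Omega>\<^sup>1D\<close>.  The right \<open>D\<close>-module \<open>M\<close> is spanned by
  products \<open>e b\<close> and, \<open>\<tau>\<^bsub>F,A\<^esub>\<close> being invertible, \<open>f a\<close>, and the product connection is determined by
  \<open>\<nabla>(e b) = \<nabla>\<^sup>E(e) b + e \<otimes> d b\<close> and, by the condition relating \<open>\<nabla>\<^sup>F\<close> to \<open>\<tau>\<^bsub>F,A\<^esub>\<close>,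
  \<open>\<nabla>(f a) = \<nabla>\<^sup>F(f) a + f \<otimes> d a\<close>; hence it is a right connection.

  A bimodule connection forces \<open>\<xi>(d x \<otimes> m) = \<delta>(x) m\<close> with \<open>\<delta>(x) m = \<nabla>(x m) - x \<nabla>(m)\<close>, and \<open>\<xi>\<close> is then automatically
  bilinear, so it has to be shown that this defines a map on \<open>\<Omega>\<^sup>1D \<otimes>\<^sub>D M\<close> and that it agrees with the \<open>\<xi>\<^sub>i\<^sub>j\<close>.  Split
  \<open>\<nabla> = N + L\<close>, with \<open>N(e b) = \<nabla>\<^sup>E(e) b\<close>, \<open>N(a f) = a \<nabla>\<^sup>F(f)\<close>, \<open>L(e b) = e \<otimes> d b\<close> and \<open>L(f a) = f \<otimes> d a\<close>.  The
  conditions relating \<open>\<nabla>\<^sup>E\<close> to \<open>\<tau>\<^bsub>B,E\<^esub>\<close> and \<open>\<nabla>\<^sup>F\<close> to \<open>\<tau>\<^bsub>F,A\<^esub>\<close> say that \<open>N(b e) = b N(e)\<close> and \<open>N(f a) = N(f) a\<close>.  This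
  computes \<open>\<delta>(a)\<close> and \<open>\<delta>(b)\<close> on \<open>e\<close> and \<open>f\<close> and shows that \<open>\<delta>\<close> respects the relation \<open>(d b) a = a\<^sub>R d(b\<^sub>R)\<close>.
  Consequently \<open>M \<oplus> W\<close> is a module over \<open>\<Omega>A\<close> and over \<open>\<Omega>B\<close> on which \<open>d x\<close> acts by \<open>(m, w) \<mapsto> (0, \<delta>(x) m)\<close>,
  and \<open>\<xi>\<close> is read off from these two actions.
\<close>

section \<open>Quotients of free abelian groups and tensor products\<close>

text \<open>A value computed on representatives of a tensor makes sense only for a biadditive and
  balanced expression. Hence every Sweedler-type sum is first recognised as the value of a linear
  map, and identities are then compared on pure tensors. The four formulas for \<xi> prescribe
  values on spanning elements of a quotient, where consistency cannot be read off. One-forms of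
  \<open>D\<close> are spanned by (d x) y, and the Leibniz rule of \<delta> settles everything
  except how differentials pass functions of the other algebra. There one relation, for (d b) a,
  suffices: the one for b (d a) follows from it by differentiating b a. It is checked on e and on f
  separately, because only one half of L is left linear over each algebra: the half on E \<otimes> B
  over A, the half on A \<otimes> F over B. Bijectivity of \<open>R\<close> enters because f b lies
  in F again while f a does not: the Leibniz rule on f can be checked only for elements of
  \<open>D\<close> written in the order b a.\<close>

definition feval :: "('k, 'w, 'z) module_scheme \<Rightarrow> ('x \<Rightarrow> 'w) \<Rightarrow> ('x \<Rightarrow>\<^sub>0 int) \<Rightarrow> 'w" where
  "feval W g x = finsum W (\<lambda>p. add_pow W (Poly_Mapping.lookup x p) (g p)) (Poly_Mapping.keys x)"

text \<open>Uncurrying lets pairs and words share one theory of evaluation, since tensors and forms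
  are both quotients of free abelian groups.\<close>

lemma frag_eval_eq_feval: "frag_eval W f = feval W (case_prod f)"
  by (simp add: frag_eval_def feval_def fun_eq_iff split_def)

context
  fixes W :: "('k, 'w, 'z) module_scheme"
  assumes W: "abelian_group W"
begin

interpretation W: abelian_group W by (rule W)

text \<open>The support of a sum differs from those of its summands; over a common finite index set
  addition becomes termwise.\<close>

lemma feval_superset:
  assumes "finite S" "Poly_Mapping.keys x \<subseteq> S" "\<And>p. p \<in> S \<Longrightarrow> g p \<in> carrier W"
  shows "feval W g x = finsum W (\<lambda>p. add_pow W (Poly_Mapping.lookup x p) (g p)) S"
proof -
  have c: "add_pow W (Poly_Mapping.lookup x p) (g p) \<in> carrier W" if "p \<in> S" for p
    using W.add.int_pow_closed[OF assms(3)[OF that]] by (simp add: add_pow_def)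
  show ?thesis
    unfolding feval_def
  proof (rule W.add.finprod_mono_neutral_cong_left[OF assms(1,2)])
    show "\<And>i. i \<in> S - Poly_Mapping.keys x \<Longrightarrow> add_pow W (Poly_Mapping.lookup x i) (g i) = \<zero>\<^bsub>W\<^esub>"
      by (auto simp: in_keys_iff add_pow_def)
  qed (use c in auto)
qed

lemma feval_add:
  assumes "\<And>p. p \<in> Poly_Mapping.keys x \<union> Poly_Mapping.keys y \<Longrightarrow> g p \<in> carrier W"
  shows "feval W g (x + y) = feval W g x \<oplus>\<^bsub>W\<^esub> feval W g y"
proof -
  let ?S = "Poly_Mapping.keys x \<union> Poly_Mapping.keys y"
  have 1: "add_pow W (Poly_Mapping.lookup (x + y) p) (g p) =
      add_pow W (Poly_Mapping.lookup x p) (g p) \<oplus>\<^bsub>W\<^esub> add_pow W (Poly_Mapping.lookup y p) (g p)"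
    if "p \<in> ?S" for p
    using W.add.int_pow_mult[OF assms[OF that]] by (simp add: lookup_add add_pow_def)
  have c: "add_pow W (Poly_Mapping.lookup z p) (g p) \<in> carrier W" if "p \<in> ?S" for p and z :: "'a \<Rightarrow>\<^sub>0 int"
    using W.add.int_pow_closed[OF assms[OF that]] by (simp add: add_pow_def)
  have k: "Poly_Mapping.keys (x + y) \<subseteq> ?S" by (rule Poly_Mapping.keys_add)
  have "feval W g (x + y) = finsum W (\<lambda>p. add_pow W (Poly_Mapping.lookup (x + y) p) (g p)) ?S"
    by (rule feval_superset[OF _ k assms]) auto
  also have "\<dots> = finsum W (\<lambda>p. add_pow W (Poly_Mapping.lookup x p) (g p) \<oplus>\<^bsub>W\<^esub>
      add_pow W (Poly_Mapping.lookup y p) (g p)) ?S"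
    by (rule W.finsum_cong') (use 1 c in auto)
  also have "\<dots> = feval W g x \<oplus>\<^bsub>W\<^esub> feval W g y"
    using feval_superset[of ?S x g] feval_superset[of ?S y g] c assms
    by (subst W.finsum_addf) auto
  finally show ?thesis .
qed

lemma feval_closed:
  assumes "\<And>p. p \<in> Poly_Mapping.keys x \<Longrightarrow> g p \<in> carrier W"
  shows "feval W g x \<in> carrier W"
  unfolding feval_def
  using W.add.int_pow_closed[OF assms] by (intro W.finsum_closed) (auto simp: add_pow_def)

lemma feval_0: "feval W g 0 = \<zero>\<^bsub>W\<^esub>"
  by (simp add: feval_def)

lemma feval_frag_of: "g p \<in> carrier W \<Longrightarrow> feval W g (frag_of p) = g p"
  using W.add.int_pow_1[of "g p"] by (simp add: feval_def keys_frag_of add_pow_def)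

lemma feval_diff:
  assumes "\<And>p. p \<in> Poly_Mapping.keys x \<union> Poly_Mapping.keys y \<Longrightarrow> g p \<in> carrier W"
  shows "feval W g (x - y) = feval W g x \<ominus>\<^bsub>W\<^esub> feval W g y"
proof -
  have k: "Poly_Mapping.keys (x - y) \<subseteq> Poly_Mapping.keys x \<union> Poly_Mapping.keys y"
    by (rule keys_diff)
  have "feval W g x = feval W g (x - y) \<oplus>\<^bsub>W\<^esub> feval W g y"
    using feval_add[of "x - y" y g] k assms by auto
  then show ?thesis
    using assms k by (subst W.minus_eq)
      (simp add: W.a_assoc W.r_neg feval_closed subset_iff)
qed

end

section \<open>Additive maps\<close>

definition ahom :: "('k, 'm, 'y) module_scheme \<Rightarrow> ('k, 'n, 'z) module_scheme \<Rightarrow> ('m \<Rightarrow> 'n) \<Rightarrow> bool" where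
  "ahom G H h \<longleftrightarrow> h \<in> carrier G \<rightarrow> carrier H \<and>
     (\<forall>x \<in> carrier G. \<forall>y \<in> carrier G. h (x \<oplus>\<^bsub>G\<^esub> y) = h x \<oplus>\<^bsub>H\<^esub> h y)"

lemma ahomI:
  assumes "\<And>x. x \<in> carrier G \<Longrightarrow> h x \<in> carrier H"
    and "\<And>x y. \<lbrakk>x \<in> carrier G; y \<in> carrier G\<rbrakk> \<Longrightarrow> h (x \<oplus>\<^bsub>G\<^esub> y) = h x \<oplus>\<^bsub>H\<^esub> h y"
  shows "ahom G H h"
  using assms by (auto simp: ahom_def)

lemma ahom_closed: "ahom G H h \<Longrightarrow> x \<in> carrier G \<Longrightarrow> h x \<in> carrier H"
  by (auto simp: ahom_def)

lemma ahom_add: "ahom G H h \<Longrightarrow> x \<in> carrier G \<Longrightarrow> y \<in> carrier G \<Longrightarrow> h (x \<oplus>\<^bsub>G\<^esub> y) = h x \<oplus>\<^bsub>H\<^esub> h y"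
  by (auto simp: ahom_def)

lemma ahom_zero:
  assumes "abelian_group G" "abelian_group H" "ahom G H h"
  shows "h \<zero>\<^bsub>G\<^esub> = \<zero>\<^bsub>H\<^esub>"
proof -
  interpret G: abelian_group G by fact
  interpret H: abelian_group H by fact
  have c: "h \<zero>\<^bsub>G\<^esub> \<in> carrier H" using assms(3) by (simp add: ahom_closed)
  have "h \<zero>\<^bsub>G\<^esub> \<oplus>\<^bsub>H\<^esub> h \<zero>\<^bsub>G\<^esub> = h \<zero>\<^bsub>G\<^esub>"
    using ahom_add[OF assms(3), of "\<zero>\<^bsub>G\<^esub>" "\<zero>\<^bsub>G\<^esub>"] by simp
  then show ?thesis using c H.add.l_cancel_one' by metis
qed

lemma ahom_diff:
  assumes "abelian_group G" "abelian_group H" "ahom G H h" "x \<in> carrier G" "y \<in> carrier G"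
  shows "h (x \<ominus>\<^bsub>G\<^esub> y) = h x \<ominus>\<^bsub>H\<^esub> h y"
proof -
  interpret G: abelian_group G by fact
  interpret H: abelian_group H by fact
  have "h x = h (x \<ominus>\<^bsub>G\<^esub> y) \<oplus>\<^bsub>H\<^esub> h y"
    using ahom_add[OF assms(3), of "x \<ominus>\<^bsub>G\<^esub> y" y] assms(4,5)
    by (simp add: G.minus_eq G.a_assoc G.l_neg)
  then show ?thesis
    using assms(4,5) by (simp add: H.minus_eq H.a_assoc H.r_neg ahom_closed[OF assms(3)])
qed

lemma add_const_on_coset:
  assumes "x \<in> coset K z" "\<And>x. x \<in> coset K z \<Longrightarrow> f x = w"
  shows "(THE w. \<forall>x \<in> coset K z. f x = w) = w"
  using assms by (intro the_equality) auto

section \<open>Quotients of free abelian groups and their universal property\<close>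

locale fquot =
  fixes K :: "('x \<Rightarrow>\<^sub>0 int) set" and S :: "'x set"
    and Q :: "('k, ('x \<Rightarrow>\<^sub>0 int) set, 'z) module_scheme"
  assumes K0: "0 \<in> K" and Kdiff: "\<And>x y. x \<in> K \<Longrightarrow> y \<in> K \<Longrightarrow> x - y \<in> K"
    and KS: "\<And>x. x \<in> K \<Longrightarrow> Poly_Mapping.keys x \<subseteq> S"
    and carr: "carrier Q = coset K ` {x. Poly_Mapping.keys x \<subseteq> S}"
    and zero: "\<zero>\<^bsub>Q\<^esub> = K" and add: "add Q = coset_add"
begin

lemma Kuminus: "x \<in> K \<Longrightarrow> - x \<in> K"
  using Kdiff[OF K0] by simp

lemma Kadd: "x \<in> K \<Longrightarrow> y \<in> K \<Longrightarrow> x + y \<in> K"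
  using Kdiff[OF _ Kuminus, of x y] by simp

lemma coset_self: "x \<in> coset K x"
  by (simp add: coset_def K0)

lemma coset_eq_iff: "coset K x = coset K y \<longleftrightarrow> x - y \<in> K"
proof
  assume "coset K x = coset K y"
  then show "x - y \<in> K" using coset_self[of x] by (simp add: coset_def)
next
  assume h: "x - y \<in> K"
  have "z - x \<in> K \<longleftrightarrow> z - y \<in> K" for z
    using Kadd[OF _ h, of "z - x"] Kdiff[OF _ h, of "z - y"] by auto
  then show "coset K x = coset K y" by (simp add: coset_def)
qed

lemma coset_add_coset: "coset_add (coset K x) (coset K y) = coset K (x + y)"
proof
  show "coset_add (coset K x) (coset K y) \<subseteq> coset K (x + y)"
    using Kadd by (fastforce simp: coset_add_def coset_def algebra_simps)
  show "coset K (x + y) \<subseteq> coset_add (coset K x) (coset K y)"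
  proof
    fix z assume "z \<in> coset K (x + y)"
    then have "z = x + (z - x)" "x \<in> coset K x" "z - x \<in> coset K y"
      by (auto simp: coset_def K0 algebra_simps)
    then show "z \<in> coset_add (coset K x) (coset K y)"
      unfolding coset_add_def by blast
  qed
qed

lemma coset_0: "coset K 0 = K"
  by (simp add: coset_def)

text \<open>Since every relation is supported in \<open>S\<close>, no representative leaves
  \<open>S\<close>; maps controlled only on \<open>S\<close> can therefore be evaluated on all
  representatives.\<close>

lemma keys_coset: "Poly_Mapping.keys x \<subseteq> S \<Longrightarrow> y \<in> coset K x \<Longrightarrow> Poly_Mapping.keys y \<subseteq> S"
  using KS[of "y - x"] Poly_Mapping.keys_add[of "y - x" x] by (auto simp: coset_def)

lemma coset_closed: "Poly_Mapping.keys x \<subseteq> S \<Longrightarrow> coset K x \<in> carrier Q"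
  by (auto simp: carr)

lemma cosetE:
  assumes "X \<in> carrier Q" obtains x where "X = coset K x" "Poly_Mapping.keys x \<subseteq> S"
  using assms by (auto simp: carr)

lemma fq_abelian_group: "abelian_group Q"
proof (rule abelian_groupI)
  show "\<zero>\<^bsub>Q\<^esub> \<in> carrier Q" using coset_closed[of 0] by (simp add: zero coset_0)
  fix X assume "X \<in> carrier Q"
  then obtain x where x: "X = coset K x" "Poly_Mapping.keys x \<subseteq> S" by (rule cosetE)
  show "\<zero>\<^bsub>Q\<^esub> \<oplus>\<^bsub>Q\<^esub> X = X" using coset_add_coset[of 0 x] by (simp add: zero add x coset_0)
  have "coset K (- x) \<in> carrier Q" "coset K (- x) \<oplus>\<^bsub>Q\<^esub> X = \<zero>\<^bsub>Q\<^esub>"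
    using x coset_closed[of "- x"] by (auto simp: add coset_add_coset zero coset_0)
  then show "\<exists>Y \<in> carrier Q. Y \<oplus>\<^bsub>Q\<^esub> X = \<zero>\<^bsub>Q\<^esub>" by blast
  fix Y assume "Y \<in> carrier Q"
  then obtain y where y: "Y = coset K y" "Poly_Mapping.keys y \<subseteq> S" by (rule cosetE)
  show "X \<oplus>\<^bsub>Q\<^esub> Y \<in> carrier Q"
    using x y Poly_Mapping.keys_add[of x y] by (auto simp: add coset_add_coset intro!: coset_closed)
  show "X \<oplus>\<^bsub>Q\<^esub> Y = Y \<oplus>\<^bsub>Q\<^esub> X" by (simp add: x y add coset_add_coset add.commute)
  fix Z assume "Z \<in> carrier Q"
  then obtain z where z: "Z = coset K z" "Poly_Mapping.keys z \<subseteq> S" by (rule cosetE)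
  show "X \<oplus>\<^bsub>Q\<^esub> Y \<oplus>\<^bsub>Q\<^esub> Z = X \<oplus>\<^bsub>Q\<^esub> (Y \<oplus>\<^bsub>Q\<^esub> Z)"
    by (simp add: x y z add coset_add_coset add.assoc)
qed

sublocale fq: abelian_group Q by (rule fq_abelian_group)

lemma coset_diff:
  assumes "Poly_Mapping.keys x \<subseteq> S" "Poly_Mapping.keys y \<subseteq> S"
  shows "coset K (x - y) = coset K x \<ominus>\<^bsub>Q\<^esub> coset K y"
proof -
  have "Poly_Mapping.keys (x - y) \<subseteq> S" using assms keys_diff[of x y] by auto
  then have c: "coset K (x - y) \<in> carrier Q" "coset K y \<in> carrier Q" using assms coset_closed by auto
  have "coset K x = coset K (x - y) \<oplus>\<^bsub>Q\<^esub> coset K y" by (simp add: add coset_add_coset)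
  then show ?thesis using c by (simp add: fq.minus_eq fq.a_assoc fq.r_neg)
qed

text \<open>The induction step is a difference because free abelian groups and the subgroups of
  relations are both generated by differences.\<close>

lemma coset_induct [consumes 1, case_names zero gen diff]:
  assumes "X \<in> carrier Q" and "P \<zero>\<^bsub>Q\<^esub>" and "\<And>p. p \<in> S \<Longrightarrow> P (coset K (frag_of p))"
    and "\<And>X Y. \<lbrakk>X \<in> carrier Q; Y \<in> carrier Q; P X; P Y\<rbrakk> \<Longrightarrow> P (X \<ominus>\<^bsub>Q\<^esub> Y)"
  shows "P X"
proof -
  obtain x where x: "X = coset K x" "Poly_Mapping.keys x \<subseteq> S" using assms(1) by (rule cosetE)
  from x(2) have "Poly_Mapping.keys x \<subseteq> S \<and> P (coset K x)"
  proof (induction x rule: frag_induction)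
    case (diff a b)
    moreover have "Poly_Mapping.keys (a - b) \<subseteq> S" using diff keys_diff[of a b] by auto
    ultimately show ?case using assms(4) coset_closed by (simp add: coset_diff)
  qed (use assms in \<open>auto simp: coset_0 zero keys_frag_of\<close>)
  then show ?thesis using x by simp
qed

text \<open>Additivity is all that is asked, so that the scalar multiplications of the quotients can
  themselves be compared in this way.\<close>

lemma ahom_ext:
  assumes W: "abelian_group W" and h: "ahom Q W h" and g: "ahom Q W g"
    and "\<And>p. p \<in> S \<Longrightarrow> h (coset K (frag_of p)) = g (coset K (frag_of p))" and "X \<in> carrier Q"
  shows "h X = g X"
  using assms(5)
proof (induction rule: coset_induct)
  case zero
  then show ?case using ahom_zero[OF fq_abelian_group W h] ahom_zero[OF fq_abelian_group W g] by simp
next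
  case (diff X Y)
  then show ?case using ahom_diff[OF fq_abelian_group W h] ahom_diff[OF fq_abelian_group W g] by simp
qed (use assms in auto)

text \<open>The map given by the universal property of the quotient, in the definite-description
  form of \<open>tbind\<close>, which is a special case.\<close>

definition clift :: "('k, 'w, 'y) module_scheme \<Rightarrow> ('x \<Rightarrow> 'w) \<Rightarrow> ('x \<Rightarrow>\<^sub>0 int) set \<Rightarrow> 'w" where
  "clift W g X = (THE w. \<forall>x \<in> X. feval W g x = w)"

context
  fixes W :: "('k, 'w, 'y) module_scheme" and g
  assumes W: "abelian_group W" and gS: "\<And>p. p \<in> S \<Longrightarrow> g p \<in> carrier W"
    and gK: "\<And>x. x \<in> K \<Longrightarrow> feval W g x = \<zero>\<^bsub>W\<^esub>"
begin

interpretation W: abelian_group W by (rule W)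

text \<open>Two representatives differ by a relation, and relations evaluate to zero.\<close>

lemma clift_coset: "Poly_Mapping.keys x \<subseteq> S \<Longrightarrow> clift W g (coset K x) = feval W g x"
  unfolding clift_def
proof (rule add_const_on_coset[OF coset_self])
  fix y assume x: "Poly_Mapping.keys x \<subseteq> S" and y: "y \<in> coset K x"
  then have k: "y - x \<in> K" "Poly_Mapping.keys (y - x) \<subseteq> S" using KS by (auto simp: coset_def)
  have "feval W g (y - x + x) = feval W g (y - x) \<oplus>\<^bsub>W\<^esub> feval W g x"
    by (rule feval_add[OF W]) (use gS k x in auto)
  then show "feval W g y = feval W g x"
    using gK[OF k(1)] feval_closed[OF W, of x g] gS x by (simp add: subset_iff)
qed

lemma clift_gen: "p \<in> S \<Longrightarrow> clift W g (coset K (frag_of p)) = g p"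
  by (simp add: clift_coset keys_frag_of feval_frag_of[OF W] gS)

lemma clift_ahom: "ahom Q W (clift W g)"
proof (rule ahomI)
  fix X assume "X \<in> carrier Q"
  then obtain x where x: "X = coset K x" "Poly_Mapping.keys x \<subseteq> S" by (rule cosetE)
  show "clift W g X \<in> carrier W"
    using x gS by (auto simp: clift_coset intro!: feval_closed[OF W])
  fix Y assume "Y \<in> carrier Q"
  then obtain y where y: "Y = coset K y" "Poly_Mapping.keys y \<subseteq> S" by (rule cosetE)
  have "Poly_Mapping.keys (x + y) \<subseteq> S" using x y Poly_Mapping.keys_add[of x y] by auto
  then show "clift W g (X \<oplus>\<^bsub>Q\<^esub> Y) = clift W g X \<oplus>\<^bsub>W\<^esub> clift W g Y"
    using x y gS by (simp add: add coset_add_coset clift_coset)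
      (rule feval_add[OF W], auto)
qed

end

context
  fixes f
  assumes fS: "\<And>p. p \<in> S \<Longrightarrow> Poly_Mapping.keys (f p) \<subseteq> S"
    and fK: "\<And>x. x \<in> K \<Longrightarrow> frag_extend f x \<in> K"
begin

text \<open>\<open>coset_map\<close> is a union over all representatives; its members coincide
  because \<open>f\<close> carries relations to relations.\<close>

lemma coset_map_coset: "coset_map K f (coset K x) = coset K (frag_extend f x)"
proof -
  have "coset K (frag_extend f y) = coset K (frag_extend f x)" if "y \<in> coset K x" for y
    using that fK[of "y - x"] unfolding coset_eq_iff frag_extend_diff by (simp add: coset_def)
  then show ?thesis unfolding coset_map_def using coset_self by blast
qed

lemma coset_map_ahom: "ahom Q Q (coset_map K f)"
proof (rule ahomI)
  fix X assume "X \<in> carrier Q"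
  then obtain x where x: "X = coset K x" "Poly_Mapping.keys x \<subseteq> S" by (rule cosetE)
  show "coset_map K f X \<in> carrier Q"
    using x fS keys_frag_extend[of f x] by (fastforce simp: coset_map_coset intro!: coset_closed)
  fix Y assume "Y \<in> carrier Q"
  then obtain y where y: "Y = coset K y" "Poly_Mapping.keys y \<subseteq> S" by (rule cosetE)
  show "coset_map K f (X \<oplus>\<^bsub>Q\<^esub> Y) = coset_map K f X \<oplus>\<^bsub>Q\<^esub> coset_map K f Y"
    by (simp add: x y add coset_add_coset coset_map_coset frag_extend_add)
qed

end

end

section \<open>Linear maps\<close>

lemma linI:
  assumes "\<And>x. x \<in> carrier M \<Longrightarrow> f x \<in> carrier N"
    and "\<And>x y. \<lbrakk>x \<in> carrier M; y \<in> carrier M\<rbrakk> \<Longrightarrow> f (x \<oplus>\<^bsub>M\<^esub> y) = f x \<oplus>\<^bsub>N\<^esub> f y"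
    and "\<And>c x. \<lbrakk>c \<in> carrier k; x \<in> carrier M\<rbrakk> \<Longrightarrow> f (c \<odot>\<^bsub>M\<^esub> x) = c \<odot>\<^bsub>N\<^esub> f x"
  shows "linear_map k M N f"
  using assms by (auto simp: linear_map_def)

lemma lin_closed: "linear_map k M N f \<Longrightarrow> x \<in> carrier M \<Longrightarrow> f x \<in> carrier N"
  by (auto simp: linear_map_def)

lemma lin_add:
  "linear_map k M N f \<Longrightarrow> x \<in> carrier M \<Longrightarrow> y \<in> carrier M \<Longrightarrow> f (x \<oplus>\<^bsub>M\<^esub> y) = f x \<oplus>\<^bsub>N\<^esub> f y"
  by (auto simp: linear_map_def)

lemma lin_smult:
  "linear_map k M N f \<Longrightarrow> c \<in> carrier k \<Longrightarrow> x \<in> carrier M \<Longrightarrow> f (c \<odot>\<^bsub>M\<^esub> x) = c \<odot>\<^bsub>N\<^esub> f x"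
  by (auto simp: linear_map_def)

lemma lin_ahom: "linear_map k M N f \<Longrightarrow> ahom M N f"
  by (auto simp: linear_map_def ahom_def)

lemma mod_ab: "Module.module k M \<Longrightarrow> abelian_group M"
  by (simp add: Module.module_def)

lemma lin_zero:
  "Module.module k M \<Longrightarrow> Module.module k N \<Longrightarrow> linear_map k M N f \<Longrightarrow> f \<zero>\<^bsub>M\<^esub> = \<zero>\<^bsub>N\<^esub>"
  using ahom_zero[OF mod_ab mod_ab lin_ahom] .

lemma lin_diff:
  "Module.module k M \<Longrightarrow> Module.module k N \<Longrightarrow> linear_map k M N f \<Longrightarrow> x \<in> carrier M \<Longrightarrow>
    y \<in> carrier M \<Longrightarrow> f (x \<ominus>\<^bsub>M\<^esub> y) = f x \<ominus>\<^bsub>N\<^esub> f y"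
  using ahom_diff[OF mod_ab mod_ab lin_ahom] .

lemma lin_comp: "linear_map k V W t \<Longrightarrow> linear_map k U V g \<Longrightarrow> linear_map k U W (\<lambda>u. t (g u))"
  by (auto simp: linear_map_def Pi_iff)

lemma lin_id: "linear_map k M M (\<lambda>x. x)"
  by (auto simp: linear_map_def)

lemma lin_cong:
  assumes "linear_map k M N f" "Module.module k M" "\<And>x. x \<in> carrier M \<Longrightarrow> f x = g x"
  shows "linear_map k M N g"
proof -
  interpret Module.module k M by fact
  show ?thesis using assms by (auto simp: linear_map_def Pi_iff)
qed

lemma lin_sum:
  assumes "Module.module k N" "linear_map k M N f" "linear_map k M N g"
  shows "linear_map k M N (\<lambda>x. f x \<oplus>\<^bsub>N\<^esub> g x)"
proof -
  interpret N: Module.module k N by fact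
  show ?thesis
    using assms(2,3)
    by (intro linI) (simp_all add: lin_closed lin_add lin_smult N.smult_r_distr N.a_ac)
qed

lemma lin_difference:
  assumes "Module.module k N" "linear_map k M N f" "linear_map k M N g"
  shows "linear_map k M N (\<lambda>x. f x \<ominus>\<^bsub>N\<^esub> g x)"
proof -
  interpret N: Module.module k N by fact
  show ?thesis
    using assms(2,3)
    by (intro linI) (simp_all add: lin_closed lin_add lin_smult N.smult_r_distr N.a_ac
        N.minus_eq N.minus_add N.smult_r_minus)
qed

lemma lin_scaled:
  assumes "Module.module k N" "linear_map k M N f" "c \<in> carrier k"
  shows "linear_map k M N (\<lambda>x. c \<odot>\<^bsub>N\<^esub> f x)"
proof -
  interpret N: Module.module k N by fact
  show ?thesis
    using assms(2,3)
    by (intro linI) (simp_all add: lin_closed lin_add lin_smult N.smult_r_distr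
        N.smult_assoc1[symmetric] N.m_comm)
qed

lemma lin_null:
  assumes "Module.module k N" shows "linear_map k M N (\<lambda>x. \<zero>\<^bsub>N\<^esub>)"
proof -
  interpret N: Module.module k N by fact
  show ?thesis by (intro linI) simp_all
qed

section \<open>Direct sums\<close>

lemma dsum_simps [simp]:
  "carrier (dsum M N) = carrier M \<times> carrier N"
  "zero (dsum M N) = (\<zero>\<^bsub>M\<^esub>, \<zero>\<^bsub>N\<^esub>)"
  "(m, n) \<oplus>\<^bsub>dsum M N\<^esub> (m', n') = (m \<oplus>\<^bsub>M\<^esub> m', n \<oplus>\<^bsub>N\<^esub> n')"
  "c \<odot>\<^bsub>dsum M N\<^esub> (m, n) = (c \<odot>\<^bsub>M\<^esub> m, c \<odot>\<^bsub>N\<^esub> n)"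
  by (simp_all add: dsum_def)

lemma dsum_module:
  assumes "Module.module k M" "Module.module k N"
  shows "Module.module k (dsum M N)"
proof -
  interpret M: Module.module k M by fact
  interpret N: Module.module k N by fact
  show ?thesis
  proof (rule moduleI)
    show "abelian_group (dsum M N)"
    proof (rule abelian_groupI)
      fix x assume x: "x \<in> carrier (dsum M N)"
      then have "(\<ominus>\<^bsub>M\<^esub> fst x, \<ominus>\<^bsub>N\<^esub> snd x) \<oplus>\<^bsub>dsum M N\<^esub> x = \<zero>\<^bsub>dsum M N\<^esub>"
        by (cases x) (auto simp: M.l_neg N.l_neg)
      moreover have "(\<ominus>\<^bsub>M\<^esub> fst x, \<ominus>\<^bsub>N\<^esub> snd x) \<in> carrier (dsum M N)" using x by auto
      ultimately show "\<exists>y \<in> carrier (dsum M N). y \<oplus>\<^bsub>dsum M N\<^esub> x = \<zero>\<^bsub>dsum M N\<^esub>" by blast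
    qed (auto simp: M.a_ac N.a_ac)
  qed (auto simp: M.smult_l_distr M.smult_r_distr N.smult_l_distr N.smult_r_distr
      M.smult_assoc1 N.smult_assoc1 M.is_cring)
qed

lemma lin_pair:
  "linear_map k U M f \<Longrightarrow> linear_map k U N g \<Longrightarrow> linear_map k U (dsum M N) (\<lambda>u. (f u, g u))"
  by (auto simp: linear_map_def Pi_iff)

lemma lin_fst: "linear_map k U (dsum M N) f \<Longrightarrow> linear_map k U M (\<lambda>u. fst (f u))"
  by (rule lin_comp[of k "dsum M N"]) (auto intro!: linI)

lemma lin_snd: "linear_map k U (dsum M N) f \<Longrightarrow> linear_map k U N (\<lambda>u. snd (f u))"
  by (rule lin_comp[of k "dsum M N"]) (auto intro!: linI)

section \<open>Bilinear maps\<close>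

definition bil ::
  "'k ring \<Rightarrow> ('k, 'm, 'x) module_scheme \<Rightarrow> ('k, 'n, 'y) module_scheme \<Rightarrow> ('k, 'w, 'z) module_scheme \<Rightarrow>
   ('m \<Rightarrow> 'n \<Rightarrow> 'w) \<Rightarrow> bool" where
  "bil k M N W f \<longleftrightarrow> (\<forall>m \<in> carrier M. linear_map k N W (f m)) \<and>
     (\<forall>n \<in> carrier N. linear_map k M W (\<lambda>m. f m n))"

lemma bilI:
  assumes "\<And>m. m \<in> carrier M \<Longrightarrow> linear_map k N W (\<lambda>n. f m n)"
    and "\<And>n. n \<in> carrier N \<Longrightarrow> linear_map k M W (\<lambda>m. f m n)"
  shows "bil k M N W f"
  using assms by (simp add: bil_def)

lemma bil_r: "bil k M N W f \<Longrightarrow> linear_map k U N g \<Longrightarrow> m \<in> carrier M \<Longrightarrow> linear_map k U W (\<lambda>u. f m (g u))"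
  unfolding bil_def by (blast intro: lin_comp)

lemma bil_l: "bil k M N W f \<Longrightarrow> linear_map k U M g \<Longrightarrow> n \<in> carrier N \<Longrightarrow> linear_map k U W (\<lambda>u. f (g u) n)"
  unfolding bil_def by (rule lin_comp[of _ _ _ "\<lambda>m. f m n"]) auto

lemma bil_closed: "bil k M N W f \<Longrightarrow> m \<in> carrier M \<Longrightarrow> n \<in> carrier N \<Longrightarrow> f m n \<in> carrier W"
  unfolding bil_def by (auto intro: lin_closed)

section \<open>Tensor products balanced over a set of operators\<close>

locale tens =
  fixes k :: "'k ring" and M :: "('k, 'm, 'x) module_scheme" and N :: "('k, 'n, 'y) module_scheme"
    and S :: "'s set" and r l and T :: "('k, ('m, 'n) tens, 'z) module_scheme"
  assumes mM: "Module.module k M" and mN: "Module.module k N"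
    and r_closed: "\<And>m s. m \<in> carrier M \<Longrightarrow> s \<in> S \<Longrightarrow> r m s \<in> carrier M"
    and l_closed: "\<And>n s. n \<in> carrier N \<Longrightarrow> s \<in> S \<Longrightarrow> l s n \<in> carrier N"
    and r_smult: "\<And>m s c. m \<in> carrier M \<Longrightarrow> s \<in> S \<Longrightarrow> c \<in> carrier k \<Longrightarrow> r (c \<odot>\<^bsub>M\<^esub> m) s = c \<odot>\<^bsub>M\<^esub> r m s"
    and scal: "\<And>c. c \<in> carrier k \<Longrightarrow> \<exists>s \<in> S. (\<forall>m \<in> carrier M. r m s = c \<odot>\<^bsub>M\<^esub> m) \<and> (\<forall>n \<in> carrier N. l s n = c \<odot>\<^bsub>N\<^esub> n)"
    and T_carrier: "carrier T = carrier (tens_space M N (tens_null M N S r l))"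
    and T_zero: "zero T = zero (tens_space M N (tens_null M N S r l))"
    and T_add: "add T = add (tens_space M N (tens_null M N S r l))"
    and T_smult: "smult T = smult (tens_space M N (tens_null M N S r l))"
begin

interpretation M: Module.module k M by (rule mM)
interpretation N: Module.module k N by (rule mN)

abbreviation "K \<equiv> tens_null M N S r l"

abbreviation "pure m n \<equiv> coset K (frag_of (m, n))"

lemma K_keys: "x \<in> K \<Longrightarrow> Poly_Mapping.keys x \<subseteq> carrier M \<times> carrier N"
proof (induction rule: tens_null.induct)
  case (diff x y)
  then show ?case using keys_diff[of x y] by blast
qed (use r_closed l_closed in \<open>auto simp: keys_frag_of dest!: subsetD[OF keys_diff]\<close>)

sublocale fquot K "carrier M \<times> carrier N" T
  by unfold_locales (auto simp: tens_null.zero tens_null.diff K_keys[THEN subsetD] T_carrier T_zero T_add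
      tens_space_def dest: subsetD[OF K_keys])

lemma pure_closed: "m \<in> carrier M \<Longrightarrow> n \<in> carrier N \<Longrightarrow> pure m n \<in> carrier T"
  by (rule coset_closed) (auto simp: keys_frag_of)

lemma pure_add_left:
  "m \<in> carrier M \<Longrightarrow> m' \<in> carrier M \<Longrightarrow> n \<in> carrier N \<Longrightarrow> pure (m \<oplus>\<^bsub>M\<^esub> m') n = pure m n \<oplus>\<^bsub>T\<^esub> pure m' n"
  by (simp add: T_add tens_space_def coset_add_coset coset_eq_iff diff_diff_add[symmetric] tens_null.add_left)

lemma pure_add_right:
  "m \<in> carrier M \<Longrightarrow> n \<in> carrier N \<Longrightarrow> n' \<in> carrier N \<Longrightarrow> pure m (n \<oplus>\<^bsub>N\<^esub> n') = pure m n \<oplus>\<^bsub>T\<^esub> pure m n'"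
  by (simp add: T_add tens_space_def coset_add_coset coset_eq_iff diff_diff_add[symmetric] tens_null.add_right)

lemma pure_bal: "m \<in> carrier M \<Longrightarrow> s \<in> S \<Longrightarrow> n \<in> carrier N \<Longrightarrow> pure (r m s) n = pure m (l s n)"
  by (simp add: coset_eq_iff tens_null.balanced)

text \<open>Scaling the left factor carries each generating relation to one of the same kind; for
  the balancing relation this holds because the operators commute with scalars.\<close>

lemma scale_K:
  assumes c: "c \<in> carrier k"
  shows "x \<in> K \<Longrightarrow> frag_extend (\<lambda>(m, n). frag_of (c \<odot>\<^bsub>M\<^esub> m, n)) x \<in> K"
proof (induction rule: tens_null.induct)
  case (balanced m s n)
  then show ?case
    using c tens_null.balanced[of "c \<odot>\<^bsub>M\<^esub> m" M s S n N r l]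
    by (simp add: frag_extend_diff r_smult[symmetric])
qed (use c in \<open>auto simp: frag_extend_diff M.smult_r_distr intro: tens_null.intros\<close>)

lemma scale_keys:
  "c \<in> carrier k \<Longrightarrow> p \<in> carrier M \<times> carrier N \<Longrightarrow>
   Poly_Mapping.keys ((\<lambda>(m, n). frag_of (c \<odot>\<^bsub>M\<^esub> m, n)) p) \<subseteq> carrier M \<times> carrier N"
  by (auto simp: keys_frag_of)

lemma T_smult_eq: "c \<odot>\<^bsub>T\<^esub> X = coset_map K (\<lambda>(m, n). frag_of (c \<odot>\<^bsub>M\<^esub> m, n)) X"
  by (simp add: T_smult tens_space_def)

lemma smult_ahom: "c \<in> carrier k \<Longrightarrow> ahom T T (\<lambda>X. c \<odot>\<^bsub>T\<^esub> X)"
  unfolding T_smult_eq by (rule coset_map_ahom[OF scale_keys scale_K])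

lemma smult_pure: "c \<in> carrier k \<Longrightarrow> c \<odot>\<^bsub>T\<^esub> pure m n = pure (c \<odot>\<^bsub>M\<^esub> m) n"
  unfolding T_smult_eq by (subst coset_map_coset[OF scale_keys scale_K]) simp_all

text \<open>Each axiom is an equality of two additive maps and is therefore checked on pure
  tensors.\<close>

lemma T_module: "Module.module k T"
proof (rule moduleI)
  show "cring k" by (rule M.is_cring)
  show "abelian_group T" by (rule fq_abelian_group)
  note ag = fq_abelian_group
  fix a X assume a: "a \<in> carrier k" and X: "X \<in> carrier T"
  show aX: "a \<odot>\<^bsub>T\<^esub> X \<in> carrier T" using ahom_closed[OF smult_ahom[OF a] X] .
  { fix Y assume "Y \<in> carrier T"
    then show "a \<odot>\<^bsub>T\<^esub> (X \<oplus>\<^bsub>T\<^esub> Y) = a \<odot>\<^bsub>T\<^esub> X \<oplus>\<^bsub>T\<^esub> a \<odot>\<^bsub>T\<^esub> Y" using ahom_add[OF smult_ahom[OF a] X] by simp }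
  fix b assume b: "b \<in> carrier k"
  have "ahom T T (\<lambda>X. a \<odot>\<^bsub>T\<^esub> X \<oplus>\<^bsub>T\<^esub> b \<odot>\<^bsub>T\<^esub> X)"
    using smult_ahom[OF a] smult_ahom[OF b]
    by (intro ahomI) (simp_all add: ahom_closed ahom_add fq.a_ac)
  from ahom_ext[OF ag smult_ahom this _ X, of "a \<oplus>\<^bsub>k\<^esub> b"]
  show "(a \<oplus>\<^bsub>k\<^esub> b) \<odot>\<^bsub>T\<^esub> X = a \<odot>\<^bsub>T\<^esub> X \<oplus>\<^bsub>T\<^esub> b \<odot>\<^bsub>T\<^esub> X"
    using a b by (auto simp: smult_pure M.smult_l_distr pure_add_left)
  have "ahom T T (\<lambda>X. a \<odot>\<^bsub>T\<^esub> (b \<odot>\<^bsub>T\<^esub> X))"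
    using smult_ahom[OF a] smult_ahom[OF b]
    by (intro ahomI) (simp_all add: ahom_closed ahom_add fq.a_ac)
  from ahom_ext[OF ag smult_ahom this _ X, of "a \<otimes>\<^bsub>k\<^esub> b"]
  show "(a \<otimes>\<^bsub>k\<^esub> b) \<odot>\<^bsub>T\<^esub> X = a \<odot>\<^bsub>T\<^esub> (b \<odot>\<^bsub>T\<^esub> X)"
    using a b by (auto simp: smult_pure M.smult_assoc1)
next
  fix X assume X: "X \<in> carrier T"
  have "ahom T T (\<lambda>X. X)" by (intro ahomI) simp_all
  from ahom_ext[OF fq_abelian_group smult_ahom this _ X, of "\<one>\<^bsub>k\<^esub>"]
  show "\<one>\<^bsub>k\<^esub> \<odot>\<^bsub>T\<^esub> X = X" by (auto simp: smult_pure)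
qed

text \<open>A scalar crosses the tensor sign disguised as the element of \<open>S\<close> that acts
  like it on both factors.\<close>

lemma smult_pure_right:
  assumes "c \<in> carrier k" "m \<in> carrier M" "n \<in> carrier N"
  shows "pure m (c \<odot>\<^bsub>N\<^esub> n) = c \<odot>\<^bsub>T\<^esub> pure m n"
proof -
  obtain s where "s \<in> S" "r m s = c \<odot>\<^bsub>M\<^esub> m" "l s n = c \<odot>\<^bsub>N\<^esub> n"
    using scal[OF assms(1)] assms by blast
  then show ?thesis using pure_bal[of m s n] assms by (simp add: smult_pure)
qed

lemma pure_bil: "bil k M N T (\<lambda>m n. pure m n)"
  by (intro bilI linI) (simp_all add: pure_closed pure_add_left pure_add_right smult_pure smult_pure_right)

lemma ext:
  assumes W: "Module.module k W" and "linear_map k T W h" "linear_map k T W g"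
    and "\<And>m n. m \<in> carrier M \<Longrightarrow> n \<in> carrier N \<Longrightarrow> h (pure m n) = g (pure m n)"
    and "X \<in> carrier T"
  shows "h X = g X"
  by (rule ahom_ext[OF mod_ab[OF W]]) (use assms in \<open>auto intro: lin_ahom\<close>)

lemma tbind_clift: "tbind W X f = clift W (case_prod f) X"
  by (simp add: tbind_def clift_def frag_eval_eq_feval)

text \<open>No balancing of \<open>f\<close> is assumed: agreement with a linear map on pure tensors
  already forces all representatives to evaluate to the same element. Most sums in the definitions
  are evaluated by finding such an \<open>h\<close>.\<close>

lemma tbind_eq:
  assumes W: "Module.module k W" and h: "linear_map k T W h"
    and f: "\<And>m n. m \<in> carrier M \<Longrightarrow> n \<in> carrier N \<Longrightarrow> f m n = h (pure m n)"
    and X: "X \<in> carrier T"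
  shows "tbind W X f = h X"
proof -
  interpret W: abelian_group W using W by (rule mod_ab)
  obtain x where x: "X = coset K x" "Poly_Mapping.keys x \<subseteq> carrier M \<times> carrier N"
    using X by (rule cosetE)
  have cl: "case_prod f p \<in> carrier W" if "p \<in> carrier M \<times> carrier N" for p
    using that f lin_closed[OF h] pure_closed by auto
  have ev: "feval W (case_prod f) y = h (coset K y)" if "Poly_Mapping.keys y \<subseteq> carrier M \<times> carrier N" for y
  proof -
    have "Poly_Mapping.keys y \<subseteq> carrier M \<times> carrier N \<and> feval W (case_prod f) y = h (coset K y)"
      using that
    proof (induction y rule: frag_induction)
      case zero
      then show ?case
        using lin_zero[OF T_module W h] by (simp add: feval_0[OF W.abelian_group_axioms] coset_0 T_zero tens_space_def)
    next
      case (one p)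
      then show ?case
        using cl[of p] feval_frag_of[OF W.abelian_group_axioms, of "case_prod f" p] f
        by (cases p) (auto simp: keys_frag_of)
    next
      case (diff a b)
      have "Poly_Mapping.keys (a - b) \<subseteq> carrier M \<times> carrier N" using diff keys_diff[of a b] by auto
      moreover have "feval W (case_prod f) (a - b) = feval W (case_prod f) a \<ominus>\<^bsub>W\<^esub> feval W (case_prod f) b"
        by (rule feval_diff[OF W.abelian_group_axioms]) (use diff cl in blast)
      ultimately show ?case
        using diff lin_diff[OF T_module W h] coset_closed by (simp add: coset_diff)
    qed
    then show ?thesis by simp
  qed
  have "h (coset K y) = h (coset K x)" if "y \<in> coset K x" for y
    using that coset_eq_iff[of y x] by (simp add: coset_def)
  then show ?thesis
    unfolding tbind_def frag_eval_eq_feval x(1)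
    by (intro add_const_on_coset[OF coset_self]) (use ev keys_coset[OF x(2)] in simp)
qed

context
  fixes W :: "('k, 'w, 'v) module_scheme" and f
  assumes W: "Module.module k W" and f: "bil k M N W f"
    and bal: "\<And>m s n. m \<in> carrier M \<Longrightarrow> s \<in> S \<Longrightarrow> n \<in> carrier N \<Longrightarrow> f (r m s) n = f m (l s n)"
begin

interpretation W: Module.module k W by (rule W)

lemma lift_null: "x \<in> K \<Longrightarrow> feval W (case_prod f) x = \<zero>\<^bsub>W\<^esub>"
proof (induction rule: tens_null.induct)
  note ag = W.abelian_group_axioms
  have cl: "case_prod f p \<in> carrier W" if "p \<in> carrier M \<times> carrier N" for p
    using that bil_closed[OF f] by auto
  { fix x y :: "'m \<times> 'n \<Rightarrow>\<^sub>0 int"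
    assume "Poly_Mapping.keys x \<subseteq> carrier M \<times> carrier N" "Poly_Mapping.keys y \<subseteq> carrier M \<times> carrier N"
    then have "feval W (case_prod f) (x - y) = feval W (case_prod f) x \<ominus>\<^bsub>W\<^esub> feval W (case_prod f) y"
      by (intro feval_diff[OF ag]) (use cl in blast) }
  note d = this
  case zero show ?case by (rule feval_0[OF ag])
  { case (diff x y) then show ?case using K_keys by (simp add: d W.r_neg W.minus_eq) }
  have kd: "Poly_Mapping.keys (frag_of p - frag_of q) \<subseteq> carrier M \<times> carrier N"
    if "p \<in> carrier M \<times> carrier N" "q \<in> carrier M \<times> carrier N" for p q :: "'m \<times> 'n"
    using that keys_diff[of "frag_of p" "frag_of q"] by (auto simp: keys_frag_of)
  have z: "x \<oplus>\<^bsub>W\<^esub> y \<ominus>\<^bsub>W\<^esub> x \<ominus>\<^bsub>W\<^esub> y = \<zero>\<^bsub>W\<^esub>" if "x \<in> carrier W" "y \<in> carrier W" for x y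
  proof -
    have "x \<oplus>\<^bsub>W\<^esub> y \<ominus>\<^bsub>W\<^esub> x \<ominus>\<^bsub>W\<^esub> y = (x \<oplus>\<^bsub>W\<^esub> y) \<oplus>\<^bsub>W\<^esub> \<ominus>\<^bsub>W\<^esub> (x \<oplus>\<^bsub>W\<^esub> y)"
      using that by (simp add: W.minus_eq W.a_assoc W.minus_add)
    then show ?thesis using that by (simp add: W.r_neg)
  qed
  { case (add_left m m' n)
    then show ?case
      using cl lin_add[of k M W "\<lambda>m. f m n" m m'] f z
      by (auto simp: d kd keys_frag_of feval_frag_of[OF ag] bil_def) }
  { case (add_right m n n')
    then show ?case
      using cl lin_add[of k N W "f m" n n'] f z
      by (auto simp: d kd keys_frag_of feval_frag_of[OF ag] bil_def) }
  { case (balanced m s n)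
    then show ?case
      using bil_closed[OF f] bal r_closed l_closed by (simp add: d keys_frag_of feval_frag_of[OF ag] W.r_neg W.minus_eq) }
qed

lemma lift_pure: "m \<in> carrier M \<Longrightarrow> n \<in> carrier N \<Longrightarrow> tbind W (pure m n) f = f m n"
  unfolding tbind_clift
  by (subst clift_gen[OF W.abelian_group_axioms _ lift_null]) (auto intro: bil_closed[OF f])

lemma lift_ahom: "ahom T W (\<lambda>X. tbind W X f)"
  unfolding tbind_clift
  by (rule clift_ahom[OF W.abelian_group_axioms _ lift_null]) (auto intro: bil_closed[OF f])

lemma lift_lin: "linear_map k T W (\<lambda>X. tbind W X f)"
proof (rule linI)
  fix X assume X: "X \<in> carrier T"
  show "tbind W X f \<in> carrier W" using ahom_closed[OF lift_ahom X] .
  { fix Y assume "Y \<in> carrier T"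
    then show "tbind W (X \<oplus>\<^bsub>T\<^esub> Y) f = tbind W X f \<oplus>\<^bsub>W\<^esub> tbind W Y f" using ahom_add[OF lift_ahom X] by simp }
  fix c assume c: "c \<in> carrier k"
  have 1: "ahom T W (\<lambda>X. tbind W (c \<odot>\<^bsub>T\<^esub> X) f)"
    using smult_ahom[OF c] lift_ahom by (auto simp: ahom_def Pi_iff)
  have 2: "ahom T W (\<lambda>X. c \<odot>\<^bsub>W\<^esub> tbind W X f)"
    using c ahom_closed[OF lift_ahom] ahom_add[OF lift_ahom] by (intro ahomI) (auto simp: W.smult_r_distr)
  show "tbind W (c \<odot>\<^bsub>T\<^esub> X) f = c \<odot>\<^bsub>W\<^esub> tbind W X f"
    by (rule ahom_ext[OF W.abelian_group_axioms 1 2 _ X])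
      (use c f in \<open>auto simp: smult_pure lift_pure bil_def lin_smult[of k M W "\<lambda>m. f m _"]\<close>)
qed

end

text \<open>Both sides of each identity in the parameter are linear in the tensor as well, so they
  are compared on pure tensors. Nested sums are linear in their outer variables by this
  argument.\<close>

lemma lin_tbind_param:
  assumes X: "X \<in> carrier T" and W: "Module.module k W" and U: "Module.module k U"
    and f: "\<And>u. u \<in> carrier U \<Longrightarrow> bil k M N W (f u)"
    and bal: "\<And>u m s n. u \<in> carrier U \<Longrightarrow> m \<in> carrier M \<Longrightarrow> s \<in> S \<Longrightarrow> n \<in> carrier N \<Longrightarrow> f u (r m s) n = f u m (l s n)"
    and fu: "\<And>m n. m \<in> carrier M \<Longrightarrow> n \<in> carrier N \<Longrightarrow> linear_map k U W (\<lambda>u. f u m n)"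
  shows "linear_map k U W (\<lambda>u. tbind W X (f u))"
proof -
  interpret W: Module.module k W by (rule W)
  interpret U: Module.module k U by (rule U)
  note L = lift_lin[OF W f bal] and P = lift_pure[OF W f bal]
  show ?thesis
  proof (rule linI)
    fix u assume u: "u \<in> carrier U"
    show "tbind W X (f u) \<in> carrier W" using lin_closed[OF L X] u by blast
    { fix v assume v: "v \<in> carrier U"
      show "tbind W X (f (u \<oplus>\<^bsub>U\<^esub> v)) = tbind W X (f u) \<oplus>\<^bsub>W\<^esub> tbind W X (f v)"
        by (rule tbind_eq[OF W _ _ X])
          (use u v in \<open>auto intro!: lin_sum[OF W] L simp: P lin_add[OF fu]\<close>) }
    fix c assume c: "c \<in> carrier k"
    show "tbind W X (f (c \<odot>\<^bsub>U\<^esub> u)) = c \<odot>\<^bsub>W\<^esub> tbind W X (f u)"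
      by (rule tbind_eq[OF W _ _ X])
        (use u c in \<open>auto intro!: lin_scaled[OF W] L simp: P lin_smult[OF fu]\<close>)
  qed
qed

end


section \<open>Algebras and bimodules\<close>

lemma k_algebraD:
  assumes "k_algebra k A"
  shows "ring A" "Module.module k A"
    and "\<And>c a b. c \<in> carrier k \<Longrightarrow> a \<in> carrier A \<Longrightarrow> b \<in> carrier A \<Longrightarrow>
      (c \<odot>\<^bsub>A\<^esub> a) \<otimes>\<^bsub>A\<^esub> b = c \<odot>\<^bsub>A\<^esub> (a \<otimes>\<^bsub>A\<^esub> b)"
    and "\<And>c a b. c \<in> carrier k \<Longrightarrow> a \<in> carrier A \<Longrightarrow> b \<in> carrier A \<Longrightarrow>
      a \<otimes>\<^bsub>A\<^esub> (c \<odot>\<^bsub>A\<^esub> b) = c \<odot>\<^bsub>A\<^esub> (a \<otimes>\<^bsub>A\<^esub> b)"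
  using assms by (auto simp: k_algebra_def)

lemma mult_bil: "k_algebra k A \<Longrightarrow> bil k A A A (\<lambda>a b. a \<otimes>\<^bsub>A\<^esub> b)"
  using k_algebraD[of k A] ring.ring_simprules[of A] by (intro bilI linI) auto

lemma bimoduleD:
  assumes "bimodule k D M"
  shows bm_module: "Module.module k M"
    and bm_lact_closed: "\<And>x m. x \<in> carrier D \<Longrightarrow> m \<in> carrier M \<Longrightarrow> lact M x m \<in> carrier M"
    and bm_ract_closed: "\<And>x m. x \<in> carrier D \<Longrightarrow> m \<in> carrier M \<Longrightarrow> ract M m x \<in> carrier M"
    and bm_lact_mult: "\<And>x y m. x \<in> carrier D \<Longrightarrow> y \<in> carrier D \<Longrightarrow> m \<in> carrier M \<Longrightarrow>
      lact M (x \<otimes>\<^bsub>D\<^esub> y) m = lact M x (lact M y m)"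
    and bm_ract_mult: "\<And>x y m. x \<in> carrier D \<Longrightarrow> y \<in> carrier D \<Longrightarrow> m \<in> carrier M \<Longrightarrow>
      ract M m (x \<otimes>\<^bsub>D\<^esub> y) = ract M (ract M m x) y"
    and bm_assoc: "\<And>x y m. x \<in> carrier D \<Longrightarrow> y \<in> carrier D \<Longrightarrow> m \<in> carrier M \<Longrightarrow>
      ract M (lact M x m) y = lact M x (ract M m y)"
    and bm_lact_one: "\<And>m. m \<in> carrier M \<Longrightarrow> lact M \<one>\<^bsub>D\<^esub> m = m"
    and bm_ract_one: "\<And>m. m \<in> carrier M \<Longrightarrow> ract M m \<one>\<^bsub>D\<^esub> = m"
  using assms by (auto simp: bimodule_def)

lemma lact_bil: "bimodule k D M \<Longrightarrow> bil k D M M (\<lambda>x m. lact M x m)"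
  by (intro bilI linI) (auto simp: bimodule_def)

lemma ract_bil: "bimodule k D M \<Longrightarrow> bil k M D M (\<lambda>m x. ract M m x)"
  by (intro bilI linI) (auto simp: bimodule_def)

lemma bimoduleI:
  assumes "Module.module k M" "bil k D M M (\<lambda>x m. lact M x m)" "bil k M D M (\<lambda>m x. ract M m x)"
    and "\<And>x y m. x \<in> carrier D \<Longrightarrow> y \<in> carrier D \<Longrightarrow> m \<in> carrier M \<Longrightarrow>
      lact M (x \<otimes>\<^bsub>D\<^esub> y) m = lact M x (lact M y m)"
    and "\<And>x y m. x \<in> carrier D \<Longrightarrow> y \<in> carrier D \<Longrightarrow> m \<in> carrier M \<Longrightarrow>
      ract M m (x \<otimes>\<^bsub>D\<^esub> y) = ract M (ract M m x) y"
    and "\<And>x y m. x \<in> carrier D \<Longrightarrow> y \<in> carrier D \<Longrightarrow> m \<in> carrier M \<Longrightarrow>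
      ract M (lact M x m) y = lact M x (ract M m y)"
    and "\<And>m. m \<in> carrier M \<Longrightarrow> lact M \<one>\<^bsub>D\<^esub> m = m" "\<And>m. m \<in> carrier M \<Longrightarrow> ract M m \<one>\<^bsub>D\<^esub> = m"
  shows "bimodule k D M"
  using assms unfolding bimodule_def bil_def linear_map_def by (simp add: Pi_iff)

section \<open>Tensor products over the field\<close>

lemma tens_tensor:
  assumes "Module.module k M" "Module.module k N"
  shows "tens k M N (carrier k) (\<lambda>m c. c \<odot>\<^bsub>M\<^esub> m) (\<lambda>c n. c \<odot>\<^bsub>N\<^esub> n) (tensor k M N)"
proof -
  interpret M: Module.module k M by fact
  interpret N: Module.module k N by fact
  show ?thesis
    using assms by unfold_locales
      (auto simp: tensor_def tnull_def M.smult_assoc1[symmetric] M.m_comm)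
qed

context
  fixes k :: "'k ring" and M :: "('k, 'm, 'x) module_scheme" and N :: "('k, 'n, 'y) module_scheme"
  assumes MN: "Module.module k M" "Module.module k N"
begin

interpretation T: tens k M N "carrier k" "\<lambda>m c. c \<odot>\<^bsub>M\<^esub> m" "\<lambda>c n. c \<odot>\<^bsub>N\<^esub> n" "tensor k M N"
  by (rule tens_tensor[OF MN])

lemmas tensor_module = T.T_module

lemma tns_bil: "bil k M N (tensor k M N) (\<lambda>m n. tns k M N m n)"
  using T.pure_bil by (simp add: tns_def tnull_def)

lemma tns_closed: "m \<in> carrier M \<Longrightarrow> n \<in> carrier N \<Longrightarrow> tns k M N m n \<in> carrier (tensor k M N)"
  using bil_closed[OF tns_bil] by blast

lemma tensor_ext:
  assumes "Module.module k W" and "linear_map k (tensor k M N) W h" "linear_map k (tensor k M N) W g"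
    and "\<And>m n. m \<in> carrier M \<Longrightarrow> n \<in> carrier N \<Longrightarrow> h (tns k M N m n) = g (tns k M N m n)"
    and "X \<in> carrier (tensor k M N)"
  shows "h X = g X"
  using T.ext[OF assms(1-3) _ assms(5)] assms(4) by (simp add: tns_def tnull_def)

lemma tbind_tensor:
  assumes "Module.module k W" "linear_map k (tensor k M N) W h"
    and "\<And>m n. m \<in> carrier M \<Longrightarrow> n \<in> carrier N \<Longrightarrow> f m n = h (tns k M N m n)"
    and "X \<in> carrier (tensor k M N)"
  shows "tbind W X f = h X"
  using T.tbind_eq[OF assms(1,2) _ assms(4)] assms(3) by (simp add: tns_def tnull_def)

lemma bil_smult:
  assumes "bil k M N W f" "c \<in> carrier k" "m \<in> carrier M" "n \<in> carrier N"
  shows "f (c \<odot>\<^bsub>M\<^esub> m) n = f m (c \<odot>\<^bsub>N\<^esub> n)"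
  using assms lin_smult[of k M W "\<lambda>m. f m n" c m] lin_smult[of k N W "f m" c n] by (simp add: bil_def)

lemma tbind_pure:
  assumes "Module.module k W" "bil k M N W f" "m \<in> carrier M" "n \<in> carrier N"
  shows "tbind W (tns k M N m n) f = f m n"
  using T.lift_pure[OF assms(1,2) bil_smult[OF assms(2)] assms(3,4)] by (simp add: tns_def tnull_def)

lemma tbind_lin:
  assumes "Module.module k W" "bil k M N W f"
  shows "linear_map k (tensor k M N) W (\<lambda>X. tbind W X f)"
  using T.lift_lin[OF assms bil_smult[OF assms(2)]] by simp

lemma tbind_lin_param:
  assumes "X \<in> carrier (tensor k M N)" "Module.module k W" "Module.module k U"
    and "\<And>u. u \<in> carrier U \<Longrightarrow> bil k M N W (f u)"
    and "\<And>m n. m \<in> carrier M \<Longrightarrow> n \<in> carrier N \<Longrightarrow> linear_map k U W (\<lambda>u. f u m n)"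
  shows "linear_map k U W (\<lambda>u. tbind W X (f u))"
  using T.lin_tbind_param[OF assms(1-4) bil_smult[OF assms(4)] assms(5)] by simp

lemma tensor_induct [consumes 1, case_names pure diff]:
  assumes X: "X \<in> carrier (tensor k M N)"
    and p: "\<And>m n. m \<in> carrier M \<Longrightarrow> n \<in> carrier N \<Longrightarrow> P (tns k M N m n)"
    and d: "\<And>X Y. \<lbrakk>X \<in> carrier (tensor k M N); Y \<in> carrier (tensor k M N); P X; P Y\<rbrakk> \<Longrightarrow> P (X \<ominus>\<^bsub>tensor k M N\<^esub> Y)"
  shows "P X"
  using X
proof (induction rule: T.coset_induct)
  case zero
  interpret M: Module.module k M by (rule MN)
  interpret N: Module.module k N by (rule MN)
  \<comment> \<open>Zero is reached without a case of its own, as the difference of a pure tensor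
    with itself.\<close>
  have "T.pure \<zero>\<^bsub>M\<^esub> \<zero>\<^bsub>N\<^esub> \<in> carrier (tensor k M N)" by (intro T.pure_closed) auto
  moreover have "P (T.pure \<zero>\<^bsub>M\<^esub> \<zero>\<^bsub>N\<^esub>)" using p[of "\<zero>\<^bsub>M\<^esub>" "\<zero>\<^bsub>N\<^esub>"] by (simp add: tns_def tnull_def)
  ultimately show ?case using d by (metis T.fq.r_neg T.fq.minus_eq)
next
  case (gen q)
  then show ?case using p by (cases q) (auto simp: tns_def tnull_def)
qed (rule d)

end

section \<open>Tensor products of bimodules over an algebra\<close>

lemma tensor_over_simps [simp]:
  "carrier (tensor_over D M N) = carrier (tens_space M N (tnull_over D M N))"
  "zero (tensor_over D M N) = zero (tens_space M N (tnull_over D M N))"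
  "add (tensor_over D M N) = add (tens_space M N (tnull_over D M N))"
  "smult (tensor_over D M N) = smult (tens_space M N (tnull_over D M N))"
  "lact (tensor_over D M N) x = coset_map (tnull_over D M N) (\<lambda>(m, n). frag_of (lact M x m, n))"
  "ract (tensor_over D M N) X x = coset_map (tnull_over D M N) (\<lambda>(m, n). frag_of (m, ract N n x)) X"
  by (simp_all add: tensor_over_def module.defs bimod.defs)

context
  fixes k :: "'k ring" and D :: "('k, 'd, 'z) module_scheme"
    and M :: "('k, 'd, 'm, 'x) bimod_scheme" and N :: "('k, 'd, 'n, 'y) bimod_scheme"
  assumes D: "k_algebra k D" and M: "bimodule k D M" and N: "bimodule k D N"
begin

interpretation M: Module.module k M by (rule bm_module[OF M])
interpretation N: Module.module k N by (rule bm_module[OF N])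
interpretation D: ring D by (rule k_algebraD(1)[OF D])

lemma tens_over: "tens k M N (carrier D) (ract M) (lact N) (tensor_over D M N)"
proof (unfold_locales)
  fix c assume c: "c \<in> carrier k"
  show "\<exists>s\<in>carrier D. (\<forall>m\<in>carrier M. ract M m s = c \<odot>\<^bsub>M\<^esub> m) \<and> (\<forall>n\<in>carrier N. lact N s n = c \<odot>\<^bsub>N\<^esub> n)"
  \<comment> \<open>A scalar acts on both factors as its multiple of the unit of \<open>D\<close>;
    this is why \<open>D\<close>-balanced tensors are also balanced over the field.\<close>
  proof (intro bexI[of _ "c \<odot>\<^bsub>D\<^esub> \<one>\<^bsub>D\<^esub>"])
    show "c \<odot>\<^bsub>D\<^esub> \<one>\<^bsub>D\<^esub> \<in> carrier D"
      using Module.module.smult_closed[OF k_algebraD(2)[OF D] c D.one_closed] .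
  qed (use M N c D.one_closed in \<open>auto simp: bimodule_def\<close>)
qed (use M N in \<open>auto simp: tnull_over_def bimodule_def\<close>)

interpretation T: tens k M N "carrier D" "ract M" "lact N" "tensor_over D M N"
  by (rule tens_over)

lemmas tover_module = T.T_module

lemma tover_bil: "bil k M N (tensor_over D M N) (\<lambda>m n. tns_over D M N m n)"
  using T.pure_bil by (simp add: tns_over_def tnull_over_def)

lemma tover_bal:
  "m \<in> carrier M \<Longrightarrow> x \<in> carrier D \<Longrightarrow> n \<in> carrier N \<Longrightarrow> tns_over D M N (ract M m x) n = tns_over D M N m (lact N x n)"
  using T.pure_bal by (simp add: tns_over_def tnull_over_def)

lemma tover_ext:
  assumes "Module.module k W" and "linear_map k (tensor_over D M N) W h" "linear_map k (tensor_over D M N) W g"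
    and "\<And>m n. m \<in> carrier M \<Longrightarrow> n \<in> carrier N \<Longrightarrow> h (tns_over D M N m n) = g (tns_over D M N m n)"
    and "X \<in> carrier (tensor_over D M N)"
  shows "h X = g X"
  using T.ext[OF assms(1-3) _ assms(5)] assms(4) by (simp add: tns_over_def tnull_over_def)

lemma tbind_tover:
  assumes "Module.module k W" "linear_map k (tensor_over D M N) W h"
    and "\<And>m n. m \<in> carrier M \<Longrightarrow> n \<in> carrier N \<Longrightarrow> f m n = h (tns_over D M N m n)"
    and "X \<in> carrier (tensor_over D M N)"
  shows "tbind W X f = h X"
  using T.tbind_eq[OF assms(1,2) _ assms(4)] assms(3) by (simp add: tns_over_def tnull_over_def)

lemma tbind_over_pure:
  assumes "Module.module k W" "bil k M N W f"
    and "\<And>m x n. m \<in> carrier M \<Longrightarrow> x \<in> carrier D \<Longrightarrow> n \<in> carrier N \<Longrightarrow> f (ract M m x) n = f m (lact N x n)"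
    and "m \<in> carrier M" "n \<in> carrier N"
  shows "tbind W (tns_over D M N m n) f = f m n"
  using T.lift_pure[OF assms] by (simp add: tns_over_def tnull_over_def)

lemma tbind_over_lin:
  assumes "Module.module k W" "bil k M N W f"
    and "\<And>m x n. m \<in> carrier M \<Longrightarrow> x \<in> carrier D \<Longrightarrow> n \<in> carrier N \<Longrightarrow> f (ract M m x) n = f m (lact N x n)"
  shows "linear_map k (tensor_over D M N) W (\<lambda>X. tbind W X f)"
  using T.lift_lin[OF assms] by simp

text \<open>The balancing relation survives because the two actions on \<open>M\<close>
  commute.\<close>

lemma lact_K:
  assumes x: "x \<in> carrier D"
  shows "z \<in> T.K \<Longrightarrow> frag_extend (\<lambda>(m, n). frag_of (lact M x m, n)) z \<in> T.K"
proof (induction rule: tens_null.induct)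
  case (balanced m s n)
  then show ?case
    using x tens_null.balanced[of "lact M x m" M s "carrier D" n N "ract M" "lact N"] M
    by (simp add: frag_extend_diff bm_lact_closed[OF M] bm_assoc[OF M, symmetric])
next
  case (add_left m m' n)
  then show ?case
    using x tens_null.add_left[of "lact M x m" M "lact M x m'" n] M
    by (simp add: frag_extend_diff bimodule_def)
qed (use x M in \<open>auto simp: frag_extend_diff bimodule_def intro: tens_null.intros\<close>)

lemma ract_K:
  assumes x: "x \<in> carrier D"
  shows "z \<in> T.K \<Longrightarrow> frag_extend (\<lambda>(m, n). frag_of (m, ract N n x)) z \<in> T.K"
proof (induction rule: tens_null.induct)
  case (balanced m s n)
  then show ?case
    using x tens_null.balanced[of m M s "carrier D" "ract N n x" N "ract M" "lact N"] N
    by (simp add: frag_extend_diff bm_ract_closed[OF N] bm_assoc[OF N])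
next
  case (add_right m n n')
  then show ?case
    using x tens_null.add_right[of m M "ract N n x" N "ract N n' x"] N
    by (simp add: frag_extend_diff bimodule_def)
qed (use x N in \<open>auto simp: frag_extend_diff bimodule_def intro: tens_null.intros\<close>)

lemma lact_keys: "x \<in> carrier D \<Longrightarrow> p \<in> carrier M \<times> carrier N \<Longrightarrow>
   Poly_Mapping.keys ((\<lambda>(m, n). frag_of (lact M x m, n)) p) \<subseteq> carrier M \<times> carrier N"
  by (auto simp: keys_frag_of bm_lact_closed[OF M])

lemma ract_keys: "x \<in> carrier D \<Longrightarrow> p \<in> carrier M \<times> carrier N \<Longrightarrow>
   Poly_Mapping.keys ((\<lambda>(m, n). frag_of (m, ract N n x)) p) \<subseteq> carrier M \<times> carrier N"
  by (auto simp: keys_frag_of bm_ract_closed[OF N])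

lemma lact_pure: "x \<in> carrier D \<Longrightarrow> lact (tensor_over D M N) x (tns_over D M N m n) = tns_over D M N (lact M x m) n"
  unfolding tensor_over_simps tns_over_def tnull_over_def
  by (subst T.coset_map_coset[OF lact_keys lact_K]) simp_all

lemma ract_pure: "x \<in> carrier D \<Longrightarrow> ract (tensor_over D M N) (tns_over D M N m n) x = tns_over D M N m (ract N n x)"
  unfolding tensor_over_simps tns_over_def tnull_over_def
  by (subst T.coset_map_coset[OF ract_keys ract_K]) simp_all


text \<open>If the values on pure tensors depend linearly on the left factor, then scaling before
  and after \<open>h\<close> gives two additive maps that agree on generators.\<close>

lemma over_lin_of_pure:
  assumes h: "ahom (tensor_over D M N) (tensor_over D M N) h"
    and g: "bil k M N (tensor_over D M N) g"
    and hg: "\<And>m n. m \<in> carrier M \<Longrightarrow> n \<in> carrier N \<Longrightarrow> h (tns_over D M N m n) = g m n"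
  shows "linear_map k (tensor_over D M N) (tensor_over D M N) h"
proof (rule linI)
  fix c X assume c: "c \<in> carrier k" and X: "X \<in> carrier (tensor_over D M N)"
  have 1: "ahom (tensor_over D M N) (tensor_over D M N) (\<lambda>X. h (c \<odot>\<^bsub>tensor_over D M N\<^esub> X))"
    using T.smult_ahom[OF c] h by (simp add: ahom_def Pi_iff del: tensor_over_simps)
  have 2: "ahom (tensor_over D M N) (tensor_over D M N) (\<lambda>X. c \<odot>\<^bsub>tensor_over D M N\<^esub> h X)"
    using T.smult_ahom[OF c] h by (simp add: ahom_def Pi_iff del: tensor_over_simps)
  show "h (c \<odot>\<^bsub>tensor_over D M N\<^esub> X) = c \<odot>\<^bsub>tensor_over D M N\<^esub> h X"
  proof (rule T.ahom_ext[OF mod_ab[OF tover_module] 1 2 _ X])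
    fix p assume "p \<in> carrier M \<times> carrier N"
    then obtain m n where p: "p = (m, n)" "m \<in> carrier M" "n \<in> carrier N" by auto
    have "h (c \<odot>\<^bsub>tensor_over D M N\<^esub> T.pure m n) = h (T.pure (c \<odot>\<^bsub>M\<^esub> m) n)"
      using c p by (simp add: T.smult_pure del: tensor_over_simps)
    also have "\<dots> = c \<odot>\<^bsub>tensor_over D M N\<^esub> h (T.pure m n)"
      using hg[of m n] hg[of "c \<odot>\<^bsub>M\<^esub> m" n] g c p lin_smult[of k M "tensor_over D M N" "\<lambda>m. g m n" c m]
      by (simp add: tns_over_def tnull_over_def bil_def del: tensor_over_simps)
    finally show "h (c \<odot>\<^bsub>tensor_over D M N\<^esub> coset T.K (frag_of p)) =
        c \<odot>\<^bsub>tensor_over D M N\<^esub> h (coset T.K (frag_of p))"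
      by (simp add: p del: tensor_over_simps)
  qed
qed (use h in \<open>simp_all add: ahom_def Pi_iff del: tensor_over_simps\<close>)

lemma lact_lin:
  assumes x: "x \<in> carrier D"
  shows "linear_map k (tensor_over D M N) (tensor_over D M N) (lact (tensor_over D M N) x)"
proof (rule over_lin_of_pure)
  show "ahom (tensor_over D M N) (tensor_over D M N) (lact (tensor_over D M N) x)"
    using T.coset_map_ahom[OF lact_keys[OF x] lact_K[OF x]]
    by (simp only: tensor_over_simps(5) tnull_over_def)
  show "bil k M N (tensor_over D M N) (\<lambda>m n. tns_over D M N (lact M x m) n)"
    by (intro bilI bil_l[OF tover_bil bil_r[OF lact_bil[OF M] lin_id x]] bil_r[OF tover_bil lin_id])
      (use x in \<open>simp_all add: bm_lact_closed[OF M]\<close>)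
qed (rule lact_pure[OF x])

lemma ract_lin:
  assumes x: "x \<in> carrier D"
  shows "linear_map k (tensor_over D M N) (tensor_over D M N) (\<lambda>X. ract (tensor_over D M N) X x)"
proof (rule over_lin_of_pure)
  show "ahom (tensor_over D M N) (tensor_over D M N) (\<lambda>X. ract (tensor_over D M N) X x)"
    using T.coset_map_ahom[OF ract_keys[OF x] ract_K[OF x]]
    by (simp only: tensor_over_simps(6) tnull_over_def)
  show "bil k M N (tensor_over D M N) (\<lambda>m n. tns_over D M N m (ract N n x))"
    by (intro bilI bil_r[OF tover_bil bil_l[OF ract_bil[OF N] lin_id x]] bil_l[OF tover_bil lin_id])
      (use x in \<open>simp_all add: bm_ract_closed[OF N]\<close>)
qed (rule ract_pure[OF x])

lemma tover_bimodule: "bimodule k D (tensor_over D M N)"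
proof (rule bimoduleI)
  let ?T = "tensor_over D M N"
  note [simp del] = tensor_over_simps
  note [simp] = lact_pure ract_pure bm_lact_closed[OF M] bm_ract_closed[OF N]
  note mod = tover_module
  interpret T': Module.module k ?T by (rule mod)
  interpret DM: Module.module k D by (rule k_algebraD(2)[OF D])
  show "Module.module k ?T" by (rule mod)
  have add: "linear_map k D ?T (\<lambda>x. tns_over D M N (lact M x m) n)" if "m \<in> carrier M" "n \<in> carrier N" for m n
    using that by (intro bil_l[OF tover_bil bil_l[OF lact_bil[OF M] lin_id]])
  have addr: "linear_map k D ?T (\<lambda>x. tns_over D M N m (ract N n x))" if "m \<in> carrier M" "n \<in> carrier N" for m n
    using that by (intro bil_r[OF tover_bil bil_r[OF ract_bil[OF N] lin_id]])
  show "bil k D ?T ?T (lact ?T)"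
  proof (intro bilI)
    fix X assume X: "X \<in> carrier ?T"
    show "linear_map k D ?T (\<lambda>x. lact ?T x X)"
    proof (rule linI)
      fix x y assume x: "x \<in> carrier D" and y: "y \<in> carrier D"
      show "lact ?T (x \<oplus>\<^bsub>D\<^esub> y) X = lact ?T x X \<oplus>\<^bsub>?T\<^esub> lact ?T y X"
        by (rule tover_ext[OF mod _ _ _ X])
          (use x y in \<open>auto intro!: lact_lin lin_sum[OF mod] simp: lin_add[OF add]\<close>)
    next
      fix c x assume x: "x \<in> carrier D" and c: "c \<in> carrier k"
      show "lact ?T (c \<odot>\<^bsub>D\<^esub> x) X = c \<odot>\<^bsub>?T\<^esub> lact ?T x X"
        by (rule tover_ext[OF mod _ _ _ X])
          (use x c in \<open>auto intro!: lact_lin lin_scaled[OF mod] simp: lin_smult[OF add]\<close>)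
    qed (rule lin_closed[OF lact_lin _], use X in auto)
  qed (use lact_lin in simp)
  show "bil k ?T D ?T (ract ?T)"
  proof (intro bilI)
    fix X assume X: "X \<in> carrier ?T"
    show "linear_map k D ?T (ract ?T X)"
    proof (rule linI)
      fix x y assume x: "x \<in> carrier D" and y: "y \<in> carrier D"
      show "ract ?T X (x \<oplus>\<^bsub>D\<^esub> y) = ract ?T X x \<oplus>\<^bsub>?T\<^esub> ract ?T X y"
        by (rule tover_ext[OF mod _ _ _ X])
          (use x y in \<open>auto intro!: ract_lin lin_sum[OF mod] simp: lin_add[OF addr]\<close>)
    next
      fix c x assume x: "x \<in> carrier D" and c: "c \<in> carrier k"
      show "ract ?T X (c \<odot>\<^bsub>D\<^esub> x) = c \<odot>\<^bsub>?T\<^esub> ract ?T X x"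
        by (rule tover_ext[OF mod _ _ _ X])
          (use x c in \<open>auto intro!: ract_lin lin_scaled[OF mod] simp: lin_smult[OF addr]\<close>)
    qed (rule lin_closed[OF ract_lin _], use X in auto)
  qed (use ract_lin in simp)
  fix X assume X: "X \<in> carrier ?T"
  show "lact ?T \<one>\<^bsub>D\<^esub> X = X"
    by (rule tover_ext[OF mod _ _ _ X]) (auto intro!: lact_lin lin_id simp: bm_lact_one[OF M])
  show "ract ?T X \<one>\<^bsub>D\<^esub> = X"
    by (rule tover_ext[OF mod _ _ _ X]) (auto intro!: ract_lin lin_id simp: bm_ract_one[OF N])
  fix x y assume x: "x \<in> carrier D" and y: "y \<in> carrier D"
  note [intro!] = lact_lin ract_lin lin_comp[OF lact_lin] lin_comp[OF ract_lin]
  show "lact ?T (x \<otimes>\<^bsub>D\<^esub> y) X = lact ?T x (lact ?T y X)"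
    by (rule tover_ext[OF mod _ _ _ X]) (use x y in \<open>auto simp: bm_lact_mult[OF M]\<close>)
  show "ract ?T X (x \<otimes>\<^bsub>D\<^esub> y) = ract ?T (ract ?T X x) y"
    by (rule tover_ext[OF mod _ _ _ X]) (use x y in \<open>auto simp: bm_ract_mult[OF N]\<close>)
  show "ract ?T (lact ?T x X) y = lact ?T x (ract ?T X y)"
    by (rule tover_ext[OF mod _ _ _ X]) (use x y in auto)
qed

end

section \<open>The universal differential graded algebra\<close>

lemma word_mult_simps [simp]:
  "word_mult 0 y = 0" "word_mult x 0 = 0"
  "word_mult (frag_of u) (frag_of v) = frag_of (u @ v)"
  "word_mult (x + x') y = word_mult x y + word_mult x' y"
  "word_mult (x - x') y = word_mult x y - word_mult x' y"
  by (simp_all add: word_mult_def frag_extend_add frag_extend_diff frag_extend_eq_0)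

lemma word_mult_diff_right [simp]: "word_mult x (y - y') = word_mult x y - word_mult x y'"
  by (induction x rule: frag_induction[OF subset_UNIV]) (simp_all add: word_mult_def frag_extend_diff)

lemma word_mult_add_right [simp]: "word_mult x (y + y') = word_mult x y + word_mult x y'"
  using word_mult_diff_right[of x "y + y'" y'] by (simp add: algebra_simps)

lemma word_mult_uminus [simp]: "word_mult (- x) y = - word_mult x y" "word_mult x (- y) = - word_mult x y"
  using word_mult_simps(5)[of 0 x y] word_mult_diff_right[of x 0 y] by simp_all

lemma word_mult_assoc: "word_mult (word_mult x y) z = word_mult x (word_mult y z)"
proof (induction x rule: frag_induction[OF subset_UNIV])
  case (2 u)
  show ?case
  proof (induction y rule: frag_induction[OF subset_UNIV])
    case (2 v)
    show ?case by (induction z rule: frag_induction[OF subset_UNIV]) simp_all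
  qed simp_all
qed simp_all

lemma word_mult_Nil [simp]: "word_mult (frag_of []) x = x" "word_mult x (frag_of []) = x"
  by (induction x rule: frag_induction[OF subset_UNIV]) simp_all

lemma keys_word_mult:
  "Poly_Mapping.keys (word_mult x y) \<subseteq> {u @ v | u v. u \<in> Poly_Mapping.keys x \<and> v \<in> Poly_Mapping.keys y}"
  unfolding word_mult_def
  by (rule order_trans[OF keys_frag_extend])
    (force dest!: subsetD[OF keys_frag_extend] simp: keys_frag_of)

lemma words_append [simp]: "u @ v \<in> words A \<longleftrightarrow> u \<in> words A \<and> v \<in> words A"
  by (auto simp: words_def)

lemma words_simps [simp]:
  "[] \<in> words A" "Fn a # w \<in> words A \<longleftrightarrow> a \<in> carrier A \<and> w \<in> words A"
  "Df a # w \<in> words A \<longleftrightarrow> a \<in> carrier A \<and> w \<in> words A"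
  by (auto simp: words_def)

lemma words_induct [consumes 1, case_names Nil Fn Df]:
  assumes "w \<in> words A" "P []"
    and "\<And>a w. a \<in> carrier A \<Longrightarrow> w \<in> words A \<Longrightarrow> P w \<Longrightarrow> P (Fn a # w)"
    and "\<And>a w. a \<in> carrier A \<Longrightarrow> w \<in> words A \<Longrightarrow> P w \<Longrightarrow> P (Df a # w)"
  shows "P w"
  using assms(1)
proof (induction w)
  case (Cons g w)
  then show ?case using assms(3,4) by (cases g) auto
qed (rule assms(2))

lemma wdeg_append [simp]: "wdeg (u @ v) = wdeg u + wdeg v"
  by (induction u rule: wdeg.induct) auto

section \<open>The algebra of forms as a quotient ring\<close>

locale omega =
  fixes k :: "'k ring" and A :: "('k, 'a, 'z) module_scheme"
  assumes alg: "k_algebra k A"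
begin

interpretation A: ring A by (rule k_algebraD(1)[OF alg])
interpretation M: Module.module k A by (rule k_algebraD(2)[OF alg])

abbreviation "K \<equiv> Omega_null k A"
abbreviation "OmA \<equiv> Omega k A"
abbreviation "\<iota> \<equiv> iota k A"
text \<open>Kept apart from \<open>dga_diff\<close> until the differential is known to descend to
  the quotient; \<open>diff_iota\<close> then identifies the two.\<close>

definition dd :: "'a \<Rightarrow> 'a forms" where "dd a = coset K (frag_of [Df a])"

lemma Omega_simps:
  "carrier OmA = coset K ` {x. Poly_Mapping.keys x \<subseteq> words A}"
  "mult OmA X Y = (\<Union>x \<in> X. \<Union>y \<in> Y. coset K (word_mult x y))"
  "one OmA = coset K (frag_of [])" "zero OmA = K" "add OmA = coset_add"
  "smult OmA c = coset_map K (\<lambda>w. frag_of (Fn (c \<odot>\<^bsub>A\<^esub> \<one>\<^bsub>A\<^esub>) # w))"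
  "dga_deg OmA p = coset K ` {x. Poly_Mapping.keys x \<subseteq> {w \<in> words A. wdeg w = p}}"
  "dga_diff OmA = coset_map K word_diff"
  by (simp_all add: Omega_def Let_def)

lemma K_keys: "x \<in> K \<Longrightarrow> Poly_Mapping.keys x \<subseteq> words A"
proof (induction rule: Omega_null.induct)
  case (diff x y)
  then show ?case using keys_diff[of x y] by blast
qed (auto simp: keys_frag_of dest!: subsetD[OF keys_diff])

sublocale O: fquot K "words A" OmA
  by unfold_locales (auto simp: Omega_null.zero Omega_null.diff Omega_simps dest: subsetD[OF K_keys])

text \<open>The relations are stated inside arbitrary words, so multiplication by a word only
  lengthens the context. With \<open>K_mult_word_left\<close> the relations form a two-sided
  ideal.\<close>

lemma K_mult_word_right: "x \<in> K \<Longrightarrow> w \<in> words A \<Longrightarrow> word_mult x (frag_of w) \<in> K"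
proof (induction rule: Omega_null.induct)
  case (fn_add u v a b)
  then show ?case using Omega_null.fn_add[of u A "v @ w" a b k] by simp
next
  case (fn_mult u v a b)
  then show ?case using Omega_null.fn_mult[of u A "v @ w" a b k] by simp
next
  case (fn_one u v)
  then show ?case using Omega_null.fn_one[of u A "v @ w" k] by simp
next
  case (df_add u v a b)
  then show ?case using Omega_null.df_add[of u A "v @ w" a b k] by simp
next
  case (df_mult u v a b)
  then show ?case using Omega_null.df_mult[of u A "v @ w" a b k] by simp
next
  case (df_smult u v c a)
  then show ?case using Omega_null.df_smult[of u A "v @ w" c k a] by simp
qed (auto intro: Omega_null.intros)

lemma K_mult_word_left: "x \<in> K \<Longrightarrow> w \<in> words A \<Longrightarrow> word_mult (frag_of w) x \<in> K"
proof (induction rule: Omega_null.induct)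
  case (fn_add u v a b)
  then show ?case using Omega_null.fn_add[of "w @ u" A v a b k] by simp
next
  case (fn_mult u v a b)
  then show ?case using Omega_null.fn_mult[of "w @ u" A v a b k] by simp
next
  case (fn_one u v)
  then show ?case using Omega_null.fn_one[of "w @ u" A v k] by simp
next
  case (df_add u v a b)
  then show ?case using Omega_null.df_add[of "w @ u" A v a b k] by simp
next
  case (df_mult u v a b)
  then show ?case using Omega_null.df_mult[of "w @ u" A v a b k] by simp
next
  case (df_smult u v c a)
  then show ?case using Omega_null.df_smult[of "w @ u" A v c k a] by simp
qed (auto intro: Omega_null.intros)

lemma K_mult_right:
  assumes "x \<in> K" "Poly_Mapping.keys y \<subseteq> words A" shows "word_mult x y \<in> K"
  using assms(2)
  by (induction y rule: frag_induction) (auto simp: assms(1) K_mult_word_right intro: Omega_null.intros)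

lemma K_mult_left:
  assumes "x \<in> K" "Poly_Mapping.keys y \<subseteq> words A" shows "word_mult y x \<in> K"
  using assms(2)
  by (induction y rule: frag_induction) (auto simp: assms(1) K_mult_word_left intro: Omega_null.intros)

lemma mult_coset:
  assumes "Poly_Mapping.keys x \<subseteq> words A" "Poly_Mapping.keys y \<subseteq> words A"
  shows "coset K x \<otimes>\<^bsub>OmA\<^esub> coset K y = coset K (word_mult x y)"
proof -
  have "coset K (word_mult x' y') = coset K (word_mult x y)" if "x' \<in> coset K x" "y' \<in> coset K y" for x' y'
  proof -
    \<comment> \<open>The difference of the products is telescoped as x'y' - xy = (x' - x) y' + x
      (y' - y).\<close>
    have "word_mult (x' - x) y' \<in> K"
      using O.keys_coset[OF assms(2) that(2)] that(1) by (intro K_mult_right) (simp_all add: coset_def)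
    moreover have "word_mult x (y' - y) \<in> K"
      using assms(1) that(2) by (intro K_mult_left) (simp_all add: coset_def)
    ultimately have "word_mult (x' - x) y' + word_mult x (y' - y) \<in> K" by (rule O.Kadd)
    then show ?thesis by (simp add: O.coset_eq_iff)
  qed
  moreover have "x \<in> coset K x" "y \<in> coset K y" by (rule O.coset_self)+
  ultimately show ?thesis unfolding Omega_simps(2) by blast
qed

lemma keys_word_mult_words:
  "Poly_Mapping.keys x \<subseteq> words A \<Longrightarrow> Poly_Mapping.keys y \<subseteq> words A \<Longrightarrow> Poly_Mapping.keys (word_mult x y) \<subseteq> words A"
  using keys_word_mult[of x y] by fastforce

lemma Omega_ring: "ring OmA"
proof (rule ringI)
  show "abelian_group OmA" by (rule O.fq_abelian_group)
  show "monoid OmA"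
  proof
    fix X Y Z assume "X \<in> carrier OmA" "Y \<in> carrier OmA" "Z \<in> carrier OmA"
    then obtain x y z where
      "X = coset K x" "Poly_Mapping.keys x \<subseteq> words A" "Y = coset K y" "Poly_Mapping.keys y \<subseteq> words A"
      "Z = coset K z" "Poly_Mapping.keys z \<subseteq> words A"
      using O.cosetE by metis
    then show "X \<otimes>\<^bsub>OmA\<^esub> Y \<in> carrier OmA" "X \<otimes>\<^bsub>OmA\<^esub> Y \<otimes>\<^bsub>OmA\<^esub> Z = X \<otimes>\<^bsub>OmA\<^esub> (Y \<otimes>\<^bsub>OmA\<^esub> Z)"
      by (simp_all add: mult_coset keys_word_mult_words O.coset_closed word_mult_assoc)
  next
    show "\<one>\<^bsub>OmA\<^esub> \<in> carrier OmA" by (simp add: Omega_simps(3) O.coset_closed keys_frag_of)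
    fix X assume "X \<in> carrier OmA"
    then obtain x where "X = coset K x" "Poly_Mapping.keys x \<subseteq> words A" by (rule O.cosetE)
    then show "\<one>\<^bsub>OmA\<^esub> \<otimes>\<^bsub>OmA\<^esub> X = X" "X \<otimes>\<^bsub>OmA\<^esub> \<one>\<^bsub>OmA\<^esub> = X"
      by (simp_all add: Omega_simps(3) mult_coset keys_frag_of)
  qed
  fix X Y Z assume "X \<in> carrier OmA" "Y \<in> carrier OmA" "Z \<in> carrier OmA"
  then obtain x y z where *:
    "X = coset K x" "Poly_Mapping.keys x \<subseteq> words A" "Y = coset K y" "Poly_Mapping.keys y \<subseteq> words A"
    "Z = coset K z" "Poly_Mapping.keys z \<subseteq> words A"
    using O.cosetE by metis
  moreover have "Poly_Mapping.keys (x + y) \<subseteq> words A"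
    using * Poly_Mapping.keys_add[of x y] by blast
  ultimately show "(X \<oplus>\<^bsub>OmA\<^esub> Y) \<otimes>\<^bsub>OmA\<^esub> Z = X \<otimes>\<^bsub>OmA\<^esub> Z \<oplus>\<^bsub>OmA\<^esub> Y \<otimes>\<^bsub>OmA\<^esub> Z"
    "Z \<otimes>\<^bsub>OmA\<^esub> (X \<oplus>\<^bsub>OmA\<^esub> Y) = Z \<otimes>\<^bsub>OmA\<^esub> X \<oplus>\<^bsub>OmA\<^esub> Z \<otimes>\<^bsub>OmA\<^esub> Y"
    by (simp_all add: Omega_simps(5) O.coset_add_coset mult_coset)
qed

sublocale OR: ring OmA by (rule Omega_ring)

lemma iota_closed [simp]: "a \<in> carrier A \<Longrightarrow> \<iota> a \<in> carrier OmA"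
  by (simp add: iota_def O.coset_closed keys_frag_of)

lemma dd_closed [simp]: "a \<in> carrier A \<Longrightarrow> dd a \<in> carrier OmA"
  by (simp add: dd_def O.coset_closed keys_frag_of)

lemma word_closed [simp]: "w \<in> words A \<Longrightarrow> coset K (frag_of w) \<in> carrier OmA"
  by (simp add: O.coset_closed keys_frag_of)

lemma word_append: "u \<in> words A \<Longrightarrow> v \<in> words A \<Longrightarrow>
   coset K (frag_of (u @ v)) = coset K (frag_of u) \<otimes>\<^bsub>OmA\<^esub> coset K (frag_of v)"
  by (simp add: mult_coset keys_frag_of)

lemma word_Nil: "coset K (frag_of []) = \<one>\<^bsub>OmA\<^esub>"
  by (simp add: Omega_simps)

lemma word_Fn: "a \<in> carrier A \<Longrightarrow> w \<in> words A \<Longrightarrow>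
   coset K (frag_of (Fn a # w)) = \<iota> a \<otimes>\<^bsub>OmA\<^esub> coset K (frag_of w)"
  using word_append[of "[Fn a]" w] by (simp add: iota_def)

lemma word_Df: "a \<in> carrier A \<Longrightarrow> w \<in> words A \<Longrightarrow>
   coset K (frag_of (Df a # w)) = dd a \<otimes>\<^bsub>OmA\<^esub> coset K (frag_of w)"
  using word_append[of "[Df a]" w] by (simp add: dd_def)

lemma iota_add: "a \<in> carrier A \<Longrightarrow> b \<in> carrier A \<Longrightarrow> \<iota> (a \<oplus>\<^bsub>A\<^esub> b) = \<iota> a \<oplus>\<^bsub>OmA\<^esub> \<iota> b"
  using Omega_null.fn_add[of "[]" A "[]" a b k]
  by (simp add: iota_def Omega_simps O.coset_add_coset O.coset_eq_iff diff_diff_add)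

lemma dd_add: "a \<in> carrier A \<Longrightarrow> b \<in> carrier A \<Longrightarrow> dd (a \<oplus>\<^bsub>A\<^esub> b) = dd a \<oplus>\<^bsub>OmA\<^esub> dd b"
  using Omega_null.df_add[of "[]" A "[]" a b k]
  by (simp add: dd_def Omega_simps O.coset_add_coset O.coset_eq_iff diff_diff_add)

lemma iota_mult: "a \<in> carrier A \<Longrightarrow> b \<in> carrier A \<Longrightarrow> \<iota> (a \<otimes>\<^bsub>A\<^esub> b) = \<iota> a \<otimes>\<^bsub>OmA\<^esub> \<iota> b"
  using Omega_null.fn_mult[of "[]" A "[]" a b k]
  by (simp add: iota_def mult_coset O.coset_eq_iff keys_frag_of)

lemma iota_one: "\<iota> \<one>\<^bsub>A\<^esub> = \<one>\<^bsub>OmA\<^esub>"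
  using Omega_null.fn_one[of "[]" A "[]" k]
  by (simp add: iota_def Omega_simps(3) O.coset_eq_iff)

lemma dd_mult: "a \<in> carrier A \<Longrightarrow> b \<in> carrier A \<Longrightarrow>
   dd (a \<otimes>\<^bsub>A\<^esub> b) = dd a \<otimes>\<^bsub>OmA\<^esub> \<iota> b \<oplus>\<^bsub>OmA\<^esub> \<iota> a \<otimes>\<^bsub>OmA\<^esub> dd b"
  using Omega_null.df_mult[of "[]" A "[]" a b k]
  by (simp add: iota_def dd_def mult_coset O.coset_eq_iff keys_frag_of Omega_simps(5) O.coset_add_coset diff_diff_add)

lemma dd_smult_iota: "c \<in> carrier k \<Longrightarrow> a \<in> carrier A \<Longrightarrow>
   dd (c \<odot>\<^bsub>A\<^esub> a) = \<iota> (c \<odot>\<^bsub>A\<^esub> \<one>\<^bsub>A\<^esub>) \<otimes>\<^bsub>OmA\<^esub> dd a"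
  using Omega_null.df_smult[of "[]" A "[]" c k a]
  by (simp add: iota_def dd_def mult_coset O.coset_eq_iff keys_frag_of)

text \<open>Scalars act through the degree 0 generator of c 1, so the vector space structure of the
  forms is contained in the ring structure.\<close>

lemma smult_eq:
  assumes c: "c \<in> carrier k" and X: "X \<in> carrier OmA"
  shows "c \<odot>\<^bsub>OmA\<^esub> X = \<iota> (c \<odot>\<^bsub>A\<^esub> \<one>\<^bsub>A\<^esub>) \<otimes>\<^bsub>OmA\<^esub> X"
proof -
  let ?f = "\<lambda>w. frag_of (Fn (c \<odot>\<^bsub>A\<^esub> \<one>\<^bsub>A\<^esub>) # w)"
  have f: "frag_extend ?f x = word_mult (frag_of [Fn (c \<odot>\<^bsub>A\<^esub> \<one>\<^bsub>A\<^esub>)]) x" for x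
    by (simp add: word_mult_def)
  obtain x where x: "X = coset K x" "Poly_Mapping.keys x \<subseteq> words A" using X by (rule O.cosetE)
  have "coset_map K ?f (coset K x) = coset K (frag_extend ?f x)"
    by (rule O.coset_map_coset) (use c in \<open>auto simp: f keys_frag_of intro!: K_mult_left\<close>)
  then show ?thesis using x c by (simp add: Omega_simps(6) iota_def mult_coset keys_frag_of f)
qed

text \<open>The Leibniz rule applied to 1 = 1 1 gives d 1 = d 1 + d 1.\<close>

lemma dd_one: "dd \<one>\<^bsub>A\<^esub> = \<zero>\<^bsub>OmA\<^esub>"
proof -
  have "dd \<one>\<^bsub>A\<^esub> = dd \<one>\<^bsub>A\<^esub> \<oplus>\<^bsub>OmA\<^esub> dd \<one>\<^bsub>A\<^esub>"
    using dd_mult[of "\<one>\<^bsub>A\<^esub>" "\<one>\<^bsub>A\<^esub>"] by (simp add: iota_one)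
  then show ?thesis using dd_closed[OF A.one_closed] by (metis O.fq.add.l_cancel_one')
qed

lemma dd_scalar: "c \<in> carrier k \<Longrightarrow> dd (c \<odot>\<^bsub>A\<^esub> \<one>\<^bsub>A\<^esub>) = \<zero>\<^bsub>OmA\<^esub>"
  by (simp add: dd_smult_iota dd_one)

text \<open>Scalars are central although no relation says so. They commute with functions inside
  \<open>A\<close>; and since d (c 1) = 0, the Leibniz rule for a (c 1) gives (d a) (c 1) = d (c a),
  which equals (c 1) (d a) by the relation for scalars.\<close>

lemma iota_scalar_comm:
  assumes c: "c \<in> carrier k" and X: "X \<in> carrier OmA"
  shows "X \<otimes>\<^bsub>OmA\<^esub> \<iota> (c \<odot>\<^bsub>A\<^esub> \<one>\<^bsub>A\<^esub>) = \<iota> (c \<odot>\<^bsub>A\<^esub> \<one>\<^bsub>A\<^esub>) \<otimes>\<^bsub>OmA\<^esub> X"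
  using X
proof (induction rule: O.coset_induct)
  note [simp] = k_algebraD(3,4)[OF alg]
  let ?c = "c \<odot>\<^bsub>A\<^esub> \<one>\<^bsub>A\<^esub>"
  have cc: "?c \<in> carrier A" using c by simp
  { case zero then show ?case using cc by simp }
  { case (gen w)
    then show ?case
    proof (induction rule: words_induct)
      case Nil show ?case using cc by (simp add: word_Nil)
    next
      case (Fn a w)
      have 1: "\<iota> a \<otimes>\<^bsub>OmA\<^esub> \<iota> ?c = \<iota> ?c \<otimes>\<^bsub>OmA\<^esub> \<iota> a"
        using Fn c cc by (simp add: iota_mult[symmetric])
      show ?case using Fn cc 1 by (simp add: word_Fn OR.m_assoc) (metis 1 OR.m_assoc iota_closed word_closed)
    next
      case (Df a w)
      have "a \<otimes>\<^bsub>A\<^esub> ?c = c \<odot>\<^bsub>A\<^esub> a" using Df c by simp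
      then have 1: "dd a \<otimes>\<^bsub>OmA\<^esub> \<iota> ?c = \<iota> ?c \<otimes>\<^bsub>OmA\<^esub> dd a"
        using Df c cc dd_mult[of a ?c] dd_smult_iota[of c a] by (simp add: dd_scalar del: k_algebraD(3,4))
      show ?case using Df cc 1 by (simp add: word_Df OR.m_assoc) (metis 1 OR.m_assoc iota_closed dd_closed word_closed)
    qed }
  { case (diff X Y) then show ?case using cc by (simp add: OR.l_distr OR.r_distr O.fq.minus_eq OR.l_minus OR.r_minus) }
qed

lemma Omega_module: "Module.module k OmA"
proof (rule moduleI)
  fix a b X assume "a \<in> carrier k" "b \<in> carrier k" "X \<in> carrier OmA"
  moreover have "(a \<otimes>\<^bsub>k\<^esub> b) \<odot>\<^bsub>A\<^esub> \<one>\<^bsub>A\<^esub> = (a \<odot>\<^bsub>A\<^esub> \<one>\<^bsub>A\<^esub>) \<otimes>\<^bsub>A\<^esub> (b \<odot>\<^bsub>A\<^esub> \<one>\<^bsub>A\<^esub>)"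
    using calculation k_algebraD(3)[OF alg, of a "\<one>\<^bsub>A\<^esub>" "b \<odot>\<^bsub>A\<^esub> \<one>\<^bsub>A\<^esub>"] by (simp add: M.smult_assoc1)
  ultimately show "(a \<otimes>\<^bsub>k\<^esub> b) \<odot>\<^bsub>OmA\<^esub> X = a \<odot>\<^bsub>OmA\<^esub> (b \<odot>\<^bsub>OmA\<^esub> X)"
    by (simp add: smult_eq iota_mult OR.m_assoc)
qed (auto simp: M.is_cring O.fq_abelian_group smult_eq M.smult_l_distr iota_add OR.l_distr OR.r_distr iota_one)

lemma Omega_algebra: "k_algebra k OmA"
  unfolding k_algebra_def
proof (intro conjI ballI)
  fix c X Y assume c: "c \<in> carrier k" and X: "X \<in> carrier OmA" and Y: "Y \<in> carrier OmA"
  have cc: "c \<odot>\<^bsub>A\<^esub> \<one>\<^bsub>A\<^esub> \<in> carrier A" using c by simp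
  show "c \<odot>\<^bsub>OmA\<^esub> X \<otimes>\<^bsub>OmA\<^esub> Y = c \<odot>\<^bsub>OmA\<^esub> (X \<otimes>\<^bsub>OmA\<^esub> Y)"
    using c X Y cc by (simp add: smult_eq OR.m_assoc)
  show "X \<otimes>\<^bsub>OmA\<^esub> (c \<odot>\<^bsub>OmA\<^esub> Y) = c \<odot>\<^bsub>OmA\<^esub> (X \<otimes>\<^bsub>OmA\<^esub> Y)"
    using c X Y cc by (simp add: smult_eq OR.m_assoc[symmetric] iota_scalar_comm)
qed (rule Omega_ring Omega_module)+

sublocale OM: Module.module k OmA by (rule Omega_module)

lemma iota_smult: "c \<in> carrier k \<Longrightarrow> a \<in> carrier A \<Longrightarrow> \<iota> (c \<odot>\<^bsub>A\<^esub> a) = c \<odot>\<^bsub>OmA\<^esub> \<iota> a"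
  by (simp add: smult_eq iota_mult[symmetric] k_algebraD(3)[OF alg])

lemma dd_smult: "c \<in> carrier k \<Longrightarrow> a \<in> carrier A \<Longrightarrow> dd (c \<odot>\<^bsub>A\<^esub> a) = c \<odot>\<^bsub>OmA\<^esub> dd a"
  by (simp add: smult_eq dd_smult_iota)

lemma iota_lin: "linear_map k A OmA \<iota>"
  by (rule linI) (simp_all add: iota_add iota_smult)

lemma dd_lin: "linear_map k A OmA dd"
  by (rule linI) (simp_all add: dd_add dd_smult)

end

section \<open>Modules over the forms given by operators\<close>

fun word_act :: "('a \<Rightarrow> 'x \<Rightarrow> 'x) \<Rightarrow> ('a \<Rightarrow> 'x \<Rightarrow> 'x) \<Rightarrow> 'a gen list \<Rightarrow> 'x \<Rightarrow> 'x" where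
  "word_act f D [] x = x"
| "word_act f D (Fn a # w) x = f a (word_act f D w x)"
| "word_act f D (Df a # w) x = D a (word_act f D w x)"

lemma word_act_append: "word_act f D (u @ v) x = word_act f D u (word_act f D v x)"
  by (induction f D u x rule: word_act.induct) simp_all

lemma lin_uminus:
  assumes "Module.module k N" "linear_map k M N f"
  shows "linear_map k M N (\<lambda>x. \<ominus>\<^bsub>N\<^esub> f x)"
proof -
  interpret N: Module.module k N by fact
  show ?thesis
    using assms(2)
    by (intro linI) (simp_all add: lin_closed lin_add lin_smult N.minus_add N.smult_r_minus)
qed

context fquot
begin

lemma coset_zero: "coset K 0 = \<zero>\<^bsub>Q\<^esub>"
  by (simp add: coset_0 zero)

lemma coset_uminus: "Poly_Mapping.keys x \<subseteq> S \<Longrightarrow> coset K (- x) = \<ominus>\<^bsub>Q\<^esub> coset K x"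
  using coset_diff[of 0 x] coset_closed[of x] by (simp add: coset_zero fq.minus_eq)

end

text \<open>The axioms are the relations of the presentation read as identities between operators,
  so these data make \<open>X\<close> a module over the forms. Such modules show that elements of
  the quotient differ and that maps out of it exist.\<close>

locale omega_rep = omega k A for k :: "'k ring" and A :: "('k, 'a, 'z) module_scheme" +
  fixes X :: "('k, 'x, 'y) module_scheme" and f D :: "'a \<Rightarrow> 'x \<Rightarrow> 'x"
  assumes X: "Module.module k X"
    and f_lin: "\<And>a. a \<in> carrier A \<Longrightarrow> linear_map k X X (f a)"
    and D_lin: "\<And>a. a \<in> carrier A \<Longrightarrow> linear_map k X X (D a)"
    and f_add: "\<And>a b x. a \<in> carrier A \<Longrightarrow> b \<in> carrier A \<Longrightarrow> x \<in> carrier X \<Longrightarrow> f (a \<oplus>\<^bsub>A\<^esub> b) x = f a x \<oplus>\<^bsub>X\<^esub> f b x"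
    and D_add: "\<And>a b x. a \<in> carrier A \<Longrightarrow> b \<in> carrier A \<Longrightarrow> x \<in> carrier X \<Longrightarrow> D (a \<oplus>\<^bsub>A\<^esub> b) x = D a x \<oplus>\<^bsub>X\<^esub> D b x"
    and f_mult: "\<And>a b x. a \<in> carrier A \<Longrightarrow> b \<in> carrier A \<Longrightarrow> x \<in> carrier X \<Longrightarrow> f (a \<otimes>\<^bsub>A\<^esub> b) x = f a (f b x)"
    and D_mult: "\<And>a b x. a \<in> carrier A \<Longrightarrow> b \<in> carrier A \<Longrightarrow> x \<in> carrier X \<Longrightarrow>
       D (a \<otimes>\<^bsub>A\<^esub> b) x = D a (f b x) \<oplus>\<^bsub>X\<^esub> f a (D b x)"
    and f_scalar: "\<And>c x. c \<in> carrier k \<Longrightarrow> x \<in> carrier X \<Longrightarrow> f (c \<odot>\<^bsub>A\<^esub> \<one>\<^bsub>A\<^esub>) x = c \<odot>\<^bsub>X\<^esub> x"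
    and D_smult: "\<And>c a x. c \<in> carrier k \<Longrightarrow> a \<in> carrier A \<Longrightarrow> x \<in> carrier X \<Longrightarrow> D (c \<odot>\<^bsub>A\<^esub> a) x = c \<odot>\<^bsub>X\<^esub> D a x"
begin

interpretation A: ring A by (rule k_algebraD(1)[OF alg])
interpretation M: Module.module k A by (rule k_algebraD(2)[OF alg])
interpretation X: Module.module k X by (rule X)

lemma f_one: "x \<in> carrier X \<Longrightarrow> f \<one>\<^bsub>A\<^esub> x = x"
  using f_scalar[of "\<one>\<^bsub>k\<^esub>" x] by simp

lemma word_act_lin: "w \<in> words A \<Longrightarrow> linear_map k X X (word_act f D w)"
proof (induction rule: words_induct)
  case Nil show ?case by (auto intro: lin_cong[OF lin_id X])
next
  case (Fn a w) then show ?case by (auto intro: lin_cong[OF lin_comp[OF f_lin] X])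
next
  case (Df a w) then show ?case by (auto intro: lin_cong[OF lin_comp[OF D_lin] X])
qed

lemma word_act_closed [simp]: "w \<in> words A \<Longrightarrow> x \<in> carrier X \<Longrightarrow> word_act f D w x \<in> carrier X"
  using lin_closed[OF word_act_lin] .

lemmas fD_closed [simp] = lin_closed[OF f_lin] lin_closed[OF D_lin]

lemma null:
  assumes x: "x \<in> carrier X"
  shows "z \<in> K \<Longrightarrow> feval X (\<lambda>w. word_act f D w x) z = \<zero>\<^bsub>X\<^esub>"
proof (induction rule: Omega_null.induct)
  note ag = X.abelian_group_axioms
  have d: "feval X (\<lambda>w. word_act f D w x) (y - z) =
      feval X (\<lambda>w. word_act f D w x) y \<ominus>\<^bsub>X\<^esub> feval X (\<lambda>w. word_act f D w x) z"
    if "Poly_Mapping.keys y \<subseteq> words A" "Poly_Mapping.keys z \<subseteq> words A" for y z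
    using that x by (intro feval_diff[OF ag]) auto
  have kd: "Poly_Mapping.keys (frag_of p - frag_of q) \<subseteq> words A"
    if "p \<in> words A" "q \<in> words A" for p q :: "'a gen list"
    using that keys_diff[of "frag_of p" "frag_of q"] by (auto simp: keys_frag_of)
  have z: "x \<oplus>\<^bsub>X\<^esub> y \<ominus>\<^bsub>X\<^esub> x \<ominus>\<^bsub>X\<^esub> y = \<zero>\<^bsub>X\<^esub>" if "x \<in> carrier X" "y \<in> carrier X" for x y
  proof -
    have "x \<oplus>\<^bsub>X\<^esub> y \<ominus>\<^bsub>X\<^esub> x \<ominus>\<^bsub>X\<^esub> y = (x \<oplus>\<^bsub>X\<^esub> y) \<oplus>\<^bsub>X\<^esub> \<ominus>\<^bsub>X\<^esub> (x \<oplus>\<^bsub>X\<^esub> y)"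
      using that by (simp add: X.minus_eq X.a_assoc X.minus_add)
    then show ?thesis using that by (simp add: X.r_neg)
  qed
  have rr: "x \<ominus>\<^bsub>X\<^esub> x = \<zero>\<^bsub>X\<^esub>" if "x \<in> carrier X" for x
    using that by (simp add: X.minus_eq X.r_neg)
  have fc: "f (c \<odot>\<^bsub>A\<^esub> \<one>\<^bsub>A\<^esub>) y = c \<odot>\<^bsub>X\<^esub> y" if "c \<in> carrier k" "y \<in> carrier X" for c y
    using f_scalar that by simp
  note [simp] = d kd keys_frag_of feval_frag_of[OF ag] word_act_append lin_add[OF word_act_lin]
    rr z f_one f_mult f_add D_add D_mult D_smult fc x
  case zero show ?case by (rule feval_0[OF ag])
  { case (diff x y) then show ?case using K_keys by simp }
  { case fn_add then show ?case by simp }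
  { case fn_mult then show ?case by simp }
  { case fn_one then show ?case by simp }
  { case df_add then show ?case by simp }
  { case df_smult then show ?case by simp }
  { case df_mult then show ?case by simp }
qed

definition rep :: "'a forms \<Rightarrow> 'x \<Rightarrow> 'x" where
  "rep Y x = O.clift X (\<lambda>w. word_act f D w x) Y"

lemma rep_word: "w \<in> words A \<Longrightarrow> x \<in> carrier X \<Longrightarrow> rep (coset K (frag_of w)) x = word_act f D w x"
  unfolding rep_def by (rule O.clift_gen[OF X.abelian_group_axioms _ null]) auto

lemma rep_ahom: "x \<in> carrier X \<Longrightarrow> ahom OmA X (\<lambda>Y. rep Y x)"
  unfolding rep_def by (rule O.clift_ahom[OF X.abelian_group_axioms _ null]) auto

lemma rep_lin: assumes x: "x \<in> carrier X" shows "linear_map k OmA X (\<lambda>Y. rep Y x)"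
proof (rule linI)
  fix Y assume Y: "Y \<in> carrier OmA"
  show "rep Y x \<in> carrier X" using ahom_closed[OF rep_ahom[OF x] Y] .
  { fix Z assume "Z \<in> carrier OmA"
    then show "rep (Y \<oplus>\<^bsub>OmA\<^esub> Z) x = rep Y x \<oplus>\<^bsub>X\<^esub> rep Z x" using ahom_add[OF rep_ahom[OF x] Y] by simp }
  fix c assume c: "c \<in> carrier k"
  have 1: "ahom OmA X (\<lambda>Y. rep (c \<odot>\<^bsub>OmA\<^esub> Y) x)"
    using c rep_ahom[OF x] by (auto simp: ahom_def Pi_iff OM.smult_r_distr)
  have 2: "ahom OmA X (\<lambda>Y. c \<odot>\<^bsub>X\<^esub> rep Y x)"
    using c rep_ahom[OF x] by (auto simp: ahom_def Pi_iff X.smult_r_distr)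
  show "rep (c \<odot>\<^bsub>OmA\<^esub> Y) x = c \<odot>\<^bsub>X\<^esub> rep Y x"
  proof (rule O.ahom_ext[OF X.abelian_group_axioms 1 2 _ Y])
    fix w assume w: "w \<in> words A"
    have cc: "c \<odot>\<^bsub>A\<^esub> \<one>\<^bsub>A\<^esub> \<in> carrier A" using c by simp
    have "rep (c \<odot>\<^bsub>OmA\<^esub> coset K (frag_of w)) x = rep (coset K (frag_of (Fn (c \<odot>\<^bsub>A\<^esub> \<one>\<^bsub>A\<^esub>) # w))) x"
      using c w cc by (simp add: smult_eq word_Fn)
    then show "rep (c \<odot>\<^bsub>OmA\<^esub> coset K (frag_of w)) x = c \<odot>\<^bsub>X\<^esub> rep (coset K (frag_of w)) x"
      using c w cc x by (simp add: rep_word f_scalar)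
  qed
qed

lemma rep_lin_arg: assumes Y: "Y \<in> carrier OmA" shows "linear_map k X X (\<lambda>x. rep Y x)"
proof (rule linI)
  fix x assume x: "x \<in> carrier X"
  show "rep Y x \<in> carrier X" using lin_closed[OF rep_lin[OF x] Y] .
  { fix y assume y: "y \<in> carrier X"
    show "rep Y (x \<oplus>\<^bsub>X\<^esub> y) = rep Y x \<oplus>\<^bsub>X\<^esub> rep Y y"
      by (rule O.ahom_ext[OF X.abelian_group_axioms _ _ _ Y])
        (use x y in \<open>auto simp: rep_word lin_add[OF word_act_lin] intro!: lin_ahom rep_lin lin_sum[OF X]\<close>) }
  fix c assume c: "c \<in> carrier k"
  show "rep Y (c \<odot>\<^bsub>X\<^esub> x) = c \<odot>\<^bsub>X\<^esub> rep Y x"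
    by (rule O.ahom_ext[OF X.abelian_group_axioms _ _ _ Y])
      (use x c in \<open>auto simp: rep_word lin_smult[OF word_act_lin] intro!: lin_ahom rep_lin lin_scaled[OF X]\<close>)
qed

lemma rep_bil: "bil k OmA X X rep"
  by (intro bilI rep_lin rep_lin_arg)

lemma rep_iota: "a \<in> carrier A \<Longrightarrow> x \<in> carrier X \<Longrightarrow> rep (\<iota> a) x = f a x"
  using rep_word[of "[Fn a]" x] by (simp add: iota_def)

lemma rep_dd_iota: "a \<in> carrier A \<Longrightarrow> b \<in> carrier A \<Longrightarrow> x \<in> carrier X \<Longrightarrow>
   rep (dd a \<otimes>\<^bsub>OmA\<^esub> \<iota> b) x = D a (f b x)"
  using rep_word[of "[Df a, Fn b]" x] word_Df[of a "[Fn b]"] by (simp add: iota_def)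

text \<open>If the class of \<open>g w\<close> is a linear function of the vector that
  \<open>w\<close> produces from a fixed \<open>x\<close>, then relations, which act as zero, are
  sent to relations. This spares a separate check of all relations for the differential, the sign
  and the projections.\<close>

lemma coset_map_rep:
  assumes g: "\<And>w. w \<in> words A \<Longrightarrow> Poly_Mapping.keys (g w) \<subseteq> words A"
    and h: "linear_map k X OmA h" and x: "x \<in> carrier X"
    and hg: "\<And>w. w \<in> words A \<Longrightarrow> h (word_act f D w x) = coset K (g w)"
  shows "linear_map k OmA OmA (coset_map K g)"
    and "\<And>w. w \<in> words A \<Longrightarrow> coset_map K g (coset K (frag_of w)) = coset K (g w)"
proof -
  have kg: "Poly_Mapping.keys (frag_extend g z) \<subseteq> words A" if "Poly_Mapping.keys z \<subseteq> words A" for z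
    using that g keys_frag_extend[of g z] by blast
  have hr: "linear_map k OmA OmA (\<lambda>Y. h (rep Y x))" using lin_comp[OF h rep_lin[OF x]] .
  have ev: "coset K (frag_extend g z) = h (rep (coset K z) x)" if "Poly_Mapping.keys z \<subseteq> words A" for z
  proof -
    have "Poly_Mapping.keys z \<subseteq> words A \<and> coset K (frag_extend g z) = h (rep (coset K z) x)"
      using that
    proof (induction z rule: frag_induction)
      case zero
      show ?case using lin_zero[OF Omega_module Omega_module hr] by (simp add: O.coset_0 O.zero)
    next
      case (one w) then show ?case using hg x by (simp add: rep_word keys_frag_of)
    next
      case (diff a b)
      have "Poly_Mapping.keys (a - b) \<subseteq> words A" using diff keys_diff[of a b] by auto
      then show ?case
        using diff kg lin_diff[OF Omega_module Omega_module hr] O.coset_closed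
        by (simp add: frag_extend_diff O.coset_diff)
    qed
    then show ?thesis by simp
  qed
  have gK: "frag_extend g z \<in> K" if "z \<in> K" for z
  proof -
    have "coset K z = \<zero>\<^bsub>OmA\<^esub>" using that O.coset_eq_iff[of z 0] by (simp add: O.coset_0 O.zero)
    then have "coset K (frag_extend g z) = coset K 0"
      using ev[OF K_keys[OF that]] lin_zero[OF Omega_module Omega_module hr] by (simp add: O.coset_0 O.zero)
    then show ?thesis by (simp add: O.coset_eq_iff)
  qed
  show 1: "\<And>w. w \<in> words A \<Longrightarrow> coset_map K g (coset K (frag_of w)) = coset K (g w)"
    by (subst O.coset_map_coset[OF g gK]) simp_all
  show "linear_map k OmA OmA (coset_map K g)"
  proof (rule lin_cong[OF hr Omega_module])
    fix Y assume "Y \<in> carrier OmA"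
    then obtain y where "Y = coset K y" "Poly_Mapping.keys y \<subseteq> words A" by (rule O.cosetE)
    then show "h (rep Y x) = coset_map K g Y"
      by (simp add: ev O.coset_map_coset[OF g gK])
  qed
qed

end

declare One_nat_def [simp del]

section \<open>Additive spans\<close>

inductive_set adspan :: "('k, 'w, 'z) module_scheme \<Rightarrow> 'w set \<Rightarrow> 'w set" for G S where
  zero: "\<zero>\<^bsub>G\<^esub> \<in> adspan G S"
| gen: "x \<in> S \<Longrightarrow> x \<in> adspan G S"
| diff: "\<lbrakk>x \<in> adspan G S; y \<in> adspan G S\<rbrakk> \<Longrightarrow> x \<ominus>\<^bsub>G\<^esub> y \<in> adspan G S"

lemma adspan_carrier:
  assumes "abelian_group G" "S \<subseteq> carrier G" "x \<in> adspan G S" shows "x \<in> carrier G"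
proof -
  interpret abelian_group G by fact
  from assms(3) show ?thesis by (induction rule: adspan.induct) (use assms(2) in auto)
qed

context omega
begin

interpretation A: ring A by (rule k_algebraD(1)[OF alg])
interpretation M: Module.module k A by (rule k_algebraD(2)[OF alg])

lemmas omega_repI = omega_rep.intro[OF omega_axioms omega_rep_axioms.intro]

text \<open>\<open>A\<close> acts on itself and differentials act as zero, which satisfies the
  Leibniz relation trivially. Its purpose is to separate the classes of functions.\<close>

lemma regular_rep: "omega_rep k A A (\<lambda>a b. a \<otimes>\<^bsub>A\<^esub> b) (\<lambda>a b. \<zero>\<^bsub>A\<^esub>)"
  proof (rule omega_repI)
    show "Module.module k A" by (rule M.module_axioms)
    show "linear_map k A A (\<lambda>b. a \<otimes>\<^bsub>A\<^esub> b)" if "a \<in> carrier A" for a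
      using that by (rule bil_r[OF mult_bil[OF alg] lin_id])
    show "linear_map k A A (\<lambda>b. \<zero>\<^bsub>A\<^esub>)"
      by (rule lin_null[OF M.module_axioms])
    fix a b x assume x: "x \<in> carrier A"
    { fix c assume c: "c \<in> carrier k"
      show "c \<odot>\<^bsub>A\<^esub> \<one>\<^bsub>A\<^esub> \<otimes>\<^bsub>A\<^esub> x = c \<odot>\<^bsub>A\<^esub> x"
        using c x by (simp add: k_algebraD(3)[OF alg])
      show "\<zero>\<^bsub>A\<^esub> = c \<odot>\<^bsub>A\<^esub> \<zero>\<^bsub>A\<^esub>" using c by simp }
    assume a: "a \<in> carrier A" and b: "b \<in> carrier A"
    show "(a \<oplus>\<^bsub>A\<^esub> b) \<otimes>\<^bsub>A\<^esub> x = a \<otimes>\<^bsub>A\<^esub> x \<oplus>\<^bsub>A\<^esub> b \<otimes>\<^bsub>A\<^esub> x"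
      using a b x by (rule A.l_distr)
    show "a \<otimes>\<^bsub>A\<^esub> b \<otimes>\<^bsub>A\<^esub> x = a \<otimes>\<^bsub>A\<^esub> (b \<otimes>\<^bsub>A\<^esub> x)"
      using a b x by (rule A.m_assoc)
    show "\<zero>\<^bsub>A\<^esub> = \<zero>\<^bsub>A\<^esub> \<oplus>\<^bsub>A\<^esub> \<zero>\<^bsub>A\<^esub>" by simp
    show "\<zero>\<^bsub>A\<^esub> = \<zero>\<^bsub>A\<^esub> \<oplus>\<^bsub>A\<^esub> a \<otimes>\<^bsub>A\<^esub> \<zero>\<^bsub>A\<^esub>" using a by simp
  qed

text \<open>Acting on the unit in the regular representation recovers \<open>a\<close> from its
  class.\<close>

lemma iota_inj: "inj_on \<iota> (carrier A)"
proof (rule inj_onI)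
  fix a b assume ab: "a \<in> carrier A" "b \<in> carrier A" "\<iota> a = \<iota> b"
  note r = omega_rep.rep_iota[OF regular_rep]
  have "a = a \<otimes>\<^bsub>A\<^esub> \<one>\<^bsub>A\<^esub>" using ab(1) by simp
  also have "\<dots> = b \<otimes>\<^bsub>A\<^esub> \<one>\<^bsub>A\<^esub>"
    using r[OF ab(1) A.one_closed] r[OF ab(2) A.one_closed] unfolding ab(3) by (rule trans[OF sym])
  also have "\<dots> = b" using ab(2) by simp
  finally show "a = b" .
qed

lemma word_mult_Fn_coset: "a \<in> carrier A \<Longrightarrow> Poly_Mapping.keys x \<subseteq> words A \<Longrightarrow>
   coset K (word_mult (frag_of [Fn a]) x) = \<iota> a \<otimes>\<^bsub>OmA\<^esub> coset K x"
  by (simp add: iota_def mult_coset keys_frag_of)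

lemma word_mult_Df_coset: "a \<in> carrier A \<Longrightarrow> Poly_Mapping.keys x \<subseteq> words A \<Longrightarrow>
   coset K (word_mult (frag_of [Df a]) x) = dd a \<otimes>\<^bsub>OmA\<^esub> coset K x"
  by (simp add: dd_def mult_coset keys_frag_of)

lemma keys_word_diff: "w \<in> words A \<Longrightarrow> Poly_Mapping.keys (word_diff w) \<subseteq> words A"
proof (induction rule: words_induct)
  case (Fn a w)
  then have "Poly_Mapping.keys (word_mult (frag_of [Fn a]) (word_diff w)) \<subseteq> words A"
    by (intro keys_word_mult_words) (auto simp: keys_frag_of)
  then show ?case using Fn Poly_Mapping.keys_add[of "frag_of (Df a # w)" "word_mult (frag_of [Fn a]) (word_diff w)"]
    by (auto simp: keys_frag_of)
next
  case (Df a w)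
  then have "Poly_Mapping.keys (word_mult (frag_of [Df a]) (word_diff w)) \<subseteq> words A"
    by (intro keys_word_mult_words) (auto simp: keys_frag_of)
  then show ?case by simp
qed simp

lemma mult_lin_left: "Y \<in> carrier OmA \<Longrightarrow> linear_map k U OmA g \<Longrightarrow> linear_map k U OmA (\<lambda>u. Y \<otimes>\<^bsub>OmA\<^esub> g u)"
  by (rule bil_r[OF mult_bil[OF Omega_algebra]])

text \<open>The graded derivation \<open>d\<close> and \<open>\<epsilon>\<close> are the entries of a representation by the triangular matrices
  \<open>(\<epsilon> \<omega>, d \<omega>; 0, \<omega>)\<close>.\<close>

definition mat_fn :: "'a \<Rightarrow> 'a forms \<times> 'a forms \<Rightarrow> 'a forms \<times> 'a forms" where
  "mat_fn a v = (\<iota> a \<otimes>\<^bsub>OmA\<^esub> fst v \<oplus>\<^bsub>OmA\<^esub> dd a \<otimes>\<^bsub>OmA\<^esub> snd v, \<iota> a \<otimes>\<^bsub>OmA\<^esub> snd v)"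

definition mat_df :: "'a \<Rightarrow> 'a forms \<times> 'a forms \<Rightarrow> 'a forms \<times> 'a forms" where
  "mat_df a v = (\<ominus>\<^bsub>OmA\<^esub> (dd a \<otimes>\<^bsub>OmA\<^esub> fst v), dd a \<otimes>\<^bsub>OmA\<^esub> snd v)"

text \<open>The corner of a product of two such matrices is d(\<omega>\<eta>) = \<epsilon>(\<omega>)
  d\<eta> + (d\<omega>) \<eta>, the graded Leibniz rule. The generator d a has the diagonal entry
  -(d a) and, as d (d a) = 0, no corner.\<close>

lemma mat_rep: "omega_rep k A (dsum OmA OmA) mat_fn mat_df"
proof (rule omega_repI)
  note m = Omega_module
  show "Module.module k (dsum OmA OmA)" by (rule dsum_module[OF m m])
  note L = lin_pair lin_sum[OF m] mult_lin_left lin_fst[OF lin_id] lin_snd[OF lin_id]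
  fix a assume a: "a \<in> carrier A"
  show "linear_map k (dsum OmA OmA) (dsum OmA OmA) (mat_fn a)"
    unfolding mat_fn_def using a by (intro L) auto
  show "linear_map k (dsum OmA OmA) (dsum OmA OmA) (mat_df a)"
    unfolding mat_df_def
    using a by (intro L lin_uminus[OF m]) auto
next
  fix a b x assume "a \<in> carrier A" "b \<in> carrier A" "x \<in> carrier (dsum OmA OmA)"
  moreover obtain p q where "x = (p, q)" by (cases x)
  ultimately have ab: "a \<in> carrier A" "b \<in> carrier A" and x: "x = (p, q)" "p \<in> carrier OmA" "q \<in> carrier OmA"
    by auto
  note [simp] = mat_fn_def mat_df_def iota_add dd_add iota_mult dd_mult OR.l_distr OR.r_distr OR.m_assoc ab x
  show "mat_fn (a \<oplus>\<^bsub>A\<^esub> b) x = mat_fn a x \<oplus>\<^bsub>dsum OmA OmA\<^esub> mat_fn b x"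
    "mat_df (a \<oplus>\<^bsub>A\<^esub> b) x = mat_df a x \<oplus>\<^bsub>dsum OmA OmA\<^esub> mat_df b x"
    "mat_fn (a \<otimes>\<^bsub>A\<^esub> b) x = mat_fn a (mat_fn b x)"
    by (simp_all add: O.fq.minus_add O.fq.a_ac)
  \<comment> \<open>In the Leibniz relation the two terms containing (d a) (d b) have opposite signs
    and cancel.\<close>
  have "y \<oplus>\<^bsub>OmA\<^esub> \<ominus>\<^bsub>OmA\<^esub> z \<oplus>\<^bsub>OmA\<^esub> (\<ominus>\<^bsub>OmA\<^esub> w \<oplus>\<^bsub>OmA\<^esub> z) = y \<oplus>\<^bsub>OmA\<^esub> \<ominus>\<^bsub>OmA\<^esub> w"
    if "y \<in> carrier OmA" "z \<in> carrier OmA" "w \<in> carrier OmA" for y z w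
  proof -
    have "y \<oplus>\<^bsub>OmA\<^esub> \<ominus>\<^bsub>OmA\<^esub> z \<oplus>\<^bsub>OmA\<^esub> (\<ominus>\<^bsub>OmA\<^esub> w \<oplus>\<^bsub>OmA\<^esub> z) = (y \<oplus>\<^bsub>OmA\<^esub> \<ominus>\<^bsub>OmA\<^esub> w) \<oplus>\<^bsub>OmA\<^esub> (z \<oplus>\<^bsub>OmA\<^esub> \<ominus>\<^bsub>OmA\<^esub> z)"
      using that by (simp only: O.fq.a_ac O.fq.a_inv_closed O.fq.a_closed)
    then show ?thesis using that by (simp add: O.fq.r_neg)
  qed
  then show "mat_df (a \<otimes>\<^bsub>A\<^esub> b) x = mat_df a (mat_fn b x) \<oplus>\<^bsub>dsum OmA OmA\<^esub> mat_fn a (mat_df b x)"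
    by (simp add: O.fq.minus_add OR.r_minus)
next
  fix c x assume "c \<in> carrier k" "x \<in> carrier (dsum OmA OmA)"
  moreover obtain p q where "x = (p, q)" by (cases x)
  moreover have "c \<odot>\<^bsub>A\<^esub> \<one>\<^bsub>A\<^esub> \<in> carrier A" using calculation by simp
  ultimately show "mat_fn (c \<odot>\<^bsub>A\<^esub> \<one>\<^bsub>A\<^esub>) x = c \<odot>\<^bsub>dsum OmA OmA\<^esub> x"
    by (simp add: mat_fn_def dd_scalar smult_eq)
next
  fix c a x assume "c \<in> carrier k" "a \<in> carrier A" "x \<in> carrier (dsum OmA OmA)"
  moreover obtain p q where "x = (p, q)" by (cases x)
  ultimately show "mat_df (c \<odot>\<^bsub>A\<^esub> a) x = c \<odot>\<^bsub>dsum OmA OmA\<^esub> mat_df a x"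
    by (simp add: mat_df_def dd_smult k_algebraD(3)[OF Omega_algebra] OM.smult_r_minus)
qed

interpretation mat: omega_rep k A "dsum OmA OmA" mat_fn mat_df by (rule mat_rep)

text \<open>Acting on the column (0, 1) reads off the corner and the lower diagonal entry; (1, 0)
  does the same for the sign in \<open>mat_eps\<close>.\<close>

lemma mat_word_diff:
  "w \<in> words A \<Longrightarrow> word_act mat_fn mat_df w (\<zero>\<^bsub>OmA\<^esub>, \<one>\<^bsub>OmA\<^esub>) = (coset K (word_diff w), coset K (frag_of w))"
proof (induction rule: words_induct)
  case Nil show ?case by (simp add: word_Nil O.coset_0 O.zero)
next
  case (Fn a w)
  have "coset K (word_diff (Fn a # w)) = \<iota> a \<otimes>\<^bsub>OmA\<^esub> coset K (word_diff w) \<oplus>\<^bsub>OmA\<^esub> dd a \<otimes>\<^bsub>OmA\<^esub> coset K (frag_of w)"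
    using Fn by (simp add: word_mult_Fn_coset[symmetric] word_Df[symmetric] keys_word_diff O.add O.coset_add_coset add.commute)
  then show ?case using Fn by (simp add: mat_fn_def word_Fn)
next
  case (Df a w)
  have k: "Poly_Mapping.keys (word_mult (frag_of [Df a]) (word_diff w)) \<subseteq> words A"
    using Df keys_word_diff by (intro keys_word_mult_words) (auto simp: keys_frag_of)
  have "coset K (word_diff (Df a # w)) = \<ominus>\<^bsub>OmA\<^esub> (dd a \<otimes>\<^bsub>OmA\<^esub> coset K (word_diff w))"
    using Df by (simp add: O.coset_uminus[OF k] word_mult_Df_coset keys_word_diff)
  then show ?case using Df by (simp add: mat_df_def word_Df)
qed

lemma mat_eps:
  "w \<in> words A \<Longrightarrow> word_act mat_fn mat_df w (\<one>\<^bsub>OmA\<^esub>, \<zero>\<^bsub>OmA\<^esub>) = (coset K (frag_cmul ((-1) ^ wdeg w) (frag_of w)), \<zero>\<^bsub>OmA\<^esub>)"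
proof (induction rule: words_induct)
  case Nil show ?case by (simp add: word_Nil)
next
  case (Fn a w)
  have "coset K (frag_cmul ((-1) ^ wdeg w) (frag_of (Fn a # w))) = \<iota> a \<otimes>\<^bsub>OmA\<^esub> coset K (frag_cmul ((-1) ^ wdeg w) (frag_of w))"
    using Fn by (cases "even (wdeg w)") (simp_all add: word_mult_Fn_coset[symmetric] keys_frag_of)
  moreover have "coset K (frag_cmul ((-1) ^ wdeg w) (frag_of w)) \<in> carrier OmA"
    using Fn by (intro O.coset_closed) (auto simp: keys_frag_of)
  ultimately show ?case using Fn by (simp add: mat_fn_def)
next
  case (Df a w)
  have k: "Poly_Mapping.keys (frag_cmul c (frag_of w)) \<subseteq> words A"
    "Poly_Mapping.keys (frag_cmul c (frag_of (Df a # w))) \<subseteq> words A" for c w' using Df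
    by (auto simp: keys_frag_of)
  have "coset K (- frag_cmul ((-1) ^ wdeg w) (frag_of (Df a # w))) =
      \<ominus>\<^bsub>OmA\<^esub> coset K (frag_cmul ((-1) ^ wdeg w) (frag_of (Df a # w)))"
    by (rule O.coset_uminus[OF k(2)])
  also have "coset K (frag_cmul ((-1) ^ wdeg w) (frag_of (Df a # w))) = dd a \<otimes>\<^bsub>OmA\<^esub> coset K (frag_cmul ((-1) ^ wdeg w) (frag_of w))"
    using Df by (cases "even (wdeg w)") (simp_all add: word_mult_Df_coset[symmetric] keys_frag_of)
  finally show ?case using Df by (simp add: mat_df_def)
qed

lemma diff_lin: "linear_map k OmA OmA (dga_diff OmA)"
  unfolding Omega_simps
  by (rule mat.coset_map_rep(1)[OF keys_word_diff lin_fst[OF lin_id], where x="(\<zero>\<^bsub>OmA\<^esub>, \<one>\<^bsub>OmA\<^esub>)"])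
    (auto simp: mat_word_diff)

lemma diff_iota: "a \<in> carrier A \<Longrightarrow> dga_diff OmA (\<iota> a) = dd a"
  unfolding Omega_simps iota_def
  by (subst mat.coset_map_rep(2)[OF keys_word_diff lin_fst[OF lin_id], where x="(\<zero>\<^bsub>OmA\<^esub>, \<one>\<^bsub>OmA\<^esub>)"])
    (auto simp: mat_word_diff dd_def)

lemma keys_eps: "w \<in> words A \<Longrightarrow> Poly_Mapping.keys (frag_cmul ((-1) ^ wdeg w) (frag_of w)) \<subseteq> words A"
  by (auto simp: keys_frag_of)

lemma eps_lin: "linear_map k OmA OmA (Omega_eps k A)"
  unfolding Omega_eps_def
  by (rule mat.coset_map_rep(1)[OF keys_eps lin_fst[OF lin_id], where x="(\<one>\<^bsub>OmA\<^esub>, \<zero>\<^bsub>OmA\<^esub>)"])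
    (auto simp: mat_eps)

lemma eps_iota: "a \<in> carrier A \<Longrightarrow> Omega_eps k A (\<iota> a) = \<iota> a"
  unfolding Omega_eps_def iota_def
  by (subst mat.coset_map_rep(2)[OF keys_eps lin_fst[OF lin_id], where x="(\<one>\<^bsub>OmA\<^esub>, \<zero>\<^bsub>OmA\<^esub>)"])
    (auto simp: mat_eps)


text \<open>A pair holds the components of degree 0 and 1. A differential moves the first into the
  second and drops the second, so forms are truncated above degree 1.\<close>

definition proj_df :: "'a \<Rightarrow> 'a forms \<times> 'a forms \<Rightarrow> 'a forms \<times> 'a forms" where
  "proj_df a v = (\<zero>\<^bsub>OmA\<^esub>, dd a \<otimes>\<^bsub>OmA\<^esub> fst v)"

definition proj_fn :: "'a \<Rightarrow> 'a forms \<times> 'a forms \<Rightarrow> 'a forms \<times> 'a forms" where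
  "proj_fn a v = (\<iota> a \<otimes>\<^bsub>OmA\<^esub> fst v, \<iota> a \<otimes>\<^bsub>OmA\<^esub> snd v)"

lemma proj_rep: "omega_rep k A (dsum OmA OmA) proj_fn proj_df"
proof (rule omega_repI)
  note m = Omega_module
  show "Module.module k (dsum OmA OmA)" by (rule dsum_module[OF m m])
  note L = lin_pair lin_null[OF m] mult_lin_left lin_fst[OF lin_id] lin_snd[OF lin_id]
  fix a assume a: "a \<in> carrier A"
  show "linear_map k (dsum OmA OmA) (dsum OmA OmA) (proj_fn a)"
    unfolding proj_fn_def using a by (intro L) auto
  show "linear_map k (dsum OmA OmA) (dsum OmA OmA) (proj_df a)"
    unfolding proj_df_def
    by (rule lin_pair[OF lin_null[OF m]]) (use a in \<open>auto intro!: L\<close>)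
next
  fix a b x assume "a \<in> carrier A" "b \<in> carrier A" "x \<in> carrier (dsum OmA OmA)"
  moreover obtain p q where "x = (p, q)" by (cases x)
  ultimately show "proj_fn (a \<oplus>\<^bsub>A\<^esub> b) x = proj_fn a x \<oplus>\<^bsub>dsum OmA OmA\<^esub> proj_fn b x"
    "proj_df (a \<oplus>\<^bsub>A\<^esub> b) x = proj_df a x \<oplus>\<^bsub>dsum OmA OmA\<^esub> proj_df b x"
    "proj_fn (a \<otimes>\<^bsub>A\<^esub> b) x = proj_fn a (proj_fn b x)"
    "proj_df (a \<otimes>\<^bsub>A\<^esub> b) x = proj_df a (proj_fn b x) \<oplus>\<^bsub>dsum OmA OmA\<^esub> proj_fn a (proj_df b x)"
    by (simp_all add: proj_fn_def proj_df_def iota_add dd_add iota_mult dd_mult OR.l_distr OR.m_assoc)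
next
  fix c x assume "c \<in> carrier k" "x \<in> carrier (dsum OmA OmA)"
  moreover obtain p q where "x = (p, q)" by (cases x)
  moreover have "c \<odot>\<^bsub>A\<^esub> \<one>\<^bsub>A\<^esub> \<in> carrier A" using calculation by simp
  ultimately show "proj_fn (c \<odot>\<^bsub>A\<^esub> \<one>\<^bsub>A\<^esub>) x = c \<odot>\<^bsub>dsum OmA OmA\<^esub> x"
    by (simp add: proj_fn_def smult_eq)
next
  fix c a x assume "c \<in> carrier k" "a \<in> carrier A" "x \<in> carrier (dsum OmA OmA)"
  moreover obtain p q where "x = (p, q)" by (cases x)
  ultimately show "proj_df (c \<odot>\<^bsub>A\<^esub> a) x = c \<odot>\<^bsub>dsum OmA OmA\<^esub> proj_df a x"
    by (simp add: proj_df_def dd_smult k_algebraD(3)[OF Omega_algebra])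
qed

interpretation proj: omega_rep k A "dsum OmA OmA" proj_fn proj_df by (rule proj_rep)

lemma proj_act: "w \<in> words A \<Longrightarrow> word_act proj_fn proj_df w (\<one>\<^bsub>OmA\<^esub>, \<zero>\<^bsub>OmA\<^esub>) =
   (coset K (if wdeg w = 0 then frag_of w else 0), coset K (if wdeg w = 1 then frag_of w else 0))"
proof (induction rule: words_induct)
  case Nil show ?case by (simp add: word_Nil O.coset_zero)
next
  case (Fn a w) then show ?case by (auto simp: word_Fn proj_fn_def O.coset_zero)
next
  case (Df a w) then show ?case by (auto simp: word_Df proj_df_def O.coset_zero)
qed

lemma keys_proj: "w \<in> words A \<Longrightarrow> Poly_Mapping.keys (if wdeg w = p then frag_of w else 0) \<subseteq> words A"
  by (auto simp: keys_frag_of)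

lemma proj0_lin: "linear_map k OmA OmA (Omega_proj k A 0)"
  unfolding Omega_proj_def
  by (rule proj.coset_map_rep(1)[OF keys_proj lin_fst[OF lin_id], where x="(\<one>\<^bsub>OmA\<^esub>, \<zero>\<^bsub>OmA\<^esub>)"])
    (auto simp: proj_act)

lemma proj0_word: "w \<in> words A \<Longrightarrow>
   Omega_proj k A 0 (coset K (frag_of w)) = (if wdeg w = 0 then coset K (frag_of w) else \<zero>\<^bsub>OmA\<^esub>)"
  unfolding Omega_proj_def
  by (subst proj.coset_map_rep(2)[OF keys_proj lin_fst[OF lin_id], where x="(\<one>\<^bsub>OmA\<^esub>, \<zero>\<^bsub>OmA\<^esub>)"])
    (auto simp: proj_act O.coset_zero)

lemma proj1_lin: "linear_map k OmA OmA (Omega_proj k A 1)"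
  unfolding Omega_proj_def
  by (rule proj.coset_map_rep(1)[OF keys_proj lin_snd[OF lin_id], where x="(\<one>\<^bsub>OmA\<^esub>, \<zero>\<^bsub>OmA\<^esub>)"])
    (auto simp: proj_act)

lemma proj1_word: "w \<in> words A \<Longrightarrow>
   Omega_proj k A 1 (coset K (frag_of w)) = (if wdeg w = 1 then coset K (frag_of w) else \<zero>\<^bsub>OmA\<^esub>)"
  unfolding Omega_proj_def
  by (subst proj.coset_map_rep(2)[OF keys_proj lin_snd[OF lin_id], where x="(\<one>\<^bsub>OmA\<^esub>, \<zero>\<^bsub>OmA\<^esub>)"])
    (auto simp: proj_act O.coset_zero)

section \<open>The grading in degrees 0 and 1\<close>

lemma deg_carrier: "dga_deg OmA p \<subseteq> carrier OmA"
  by (auto simp: Omega_simps)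

lemma deg_zero: "\<zero>\<^bsub>OmA\<^esub> \<in> dga_deg OmA p"
  unfolding Omega_simps(7) by (rule image_eqI[of _ _ 0]) (auto simp: O.coset_zero)

lemma deg_word: "w \<in> words A \<Longrightarrow> coset K (frag_of w) \<in> dga_deg OmA (wdeg w)"
  unfolding Omega_simps(7) by (auto simp: keys_frag_of)

lemma deg_diff:
  assumes "Y \<in> dga_deg OmA p" "Z \<in> dga_deg OmA p" shows "Y \<ominus>\<^bsub>OmA\<^esub> Z \<in> dga_deg OmA p"
proof -
  obtain y z where "Y = coset K y" "Poly_Mapping.keys y \<subseteq> {w \<in> words A. wdeg w = p}"
    "Z = coset K z" "Poly_Mapping.keys z \<subseteq> {w \<in> words A. wdeg w = p}"
    using assms unfolding Omega_simps(7) by blast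
  moreover have "Poly_Mapping.keys y \<subseteq> words A" "Poly_Mapping.keys z \<subseteq> words A" using calculation by auto
  ultimately show ?thesis
    unfolding Omega_simps(7) using keys_diff[of y z] by (intro image_eqI[of _ _ "y - z"]) (auto simp: O.coset_diff)
qed

lemma deg_induct [consumes 1, case_names zero word diff]:
  assumes "Y \<in> dga_deg OmA p" and "P \<zero>\<^bsub>OmA\<^esub>"
    and "\<And>w. w \<in> words A \<Longrightarrow> wdeg w = p \<Longrightarrow> P (coset K (frag_of w))"
    and "\<And>X Y. \<lbrakk>X \<in> dga_deg OmA p; Y \<in> dga_deg OmA p; P X; P Y\<rbrakk> \<Longrightarrow> P (X \<ominus>\<^bsub>OmA\<^esub> Y)"
  shows "P Y"
proof -
  obtain y where y: "Y = coset K y" "Poly_Mapping.keys y \<subseteq> {w \<in> words A. wdeg w = p}"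
    using assms(1) unfolding Omega_simps(7) by blast
  from y(2) have "Poly_Mapping.keys y \<subseteq> words A \<and> coset K y \<in> dga_deg OmA p \<and> P (coset K y)"
  proof (induction y rule: frag_induction)
    case zero then show ?case using assms(2) deg_zero by (simp add: O.coset_zero)
  next
    case (one w) then show ?case using assms(3) deg_word[of w] by (auto simp: keys_frag_of)
  next
    case (diff a b)
    then have "Poly_Mapping.keys (a - b) \<subseteq> words A" using keys_diff[of a b] by blast
    then show ?case using diff assms(4) deg_diff by (simp add: O.coset_diff)
  qed
  then show ?thesis using y by simp
qed

lemma deg_mult:
  assumes "Y \<in> dga_deg OmA p" "Z \<in> dga_deg OmA q" shows "Y \<otimes>\<^bsub>OmA\<^esub> Z \<in> dga_deg OmA (p + q)"
proof -
  obtain y z where yz: "Y = coset K y" "Poly_Mapping.keys y \<subseteq> {w \<in> words A. wdeg w = p}"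
    "Z = coset K z" "Poly_Mapping.keys z \<subseteq> {w \<in> words A. wdeg w = q}"
    using assms unfolding Omega_simps(7) by blast
  then have "Poly_Mapping.keys y \<subseteq> words A" "Poly_Mapping.keys z \<subseteq> words A" by auto
  then have "Y \<otimes>\<^bsub>OmA\<^esub> Z = coset K (word_mult y z)" by (simp add: yz mult_coset)
  moreover have "w \<in> words A \<and> wdeg w = p + q" if w: "w \<in> Poly_Mapping.keys (word_mult y z)" for w
  proof -
    obtain u v where "w = u @ v" "u \<in> Poly_Mapping.keys y" "v \<in> Poly_Mapping.keys z"
      using subsetD[OF keys_word_mult w] by blast
    then show ?thesis using yz(2,4) by auto
  qed
  then have "word_mult y z \<in> {x. Poly_Mapping.keys x \<subseteq> {w \<in> words A. wdeg w = p + q}}" by blast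
  ultimately show ?thesis unfolding Omega_simps(7) by blast
qed

lemma iota_deg: "a \<in> carrier A \<Longrightarrow> \<iota> a \<in> dga_deg OmA 0"
  using deg_word[of "[Fn a]"] by (simp add: iota_def)

lemma dd_deg: "a \<in> carrier A \<Longrightarrow> dd a \<in> dga_deg OmA 1"
  using deg_word[of "[Df a]"] by (simp add: dd_def One_nat_def)

lemma deg0_word: "w \<in> words A \<Longrightarrow> wdeg w = 0 \<Longrightarrow> coset K (frag_of w) \<in> \<iota> ` carrier A"
proof (induction rule: words_induct)
  case Nil show ?case by (rule image_eqI[of _ _ "\<one>\<^bsub>A\<^esub>"]) (auto simp: word_Nil iota_one)
next
  case (Fn a w)
  then obtain b where "b \<in> carrier A" "coset K (frag_of w) = \<iota> b" by auto
  then show ?case using Fn by (intro image_eqI[of _ _ "a \<otimes>\<^bsub>A\<^esub> b"]) (auto simp: word_Fn iota_mult)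
qed simp

lemma iota_image_diff: "X \<in> \<iota> ` carrier A \<Longrightarrow> Y \<in> \<iota> ` carrier A \<Longrightarrow> X \<ominus>\<^bsub>OmA\<^esub> Y \<in> \<iota> ` carrier A"
proof -
  assume "X \<in> \<iota> ` carrier A" "Y \<in> \<iota> ` carrier A"
  then obtain a b where ab: "a \<in> carrier A" "b \<in> carrier A" "X = \<iota> a" "Y = \<iota> b" by blast
  then have "X \<ominus>\<^bsub>OmA\<^esub> Y = \<iota> (a \<ominus>\<^bsub>A\<^esub> b)"
    using lin_diff[OF M.module_axioms Omega_module iota_lin, of a b] by simp
  then show ?thesis using ab by simp
qed

lemma iota_image_zero: "\<zero>\<^bsub>OmA\<^esub> \<in> \<iota> ` carrier A"
  using lin_zero[OF M.module_axioms Omega_module iota_lin] by (metis A.zero_closed image_eqI)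

lemma deg0: "dga_deg OmA 0 = \<iota> ` carrier A"
proof
  show "dga_deg OmA 0 \<subseteq> \<iota> ` carrier A"
  proof
    fix Y assume "Y \<in> dga_deg OmA 0"
    then show "Y \<in> \<iota> ` carrier A"
      by (induction rule: deg_induct) (auto intro: deg0_word iota_image_diff iota_image_zero)
  qed
qed (auto intro: iota_deg)

lemma proj0_image: "Y \<in> carrier OmA \<Longrightarrow> Omega_proj k A 0 Y \<in> \<iota> ` carrier A"
proof (induction rule: O.coset_induct)
  case zero show ?case using lin_zero[OF Omega_module Omega_module proj0_lin] iota_image_zero by simp
next
  case (gen w) then show ?case using deg0_word iota_image_zero by (auto simp: proj0_word)
next
  case (diff X Y)
  then show ?case using lin_diff[OF Omega_module Omega_module proj0_lin] iota_image_diff by simp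
qed

lemma proj1_deg: "Y \<in> carrier OmA \<Longrightarrow> Omega_proj k A 1 Y \<in> dga_deg OmA 1"
proof (induction rule: O.coset_induct)
  case zero show ?case using lin_zero[OF Omega_module Omega_module proj1_lin] deg_zero by simp
next
  case (gen w) then show ?case using deg_word[of w] deg_zero by (auto simp: proj1_word)
next
  case (diff X Y)
  then show ?case using lin_diff[OF Omega_module Omega_module proj1_lin] deg_diff by simp
qed

lemma proj1_id: "Y \<in> dga_deg OmA 1 \<Longrightarrow> Omega_proj k A 1 Y = Y"
proof (induction rule: deg_induct)
  case zero show ?case using lin_zero[OF Omega_module Omega_module proj1_lin] by simp
next
  case (diff X Y)
  then show ?case using lin_diff[OF Omega_module Omega_module proj1_lin] deg_carrier by (simp add: subset_iff)
qed (simp add: proj1_word)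

lemma proj0_iota: "a \<in> carrier A \<Longrightarrow> Omega_proj k A 0 (\<iota> a) = \<iota> a"
  using proj0_word[of "[Fn a]"] by (simp add: iota_def)

lemma iota_base: "Y \<in> carrier OmA \<Longrightarrow> \<iota> (Omega_base k A Y) = Omega_proj k A 0 Y"
  unfolding Omega_base_def using proj0_image by (rule f_inv_into_f)

lemma base_closed: "Y \<in> carrier OmA \<Longrightarrow> Omega_base k A Y \<in> carrier A"
  unfolding Omega_base_def using proj0_image by (rule inv_into_into)

lemma base_iota: "a \<in> carrier A \<Longrightarrow> Omega_base k A (\<iota> a) = a"
  using iota_inj by (simp add: Omega_base_def proj0_iota)

text \<open>\<open>Omega_base\<close> undoes the injective map \<iota> on degree 0, so its linearity
  is tested after applying \<iota>.\<close>

lemma base_lin: "linear_map k OmA A (Omega_base k A)"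
proof (rule linI)
  note inj = inj_onD[OF iota_inj]
  fix X assume X: "X \<in> carrier OmA"
  { fix Y assume Y: "Y \<in> carrier OmA"
    show "Omega_base k A (X \<oplus>\<^bsub>OmA\<^esub> Y) = Omega_base k A X \<oplus>\<^bsub>A\<^esub> Omega_base k A Y"
      by (rule inj) (use X Y base_closed in \<open>simp_all add: iota_base iota_add lin_add[OF proj0_lin]\<close>) }
  fix c assume c: "c \<in> carrier k"
  show "Omega_base k A (c \<odot>\<^bsub>OmA\<^esub> X) = c \<odot>\<^bsub>A\<^esub> Omega_base k A X"
  proof (rule inj)
    note b = base_closed[OF X]
    show "Omega_base k A (c \<odot>\<^bsub>OmA\<^esub> X) \<in> carrier A" by (rule base_closed) (use X c in simp)
    show "c \<odot>\<^bsub>A\<^esub> Omega_base k A X \<in> carrier A" using b c by simp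
    have "\<iota> (Omega_base k A (c \<odot>\<^bsub>OmA\<^esub> X)) = c \<odot>\<^bsub>OmA\<^esub> Omega_proj k A 0 X"
      using lin_smult[OF proj0_lin c X] X c by (simp add: iota_base)
    then show "\<iota> (Omega_base k A (c \<odot>\<^bsub>OmA\<^esub> X)) = \<iota> (c \<odot>\<^bsub>A\<^esub> Omega_base k A X)"
      using iota_smult[OF c b] iota_base[OF X] by simp
  qed
qed (rule base_closed)

abbreviation "form_span Y \<equiv> Y \<in> adspan OmA {dd a \<otimes>\<^bsub>OmA\<^esub> \<iota> b | a b. a \<in> carrier A \<and> b \<in> carrier A}"

lemma form_span_carrier: "form_span X \<Longrightarrow> X \<in> carrier OmA"
proof -
  assume "form_span X"
  then show ?thesis by (rule adspan_carrier[OF O.fq_abelian_group, rotated]) auto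
qed

text \<open>The left factor is absorbed by a (d b) c = d(a b) c - (d a) b c.\<close>

lemma form_span_left: "form_span X \<Longrightarrow> a \<in> carrier A \<Longrightarrow> form_span (\<iota> a \<otimes>\<^bsub>OmA\<^esub> X)"
proof (induction rule: adspan.induct)
  case (gen X)
  then obtain b c where X: "X = dd b \<otimes>\<^bsub>OmA\<^esub> \<iota> c" "b \<in> carrier A" "c \<in> carrier A" by auto
  have "\<iota> a \<otimes>\<^bsub>OmA\<^esub> (dd b \<otimes>\<^bsub>OmA\<^esub> \<iota> c) =
      dd (a \<otimes>\<^bsub>A\<^esub> b) \<otimes>\<^bsub>OmA\<^esub> \<iota> c \<ominus>\<^bsub>OmA\<^esub> dd a \<otimes>\<^bsub>OmA\<^esub> \<iota> (b \<otimes>\<^bsub>A\<^esub> c)"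
  proof -
    have r: "x \<oplus>\<^bsub>OmA\<^esub> y \<ominus>\<^bsub>OmA\<^esub> x = y" if "x \<in> carrier OmA" "y \<in> carrier OmA" for x y
    proof -
      have "x \<oplus>\<^bsub>OmA\<^esub> y \<ominus>\<^bsub>OmA\<^esub> x = y \<oplus>\<^bsub>OmA\<^esub> (x \<oplus>\<^bsub>OmA\<^esub> \<ominus>\<^bsub>OmA\<^esub> x)"
        using that by (simp only: O.fq.minus_eq O.fq.a_ac O.fq.a_inv_closed O.fq.a_closed)
      then show ?thesis using that by (simp add: O.fq.r_neg)
    qed
    show ?thesis using gen X by (simp add: dd_mult iota_mult OR.l_distr OR.m_assoc r)
  qed
  moreover have "form_span (dd (a \<otimes>\<^bsub>A\<^esub> b) \<otimes>\<^bsub>OmA\<^esub> \<iota> c)" "form_span (dd a \<otimes>\<^bsub>OmA\<^esub> \<iota> (b \<otimes>\<^bsub>A\<^esub> c))"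
    using gen X by (auto intro!: adspan.gen)
  ultimately show ?case using X by (simp add: adspan.diff)
next
  case (diff X Y)
  then have "\<iota> a \<otimes>\<^bsub>OmA\<^esub> (X \<ominus>\<^bsub>OmA\<^esub> Y) = \<iota> a \<otimes>\<^bsub>OmA\<^esub> X \<ominus>\<^bsub>OmA\<^esub> \<iota> a \<otimes>\<^bsub>OmA\<^esub> Y"
    by (simp add: form_span_carrier O.fq.minus_eq OR.r_distr OR.r_minus)
  then show ?case using diff by (simp add: adspan.diff)
qed (simp add: adspan.zero)

text \<open>A word of degree 1 contains one differential. The functions to its right multiply to a
  single one, and those to its left are absorbed one at a time by
  \<open>form_span_left\<close>.\<close>

lemma deg1_span: "Y \<in> dga_deg OmA 1 \<Longrightarrow> form_span Y"
proof -
  have w: "form_span (coset K (frag_of w))" if "w \<in> words A" "wdeg w = 1" for w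
    using that
  proof (induction rule: words_induct)
    case (Fn a w) then show ?case by (simp add: word_Fn form_span_left)
  next
    case (Df a w)
    then obtain b where "b \<in> carrier A" "coset K (frag_of w) = \<iota> b" using deg0_word[of w] by auto
    then show ?case using Df(1,2) unfolding word_Df[OF Df(1,2)] by (intro adspan.gen) auto
  qed simp
  assume "Y \<in> dga_deg OmA 1"
  then show "form_span Y" by (induction rule: deg_induct) (auto intro: adspan.intros w)
qed

lemma deg1_induct [consumes 1, case_names zero gen diff]:
  assumes "Y \<in> dga_deg OmA 1" and "P \<zero>\<^bsub>OmA\<^esub>"
    and "\<And>a b. a \<in> carrier A \<Longrightarrow> b \<in> carrier A \<Longrightarrow> P (dd a \<otimes>\<^bsub>OmA\<^esub> \<iota> b)"
    and "\<And>X Y. \<lbrakk>X \<in> dga_deg OmA 1; Y \<in> dga_deg OmA 1; P X; P Y\<rbrakk> \<Longrightarrow> P (X \<ominus>\<^bsub>OmA\<^esub> Y)"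
  shows "P Y"
proof -
  have "form_span Y" using assms(1) by (rule deg1_span)
  then have "Y \<in> dga_deg OmA 1 \<and> P Y"
  proof (induction rule: adspan.induct)
    case (gen X) then show ?case using assms(3) deg_mult[OF dd_deg iota_deg] by auto
  qed (use assms deg_zero deg_diff in auto)
  then show ?thesis by simp
qed

end

section \<open>The bimodule of one-forms of a calculus\<close>

lemma one_forms_simps [simp]:
  "carrier (one_forms \<Gamma> j) = dga_deg \<Gamma> 1" "zero (one_forms \<Gamma> j) = \<zero>\<^bsub>\<Gamma>\<^esub>"
  "add (one_forms \<Gamma> j) = add \<Gamma>" "smult (one_forms \<Gamma> j) = smult \<Gamma>"
  "lact (one_forms \<Gamma> j) x \<omega> = j x \<otimes>\<^bsub>\<Gamma>\<^esub> \<omega>" "ract (one_forms \<Gamma> j) \<omega> x = \<omega> \<otimes>\<^bsub>\<Gamma>\<^esub> j x"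
  by (simp_all add: one_forms_def)

lemma one_forms_bimodule:
  assumes G: "k_algebra k \<Gamma>" and D: "k_algebra k D" and j: "linear_map k D \<Gamma> j"
    and jm: "\<And>x y. x \<in> carrier D \<Longrightarrow> y \<in> carrier D \<Longrightarrow> j (x \<otimes>\<^bsub>D\<^esub> y) = j x \<otimes>\<^bsub>\<Gamma>\<^esub> j y"
    and j1: "j \<one>\<^bsub>D\<^esub> = \<one>\<^bsub>\<Gamma>\<^esub>"
    and S: "dga_deg \<Gamma> 1 \<subseteq> carrier \<Gamma>" and S0: "\<zero>\<^bsub>\<Gamma>\<^esub> \<in> dga_deg \<Gamma> 1"
    and Sd: "\<And>X Y. X \<in> dga_deg \<Gamma> 1 \<Longrightarrow> Y \<in> dga_deg \<Gamma> 1 \<Longrightarrow> X \<ominus>\<^bsub>\<Gamma>\<^esub> Y \<in> dga_deg \<Gamma> 1"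
    and Sl: "\<And>x X. x \<in> carrier D \<Longrightarrow> X \<in> dga_deg \<Gamma> 1 \<Longrightarrow> j x \<otimes>\<^bsub>\<Gamma>\<^esub> X \<in> dga_deg \<Gamma> 1"
    and Sr: "\<And>x X. x \<in> carrier D \<Longrightarrow> X \<in> dga_deg \<Gamma> 1 \<Longrightarrow> X \<otimes>\<^bsub>\<Gamma>\<^esub> j x \<in> dga_deg \<Gamma> 1"
  shows "bimodule k D (one_forms \<Gamma> j)"
proof -
  interpret G: ring \<Gamma> by (rule k_algebraD(1)[OF G])
  interpret GM: Module.module k \<Gamma> by (rule k_algebraD(2)[OF G])
  interpret D: ring D by (rule k_algebraD(1)[OF D])
  interpret DM: Module.module k D by (rule k_algebraD(2)[OF D])
  have c: "X \<in> carrier \<Gamma>" if "X \<in> dga_deg \<Gamma> 1" for X using S that by blast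
  have Sm: "\<ominus>\<^bsub>\<Gamma>\<^esub> X \<in> dga_deg \<Gamma> 1" if "X \<in> dga_deg \<Gamma> 1" for X
    using Sd[OF S0 that] c[OF that] by (simp add: G.minus_eq)
  have Sp: "X \<oplus>\<^bsub>\<Gamma>\<^esub> Y \<in> dga_deg \<Gamma> 1" if "X \<in> dga_deg \<Gamma> 1" "Y \<in> dga_deg \<Gamma> 1" for X Y
    using Sd[OF that(1) Sm[OF that(2)]] c that by (simp add: G.minus_eq)
  \<comment> \<open>A scalar multiple is the product with the image of a multiple of the unit, so
    stability under left multiplication covers it.\<close>
  have sm: "a \<odot>\<^bsub>\<Gamma>\<^esub> X \<in> dga_deg \<Gamma> 1" if "a \<in> carrier k" "X \<in> dga_deg \<Gamma> 1" for a X
  proof -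
    have "j (a \<odot>\<^bsub>D\<^esub> \<one>\<^bsub>D\<^esub>) \<otimes>\<^bsub>\<Gamma>\<^esub> X = a \<odot>\<^bsub>\<Gamma>\<^esub> X"
      using that c[OF that(2)] lin_smult[OF j] by (simp add: j1 k_algebraD(3)[OF G])
    then show ?thesis using Sl[OF _ that(2), of "a \<odot>\<^bsub>D\<^esub> \<one>\<^bsub>D\<^esub>"] that(1) by simp
  qed
  have jc: "j x \<in> carrier \<Gamma>" if "x \<in> carrier D" for x using lin_closed[OF j that] .
  show ?thesis
  proof (rule bimoduleI)
    show "Module.module k (one_forms \<Gamma> j)"
    proof (rule moduleI)
      show "abelian_group (one_forms \<Gamma> j)"
      proof (rule abelian_groupI)
        fix X assume "X \<in> carrier (one_forms \<Gamma> j)"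
        then show "\<exists>Y \<in> carrier (one_forms \<Gamma> j). Y \<oplus>\<^bsub>one_forms \<Gamma> j\<^esub> X = \<zero>\<^bsub>one_forms \<Gamma> j\<^esub>"
          using Sm[of X] c by (intro bexI[of _ "\<ominus>\<^bsub>\<Gamma>\<^esub> X"]) (simp_all add: G.l_neg)
      qed (simp_all add: S0 Sp c G.a_ac)
    qed (simp_all add: GM.is_cring sm c GM.smult_l_distr GM.smult_r_distr GM.smult_assoc1)
    show "bil k D (one_forms \<Gamma> j) (one_forms \<Gamma> j) (lact (one_forms \<Gamma> j))"
      by (intro bilI linI) (simp_all add: Sl c jc G.r_distr G.l_distr k_algebraD(3,4)[OF G] lin_add[OF j] lin_smult[OF j])
    show "bil k (one_forms \<Gamma> j) D (one_forms \<Gamma> j) (ract (one_forms \<Gamma> j))"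
      by (intro bilI linI) (simp_all add: Sr c jc G.r_distr G.l_distr k_algebraD(3,4)[OF G] lin_add[OF j] lin_smult[OF j])
  qed (simp_all add: c jc jm j1 G.m_assoc)
qed

lemma (in omega) Omega1_bimodule: "bimodule k A (Omega1 k A)"
proof (rule one_forms_bimodule[OF Omega_algebra alg iota_lin])
  show "\<iota> x \<otimes>\<^bsub>OmA\<^esub> X \<in> dga_deg OmA 1" if "x \<in> carrier A" "X \<in> dga_deg OmA 1" for x X
    using deg_mult[OF iota_deg that(2), of x] that by simp
  show "X \<otimes>\<^bsub>OmA\<^esub> \<iota> x \<in> dga_deg OmA 1" if "x \<in> carrier A" "X \<in> dga_deg OmA 1" for x X
    using deg_mult[OF that(2) iota_deg, of x] that by simp
qed (auto simp: iota_mult iota_one deg_carrier deg_zero deg_diff)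

lemma adspan_mono:
  assumes "x \<in> adspan G S" "\<And>y. y \<in> S \<Longrightarrow> y \<in> adspan G S'" shows "x \<in> adspan G S'"
  using assms(1) by (induction rule: adspan.induct) (auto intro: adspan.intros assms(2))

text \<open>Homogeneous components are defined as classes of combinations with restricted support;
  as spans they admit induction on generators.\<close>

lemma (in fquot) coset_image_adspan:
  assumes "S' \<subseteq> S"
  shows "coset K ` {x. Poly_Mapping.keys x \<subseteq> S'} = adspan Q ((\<lambda>p. coset K (frag_of p)) ` S')"
proof (intro equalityI subsetI)
  fix X assume "X \<in> coset K ` {x. Poly_Mapping.keys x \<subseteq> S'}"
  then obtain x where x: "X = coset K x" "Poly_Mapping.keys x \<subseteq> S'" by blast
  from x(2) have "Poly_Mapping.keys x \<subseteq> S \<and> coset K x \<in> adspan Q ((\<lambda>p. coset K (frag_of p)) ` S')"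
  proof (induction x rule: frag_induction)
    case zero then show ?case by (simp add: coset_zero adspan.zero)
  next
    case (one p) then show ?case using assms by (auto simp: keys_frag_of intro: adspan.gen)
  next
    case (diff a b)
    then have "Poly_Mapping.keys (a - b) \<subseteq> S" using keys_diff[of a b] by blast
    then show ?case using diff by (simp add: coset_diff adspan.diff)
  qed
  then show "X \<in> adspan Q ((\<lambda>p. coset K (frag_of p)) ` S')" using x by simp
next
  fix X assume "X \<in> adspan Q ((\<lambda>p. coset K (frag_of p)) ` S')"
  then show "X \<in> coset K ` {x. Poly_Mapping.keys x \<subseteq> S'}"
  proof (induction rule: adspan.induct)
    case zero show ?case by (rule image_eqI[of _ _ 0]) (simp_all add: coset_zero)
  next
    case (gen x)
    then obtain p where "p \<in> S'" "x = coset K (frag_of p)" by blast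
    then show ?case by (intro image_eqI[of _ _ "frag_of p"]) (auto simp: keys_frag_of)
  next
    case (diff X Y)
    then obtain x y where "X = coset K x" "Y = coset K y" "Poly_Mapping.keys x \<subseteq> S'" "Poly_Mapping.keys y \<subseteq> S'"
      by blast
    then show ?case
      using assms keys_diff[of x y] by (intro image_eqI[of _ _ "x - y"]) (auto simp: coset_diff)
  qed
qed

text \<open>Algebras and calculi built on a tensor product share its additive fields and differ in
  the others, so the module structure is transported.\<close>

lemma module_cong:
  assumes "Module.module k M" "carrier N = carrier M" "zero N = zero M" "add N = add M" "smult N = smult M"
  shows "Module.module k N"
proof -
  interpret M: Module.module k M by fact
  show ?thesis
  proof (rule moduleI)
    show "abelian_group N"
    proof (rule abelian_groupI)
      fix x assume "x \<in> carrier N"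
      then show "\<exists>y \<in> carrier N. y \<oplus>\<^bsub>N\<^esub> x = \<zero>\<^bsub>N\<^esub>"
        using assms by (intro bexI[of _ "\<ominus>\<^bsub>M\<^esub> x"]) (simp_all add: M.l_neg)
    qed (use assms in \<open>simp_all add: M.a_ac\<close>)
  qed (use assms in \<open>simp_all add: M.is_cring M.smult_l_distr M.smult_r_distr M.smult_assoc1\<close>)
qed

section \<open>Twisted tensor products and their calculus\<close>

text \<open>Stated in this generality because it is used twice: for \<open>A\<close>,
  \<open>B\<close> and \<open>R\<close>, and for the two algebras of forms with the extended
  twisting map.\<close>

locale twist =
  fixes k :: "'k ring" and A :: "('k, 'a, 'y) module_scheme" and B :: "('k, 'b, 'z) module_scheme"
    and R :: "('b, 'a) tens \<Rightarrow> ('a, 'b) tens"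
  assumes algA: "k_algebra k A" and algB: "k_algebra k B" and twR: "twisting_map k A B R"
begin

sublocale A: ring A by (rule k_algebraD(1)[OF algA])
sublocale B: ring B by (rule k_algebraD(1)[OF algB])

lemmas mA = k_algebraD(2)[OF algA] and mB = k_algebraD(2)[OF algB]

abbreviation "T \<equiv> tensor k A B"
abbreviation "D \<equiv> twisted_tensor k A B R"
abbreviation t (infix "\<cdot>" 75) where "a \<cdot> b \<equiv> tns k A B a b"
abbreviation "rr b a \<equiv> R (tns k B A b a)"

lemmas mT = tensor_module[OF mA mB]
lemmas t_bil = tns_bil[OF mA mB]
lemmas t_closed [simp] = tns_closed[OF mA mB]

lemma D_simps [simp]:
  "carrier D = carrier T" "add D = add T" "zero D = zero T" "smult D = smult T" "one D = \<one>\<^bsub>A\<^esub> \<cdot> \<one>\<^bsub>B\<^esub>"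
  by (simp_all add: twisted_tensor_def)

lemma R_lin: "linear_map k (tensor k B A) T R" using twR by (simp add: twisting_map_def)

lemma R_closed [simp]: "b \<in> carrier B \<Longrightarrow> a \<in> carrier A \<Longrightarrow> rr b a \<in> carrier T"
  by (rule lin_closed[OF R_lin]) (rule tns_closed[OF mB mA])

lemma rr_bil: "bil k B A T rr"
  by (intro bilI lin_comp[OF R_lin] bil_r[OF tns_bil[OF mB mA] lin_id] bil_l[OF tns_bil[OF mB mA] lin_id])

lemmas mulA_r = bil_r[OF mult_bil[OF algA]] and mulA_l = bil_l[OF mult_bil[OF algA]]
lemmas mulB_r = bil_r[OF mult_bil[OF algB]] and mulB_l = bil_l[OF mult_bil[OF algB]]
lemmas t_r = bil_r[OF t_bil] and t_l = bil_l[OF t_bil]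

text \<open>The product of a, Z and b in this order, with a in the first and b in the second
  algebra: the part of the multiplication for which nothing has to be twisted.\<close>

definition core :: "'a \<Rightarrow> 'b \<Rightarrow> ('a, 'b) tens \<Rightarrow> ('a, 'b) tens" where
  "core a b Z = tbind T Z (\<lambda>a' b'. (a \<otimes>\<^bsub>A\<^esub> a') \<cdot> (b' \<otimes>\<^bsub>B\<^esub> b))"

lemma core_bil: "a \<in> carrier A \<Longrightarrow> b \<in> carrier B \<Longrightarrow> bil k A B T (\<lambda>a' b'. (a \<otimes>\<^bsub>A\<^esub> a') \<cdot> (b' \<otimes>\<^bsub>B\<^esub> b))"
  by (intro bilI t_l t_r mulA_r mulB_l lin_id) simp_all

lemma core_pure [simp]: "a \<in> carrier A \<Longrightarrow> b \<in> carrier B \<Longrightarrow> a' \<in> carrier A \<Longrightarrow> b' \<in> carrier B \<Longrightarrow>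
   core a b (a' \<cdot> b') = (a \<otimes>\<^bsub>A\<^esub> a') \<cdot> (b' \<otimes>\<^bsub>B\<^esub> b)"
  unfolding core_def by (rule tbind_pure[OF mA mB mT core_bil])

lemma core_lin: "a \<in> carrier A \<Longrightarrow> b \<in> carrier B \<Longrightarrow> linear_map k T T (core a b)"
  unfolding core_def by (rule tbind_lin[OF mA mB mT core_bil])

lemmas core_closed [simp] = lin_closed[OF core_lin]

lemma core_lin_left: "Z \<in> carrier T \<Longrightarrow> b \<in> carrier B \<Longrightarrow> linear_map k A T (\<lambda>a. core a b Z)"
  unfolding core_def
  by (rule tbind_lin_param[OF mA mB _ mT mA core_bil]) (simp_all add: t_l mulA_l lin_id)

lemma core_lin_right: "Z \<in> carrier T \<Longrightarrow> a \<in> carrier A \<Longrightarrow> linear_map k B T (\<lambda>b. core a b Z)"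
  unfolding core_def
  by (rule tbind_lin_param[OF mA mB _ mT mB core_bil]) (simp_all add: t_r mulB_r lin_id)

lemma inner_bil: "a \<in> carrier A \<Longrightarrow> b \<in> carrier B \<Longrightarrow> bil k A B T (\<lambda>a' b'. core a b' (rr b a'))"
  by (intro bilI core_lin_right lin_comp[OF core_lin] bil_r[OF rr_bil lin_id]) simp_all

lemma mult_eq: "X \<otimes>\<^bsub>D\<^esub> Y = tbind T X (\<lambda>a b. tbind T Y (\<lambda>a' b'. core a b' (rr b a')))"
  by (simp add: twisted_tensor_def core_def)

lemma outer_bil: "Y \<in> carrier T \<Longrightarrow> bil k A B T (\<lambda>a b. tbind T Y (\<lambda>a' b'. core a b' (rr b a')))"
  by (intro bilI; rule tbind_lin_param[OF mA mB _ mT])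
    (simp_all add: mA mB inner_bil core_lin_left lin_comp[OF core_lin] bil_l[OF rr_bil lin_id])

lemma D_mult_lin_left: "Y \<in> carrier T \<Longrightarrow> linear_map k T T (\<lambda>X. X \<otimes>\<^bsub>D\<^esub> Y)"
  unfolding mult_eq by (rule tbind_lin[OF mA mB mT outer_bil])

lemma D_mult_pure: "a \<in> carrier A \<Longrightarrow> b \<in> carrier B \<Longrightarrow> a' \<in> carrier A \<Longrightarrow> b' \<in> carrier B \<Longrightarrow>
   (a \<cdot> b) \<otimes>\<^bsub>D\<^esub> (a' \<cdot> b') = core a b' (rr b a')"
  unfolding mult_eq by (simp add: tbind_pure[OF mA mB mT outer_bil] tbind_pure[OF mA mB mT inner_bil])

lemma D_mult_lin_right: "X \<in> carrier T \<Longrightarrow> linear_map k T T (\<lambda>Y. X \<otimes>\<^bsub>D\<^esub> Y)"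
  unfolding mult_eq
  by (rule tbind_lin_param[OF mA mB _ mT mT outer_bil])
    (simp_all add: tbind_lin[OF mA mB mT inner_bil])

lemma D_closed [simp]: "X \<in> carrier T \<Longrightarrow> Y \<in> carrier T \<Longrightarrow> X \<otimes>\<^bsub>D\<^esub> Y \<in> carrier T"
  using lin_closed[OF D_mult_lin_right] .

lemma R_one: "b \<in> carrier B \<Longrightarrow> rr b \<one>\<^bsub>A\<^esub> = \<one>\<^bsub>A\<^esub> \<cdot> b" "a \<in> carrier A \<Longrightarrow> rr \<one>\<^bsub>B\<^esub> a = a \<cdot> \<one>\<^bsub>B\<^esub>"
  using twR by (auto simp: twisting_map_def)

text \<open>To move b b' past a, first b' is moved and then b is multiplied on from the left. Read
  this way, each multiplicativity axiom of \<open>R\<close> is an instance of associativity in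
  \<open>D\<close>.\<close>

lemma R_mult_left:
  assumes [simp]: "b \<in> carrier B" "b' \<in> carrier B" "a \<in> carrier A"
  shows "rr (b \<otimes>\<^bsub>B\<^esub> b') a = (\<one>\<^bsub>A\<^esub> \<cdot> b) \<otimes>\<^bsub>D\<^esub> rr b' a"
proof -
  have "rr (b \<otimes>\<^bsub>B\<^esub> b') a = tbind T (rr b' a) (\<lambda>a1 b1. tbind T (rr b a1) (\<lambda>a2 b2. a2 \<cdot> (b2 \<otimes>\<^bsub>B\<^esub> b1)))"
    using twR assms by (simp add: twisting_map_def)
  also have "\<dots> = (\<one>\<^bsub>A\<^esub> \<cdot> b) \<otimes>\<^bsub>D\<^esub> rr b' a"
  proof (rule tbind_tensor[OF mA mB mT D_mult_lin_right])
    have "tbind T Q (\<lambda>a2 b2. a2 \<cdot> (b2 \<otimes>\<^bsub>B\<^esub> b1)) = core \<one>\<^bsub>A\<^esub> b1 Q" if "Q \<in> carrier T" "b1 \<in> carrier B" for Q b1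
      by (rule tbind_tensor[OF mA mB mT core_lin]) (use that in simp_all)
    then show "tbind T (rr b a1) (\<lambda>a2 b2. a2 \<cdot> (b2 \<otimes>\<^bsub>B\<^esub> b1)) = (\<one>\<^bsub>A\<^esub> \<cdot> b) \<otimes>\<^bsub>D\<^esub> (a1 \<cdot> b1)"
      if "a1 \<in> carrier A" "b1 \<in> carrier B" for a1 b1
      using that by (simp add: D_mult_pure)
  qed simp_all
  finally show ?thesis .
qed

lemma R_mult_right:
  assumes [simp]: "b \<in> carrier B" "a' \<in> carrier A" "a \<in> carrier A"
  shows "rr b (a \<otimes>\<^bsub>A\<^esub> a') = rr b a \<otimes>\<^bsub>D\<^esub> (a' \<cdot> \<one>\<^bsub>B\<^esub>)"
proof -
  have "rr b (a \<otimes>\<^bsub>A\<^esub> a') = tbind T (rr b a) (\<lambda>a1 b1. tbind T (rr b1 a') (\<lambda>a2 b2. (a1 \<otimes>\<^bsub>A\<^esub> a2) \<cdot> b2))"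
    using twR assms by (simp add: twisting_map_def)
  also have "\<dots> = rr b a \<otimes>\<^bsub>D\<^esub> (a' \<cdot> \<one>\<^bsub>B\<^esub>)"
  proof (rule tbind_tensor[OF mA mB mT D_mult_lin_left])
    have "tbind T Q (\<lambda>a2 b2. (a1 \<otimes>\<^bsub>A\<^esub> a2) \<cdot> b2) = core a1 \<one>\<^bsub>B\<^esub> Q" if "Q \<in> carrier T" "a1 \<in> carrier A" for Q a1
      by (rule tbind_tensor[OF mA mB mT core_lin]) (use that in simp_all)
    then show "tbind T (rr b1 a') (\<lambda>a2 b2. (a1 \<otimes>\<^bsub>A\<^esub> a2) \<cdot> b2) = (a1 \<cdot> b1) \<otimes>\<^bsub>D\<^esub> (a' \<cdot> \<one>\<^bsub>B\<^esub>)"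
      if "a1 \<in> carrier A" "b1 \<in> carrier B" for a1 b1
      using that by (simp add: D_mult_pure)
  qed simp_all
  finally show ?thesis .
qed

lemma core_mult_left:
  assumes [simp]: "a \<in> carrier A" "b' \<in> carrier B" "a'' \<in> carrier A" "b'' \<in> carrier B" and W: "W \<in> carrier T"
  shows "core a b' W \<otimes>\<^bsub>D\<^esub> (a'' \<cdot> b'') = core a b'' (W \<otimes>\<^bsub>D\<^esub> rr b' a'')"
proof (rule tensor_ext[OF mA mB mT _ _ _ W])
  show "linear_map k T T (\<lambda>W. core a b' W \<otimes>\<^bsub>D\<^esub> (a'' \<cdot> b''))"
    by (intro lin_comp[OF D_mult_lin_left] core_lin) simp_all
  show "linear_map k T T (\<lambda>W. core a b'' (W \<otimes>\<^bsub>D\<^esub> rr b' a''))"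
    by (intro lin_comp[OF core_lin] D_mult_lin_left) simp_all
  fix a0 b0 assume [simp]: "a0 \<in> carrier A" "b0 \<in> carrier B"
  have "core (a \<otimes>\<^bsub>A\<^esub> a0) b'' ((\<one>\<^bsub>A\<^esub> \<cdot> b0) \<otimes>\<^bsub>D\<^esub> V) = core a b'' ((a0 \<cdot> b0) \<otimes>\<^bsub>D\<^esub> V)" if "V \<in> carrier T" for V
  proof (rule tensor_ext[OF mA mB mT _ _ _ that])
    fix a1 b1 assume [simp]: "a1 \<in> carrier A" "b1 \<in> carrier B"
    have "core (a \<otimes>\<^bsub>A\<^esub> a0) b'' (core \<one>\<^bsub>A\<^esub> b1 Q) = core a b'' (core a0 b1 Q)" if "Q \<in> carrier T" for Q
      by (rule tensor_ext[OF mA mB mT lin_comp[OF core_lin core_lin] lin_comp[OF core_lin core_lin] _ that])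
        (simp_all add: A.m_assoc)
    then show "core (a \<otimes>\<^bsub>A\<^esub> a0) b'' ((\<one>\<^bsub>A\<^esub> \<cdot> b0) \<otimes>\<^bsub>D\<^esub> (a1 \<cdot> b1)) = core a b'' ((a0 \<cdot> b0) \<otimes>\<^bsub>D\<^esub> (a1 \<cdot> b1))"
      by (simp add: D_mult_pure)
  qed (simp_all add: lin_comp[OF core_lin D_mult_lin_right])
  then show "core a b' (a0 \<cdot> b0) \<otimes>\<^bsub>D\<^esub> (a'' \<cdot> b'') = core a b'' ((a0 \<cdot> b0) \<otimes>\<^bsub>D\<^esub> rr b' a'')"
    by (simp add: D_mult_pure R_mult_left)
qed

lemma core_mult_right:
  assumes [simp]: "a \<in> carrier A" "b \<in> carrier B" "a' \<in> carrier A" "b'' \<in> carrier B" and V: "V \<in> carrier T"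
  shows "(a \<cdot> b) \<otimes>\<^bsub>D\<^esub> core a' b'' V = core a b'' (rr b a' \<otimes>\<^bsub>D\<^esub> V)"
proof (rule tensor_ext[OF mA mB mT _ _ _ V])
  show "linear_map k T T (\<lambda>V. (a \<cdot> b) \<otimes>\<^bsub>D\<^esub> core a' b'' V)"
    by (intro lin_comp[OF D_mult_lin_right] core_lin) simp_all
  show "linear_map k T T (\<lambda>V. core a b'' (rr b a' \<otimes>\<^bsub>D\<^esub> V))"
    by (intro lin_comp[OF core_lin] D_mult_lin_right) simp_all
  fix a0 b0 assume [simp]: "a0 \<in> carrier A" "b0 \<in> carrier B"
  have "core a (b0 \<otimes>\<^bsub>B\<^esub> b'') (U \<otimes>\<^bsub>D\<^esub> (a0 \<cdot> \<one>\<^bsub>B\<^esub>)) = core a b'' (U \<otimes>\<^bsub>D\<^esub> (a0 \<cdot> b0))" if "U \<in> carrier T" for U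
  proof (rule tensor_ext[OF mA mB mT _ _ _ that])
    fix a1 b1 assume [simp]: "a1 \<in> carrier A" "b1 \<in> carrier B"
    have "core a (b0 \<otimes>\<^bsub>B\<^esub> b'') (core a1 \<one>\<^bsub>B\<^esub> Q) = core a b'' (core a1 b0 Q)" if "Q \<in> carrier T" for Q
      by (rule tensor_ext[OF mA mB mT lin_comp[OF core_lin core_lin] lin_comp[OF core_lin core_lin] _ that])
        (simp_all add: B.m_assoc)
    then show "core a (b0 \<otimes>\<^bsub>B\<^esub> b'') ((a1 \<cdot> b1) \<otimes>\<^bsub>D\<^esub> (a0 \<cdot> \<one>\<^bsub>B\<^esub>)) = core a b'' ((a1 \<cdot> b1) \<otimes>\<^bsub>D\<^esub> (a0 \<cdot> b0))"
      by (simp add: D_mult_pure)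
  qed (simp_all add: lin_comp[OF core_lin D_mult_lin_left])
  then show "(a \<cdot> b) \<otimes>\<^bsub>D\<^esub> core a' b'' (a0 \<cdot> b0) = core a b'' (rr b a' \<otimes>\<^bsub>D\<^esub> (a0 \<cdot> b0))"
    by (simp add: D_mult_pure R_mult_right)
qed

text \<open>On pure tensors both bracketings become a [R(b \<otimes> a') R(b' \<otimes> a'')] b''.
  Each of \<open>core_mult_left\<close> and \<open>core_mult_right\<close> contributes one side and
  rests on one multiplicativity axiom of \<open>R\<close>.\<close>

lemma D_assoc:
  assumes X: "X \<in> carrier T" and Y: "Y \<in> carrier T" and Z: "Z \<in> carrier T"
  shows "X \<otimes>\<^bsub>D\<^esub> Y \<otimes>\<^bsub>D\<^esub> Z = X \<otimes>\<^bsub>D\<^esub> (Y \<otimes>\<^bsub>D\<^esub> Z)"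
proof (rule tensor_ext[OF mA mB mT _ _ _ X])
  show "linear_map k T T (\<lambda>X. X \<otimes>\<^bsub>D\<^esub> Y \<otimes>\<^bsub>D\<^esub> Z)" "linear_map k T T (\<lambda>X. X \<otimes>\<^bsub>D\<^esub> (Y \<otimes>\<^bsub>D\<^esub> Z))"
    using Y Z by (simp_all add: lin_comp[OF D_mult_lin_left D_mult_lin_left] D_mult_lin_left)
  fix a b assume a [simp]: "a \<in> carrier A" and b [simp]: "b \<in> carrier B"
  show "(a \<cdot> b) \<otimes>\<^bsub>D\<^esub> Y \<otimes>\<^bsub>D\<^esub> Z = (a \<cdot> b) \<otimes>\<^bsub>D\<^esub> (Y \<otimes>\<^bsub>D\<^esub> Z)"
  proof (rule tensor_ext[OF mA mB mT _ _ _ Y])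
    show "linear_map k T T (\<lambda>Y. (a \<cdot> b) \<otimes>\<^bsub>D\<^esub> Y \<otimes>\<^bsub>D\<^esub> Z)" "linear_map k T T (\<lambda>Y. (a \<cdot> b) \<otimes>\<^bsub>D\<^esub> (Y \<otimes>\<^bsub>D\<^esub> Z))"
      using Z by (simp_all add: lin_comp[OF D_mult_lin_left D_mult_lin_right] lin_comp[OF D_mult_lin_right D_mult_lin_left])
    fix a' b' assume a' [simp]: "a' \<in> carrier A" and b' [simp]: "b' \<in> carrier B"
    show "(a \<cdot> b) \<otimes>\<^bsub>D\<^esub> (a' \<cdot> b') \<otimes>\<^bsub>D\<^esub> Z = (a \<cdot> b) \<otimes>\<^bsub>D\<^esub> ((a' \<cdot> b') \<otimes>\<^bsub>D\<^esub> Z)"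
      by (rule tensor_ext[OF mA mB mT _ _ _ Z])
        (simp_all add: D_mult_lin_right lin_comp[OF D_mult_lin_right D_mult_lin_right]
          D_mult_pure core_mult_left core_mult_right)
  qed
qed

lemma D_algebra: "k_algebra k D"
  unfolding k_algebra_def
proof (intro conjI ballI)
  show m: "Module.module k D" by (rule module_cong[OF mT]) simp_all
  show "ring D"
  proof (rule ringI)
    show "abelian_group D" by (rule mod_ab[OF m])
    show "monoid D"
    proof
      fix X assume X: "X \<in> carrier D"
      show "\<one>\<^bsub>D\<^esub> \<otimes>\<^bsub>D\<^esub> X = X"
        by (rule tensor_ext[OF mA mB mT D_mult_lin_right lin_id]) (use X in \<open>simp_all add: D_mult_pure R_one\<close>)
      show "X \<otimes>\<^bsub>D\<^esub> \<one>\<^bsub>D\<^esub> = X"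
        by (rule tensor_ext[OF mA mB mT D_mult_lin_left lin_id]) (use X in \<open>simp_all add: D_mult_pure R_one\<close>)
    qed (simp_all add: D_assoc)
    fix X Y Z assume X: "X \<in> carrier D" and Y: "Y \<in> carrier D" and Z: "Z \<in> carrier D"
    show "(X \<oplus>\<^bsub>D\<^esub> Y) \<otimes>\<^bsub>D\<^esub> Z = X \<otimes>\<^bsub>D\<^esub> Z \<oplus>\<^bsub>D\<^esub> Y \<otimes>\<^bsub>D\<^esub> Z"
      using lin_add[OF D_mult_lin_left, of Z X Y] X Y Z by simp
    show "Z \<otimes>\<^bsub>D\<^esub> (X \<oplus>\<^bsub>D\<^esub> Y) = Z \<otimes>\<^bsub>D\<^esub> X \<oplus>\<^bsub>D\<^esub> Z \<otimes>\<^bsub>D\<^esub> Y"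
      using lin_add[OF D_mult_lin_right, of Z X Y] X Y Z by simp
  qed
  fix c X Y assume c: "c \<in> carrier k" and X: "X \<in> carrier D" and Y: "Y \<in> carrier D"
  show "c \<odot>\<^bsub>D\<^esub> X \<otimes>\<^bsub>D\<^esub> Y = c \<odot>\<^bsub>D\<^esub> (X \<otimes>\<^bsub>D\<^esub> Y)"
    using lin_smult[OF D_mult_lin_left, of Y c X] c X Y by simp
  show "X \<otimes>\<^bsub>D\<^esub> (c \<odot>\<^bsub>D\<^esub> Y) = c \<odot>\<^bsub>D\<^esub> (X \<otimes>\<^bsub>D\<^esub> Y)"
    using lin_smult[OF D_mult_lin_right, of X c Y] c X Y by simp
qed


sublocale D: ring D by (rule k_algebraD(1)[OF D_algebra])


lemma D_mult_simps:
  "a \<in> carrier A \<Longrightarrow> a' \<in> carrier A \<Longrightarrow> b \<in> carrier B \<Longrightarrow> (a \<cdot> \<one>\<^bsub>B\<^esub>) \<otimes>\<^bsub>D\<^esub> (a' \<cdot> b) = (a \<otimes>\<^bsub>A\<^esub> a') \<cdot> b"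
  "a \<in> carrier A \<Longrightarrow> b' \<in> carrier B \<Longrightarrow> b \<in> carrier B \<Longrightarrow> (a \<cdot> b) \<otimes>\<^bsub>D\<^esub> (\<one>\<^bsub>A\<^esub> \<cdot> b') = a \<cdot> (b \<otimes>\<^bsub>B\<^esub> b')"
  by (simp_all add: D_mult_pure R_one)

lemma core_one: "Z \<in> carrier T \<Longrightarrow> core \<one>\<^bsub>A\<^esub> \<one>\<^bsub>B\<^esub> Z = Z"
  by (rule tensor_ext[OF mA mB mT core_lin lin_id]) simp_all

lemma R_eq_mult: "a \<in> carrier A \<Longrightarrow> b \<in> carrier B \<Longrightarrow> (\<one>\<^bsub>A\<^esub> \<cdot> b) \<otimes>\<^bsub>D\<^esub> (a \<cdot> \<one>\<^bsub>B\<^esub>) = rr b a"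
  by (simp add: D_mult_pure core_one)

end

lemma adspan_induct_lin:
  assumes "x \<in> adspan G S" and G: "Module.module k G" and W: "Module.module k W"
    and "linear_map k G W f" "linear_map k G W g" and S: "S \<subseteq> carrier G"
    and eq: "\<And>y. y \<in> S \<Longrightarrow> f y = g y"
  shows "f x = g x"
proof -
  note ab = mod_ab[OF G]
  from assms(1) show ?thesis
  proof (induction rule: adspan.induct)
    case zero then show ?case using lin_zero[OF G W assms(4)] lin_zero[OF G W assms(5)] by simp
  next
    case (diff x y)
    then show ?case
      using lin_diff[OF G W assms(4)] lin_diff[OF G W assms(5)] adspan_carrier[OF ab S] by simp
  qed (rule eq)
qed

section \<open>The differential calculus on the twisted tensor product\<close>

locale calculus = twist k A B R
  for k :: "'k ring" and A :: "('k, 'a, 'y) module_scheme" and B :: "('k, 'b, 'z) module_scheme"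
    and R :: "('b, 'a) tens \<Rightarrow> ('a, 'b) tens" +
  fixes Rt :: "('b forms, 'a forms) tens \<Rightarrow> ('a forms, 'b forms) tens"
  assumes ext: "extended_twisting_map k A B R Rt"
begin

sublocale OA: omega k A by (rule omega.intro[OF algA])
sublocale OB: omega k B by (rule omega.intro[OF algB])

abbreviation "OmA \<equiv> Omega k A"
abbreviation "OmB \<equiv> Omega k B"
abbreviation "G \<equiv> twisted_calculus k A B Rt"
abbreviation "J \<equiv> twisted_iota k A B"
abbreviation "Om \<equiv> one_forms G J"
abbreviation "\<iota>A \<equiv> iota k A"
abbreviation "\<iota>B \<equiv> iota k B"

sublocale O: twist k OmA OmB Rt
  by (rule twist.intro[OF OA.Omega_algebra OB.Omega_algebra])
    (use ext in \<open>simp add: extended_twisting_map_def Let_def\<close>)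

notation O.t (infix "\<bullet>" 75)

lemma Rt_iota: "b \<in> carrier B \<Longrightarrow> a \<in> carrier A \<Longrightarrow> O.rr (\<iota>B b) (\<iota>A a) = J (rr b a)"
  using ext by (simp add: extended_twisting_map_def Let_def twisted_iota_def)

lemma Rt_diff_left: "\<eta> \<in> carrier OmB \<Longrightarrow> \<omega> \<in> carrier OmA \<Longrightarrow>
   O.rr (dga_diff OmB \<eta>) \<omega> = tbind O.T (O.rr \<eta> \<omega>) (\<lambda>\<omega>' \<eta>'. Omega_eps k A \<omega>' \<bullet> dga_diff OmB \<eta>')"
  using ext by (simp add: extended_twisting_map_def Let_def)

lemma Rt_diff_right: "\<eta> \<in> carrier OmB \<Longrightarrow> \<omega> \<in> carrier OmA \<Longrightarrow>
   O.rr \<eta> (dga_diff OmA \<omega>) = tbind O.T (O.rr \<eta> \<omega>) (\<lambda>\<omega>' \<eta>'. dga_diff OmA \<omega>' \<bullet> Omega_eps k B \<eta>')"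
  using ext by (simp add: extended_twisting_map_def Let_def)

lemma G_simps [simp]:
  "carrier G = carrier O.T" "add G = add O.T" "zero G = zero O.T" "smult G = smult O.T"
  "mult G = mult O.D" "one G = one O.D"
  "dga_deg G p = coset (tnull k OmA OmB) ` {x. Poly_Mapping.keys x \<subseteq> (\<Union>i \<in> {..p}. dga_deg OmA i \<times> dga_deg OmB (p - i))}"
  "dga_diff G X = tbind O.T X (\<lambda>\<omega> \<eta>. dga_diff OmA \<omega> \<bullet> \<eta> \<oplus>\<^bsub>O.T\<^esub> Omega_eps k A \<omega> \<bullet> dga_diff OmB \<eta>)"
  by (simp_all add: twisted_calculus_def Let_def module.defs dga.defs twisted_tensor_def)

lemma mG: "Module.module k G"
  by (rule module_cong[OF O.mT]) simp_all

lemma G_algebra: "k_algebra k G"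
  unfolding k_algebra_def
proof (intro conjI)
  show "Module.module k G" by (rule mG)
  show "ring G"
    using O.D.ring_axioms mod_ab[OF mG]
    by (simp add: ring_def monoid_def ring_axioms_def)
qed (use k_algebraD(3,4)[OF O.D_algebra] in simp)

text \<open>The images of a, b, d a and d b in the calculus. Computations are reduced to products of
  these four and their exchange rules \<open>q_p\<close>, \<open>q_P\<close> and
  \<open>Q_p\<close>.\<close>

abbreviation "p a \<equiv> \<iota>A a \<bullet> \<one>\<^bsub>OmB\<^esub>"
abbreviation "q b \<equiv> \<one>\<^bsub>OmA\<^esub> \<bullet> \<iota>B b"
abbreviation "P a \<equiv> OA.dd a \<bullet> \<one>\<^bsub>OmB\<^esub>"
abbreviation "Q b \<equiv> \<one>\<^bsub>OmA\<^esub> \<bullet> OB.dd b"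

lemma iota_bil: "bil k A B O.T (\<lambda>a b. \<iota>A a \<bullet> \<iota>B b)"
  by (intro bilI O.t_l O.t_r OA.iota_lin OB.iota_lin) simp_all

lemma J_pure [simp]: "a \<in> carrier A \<Longrightarrow> b \<in> carrier B \<Longrightarrow> J (a \<cdot> b) = \<iota>A a \<bullet> \<iota>B b"
  unfolding twisted_iota_def by (rule tbind_pure[OF mA mB O.mT iota_bil])

lemma J_lin: "linear_map k T O.T J"
  unfolding twisted_iota_def by (rule tbind_lin[OF mA mB O.mT iota_bil])

lemma J_closed [simp]: "X \<in> carrier T \<Longrightarrow> J X \<in> carrier O.T"
  using lin_closed[OF J_lin] .

lemma d_bil: "bil k OmA OmB O.T (\<lambda>\<omega> \<eta>. dga_diff OmA \<omega> \<bullet> \<eta> \<oplus>\<^bsub>O.T\<^esub> Omega_eps k A \<omega> \<bullet> dga_diff OmB \<eta>)"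
  by (intro bilI lin_sum[OF O.mT] O.t_l O.t_r OA.diff_lin OB.diff_lin OA.eps_lin lin_id)
    (simp_all add: lin_closed[OF OA.diff_lin] lin_closed[OF OB.diff_lin] lin_closed[OF OA.eps_lin])

lemma d_lin: "linear_map k O.T O.T (dga_diff G)"
  unfolding G_simps(8) by (rule tbind_lin[OF O.mA O.mB O.mT d_bil])

definition dD :: "('a, 'b) tens \<Rightarrow> ('a forms, 'b forms) tens" where "dD X = dga_diff G (J X)"

lemma dD_lin: "linear_map k T O.T dD"
  unfolding dD_def by (rule lin_comp[OF d_lin J_lin])

lemma dD_closed [simp]: "X \<in> carrier T \<Longrightarrow> dD X \<in> carrier O.T"
  using lin_closed[OF dD_lin] .

lemma dD_pure: "a \<in> carrier A \<Longrightarrow> b \<in> carrier B \<Longrightarrow>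
   dD (a \<cdot> b) = OA.dd a \<bullet> \<iota>B b \<oplus>\<^bsub>O.T\<^esub> \<iota>A a \<bullet> OB.dd b"
  unfolding dD_def G_simps(8)
  by (simp add: tbind_pure[OF O.mA O.mB O.mT d_bil] OA.diff_iota OB.diff_iota OA.eps_iota)

lemma d1_bil: "bil k A B O.T (\<lambda>a b. OA.dd a \<bullet> \<iota>B b)"
  by (intro bilI O.t_l O.t_r OA.dd_lin OB.iota_lin) simp_all

lemma d2_bil: "bil k A B O.T (\<lambda>a b. \<iota>A a \<bullet> OB.dd b)"
  by (intro bilI O.t_l O.t_r OB.dd_lin OA.iota_lin) simp_all

text \<open>The components of d on functions with values in \<Omega>^1 A \<otimes> B and in A
  \<otimes> \<Omega>^1 B.\<close>

definition "d1 X = tbind O.T X (\<lambda>a b. OA.dd a \<bullet> \<iota>B b)"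
definition "d2 X = tbind O.T X (\<lambda>a b. \<iota>A a \<bullet> OB.dd b)"

lemma d1_lin: "linear_map k T O.T d1" unfolding d1_def by (rule tbind_lin[OF mA mB O.mT d1_bil])
lemma d2_lin: "linear_map k T O.T d2" unfolding d2_def by (rule tbind_lin[OF mA mB O.mT d2_bil])
lemmas d1_closed [simp] = lin_closed[OF d1_lin] and d2_closed [simp] = lin_closed[OF d2_lin]

lemma d1_pure [simp]: "a \<in> carrier A \<Longrightarrow> b \<in> carrier B \<Longrightarrow> d1 (a \<cdot> b) = OA.dd a \<bullet> \<iota>B b"
  unfolding d1_def by (rule tbind_pure[OF mA mB O.mT d1_bil])

lemma d2_pure [simp]: "a \<in> carrier A \<Longrightarrow> b \<in> carrier B \<Longrightarrow> d2 (a \<cdot> b) = \<iota>A a \<bullet> OB.dd b"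
  unfolding d2_def by (rule tbind_pure[OF mA mB O.mT d2_bil])

lemma dD_eq: "X \<in> carrier T \<Longrightarrow> dD X = d1 X \<oplus>\<^bsub>O.T\<^esub> d2 X"
  by (rule tensor_ext[OF mA mB O.mT dD_lin lin_sum[OF O.mT d1_lin d2_lin]]) (simp_all add: dD_pure)

text \<open>On functions the sign \<epsilon> is trivial, so compatibility of \<open>Rt\<close> with
  the differential of \<open>A\<close> says that b (d a) is the A-part of d(b a). Likewise
  \<open>Rt_dd_iota\<close> makes (d b) a its B-part.\<close>

lemma Rt_iota_dd:
  assumes [simp]: "b \<in> carrier B" "a \<in> carrier A" shows "O.rr (\<iota>B b) (OA.dd a) = d1 (rr b a)"
proof -
  have "O.rr (\<iota>B b) (OA.dd a) = tbind O.T (J (rr b a)) (\<lambda>\<omega>' \<eta>'. dga_diff OmA \<omega>' \<bullet> Omega_eps k B \<eta>')"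
    using Rt_diff_right[of "\<iota>B b" "\<iota>A a"] by (simp add: OA.diff_iota Rt_iota)
  also have "\<dots> = d1 (rr b a)"
  proof (rule tensor_ext[OF mA mB O.mT lin_comp[OF tbind_lin[OF O.mA O.mB O.mT] J_lin] d1_lin])
    show bl: "bil k OmA OmB O.T (\<lambda>\<omega>' \<eta>'. dga_diff OmA \<omega>' \<bullet> Omega_eps k B \<eta>')"
      by (intro bilI O.t_l O.t_r OA.diff_lin OB.eps_lin)
        (simp_all add: lin_closed[OF OA.diff_lin] lin_closed[OF OB.eps_lin])
    fix a b assume "a \<in> carrier A" "b \<in> carrier B"
    then show "tbind O.T (J (a \<cdot> b)) (\<lambda>\<omega>' \<eta>'. dga_diff OmA \<omega>' \<bullet> Omega_eps k B \<eta>') = d1 (a \<cdot> b)"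
      by (simp add: tbind_pure[OF O.mA O.mB O.mT bl] OA.diff_iota OB.eps_iota)
  qed simp
  finally show ?thesis .
qed

lemma Rt_dd_iota:
  assumes [simp]: "b \<in> carrier B" "a \<in> carrier A" shows "O.rr (OB.dd b) (\<iota>A a) = d2 (rr b a)"
proof -
  have "O.rr (OB.dd b) (\<iota>A a) = tbind O.T (J (rr b a)) (\<lambda>\<omega>' \<eta>'. Omega_eps k A \<omega>' \<bullet> dga_diff OmB \<eta>')"
    using Rt_diff_left[of "\<iota>B b" "\<iota>A a"] by (simp add: OB.diff_iota Rt_iota)
  also have "\<dots> = d2 (rr b a)"
  proof (rule tensor_ext[OF mA mB O.mT lin_comp[OF tbind_lin[OF O.mA O.mB O.mT] J_lin] d2_lin])
    show bl: "bil k OmA OmB O.T (\<lambda>\<omega>' \<eta>'. Omega_eps k A \<omega>' \<bullet> dga_diff OmB \<eta>')"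
      by (intro bilI O.t_l O.t_r OB.diff_lin OA.eps_lin)
        (simp_all add: lin_closed[OF OB.diff_lin] lin_closed[OF OA.eps_lin])
    fix a b assume "a \<in> carrier A" "b \<in> carrier B"
    then show "tbind O.T (J (a \<cdot> b)) (\<lambda>\<omega>' \<eta>'. Omega_eps k A \<omega>' \<bullet> dga_diff OmB \<eta>') = d2 (a \<cdot> b)"
      by (simp add: tbind_pure[OF O.mA O.mB O.mT bl] OB.diff_iota OA.eps_iota)
  qed simp
  finally show ?thesis .
qed

lemma J_core:
  assumes [simp]: "a \<in> carrier A" "b \<in> carrier B" and Z: "Z \<in> carrier T"
  shows "J (core a b Z) = O.core (\<iota>A a) (\<iota>B b) (J Z)"
  by (rule tensor_ext[OF mA mB O.mT lin_comp[OF J_lin core_lin] lin_comp[OF O.core_lin J_lin] _ Z])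
    (simp_all add: OA.iota_mult OB.iota_mult)

lemma J_mult:
  assumes X: "X \<in> carrier T" and Y: "Y \<in> carrier T"
  shows "J (X \<otimes>\<^bsub>D\<^esub> Y) = J X \<otimes>\<^bsub>O.D\<^esub> J Y"
proof (rule tensor_ext[OF mA mB O.mT lin_comp[OF J_lin D_mult_lin_left[OF Y]] lin_comp[OF O.D_mult_lin_left J_lin] _ X])
  fix a b assume ab [simp]: "a \<in> carrier A" "b \<in> carrier B"
  show "J ((a \<cdot> b) \<otimes>\<^bsub>D\<^esub> Y) = J (a \<cdot> b) \<otimes>\<^bsub>O.D\<^esub> J Y"
    by (rule tensor_ext[OF mA mB O.mT lin_comp[OF J_lin D_mult_lin_right] lin_comp[OF O.D_mult_lin_right J_lin] _ Y])
      (simp_all add: D_mult_pure O.D_mult_pure J_core Rt_iota)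
qed (use Y in simp)

lemma J_one: "J \<one>\<^bsub>D\<^esub> = \<one>\<^bsub>O.D\<^esub>"
  by (simp add: OA.iota_one OB.iota_one)

end

context twist
begin
lemmas D_l_distr = D.l_distr[unfolded D_simps] and D_r_distr = D.r_distr[unfolded D_simps]
end

context calculus
begin

interpretation OT: Module.module k O.T by (rule O.mT)
interpretation TT: Module.module k T by (rule mT)

lemma q_p: "b \<in> carrier B \<Longrightarrow> a \<in> carrier A \<Longrightarrow> q b \<otimes>\<^bsub>O.D\<^esub> p a = J (rr b a)"
  by (simp add: O.R_eq_mult Rt_iota)

lemma q_P: "b \<in> carrier B \<Longrightarrow> a \<in> carrier A \<Longrightarrow> q b \<otimes>\<^bsub>O.D\<^esub> P a = d1 (rr b a)"
  by (simp add: O.R_eq_mult Rt_iota_dd)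

lemma Q_p: "b \<in> carrier B \<Longrightarrow> a \<in> carrier A \<Longrightarrow> Q b \<otimes>\<^bsub>O.D\<^esub> p a = d2 (rr b a)"
  by (simp add: O.R_eq_mult Rt_dd_iota)

text \<open>The product of a, Z and b' involves no twisting, so its Leibniz rule holds factor by
  factor in each algebra.\<close>

lemma dD_core:
  assumes [simp]: "a \<in> carrier A" "b' \<in> carrier B" and Z: "Z \<in> carrier T"
  shows "dD (core a b' Z) = P a \<otimes>\<^bsub>O.D\<^esub> (J Z \<otimes>\<^bsub>O.D\<^esub> q b') \<oplus>\<^bsub>O.T\<^esub>
    (p a \<otimes>\<^bsub>O.D\<^esub> (dD Z \<otimes>\<^bsub>O.D\<^esub> q b') \<oplus>\<^bsub>O.T\<^esub> p a \<otimes>\<^bsub>O.D\<^esub> (J Z \<otimes>\<^bsub>O.D\<^esub> Q b'))"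
proof (rule tensor_ext[OF mA mB O.mT lin_comp[OF dD_lin core_lin] _ _ Z])
  show "linear_map k T O.T (\<lambda>Z. P a \<otimes>\<^bsub>O.D\<^esub> (J Z \<otimes>\<^bsub>O.D\<^esub> q b') \<oplus>\<^bsub>O.T\<^esub>
    (p a \<otimes>\<^bsub>O.D\<^esub> (dD Z \<otimes>\<^bsub>O.D\<^esub> q b') \<oplus>\<^bsub>O.T\<^esub> p a \<otimes>\<^bsub>O.D\<^esub> (J Z \<otimes>\<^bsub>O.D\<^esub> Q b')))"
    by (intro lin_sum[OF O.mT] lin_comp[OF O.D_mult_lin_right] lin_comp[OF O.D_mult_lin_left] J_lin dD_lin) simp_all
  fix a1 b1 assume [simp]: "a1 \<in> carrier A" "b1 \<in> carrier B"
  show "dD (core a b' (a1 \<cdot> b1)) = P a \<otimes>\<^bsub>O.D\<^esub> (J (a1 \<cdot> b1) \<otimes>\<^bsub>O.D\<^esub> q b') \<oplus>\<^bsub>O.T\<^esub>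
    (p a \<otimes>\<^bsub>O.D\<^esub> (dD (a1 \<cdot> b1) \<otimes>\<^bsub>O.D\<^esub> q b') \<oplus>\<^bsub>O.T\<^esub> p a \<otimes>\<^bsub>O.D\<^esub> (J (a1 \<cdot> b1) \<otimes>\<^bsub>O.D\<^esub> Q b'))"
    by (simp add: dD_pure OA.dd_mult OB.dd_mult OA.iota_mult OB.iota_mult O.D_mult_simps O.D_l_distr O.D_r_distr
        lin_add[OF O.t_l[OF lin_id]] lin_add[OF O.t_r[OF lin_id]] OT.a_ac)
qed simp_all

text \<open>The product (a b) (a' b') is regrouped as a (b a') b'. The differential of the middle
  factor is b (d a') + (d b) a', because these two products are its A-part and its B-part.\<close>

lemma dD_mult_pure:
  assumes [simp]: "a \<in> carrier A" "b \<in> carrier B" "a' \<in> carrier A" "b' \<in> carrier B"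
  shows "dD ((a \<cdot> b) \<otimes>\<^bsub>D\<^esub> (a' \<cdot> b')) = dD (a \<cdot> b) \<otimes>\<^bsub>O.D\<^esub> J (a' \<cdot> b') \<oplus>\<^bsub>O.T\<^esub> J (a \<cdot> b) \<otimes>\<^bsub>O.D\<^esub> dD (a' \<cdot> b')"
proof -
  have J: "J (a \<cdot> b) = p a \<otimes>\<^bsub>O.D\<^esub> q b" and d: "dD (a \<cdot> b) = P a \<otimes>\<^bsub>O.D\<^esub> q b \<oplus>\<^bsub>O.T\<^esub> p a \<otimes>\<^bsub>O.D\<^esub> Q b"
    if "a \<in> carrier A" "b \<in> carrier B" for a b
    using that by (simp_all add: O.D_mult_simps dD_pure)
  have "dD ((a \<cdot> b) \<otimes>\<^bsub>D\<^esub> (a' \<cdot> b')) = P a \<otimes>\<^bsub>O.D\<^esub> (q b \<otimes>\<^bsub>O.D\<^esub> p a' \<otimes>\<^bsub>O.D\<^esub> q b') \<oplus>\<^bsub>O.T\<^esub>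
    (p a \<otimes>\<^bsub>O.D\<^esub> ((q b \<otimes>\<^bsub>O.D\<^esub> P a' \<oplus>\<^bsub>O.T\<^esub> Q b \<otimes>\<^bsub>O.D\<^esub> p a') \<otimes>\<^bsub>O.D\<^esub> q b') \<oplus>\<^bsub>O.T\<^esub> p a \<otimes>\<^bsub>O.D\<^esub> (q b \<otimes>\<^bsub>O.D\<^esub> p a' \<otimes>\<^bsub>O.D\<^esub> Q b'))"
    by (simp add: D_mult_pure dD_core q_p q_P Q_p dD_eq[of "rr b a'"])
  also have "\<dots> = (P a \<otimes>\<^bsub>O.D\<^esub> q b \<oplus>\<^bsub>O.T\<^esub> p a \<otimes>\<^bsub>O.D\<^esub> Q b) \<otimes>\<^bsub>O.D\<^esub> (p a' \<otimes>\<^bsub>O.D\<^esub> q b') \<oplus>\<^bsub>O.T\<^esub>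
     (p a \<otimes>\<^bsub>O.D\<^esub> q b) \<otimes>\<^bsub>O.D\<^esub> (P a' \<otimes>\<^bsub>O.D\<^esub> q b' \<oplus>\<^bsub>O.T\<^esub> p a' \<otimes>\<^bsub>O.D\<^esub> Q b')"
    by (simp add: O.D_l_distr O.D_r_distr O.D_assoc OT.a_ac del: O.D_mult_simps)
  finally show ?thesis by (simp only: J d assms)
qed

lemma dD_mult:
  assumes X: "X \<in> carrier T" and Y: "Y \<in> carrier T"
  shows "dD (X \<otimes>\<^bsub>D\<^esub> Y) = dD X \<otimes>\<^bsub>O.D\<^esub> J Y \<oplus>\<^bsub>O.T\<^esub> J X \<otimes>\<^bsub>O.D\<^esub> dD Y"
proof (rule tensor_ext[OF mA mB O.mT lin_comp[OF dD_lin D_mult_lin_left[OF Y]] _ _ X])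
  show "linear_map k T O.T (\<lambda>X. dD X \<otimes>\<^bsub>O.D\<^esub> J Y \<oplus>\<^bsub>O.T\<^esub> J X \<otimes>\<^bsub>O.D\<^esub> dD Y)"
    using Y by (intro lin_sum[OF O.mT] lin_comp[OF O.D_mult_lin_left] J_lin dD_lin) simp_all
  fix a b assume ab [simp]: "a \<in> carrier A" "b \<in> carrier B"
  show "dD ((a \<cdot> b) \<otimes>\<^bsub>D\<^esub> Y) = dD (a \<cdot> b) \<otimes>\<^bsub>O.D\<^esub> J Y \<oplus>\<^bsub>O.T\<^esub> J (a \<cdot> b) \<otimes>\<^bsub>O.D\<^esub> dD Y"
  proof (rule tensor_ext[OF mA mB O.mT _ _ _ Y])
    show "linear_map k T O.T (\<lambda>Y. dD ((a \<cdot> b) \<otimes>\<^bsub>D\<^esub> Y))"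
      by (rule lin_comp[OF dD_lin D_mult_lin_right]) simp
    show "linear_map k T O.T (\<lambda>Y. dD (a \<cdot> b) \<otimes>\<^bsub>O.D\<^esub> J Y \<oplus>\<^bsub>O.T\<^esub> J (a \<cdot> b) \<otimes>\<^bsub>O.D\<^esub> dD Y)"
      by (intro lin_sum[OF O.mT] lin_comp[OF O.D_mult_lin_right] J_lin dD_lin) (simp_all del: J_pure)
  qed (rule dD_mult_pure[OF ab])
qed

lemma deg1_eq: "dga_deg G 1 = adspan O.T {\<omega> \<bullet> \<eta> | \<omega> \<eta>. (\<omega> \<in> dga_deg OmA 0 \<and> \<eta> \<in> dga_deg OmB 1) \<or> (\<omega> \<in> dga_deg OmA 1 \<and> \<eta> \<in> dga_deg OmB 0)}"
proof -
  interpret TO: tens k OmA OmB "carrier k" "\<lambda>m c. c \<odot>\<^bsub>OmA\<^esub> m" "\<lambda>c n. c \<odot>\<^bsub>OmB\<^esub> n" O.T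
    by (rule tens_tensor[OF O.mA O.mB])
  let ?S = "\<Union>i \<in> {..1}. dga_deg OmA i \<times> dga_deg OmB (1 - i)"
  have "i = 0 \<or> i = 1" if "i \<le> 1" for i :: nat using that by auto
  then have S: "?S = dga_deg OmA 0 \<times> dga_deg OmB 1 \<union> dga_deg OmA 1 \<times> dga_deg OmB 0"
    by (fastforce simp: atMost_Suc One_nat_def)
  have "?S \<subseteq> carrier OmA \<times> carrier OmB" using OA.deg_carrier OB.deg_carrier by blast
  note TO.coset_image_adspan[OF this, folded tnull_def]
  moreover have "(\<lambda>p. coset (tnull k OmA OmB) (frag_of p)) ` ?S =
     {\<omega> \<bullet> \<eta> | \<omega> \<eta>. (\<omega> \<in> dga_deg OmA 0 \<and> \<eta> \<in> dga_deg OmB 1) \<or> (\<omega> \<in> dga_deg OmA 1 \<and> \<eta> \<in> dga_deg OmB 0)}"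
    unfolding S by (auto simp: tns_def image_iff)
  ultimately show ?thesis by simp
qed

text \<open>The span of all (d x) y, on which \<open>D\<close>-linear maps are easiest to test;
  \<open>dga_deg_eq\<close> shows that it is the whole component of degree 1.\<close>

abbreviation "dspan \<equiv> adspan O.T {dD X \<otimes>\<^bsub>O.D\<^esub> J Y | X Y. X \<in> carrier T \<and> Y \<in> carrier T}"

lemma dgen: "X \<in> carrier T \<Longrightarrow> Y \<in> carrier T \<Longrightarrow> dD X \<otimes>\<^bsub>O.D\<^esub> J Y \<in> dspan"
  by (rule adspan.gen) blast

lemma dspan_carrier: "X \<in> dspan \<Longrightarrow> X \<in> carrier O.T"
  by (rule adspan_carrier[OF OT.abelian_group_axioms, rotated]) auto

lemma D_diff_left: "X \<in> carrier O.T \<Longrightarrow> Y \<in> carrier O.T \<Longrightarrow> Z \<in> carrier O.T \<Longrightarrow>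
    X \<otimes>\<^bsub>O.D\<^esub> (Y \<ominus>\<^bsub>O.T\<^esub> Z) = X \<otimes>\<^bsub>O.D\<^esub> Y \<ominus>\<^bsub>O.T\<^esub> X \<otimes>\<^bsub>O.D\<^esub> Z"
  using lin_diff[OF O.mT O.mT O.D_mult_lin_right] by simp

lemma D_diff_right: "X \<in> carrier O.T \<Longrightarrow> Y \<in> carrier O.T \<Longrightarrow> Z \<in> carrier O.T \<Longrightarrow>
    (Y \<ominus>\<^bsub>O.T\<^esub> Z) \<otimes>\<^bsub>O.D\<^esub> X = Y \<otimes>\<^bsub>O.D\<^esub> X \<ominus>\<^bsub>O.T\<^esub> Z \<otimes>\<^bsub>O.D\<^esub> X"
  using lin_diff[OF O.mT O.mT O.D_mult_lin_left] by simp

lemma dspan_right: "X \<in> dspan \<Longrightarrow> Z \<in> carrier T \<Longrightarrow> X \<otimes>\<^bsub>O.D\<^esub> J Z \<in> dspan"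
proof (induction rule: adspan.induct)
  case zero
  then show ?case using lin_zero[OF O.mT O.mT O.D_mult_lin_left, of "J Z"] adspan.zero by simp
next
  case (gen W)
  then obtain X Y where W: "W = dD X \<otimes>\<^bsub>O.D\<^esub> J Y" "X \<in> carrier T" "Y \<in> carrier T" by blast
  then show ?case using dgen[of X "Y \<otimes>\<^bsub>D\<^esub> Z"] gen by (simp add: O.D_assoc J_mult)
next
  case (diff X Y)
  then show ?case by (simp add: D_diff_right dspan_carrier adspan.diff)
qed

text \<open>The Leibniz rule for z x, solved for z (d x) y.\<close>

lemma Leibniz_left:
  assumes "X \<in> carrier T" "Y \<in> carrier T" "Z \<in> carrier T"
  shows "J Z \<otimes>\<^bsub>O.D\<^esub> (dD X \<otimes>\<^bsub>O.D\<^esub> J Y) = dD (Z \<otimes>\<^bsub>D\<^esub> X) \<otimes>\<^bsub>O.D\<^esub> J Y \<ominus>\<^bsub>O.T\<^esub> dD Z \<otimes>\<^bsub>O.D\<^esub> J (X \<otimes>\<^bsub>D\<^esub> Y)"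
proof -
  have r: "x \<oplus>\<^bsub>O.T\<^esub> y \<ominus>\<^bsub>O.T\<^esub> x = y" if "x \<in> carrier O.T" "y \<in> carrier O.T" for x y
    using that by (simp add: OT.minus_eq OT.a_comm[of x y] OT.a_assoc OT.r_neg)
  show ?thesis using assms by (simp add: dD_mult O.D_l_distr J_mult O.D_assoc r)
qed

lemma dspan_left: "X \<in> dspan \<Longrightarrow> Z \<in> carrier T \<Longrightarrow> J Z \<otimes>\<^bsub>O.D\<^esub> X \<in> dspan"
proof (induction rule: adspan.induct)
  case zero
  then show ?case using lin_zero[OF O.mT O.mT O.D_mult_lin_right, of "J Z"] adspan.zero by simp
next
  case (gen W)
  then obtain X Y where W: "W = dD X \<otimes>\<^bsub>O.D\<^esub> J Y" "X \<in> carrier T" "Y \<in> carrier T" by blast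
  then show ?case using gen by (simp add: Leibniz_left adspan.diff dgen)
next
  case (diff X Y)
  then show ?case by (simp add: D_diff_left dspan_carrier adspan.diff)
qed

lemma dD_a: "a \<in> carrier A \<Longrightarrow> dD (a \<cdot> \<one>\<^bsub>B\<^esub>) = P a"
proof -
  assume a: "a \<in> carrier A"
  have "\<iota>A a \<bullet> \<zero>\<^bsub>OmB\<^esub> = \<zero>\<^bsub>O.T\<^esub>"
    using lin_zero[OF O.mB O.mT O.t_r[OF lin_id]] a by simp
  then show ?thesis using a by (simp add: dD_pure OB.dd_one OB.iota_one)
qed

lemma dD_b: "b \<in> carrier B \<Longrightarrow> dD (\<one>\<^bsub>A\<^esub> \<cdot> b) = Q b"
proof -
  assume b: "b \<in> carrier B"
  have "\<zero>\<^bsub>OmA\<^esub> \<bullet> \<iota>B b = \<zero>\<^bsub>O.T\<^esub>"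
    using lin_zero[OF O.mA O.mT O.t_l[OF lin_id]] b by simp
  then show ?thesis using b by (simp add: dD_pure OA.dd_one OA.iota_one)
qed

text \<open>Degree 1 is additively exhausted by a (d b) b' and (d a) a' b. The second is visibly of
  the form (d x) y, and the first is a left multiple of such a form.\<close>

lemma dga_deg_subset: "dga_deg G 1 \<subseteq> dspan"
proof
  fix W assume "W \<in> dga_deg G 1"
  then show "W \<in> dspan" unfolding deg1_eq
  proof (rule adspan_mono)
    fix y assume "y \<in> {\<omega> \<bullet> \<eta> | \<omega> \<eta>. (\<omega> \<in> dga_deg OmA 0 \<and> \<eta> \<in> dga_deg OmB 1) \<or> (\<omega> \<in> dga_deg OmA 1 \<and> \<eta> \<in> dga_deg OmB 0)}"
    then obtain \<omega> \<eta> where y: "y = \<omega> \<bullet> \<eta>"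
      "(\<omega> \<in> dga_deg OmA 0 \<and> \<eta> \<in> dga_deg OmB 1) \<or> (\<omega> \<in> dga_deg OmA 1 \<and> \<eta> \<in> dga_deg OmB 0)" by blast
    from y(2) show "y \<in> dspan"
    proof
      assume h: "\<omega> \<in> dga_deg OmA 0 \<and> \<eta> \<in> dga_deg OmB 1"
      then obtain a where a [simp]: "a \<in> carrier A" "\<omega> = \<iota>A a" unfolding OA.deg0 by blast
      from h have "\<eta> \<in> dga_deg OmB 1" by simp
      then show ?thesis unfolding y(1)
      proof (induction rule: OB.deg1_induct)
        case zero
        then show ?case using lin_zero[OF O.mB O.mT O.t_r[OF lin_id]] adspan.zero by simp
      next
        case (gen b b')
        have "J (a \<cdot> \<one>\<^bsub>B\<^esub>) \<otimes>\<^bsub>O.D\<^esub> (dD (\<one>\<^bsub>A\<^esub> \<cdot> b) \<otimes>\<^bsub>O.D\<^esub> J (\<one>\<^bsub>A\<^esub> \<cdot> b')) \<in> dspan"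
          using gen by (intro dspan_left dgen) simp_all
        then show ?case using gen by (simp add: dD_b O.D_mult_simps OA.iota_one OB.iota_one)
      next
        case (diff X Y)
        then have "X \<in> carrier OmB" "Y \<in> carrier OmB" using OB.deg_carrier by blast+
        then show ?case using diff lin_diff[OF O.mB O.mT O.t_r[OF lin_id]] by (simp add: adspan.diff)
      qed
    next
      assume h: "\<omega> \<in> dga_deg OmA 1 \<and> \<eta> \<in> dga_deg OmB 0"
      then obtain b where b [simp]: "b \<in> carrier B" "\<eta> = \<iota>B b" unfolding OB.deg0 by blast
      from h have "\<omega> \<in> dga_deg OmA 1" by simp
      then show ?thesis unfolding y(1)
      proof (induction rule: OA.deg1_induct)
        case zero
        then show ?case using lin_zero[OF O.mA O.mT O.t_l[OF lin_id]] adspan.zero by simp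
      next
        case (gen a a')
        have "dD (a \<cdot> \<one>\<^bsub>B\<^esub>) \<otimes>\<^bsub>O.D\<^esub> J (a' \<cdot> b) \<in> dspan"
          using gen by (intro dgen) simp_all
        then show ?case using gen by (simp add: dD_a O.D_mult_simps)
      next
        case (diff X Y)
        then have "X \<in> carrier OmA" "Y \<in> carrier OmA" using OA.deg_carrier by blast+
        then show ?case using diff lin_diff[OF O.mA O.mT O.t_l[OF lin_id]] by (simp add: adspan.diff)
      qed
    qed
  qed
qed

lemma deg1_pure_A: "\<omega> \<in> dga_deg OmA 1 \<Longrightarrow> b \<in> carrier B \<Longrightarrow> \<omega> \<bullet> \<iota>B b \<in> dga_deg G 1"
  unfolding deg1_eq using OB.iota_deg by (intro adspan.gen) blast

lemma deg1_pure_B: "\<eta> \<in> dga_deg OmB 1 \<Longrightarrow> a \<in> carrier A \<Longrightarrow> \<iota>A a \<bullet> \<eta> \<in> dga_deg G 1"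
  unfolding deg1_eq using OA.iota_deg by (intro adspan.gen) blast

lemma dga_deg_diff: "X \<in> dga_deg G 1 \<Longrightarrow> Y \<in> dga_deg G 1 \<Longrightarrow> X \<ominus>\<^bsub>O.T\<^esub> Y \<in> dga_deg G 1"
  unfolding deg1_eq by (rule adspan.diff)

lemma dga_deg_add: assumes "X \<in> dga_deg G 1" "Y \<in> dga_deg G 1" shows "X \<oplus>\<^bsub>O.T\<^esub> Y \<in> dga_deg G 1"
proof -
  have c: "X \<in> carrier O.T" "Y \<in> carrier O.T" using assms dga_deg_subset dspan_carrier by blast+
  have "\<zero>\<^bsub>O.T\<^esub> \<in> dga_deg G 1" unfolding deg1_eq by (rule adspan.zero)
  then have "X \<ominus>\<^bsub>O.T\<^esub> (\<zero>\<^bsub>O.T\<^esub> \<ominus>\<^bsub>O.T\<^esub> Y) \<in> dga_deg G 1" using assms dga_deg_diff by blast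
  then show ?thesis using c by (simp add: OT.minus_eq)
qed

lemma d1_mult_deg:
  assumes [simp]: "a \<in> carrier A" "b' \<in> carrier B" and Z: "Z \<in> carrier T"
  shows "P a \<otimes>\<^bsub>O.D\<^esub> (J Z \<otimes>\<^bsub>O.D\<^esub> q b') \<in> dga_deg G 1"
  using Z
proof (induction rule: tensor_induct[OF mA mB, consumes 1, case_names pure diff])
  case (pure a1 b1)
  then show ?case using deg1_pure_A[OF OA.deg_mult[OF OA.dd_deg OA.iota_deg, unfolded add_0_right], of a a1 "b1 \<otimes>\<^bsub>B\<^esub> b'"]
    by (simp add: O.D_mult_simps OB.iota_mult del: G_simps)
next
  case (diff X Y)
  then show ?case
    by (simp add: lin_diff[OF mT O.mT J_lin] D_diff_left D_diff_right dga_deg_diff del: G_simps)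
qed

lemma d2_mult_deg:
  assumes [simp]: "a \<in> carrier A" "b' \<in> carrier B" and Z: "Z \<in> carrier T"
  shows "p a \<otimes>\<^bsub>O.D\<^esub> (d2 Z \<otimes>\<^bsub>O.D\<^esub> q b') \<in> dga_deg G 1"
  using Z
proof (induction rule: tensor_induct[OF mA mB, consumes 1, case_names pure diff])
  case (pure a1 b1)
  then show ?case using deg1_pure_B[OF OB.deg_mult[OF OB.dd_deg OB.iota_deg, unfolded add_0_right], of b1 b' "a \<otimes>\<^bsub>A\<^esub> a1"]
    by (simp add: O.D_mult_simps OA.iota_mult del: G_simps)
next
  case (diff X Y)
  then show ?case
    by (simp add: lin_diff[OF mT O.mT d2_lin] D_diff_left D_diff_right dga_deg_diff del: G_simps)
qed

text \<open>Moving b and d b past a' with \<open>R\<close> restores the order A before B, in which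
  the degrees of the two factors are visible.\<close>

lemma dD_J_deg:
  assumes X: "X \<in> carrier T" and Y: "Y \<in> carrier T"
  shows "dD X \<otimes>\<^bsub>O.D\<^esub> J Y \<in> dga_deg G 1"
  using X
proof (induction rule: tensor_induct[OF mA mB, consumes 1, case_names pure diff])
  case (pure a b)
  note ab [simp] = pure
  show ?case using Y
  proof (induction rule: tensor_induct[OF mA mB, consumes 1, case_names pure diff])
    case (pure a' b')
    note ab' [simp] = pure
    have "dD (a \<cdot> b) \<otimes>\<^bsub>O.D\<^esub> J (a' \<cdot> b') = (P a \<otimes>\<^bsub>O.D\<^esub> q b \<oplus>\<^bsub>O.T\<^esub> p a \<otimes>\<^bsub>O.D\<^esub> Q b) \<otimes>\<^bsub>O.D\<^esub> (p a' \<otimes>\<^bsub>O.D\<^esub> q b')"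
      by (simp add: O.D_mult_simps dD_pure)
    also have "\<dots> = P a \<otimes>\<^bsub>O.D\<^esub> ((q b \<otimes>\<^bsub>O.D\<^esub> p a') \<otimes>\<^bsub>O.D\<^esub> q b') \<oplus>\<^bsub>O.T\<^esub> p a \<otimes>\<^bsub>O.D\<^esub> ((Q b \<otimes>\<^bsub>O.D\<^esub> p a') \<otimes>\<^bsub>O.D\<^esub> q b')"
      by (simp add: O.D_l_distr O.D_assoc)
    also have "\<dots> = P a \<otimes>\<^bsub>O.D\<^esub> (J (rr b a') \<otimes>\<^bsub>O.D\<^esub> q b') \<oplus>\<^bsub>O.T\<^esub> p a \<otimes>\<^bsub>O.D\<^esub> (d2 (rr b a') \<otimes>\<^bsub>O.D\<^esub> q b')"
      by (simp add: q_p Q_p)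
    also have "\<dots> \<in> dga_deg G 1" by (intro dga_deg_add d1_mult_deg d2_mult_deg) simp_all
    finally show ?case .
  next
    case (diff X Y)
    then show ?case
      by (simp add: lin_diff[OF mT O.mT J_lin] D_diff_left dga_deg_diff del: G_simps)
  qed
next
  case (diff X X')
  then show ?case using Y
    by (simp add: lin_diff[OF mT O.mT dD_lin] D_diff_right dga_deg_diff del: G_simps)
qed

lemma dga_deg_eq: "dga_deg G 1 = dspan"
proof
  show "dspan \<subseteq> dga_deg G 1"
  proof
    fix x assume "x \<in> dspan"
    then show "x \<in> dga_deg G 1"
      unfolding deg1_eq by (rule adspan_mono) (use dD_J_deg[unfolded deg1_eq] in blast)
  qed
qed (rule dga_deg_subset)

lemma Om_bimodule: "bimodule k D Om"
proof (rule one_forms_bimodule[OF G_algebra D_algebra])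
  show "linear_map k D G J" using J_lin by (simp add: linear_map_def)
  show "dga_deg G 1 \<subseteq> carrier G" unfolding dga_deg_eq using dspan_carrier by auto
  show "\<zero>\<^bsub>G\<^esub> \<in> dga_deg G 1" unfolding dga_deg_eq using adspan.zero[of O.T] by simp
  \<comment> \<open>Subtraction depends only on the additive fields, in which the two records
    agree.\<close>
  have m: "X \<ominus>\<^bsub>G\<^esub> Y = X \<ominus>\<^bsub>O.T\<^esub> Y" for X Y by (simp add: a_minus_def a_inv_def m_inv_def)
  show "X \<ominus>\<^bsub>G\<^esub> Y \<in> dga_deg G 1" if "X \<in> dga_deg G 1" "Y \<in> dga_deg G 1" for X Y
    unfolding m using that by (rule dga_deg_diff)
  show "J x \<otimes>\<^bsub>G\<^esub> X \<in> dga_deg G 1" if "x \<in> carrier D" "X \<in> dga_deg G 1" for x X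
    using that dspan_left unfolding dga_deg_eq by simp
  show "X \<otimes>\<^bsub>G\<^esub> J x \<in> dga_deg G 1" if "x \<in> carrier D" "X \<in> dga_deg G 1" for x X
    using that dspan_right unfolding dga_deg_eq by simp
qed (simp_all add: J_mult J_one[unfolded D_simps O.D_simps] del: J_pure)

end

section \<open>The twisting map on functions and one-forms\<close>

context calculus
begin

interpretation OT: Module.module k O.T by (rule O.mT)

abbreviation "OmA1 \<equiv> Omega1 k A"
abbreviation "OmB1 \<equiv> Omega1 k B"

lemmas mOA1 = bm_module[OF OA.Omega1_bimodule] and mOB1 = bm_module[OF OB.Omega1_bimodule]

lemma deg1_A [simp]: "\<omega> \<in> dga_deg OmA 1 \<Longrightarrow> \<omega> \<in> carrier OmA" using OA.deg_carrier by blast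
lemma deg1_B [simp]: "\<omega> \<in> dga_deg OmB 1 \<Longrightarrow> \<omega> \<in> carrier OmB" using OB.deg_carrier by blast

lemma deg1_closed [simp]:
  "\<omega> \<in> dga_deg OmA 1 \<Longrightarrow> a \<in> carrier A \<Longrightarrow> \<iota>A a \<otimes>\<^bsub>OmA\<^esub> \<omega> \<in> dga_deg OmA 1"
  "\<omega> \<in> dga_deg OmA 1 \<Longrightarrow> a \<in> carrier A \<Longrightarrow> \<omega> \<otimes>\<^bsub>OmA\<^esub> \<iota>A a \<in> dga_deg OmA 1"
  "\<eta> \<in> dga_deg OmB 1 \<Longrightarrow> b \<in> carrier B \<Longrightarrow> \<iota>B b \<otimes>\<^bsub>OmB\<^esub> \<eta> \<in> dga_deg OmB 1"
  "\<eta> \<in> dga_deg OmB 1 \<Longrightarrow> b \<in> carrier B \<Longrightarrow> \<eta> \<otimes>\<^bsub>OmB\<^esub> \<iota>B b \<in> dga_deg OmB 1"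
  using bm_lact_closed[OF OA.Omega1_bimodule] bm_ract_closed[OF OA.Omega1_bimodule]
    bm_lact_closed[OF OB.Omega1_bimodule] bm_ract_closed[OF OB.Omega1_bimodule] by simp_all

lemma incA: "linear_map k OmA1 OmA (\<lambda>x. x)" and incB: "linear_map k OmB1 OmB (\<lambda>x. x)"
  by (auto intro!: linI)

abbreviation "TL \<equiv> tensor k OmA1 B"
abbreviation "TR \<equiv> tensor k A OmB1"

lemmas mTL = tensor_module[OF mOA1 mB] and mTR = tensor_module[OF mA mOB1]

text \<open>\<open>hl\<close> and \<open>hr\<close> map the two summands of the one-forms into the
  full tensor product, \<open>pl\<close> and \<open>pr\<close> lead back. The conditions on the
  connections are stated in the summands, while products are formed in the full calculus.\<close>

definition "hl X = tbind O.T X (\<lambda>\<omega> b. \<omega> \<bullet> \<iota>B b)"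
definition "hr X = tbind O.T X (\<lambda>a \<eta>. \<iota>A a \<bullet> \<eta>)"
definition "pl X = tbind TL X (\<lambda>\<omega> \<eta>. tns k OmA1 B (Omega_proj k A 1 \<omega>) (Omega_base k B \<eta>))"
definition "pr X = tbind TR X (\<lambda>\<omega> \<eta>. tns k A OmB1 (Omega_base k A \<omega>) (Omega_proj k B 1 \<eta>))"

lemma hl_bil: "bil k OmA1 B O.T (\<lambda>\<omega> b. \<omega> \<bullet> \<iota>B b)"
  by (intro bilI O.t_l O.t_r incA OB.iota_lin) simp_all
lemma hr_bil: "bil k A OmB1 O.T (\<lambda>a \<eta>. \<iota>A a \<bullet> \<eta>)"
  by (intro bilI O.t_l O.t_r incB OA.iota_lin) simp_all

lemma hl_lin: "linear_map k TL O.T hl" unfolding hl_def by (rule tbind_lin[OF mOA1 mB O.mT hl_bil])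
lemma hr_lin: "linear_map k TR O.T hr" unfolding hr_def by (rule tbind_lin[OF mA mOB1 O.mT hr_bil])

lemma hl_pure: "\<omega> \<in> dga_deg OmA 1 \<Longrightarrow> b \<in> carrier B \<Longrightarrow> hl (tns k OmA1 B \<omega> b) = \<omega> \<bullet> \<iota>B b"
  unfolding hl_def by (rule tbind_pure[OF mOA1 mB O.mT hl_bil]) simp_all
lemma hr_pure: "a \<in> carrier A \<Longrightarrow> \<eta> \<in> dga_deg OmB 1 \<Longrightarrow> hr (tns k A OmB1 a \<eta>) = \<iota>A a \<bullet> \<eta>"
  unfolding hr_def by (rule tbind_pure[OF mA mOB1 O.mT hr_bil]) simp_all

lemma proj1_lin': "linear_map k OmA OmA1 (Omega_proj k A 1)" "linear_map k OmB OmB1 (Omega_proj k B 1)"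
  using OA.proj1_lin OA.proj1_deg OB.proj1_lin OB.proj1_deg by (auto simp: linear_map_def)

lemma pl_bil: "bil k OmA OmB TL (\<lambda>\<omega> \<eta>. tns k OmA1 B (Omega_proj k A 1 \<omega>) (Omega_base k B \<eta>))"
  by (intro bilI bil_l[OF tns_bil[OF mOA1 mB]] bil_r[OF tns_bil[OF mOA1 mB]] proj1_lin' OB.base_lin)
    (simp_all add: OB.base_closed OA.proj1_deg)
lemma pr_bil: "bil k OmA OmB TR (\<lambda>\<omega> \<eta>. tns k A OmB1 (Omega_base k A \<omega>) (Omega_proj k B 1 \<eta>))"
  by (intro bilI bil_l[OF tns_bil[OF mA mOB1]] bil_r[OF tns_bil[OF mA mOB1]] proj1_lin' OA.base_lin)
    (simp_all add: OA.base_closed OB.proj1_deg)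

lemma pl_lin: "linear_map k O.T TL pl" unfolding pl_def by (rule tbind_lin[OF O.mA O.mB mTL pl_bil])
lemma pr_lin: "linear_map k O.T TR pr" unfolding pr_def by (rule tbind_lin[OF O.mA O.mB mTR pr_bil])

lemma pl_pure: "\<omega> \<in> dga_deg OmA 1 \<Longrightarrow> b \<in> carrier B \<Longrightarrow> pl (\<omega> \<bullet> \<iota>B b) = tns k OmA1 B \<omega> b"
  unfolding pl_def by (subst tbind_pure[OF O.mA O.mB mTL pl_bil]) (simp_all add: OA.proj1_id OB.base_iota)
lemma pr_pure: "a \<in> carrier A \<Longrightarrow> \<eta> \<in> dga_deg OmB 1 \<Longrightarrow> pr (\<iota>A a \<bullet> \<eta>) = tns k A OmB1 a \<eta>"
  unfolding pr_def by (subst tbind_pure[OF O.mA O.mB mTR pr_bil]) (simp_all add: OB.proj1_id OA.base_iota)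

lemma Rt_left_eq: "\<omega> \<in> carrier OmA \<Longrightarrow> b \<in> carrier B \<Longrightarrow> Rt_left k A B Rt b \<omega> = pl (q b \<otimes>\<^bsub>O.D\<^esub> (\<omega> \<bullet> \<one>\<^bsub>OmB\<^esub>))"
  by (simp add: Rt_left_def pl_def O.R_eq_mult)
lemma Rt_right_eq: "\<eta> \<in> carrier OmB \<Longrightarrow> a \<in> carrier A \<Longrightarrow> Rt_right k A B Rt \<eta> a = pr ((\<one>\<^bsub>OmA\<^esub> \<bullet> \<eta>) \<otimes>\<^bsub>O.D\<^esub> p a)"
  by (simp add: Rt_right_def pr_def O.R_eq_mult)

abbreviation "spanL \<equiv> adspan O.T {\<omega> \<bullet> \<iota>B b | \<omega> b. \<omega> \<in> dga_deg OmA 1 \<and> b \<in> carrier B}"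
abbreviation "spanR \<equiv> adspan O.T {\<iota>A a \<bullet> \<eta> | a \<eta>. a \<in> carrier A \<and> \<eta> \<in> dga_deg OmB 1}"

lemma spanL_gen: "\<omega> \<in> dga_deg OmA 1 \<Longrightarrow> b \<in> carrier B \<Longrightarrow> \<omega> \<bullet> \<iota>B b \<in> spanL"
  by (rule adspan.gen) blast
lemma spanR_gen: "a \<in> carrier A \<Longrightarrow> \<eta> \<in> dga_deg OmB 1 \<Longrightarrow> \<iota>A a \<bullet> \<eta> \<in> spanR"
  by (rule adspan.gen) blast

lemmas T_induct = tensor_induct[OF mA mB, consumes 1, case_names pure diff]
lemmas dd_iota_deg = OA.deg_mult[OF OA.dd_deg OA.iota_deg, unfolded add_0_right]
  OB.deg_mult[OF OB.dd_deg OB.iota_deg, unfolded add_0_right]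

lemma PJ_span:
  assumes [simp]: "a \<in> carrier A" and Z: "Z \<in> carrier T" shows "P a \<otimes>\<^bsub>O.D\<^esub> J Z \<in> spanL"
  using Z
proof (induction rule: T_induct)
  case (pure a1 b1)
  then show ?case using spanL_gen[OF dd_iota_deg(1)] by (simp add: O.D_mult_simps)
next
  case (diff X Y) then show ?case by (simp add: lin_diff[OF mT O.mT J_lin] D_diff_left adspan.diff)
qed

lemma d1p_span:
  assumes [simp]: "a \<in> carrier A" and Z: "Z \<in> carrier T" shows "d1 Z \<otimes>\<^bsub>O.D\<^esub> p a \<in> spanL"
  using Z
proof (induction rule: T_induct)
  case (pure a1 b1)
  then have "d1 (a1 \<cdot> b1) \<otimes>\<^bsub>O.D\<^esub> p a = P a1 \<otimes>\<^bsub>O.D\<^esub> (q b1 \<otimes>\<^bsub>O.D\<^esub> p a)"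
    by (subst O.D_assoc[symmetric]) (simp_all add: O.D_mult_simps)
  then show ?case using pure PJ_span by (simp add: q_p)
next
  case (diff X Y) then show ?case by (simp add: lin_diff[OF mT O.mT d1_lin] D_diff_right adspan.diff)
qed

text \<open>The bidegree is preserved because b (d a) is the A-part of d(b a), so projecting b
  \<omega> to the summand \<Omega>^1 A \<otimes> B loses nothing.\<close>

lemma q_omega_span:
  assumes b [simp]: "b \<in> carrier B" and "\<omega> \<in> dga_deg OmA 1"
  shows "q b \<otimes>\<^bsub>O.D\<^esub> (\<omega> \<bullet> \<one>\<^bsub>OmB\<^esub>) \<in> spanL"
  using assms(2)
proof (induction rule: OA.deg1_induct)
  have l: "linear_map k OmA O.T (\<lambda>\<omega>. q b \<otimes>\<^bsub>O.D\<^esub> (\<omega> \<bullet> \<one>\<^bsub>OmB\<^esub>))"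
    by (intro lin_comp[OF O.D_mult_lin_right] O.t_l lin_id) simp_all
  { case zero show ?case using lin_zero[OF O.mA O.mT l] adspan.zero by simp }
  { case (gen a a')
    then have "q b \<otimes>\<^bsub>O.D\<^esub> ((OA.dd a \<otimes>\<^bsub>OmA\<^esub> \<iota>A a') \<bullet> \<one>\<^bsub>OmB\<^esub>) = q b \<otimes>\<^bsub>O.D\<^esub> P a \<otimes>\<^bsub>O.D\<^esub> p a'"
      by (subst O.D_assoc) (simp_all add: O.D_mult_simps)
    then show ?case using gen d1p_span by (simp add: q_P) }
  { case (diff X Y)
    then show ?case using lin_diff[OF O.mA O.mT l] by (simp add: adspan.diff) }
qed

lemma d2q_span:
  assumes [simp]: "b \<in> carrier B" and Z: "Z \<in> carrier T" shows "d2 Z \<otimes>\<^bsub>O.D\<^esub> q b \<in> spanR"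
  using Z
proof (induction rule: T_induct)
  case (pure a1 b1)
  then show ?case using spanR_gen[OF _ dd_iota_deg(2)] by (simp add: O.D_mult_simps)
next
  case (diff X Y) then show ?case by (simp add: lin_diff[OF mT O.mT d2_lin] D_diff_right adspan.diff)
qed

lemma QJ_span:
  assumes [simp]: "b \<in> carrier B" and Z: "Z \<in> carrier T" shows "Q b \<otimes>\<^bsub>O.D\<^esub> J Z \<in> spanR"
  using Z
proof (induction rule: T_induct)
  case (pure a1 b1)
  then have "Q b \<otimes>\<^bsub>O.D\<^esub> J (a1 \<cdot> b1) = Q b \<otimes>\<^bsub>O.D\<^esub> p a1 \<otimes>\<^bsub>O.D\<^esub> q b1"
    by (subst O.D_assoc) (simp_all add: O.D_mult_simps)
  then show ?case using pure d2q_span by (simp add: Q_p)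
next
  case (diff X Y) then show ?case by (simp add: lin_diff[OF mT O.mT J_lin] D_diff_left adspan.diff)
qed

text \<open>Here b' in (d b) b' a is first moved past a with \<open>R\<close>; only then does d b
  meet a function of \<open>A\<close>, and the product is a B-part again.\<close>

lemma eta_p_span:
  assumes a [simp]: "a \<in> carrier A" and "\<eta> \<in> dga_deg OmB 1"
  shows "(\<one>\<^bsub>OmA\<^esub> \<bullet> \<eta>) \<otimes>\<^bsub>O.D\<^esub> p a \<in> spanR"
  using assms(2)
proof (induction rule: OB.deg1_induct)
  have l: "linear_map k OmB O.T (\<lambda>\<eta>. (\<one>\<^bsub>OmA\<^esub> \<bullet> \<eta>) \<otimes>\<^bsub>O.D\<^esub> p a)"
    by (intro lin_comp[OF O.D_mult_lin_left] O.t_r lin_id) simp_all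
  { case zero show ?case using lin_zero[OF O.mB O.mT l] adspan.zero by simp }
  { case (gen b b')
    then have "(\<one>\<^bsub>OmA\<^esub> \<bullet> (OB.dd b \<otimes>\<^bsub>OmB\<^esub> \<iota>B b')) \<otimes>\<^bsub>O.D\<^esub> p a = Q b \<otimes>\<^bsub>O.D\<^esub> (q b' \<otimes>\<^bsub>O.D\<^esub> p a)"
      by (subst O.D_assoc[symmetric]) (simp_all add: O.D_mult_simps)
    then show ?case using gen QJ_span by (simp add: q_p) }
  { case (diff X Y)
    then show ?case using lin_diff[OF O.mB O.mT l] by (simp add: adspan.diff) }
qed

lemma spanL_carrier: "{\<omega> \<bullet> \<iota>B b | \<omega> b. \<omega> \<in> dga_deg OmA 1 \<and> b \<in> carrier B} \<subseteq> carrier O.T" by auto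
lemma spanR_carrier: "{\<iota>A a \<bullet> \<eta> | a \<eta>. a \<in> carrier A \<and> \<eta> \<in> dga_deg OmB 1} \<subseteq> carrier O.T" by auto

lemma hl_pl: "X \<in> spanL \<Longrightarrow> hl (pl X) = X"
  by (rule adspan_induct_lin[OF _ O.mT O.mT lin_comp[OF hl_lin pl_lin] lin_id spanL_carrier])
    (auto simp only: mem_Collect_eq pl_pure hl_pure)
lemma hr_pr: "X \<in> spanR \<Longrightarrow> hr (pr X) = X"
  by (rule adspan_induct_lin[OF _ O.mT O.mT lin_comp[OF hr_lin pr_lin] lin_id spanR_carrier])
    (auto simp only: mem_Collect_eq pr_pure hr_pure)

lemma Rt_left_closed: "\<omega> \<in> dga_deg OmA 1 \<Longrightarrow> b \<in> carrier B \<Longrightarrow> Rt_left k A B Rt b \<omega> \<in> carrier TL"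
  by (simp add: Rt_left_eq lin_closed[OF pl_lin])
lemma Rt_right_closed: "\<eta> \<in> dga_deg OmB 1 \<Longrightarrow> a \<in> carrier A \<Longrightarrow> Rt_right k A B Rt \<eta> a \<in> carrier TR"
  by (simp add: Rt_right_eq lin_closed[OF pr_lin])

text \<open>Since b \<omega> already lies in the summand, projecting and embedding again gives it
  back. The restricted twisting map is thus nothing but a product in the calculus.\<close>

lemma hl_Rt_left: "\<omega> \<in> dga_deg OmA 1 \<Longrightarrow> b \<in> carrier B \<Longrightarrow> hl (Rt_left k A B Rt b \<omega>) = q b \<otimes>\<^bsub>O.D\<^esub> (\<omega> \<bullet> \<one>\<^bsub>OmB\<^esub>)"
  by (simp add: Rt_left_eq hl_pl q_omega_span)
lemma hr_Rt_right: "\<eta> \<in> dga_deg OmB 1 \<Longrightarrow> a \<in> carrier A \<Longrightarrow> hr (Rt_right k A B Rt \<eta> a) = (\<one>\<^bsub>OmA\<^esub> \<bullet> \<eta>) \<otimes>\<^bsub>O.D\<^esub> p a"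
  by (simp add: Rt_right_eq hr_pr eta_p_span)

lemma Rt_left_bil: "bil k B OmA1 TL (Rt_left k A B Rt)"
proof (intro bilI)
  fix b assume [simp]: "b \<in> carrier B"
  have "linear_map k OmA1 TL (\<lambda>\<omega>. pl (q b \<otimes>\<^bsub>O.D\<^esub> (\<omega> \<bullet> \<one>\<^bsub>OmB\<^esub>)))"
    by (intro lin_comp[OF pl_lin] lin_comp[OF O.D_mult_lin_right] O.t_l incA) simp_all
  then show "linear_map k OmA1 TL (Rt_left k A B Rt b)"
    by (rule lin_cong[OF _ mOA1]) (simp add: Rt_left_eq)
next
  fix \<omega> assume [simp]: "\<omega> \<in> carrier OmA1"
  have "linear_map k B TL (\<lambda>b. pl (q b \<otimes>\<^bsub>O.D\<^esub> (\<omega> \<bullet> \<one>\<^bsub>OmB\<^esub>)))"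
    by (intro lin_comp[OF pl_lin] lin_comp[OF O.D_mult_lin_left] O.t_r OB.iota_lin)
      (use \<open>\<omega> \<in> carrier OmA1\<close> in simp_all)
  then show "linear_map k B TL (\<lambda>b. Rt_left k A B Rt b \<omega>)"
    by (rule lin_cong[OF _ mB]) (use \<open>\<omega> \<in> carrier OmA1\<close> in \<open>simp add: Rt_left_eq\<close>)
qed

lemma Rt_right_bil: "bil k OmB1 A TR (Rt_right k A B Rt)"
proof (intro bilI)
  fix a assume [simp]: "a \<in> carrier A"
  have "linear_map k OmB1 TR (\<lambda>\<eta>. pr ((\<one>\<^bsub>OmA\<^esub> \<bullet> \<eta>) \<otimes>\<^bsub>O.D\<^esub> p a))"
    by (intro lin_comp[OF pr_lin] lin_comp[OF O.D_mult_lin_left] O.t_r incB) simp_all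
  then show "linear_map k OmB1 TR (\<lambda>\<eta>. Rt_right k A B Rt \<eta> a)"
    by (rule lin_cong[OF _ mOB1]) (simp add: Rt_right_eq)
next
  fix \<eta> assume e: "\<eta> \<in> carrier OmB1"
  have "linear_map k A TR (\<lambda>a. pr ((\<one>\<^bsub>OmA\<^esub> \<bullet> \<eta>) \<otimes>\<^bsub>O.D\<^esub> p a))"
    by (intro lin_comp[OF pr_lin] lin_comp[OF O.D_mult_lin_right] O.t_l OA.iota_lin)
      (use e in simp_all)
  then show "linear_map k A TR (Rt_right k A B Rt \<eta>)"
    by (rule lin_cong[OF _ mA]) (use e in \<open>simp add: Rt_right_eq\<close>)
qed

text \<open>Left multiplication by functions, transported to the summands: by a on \<Omega>^1 A
  \<otimes> B without twisting, by b on A \<otimes> \<Omega>^1 B after b has been moved past the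
  first factor.\<close>

definition "mulL a Z = tbind TL Z (\<lambda>\<omega> b. tns k OmA1 B (\<iota>A a \<otimes>\<^bsub>OmA\<^esub> \<omega>) b)"
definition "mulR b Z = tbind TR Z (\<lambda>a \<eta>. tbind TR (rr b a) (\<lambda>a' b'. tns k A OmB1 a' (\<iota>B b' \<otimes>\<^bsub>OmB\<^esub> \<eta>)))"

lemma lactA: "a \<in> carrier A \<Longrightarrow> linear_map k U OmA1 g \<Longrightarrow> linear_map k U OmA1 (\<lambda>u. \<iota>A a \<otimes>\<^bsub>OmA\<^esub> g u)"
  using bil_r[OF lact_bil[OF OA.Omega1_bimodule], of U g a] by simp
lemma lactA': "\<omega> \<in> dga_deg OmA 1 \<Longrightarrow> linear_map k U A g \<Longrightarrow> linear_map k U OmA1 (\<lambda>u. \<iota>A (g u) \<otimes>\<^bsub>OmA\<^esub> \<omega>)"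
  using bil_l[OF lact_bil[OF OA.Omega1_bimodule], of U g \<omega>] by simp
lemma lactB: "b \<in> carrier B \<Longrightarrow> linear_map k U OmB1 g \<Longrightarrow> linear_map k U OmB1 (\<lambda>u. \<iota>B b \<otimes>\<^bsub>OmB\<^esub> g u)"
  using bil_r[OF lact_bil[OF OB.Omega1_bimodule], of U g b] by simp
lemma lactB': "\<eta> \<in> dga_deg OmB 1 \<Longrightarrow> linear_map k U B g \<Longrightarrow> linear_map k U OmB1 (\<lambda>u. \<iota>B (g u) \<otimes>\<^bsub>OmB\<^esub> \<eta>)"
  using bil_l[OF lact_bil[OF OB.Omega1_bimodule], of U g \<eta>] by simp

lemmas tl_l = bil_l[OF tns_bil[OF mOA1 mB]] and tl_r = bil_r[OF tns_bil[OF mOA1 mB]]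
lemmas tr_l = bil_l[OF tns_bil[OF mA mOB1]] and tr_r = bil_r[OF tns_bil[OF mA mOB1]]

lemma mulL_bil: "a \<in> carrier A \<Longrightarrow> bil k OmA1 B TL (\<lambda>\<omega> b. tns k OmA1 B (\<iota>A a \<otimes>\<^bsub>OmA\<^esub> \<omega>) b)"
  by (intro bilI tl_l tl_r lactA lin_id) simp_all

lemma mulL_lin: "a \<in> carrier A \<Longrightarrow> linear_map k TL TL (mulL a)"
  unfolding mulL_def by (rule tbind_lin[OF mOA1 mB mTL mulL_bil])

lemma mulL_pure: "a \<in> carrier A \<Longrightarrow> \<omega> \<in> dga_deg OmA 1 \<Longrightarrow> b \<in> carrier B \<Longrightarrow>
   mulL a (tns k OmA1 B \<omega> b) = tns k OmA1 B (\<iota>A a \<otimes>\<^bsub>OmA\<^esub> \<omega>) b"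
  unfolding mulL_def by (rule tbind_pure[OF mOA1 mB mTL mulL_bil]) simp_all

lemma mulL_lin_left: "Z \<in> carrier TL \<Longrightarrow> linear_map k A TL (\<lambda>a. mulL a Z)"
  unfolding mulL_def
  by (rule tbind_lin_param[OF mOA1 mB _ mTL mA mulL_bil]) (simp_all add: tl_l lactA' lin_id)

lemma pl_mult: "X \<in> spanL \<Longrightarrow> a \<in> carrier A \<Longrightarrow> pl (p a \<otimes>\<^bsub>O.D\<^esub> X) = mulL a (pl X)"
proof (rule adspan_induct_lin[OF _ O.mT mTL _ _ spanL_carrier])
  assume [simp]: "a \<in> carrier A"
  show "linear_map k O.T TL (\<lambda>X. pl (p a \<otimes>\<^bsub>O.D\<^esub> X))" "linear_map k O.T TL (\<lambda>X. mulL a (pl X))"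
    by (simp_all add: lin_comp[OF pl_lin O.D_mult_lin_right] lin_comp[OF mulL_lin pl_lin])
  fix y assume "y \<in> {\<omega> \<bullet> \<iota>B b | \<omega> b. \<omega> \<in> dga_deg OmA 1 \<and> b \<in> carrier B}"
  then obtain \<omega> b where "y = \<omega> \<bullet> \<iota>B b" "\<omega> \<in> dga_deg OmA 1" "b \<in> carrier B" by blast
  then show "pl (p a \<otimes>\<^bsub>O.D\<^esub> y) = mulL a (pl y)" by (simp add: O.D_mult_simps pl_pure mulL_pure)
qed

lemma Rt_left_act_bil: "\<omega> \<in> dga_deg OmA 1 \<Longrightarrow> bil k A B TL (\<lambda>a' b'. mulL a' (Rt_left k A B Rt b' \<omega>))"
  by (intro bilI lin_comp[OF mulL_lin] mulL_lin_left bil_l[OF Rt_left_bil lin_id]) (simp_all add: Rt_left_closed)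

text \<open>Associativity of b, a and \<omega> in the calculus, seen in the summand. It makes the
  right side of the condition on \<nabla>^E balanced over \<open>A\<close>.\<close>

lemma Rt_left_act:
  assumes [simp]: "a \<in> carrier A" "b \<in> carrier B" "\<omega> \<in> dga_deg OmA 1"
  shows "Rt_left k A B Rt b (\<iota>A a \<otimes>\<^bsub>OmA\<^esub> \<omega>) = tbind TL (rr b a) (\<lambda>a' b'. mulL a' (Rt_left k A B Rt b' \<omega>))"
proof -
  have "Rt_left k A B Rt b (\<iota>A a \<otimes>\<^bsub>OmA\<^esub> \<omega>) = pl (q b \<otimes>\<^bsub>O.D\<^esub> p a \<otimes>\<^bsub>O.D\<^esub> (\<omega> \<bullet> \<one>\<^bsub>OmB\<^esub>))"
    by (subst O.D_assoc) (simp_all add: Rt_left_eq O.D_mult_simps)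
  also have "\<dots> = pl (J (rr b a) \<otimes>\<^bsub>O.D\<^esub> (\<omega> \<bullet> \<one>\<^bsub>OmB\<^esub>))" by (simp add: q_p)
  also have "\<dots> = tbind TL (rr b a) (\<lambda>a' b'. mulL a' (Rt_left k A B Rt b' \<omega>))"
  proof (rule tbind_tensor[OF mA mB mTL lin_comp[OF pl_lin lin_comp[OF O.D_mult_lin_left J_lin]], symmetric])
    fix a' b' assume ab [simp]: "a' \<in> carrier A" "b' \<in> carrier B"
    have "J (a' \<cdot> b') \<otimes>\<^bsub>O.D\<^esub> (\<omega> \<bullet> \<one>\<^bsub>OmB\<^esub>) = p a' \<otimes>\<^bsub>O.D\<^esub> (q b' \<otimes>\<^bsub>O.D\<^esub> (\<omega> \<bullet> \<one>\<^bsub>OmB\<^esub>))"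
      by (subst O.D_assoc[symmetric]) (simp_all add: O.D_mult_simps)
    then show "mulL a' (Rt_left k A B Rt b' \<omega>) = pl (J (a' \<cdot> b') \<otimes>\<^bsub>O.D\<^esub> (\<omega> \<bullet> \<one>\<^bsub>OmB\<^esub>))"
      by (simp add: Rt_left_eq pl_mult q_omega_span)
  qed simp_all
  finally show ?thesis .
qed

lemma mulR_inner: "\<eta> \<in> dga_deg OmB 1 \<Longrightarrow> bil k A B TR (\<lambda>a' b'. tns k A OmB1 a' (\<iota>B b' \<otimes>\<^bsub>OmB\<^esub> \<eta>))"
  by (intro bilI tr_l tr_r lactB' lin_id) simp_all

lemma mulR_bil: "b \<in> carrier B \<Longrightarrow> bil k A OmB1 TR (\<lambda>a \<eta>. tbind TR (rr b a) (\<lambda>a' b'. tns k A OmB1 a' (\<iota>B b' \<otimes>\<^bsub>OmB\<^esub> \<eta>)))"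
  by (intro bilI lin_comp[OF tbind_lin[OF mA mB mTR mulR_inner]] bil_r[OF rr_bil lin_id]
      tbind_lin_param[OF mA mB R_closed mTR mOB1 mulR_inner] tr_r lactB lin_id) simp_all

lemma mulR_lin: "b \<in> carrier B \<Longrightarrow> linear_map k TR TR (mulR b)"
  unfolding mulR_def by (rule tbind_lin[OF mA mOB1 mTR mulR_bil])

lemma mulR_pure: "b \<in> carrier B \<Longrightarrow> a \<in> carrier A \<Longrightarrow> \<eta> \<in> dga_deg OmB 1 \<Longrightarrow>
   mulR b (tns k A OmB1 a \<eta>) = tbind TR (rr b a) (\<lambda>a' b'. tns k A OmB1 a' (\<iota>B b' \<otimes>\<^bsub>OmB\<^esub> \<eta>))"
  unfolding mulR_def by (rule tbind_pure[OF mA mOB1 mTR mulR_bil]) simp_all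

text \<open>Associativity of b, \<eta> and a, seen in the summand; it serves the balancing over
  \<open>B\<close> in the condition on \<nabla>^F.\<close>

lemma Rt_right_act:
  assumes [simp]: "a \<in> carrier A" "b \<in> carrier B" "\<eta> \<in> dga_deg OmB 1"
  shows "Rt_right k A B Rt (\<iota>B b \<otimes>\<^bsub>OmB\<^esub> \<eta>) a = mulR b (Rt_right k A B Rt \<eta> a)"
proof -
  have "Rt_right k A B Rt (\<iota>B b \<otimes>\<^bsub>OmB\<^esub> \<eta>) a = pr (q b \<otimes>\<^bsub>O.D\<^esub> ((\<one>\<^bsub>OmA\<^esub> \<bullet> \<eta>) \<otimes>\<^bsub>O.D\<^esub> p a))"
    by (subst O.D_assoc[symmetric]) (simp_all add: Rt_right_eq O.D_mult_simps)
  also have "\<dots> = mulR b (pr ((\<one>\<^bsub>OmA\<^esub> \<bullet> \<eta>) \<otimes>\<^bsub>O.D\<^esub> p a))"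
  proof (rule adspan_induct_lin[OF eta_p_span O.mT mTR _ _ spanR_carrier])
    show "linear_map k O.T TR (\<lambda>X. pr (q b \<otimes>\<^bsub>O.D\<^esub> X))" "linear_map k O.T TR (\<lambda>X. mulR b (pr X))"
      by (simp_all add: lin_comp[OF pr_lin O.D_mult_lin_right] lin_comp[OF mulR_lin pr_lin])
    fix y assume "y \<in> {\<iota>A a \<bullet> \<eta> | a \<eta>. a \<in> carrier A \<and> \<eta> \<in> dga_deg OmB 1}"
    then obtain a1 \<eta>1 where y: "y = \<iota>A a1 \<bullet> \<eta>1" and [simp]: "a1 \<in> carrier A" "\<eta>1 \<in> dga_deg OmB 1" by blast
    have "q b \<otimes>\<^bsub>O.D\<^esub> y = q b \<otimes>\<^bsub>O.D\<^esub> p a1 \<otimes>\<^bsub>O.D\<^esub> (\<one>\<^bsub>OmA\<^esub> \<bullet> \<eta>1)"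
      unfolding y by (subst O.D_assoc) (simp_all add: O.D_mult_simps)
    then have "pr (q b \<otimes>\<^bsub>O.D\<^esub> y) = pr (J (rr b a1) \<otimes>\<^bsub>O.D\<^esub> (\<one>\<^bsub>OmA\<^esub> \<bullet> \<eta>1))" by (simp add: q_p)
    also have "\<dots> = tbind TR (rr b a1) (\<lambda>a' b'. tns k A OmB1 a' (\<iota>B b' \<otimes>\<^bsub>OmB\<^esub> \<eta>1))"
      by (rule tbind_tensor[OF mA mB mTR lin_comp[OF pr_lin lin_comp[OF O.D_mult_lin_left J_lin]], symmetric])
        (simp_all add: O.D_mult_simps pr_pure)
    also have "\<dots> = mulR b (pr y)" by (simp add: y pr_pure mulR_pure)
    finally show "pr (q b \<otimes>\<^bsub>O.D\<^esub> y) = mulR b (pr y)" .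
  qed simp_all
  finally show ?thesis by (simp add: Rt_right_eq)
qed

end

section \<open>The product bimodule and the product connection\<close>

text \<open>The common shape \<open>(x\<^sub>1 \<otimes> x\<^sub>2) (z\<^sub>1 \<otimes> z\<^sub>2) = x\<^sub>1 u \<otimes> v z\<^sub>2\<close>, where \<open>u \<otimes> v = h x\<^sub>2 z\<^sub>1\<close>, of the actions on \<open>E \<otimes> B\<close> and \<open>A \<otimes> F\<close>.\<close>

locale twisted_action =
  fixes k :: "'k ring" and X1 :: "('k, 'x1, 'y1) module_scheme" and X2 :: "('k, 'x2, 'y2) module_scheme"
    and Z1 :: "('k, 'z1, 'y3) module_scheme" and Z2 :: "('k, 'z2, 'y4) module_scheme"
    and U :: "('k, 'u, 'y5) module_scheme" and V :: "('k, 'v, 'y6) module_scheme"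
    and N1 :: "('k, 'n1, 'y7) module_scheme" and N2 :: "('k, 'n2, 'y8) module_scheme"
    and h :: "'x2 \<Rightarrow> 'z1 \<Rightarrow> ('u, 'v) tens" and m1 :: "'x1 \<Rightarrow> 'u \<Rightarrow> 'n1" and m2 :: "'v \<Rightarrow> 'z2 \<Rightarrow> 'n2"
  assumes mods: "Module.module k X1" "Module.module k X2" "Module.module k Z1" "Module.module k Z2"
      "Module.module k U" "Module.module k V" "Module.module k N1" "Module.module k N2"
    and h: "bil k X2 Z1 (tensor k U V) h" and m1: "bil k X1 U N1 m1" and m2: "bil k V Z2 N2 m2"
begin

abbreviation "W \<equiv> tensor k N1 N2"

lemmas mW = tensor_module[OF mods(7,8)]
lemmas W_l = bil_l[OF tns_bil[OF mods(7,8)]] and W_r = bil_r[OF tns_bil[OF mods(7,8)]]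

definition "tcore x1 z2 Q = tbind W Q (\<lambda>u v. tns k N1 N2 (m1 x1 u) (m2 v z2))"
definition "act X Z = tbind W X (\<lambda>x1 x2. tbind W Z (\<lambda>z1 z2. tcore x1 z2 (h x2 z1)))"

lemma tcore_bil: "x1 \<in> carrier X1 \<Longrightarrow> z2 \<in> carrier Z2 \<Longrightarrow> bil k U V W (\<lambda>u v. tns k N1 N2 (m1 x1 u) (m2 v z2))"
  by (intro bilI W_l W_r bil_r[OF m1 lin_id] bil_l[OF m2 lin_id]) (simp_all add: bil_closed[OF m1] bil_closed[OF m2])

lemma tcore_lin: "x1 \<in> carrier X1 \<Longrightarrow> z2 \<in> carrier Z2 \<Longrightarrow> linear_map k (tensor k U V) W (tcore x1 z2)"
  unfolding tcore_def by (rule tbind_lin[OF mods(5,6) mW tcore_bil])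

lemma tcore_pure: "x1 \<in> carrier X1 \<Longrightarrow> z2 \<in> carrier Z2 \<Longrightarrow> u \<in> carrier U \<Longrightarrow> v \<in> carrier V \<Longrightarrow>
   tcore x1 z2 (tns k U V u v) = tns k N1 N2 (m1 x1 u) (m2 v z2)"
  unfolding tcore_def by (rule tbind_pure[OF mods(5,6) mW tcore_bil])

lemma tcore_left: "Q \<in> carrier (tensor k U V) \<Longrightarrow> z2 \<in> carrier Z2 \<Longrightarrow> linear_map k X1 W (\<lambda>x1. tcore x1 z2 Q)"
  unfolding tcore_def
  by (rule tbind_lin_param[OF mods(5,6) _ mW mods(1) tcore_bil])
    (simp_all add: W_l bil_l[OF m1 lin_id] bil_closed[OF m2])

lemma tcore_right: "Q \<in> carrier (tensor k U V) \<Longrightarrow> x1 \<in> carrier X1 \<Longrightarrow> linear_map k Z2 W (\<lambda>z2. tcore x1 z2 Q)"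
  unfolding tcore_def
  by (rule tbind_lin_param[OF mods(5,6) _ mW mods(4) tcore_bil])
    (simp_all add: W_r bil_r[OF m2 lin_id] bil_closed[OF m1])

lemma inner: "x1 \<in> carrier X1 \<Longrightarrow> x2 \<in> carrier X2 \<Longrightarrow> bil k Z1 Z2 W (\<lambda>z1 z2. tcore x1 z2 (h x2 z1))"
  by (intro bilI tcore_right lin_comp[OF tcore_lin] bil_r[OF h lin_id]) (simp_all add: bil_closed[OF h])

lemma outer: "Z \<in> carrier (tensor k Z1 Z2) \<Longrightarrow> bil k X1 X2 W (\<lambda>x1 x2. tbind W Z (\<lambda>z1 z2. tcore x1 z2 (h x2 z1)))"
  by (intro bilI; rule tbind_lin_param[OF mods(3,4) _ mW])
    (simp_all add: mods inner tcore_left lin_comp[OF tcore_lin] bil_l[OF h lin_id] bil_closed[OF h])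

lemma act_bil: "bil k (tensor k X1 X2) (tensor k Z1 Z2) W act"
  unfolding act_def
  by (intro bilI tbind_lin[OF mods(1,2) mW outer]
      tbind_lin_param[OF mods(1,2) _ mW tensor_module[OF mods(3,4)] outer] tbind_lin[OF mods(3,4) mW inner])

lemma act_pure: "x1 \<in> carrier X1 \<Longrightarrow> x2 \<in> carrier X2 \<Longrightarrow> z1 \<in> carrier Z1 \<Longrightarrow> z2 \<in> carrier Z2 \<Longrightarrow>
   act (tns k X1 X2 x1 x2) (tns k Z1 Z2 z1 z2) = tcore x1 z2 (h x2 z1)"
  unfolding act_def
  by (simp add: tbind_pure[OF mods(1,2) mW outer] tbind_pure[OF mods(3,4) mW inner] tns_closed[OF mods(3,4)])

end

section \<open>The product bimodule and its generators\<close>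

locale product = calculus k A B R Rt
  for k :: "'k ring" and A :: "('k, 'a) module" and B :: "('k, 'b) module"
    and R :: "('b, 'a) tens \<Rightarrow> ('a, 'b) tens"
    and Rt :: "('b forms, 'a forms) tens \<Rightarrow> ('a forms, 'b forms) tens" +
  fixes E :: "('k, 'a, 'e) bimod" and F :: "('k, 'b, 'f) bimod"
    and nabE :: "'e \<Rightarrow> ('e, 'a forms) tens" and nabF :: "'f \<Rightarrow> ('f, 'b forms) tens"
    and \<phi> :: "('a forms, 'e) tens \<Rightarrow> ('e, 'a forms) tens"
    and \<psi> :: "('b forms, 'f) tens \<Rightarrow> ('f, 'b forms) tens"
    and \<tau>FA :: "('f, 'a) tens \<Rightarrow> ('a, 'f) tens"
    and \<tau>BE :: "('b, 'e) tens \<Rightarrow> ('e, 'b) tens"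
  assumes bE: "bimodule k A E" and bcE: "bimodule_connection k A (Omega k A) (iota k A) E nabE \<phi>"
    and bF: "bimodule k B F" and bcF: "bimodule_connection k B (Omega k B) (iota k B) F nabF \<psi>"
    and R_bij: "bij_betw R (carrier (tensor k B A)) (carrier (tensor k A B))"
    and twF: "right_module_twisting_map k A B R F \<tau>FA"
    and tauF_bij: "bij_betw \<tau>FA (carrier (tensor k F A)) (carrier (tensor k A F))"
    and compatF: "\<forall>f \<in> carrier F. \<forall>a \<in> carrier A.
      (let F\<Omega> = tensor_over B F (Omega1 k B); W = tensor k A F\<Omega> in
        tbind W (\<tau>FA (tns k F A f a)) (\<lambda>a1 f1. tns k A F\<Omega> a1 (nabF f1)) =
        tbind W (nabF f) (\<lambda>f1 \<eta>.
        tbind W (Rt_right k A B Rt \<eta> a) (\<lambda>a1 \<eta>1.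
        tbind W (\<tau>FA (tns k F A f1 a1)) (\<lambda>a2 f2.
          tns k A F\<Omega> a2 (tns_over B F (Omega1 k B) f2 \<eta>1)))))"
    and twE: "left_module_twisting_map k A B R E \<tau>BE"
    and compatE: "\<forall>b \<in> carrier B. \<forall>e \<in> carrier E.
      (let E\<Omega> = tensor_over A E (Omega1 k A); W = tensor k E\<Omega> B in
        tbind W (\<tau>BE (tns k B E b e)) (\<lambda>e1 b1. tns k E\<Omega> B (nabE e1) b1) =
        tbind W (nabE e) (\<lambda>e1 \<omega>.
        tbind W (\<tau>BE (tns k B E b e1)) (\<lambda>e2 b1.
        tbind W (Rt_left k A B Rt b1 \<omega>) (\<lambda>\<omega>1 b2.
          tns k E\<Omega> B (tns_over A E (Omega1 k A) e2 \<omega>1) b2))))"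
    and bM: "bimodule k (twisted_tensor k A B R) (product_bimodule k A B R E F \<tau>FA \<tau>BE)"
begin

abbreviation "M \<equiv> product_bimodule k A B R E F \<tau>FA \<tau>BE"
abbreviation "EB \<equiv> tensor k E B"
abbreviation "AF \<equiv> tensor k A F"
abbreviation "te b e \<equiv> \<tau>BE (tns k B E b e)"
abbreviation "tf f a \<equiv> \<tau>FA (tns k F A f a)"

lemmas mE = bm_module[OF bE] and mF = bm_module[OF bF]
lemmas mEB = tensor_module[OF mE mB] and mAF = tensor_module[OF mA mF]

interpretation E: Module.module k E by (rule mE)
interpretation F: Module.module k F by (rule mF)
interpretation EB: Module.module k EB by (rule mEB)
interpretation AF: Module.module k AF by (rule mAF)

lemma tauE_lin: "linear_map k (tensor k B E) EB \<tau>BE"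
  using twE by (simp add: left_module_twisting_map_def)
lemma tauF_lin: "linear_map k (tensor k F A) AF \<tau>FA"
  using twF by (simp add: right_module_twisting_map_def)

lemma te_bil: "bil k B E EB te"
  by (intro bilI lin_comp[OF tauE_lin] bil_r[OF tns_bil[OF mB mE] lin_id] bil_l[OF tns_bil[OF mB mE] lin_id])
lemma tf_bil: "bil k F A AF tf"
  by (intro bilI lin_comp[OF tauF_lin] bil_r[OF tns_bil[OF mF mA] lin_id] bil_l[OF tns_bil[OF mF mA] lin_id])

lemmas te_closed [simp] = bil_closed[OF te_bil] and tf_closed [simp] = bil_closed[OF tf_bil]
lemmas EB_closed [simp] = tns_closed[OF mE mB] and AF_closed [simp] = tns_closed[OF mA mF]
lemmas E_acts [simp] = bm_lact_closed[OF bE] bm_ract_closed[OF bE] bm_lact_one[OF bE] bm_ract_one[OF bE]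
lemmas F_acts [simp] = bm_lact_closed[OF bF] bm_ract_closed[OF bF] bm_lact_one[OF bF] bm_ract_one[OF bF]

sublocale lE: twisted_action k A B E B E B E B te "\<lambda>x m. lact E x m" "\<lambda>x y. x \<otimes>\<^bsub>B\<^esub> y"
  by (rule twisted_action.intro) (rule mA mB mE te_bil lact_bil[OF bE] mult_bil[OF algB])+
sublocale rE: twisted_action k E B A B A B E B rr "\<lambda>m x. ract E m x" "\<lambda>x y. x \<otimes>\<^bsub>B\<^esub> y"
  by (rule twisted_action.intro) (rule mA mB mE rr_bil ract_bil[OF bE] mult_bil[OF algB])+
sublocale lF: twisted_action k A B A F A B A F rr "\<lambda>x y. x \<otimes>\<^bsub>A\<^esub> y" "\<lambda>x m. lact F x m"
  by (rule twisted_action.intro) (rule mA mB mF rr_bil lact_bil[OF bF] mult_bil[OF algA])+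
sublocale rF: twisted_action k A F A B A F A F tf "\<lambda>x y. x \<otimes>\<^bsub>A\<^esub> y" "\<lambda>m x. ract F m x"
  by (rule twisted_action.intro) (rule mA mB mF tf_bil ract_bil[OF bF] mult_bil[OF algA])+

lemma M_simps [simp]:
  "carrier M = carrier EB \<times> carrier AF" "\<zero>\<^bsub>M\<^esub> = (\<zero>\<^bsub>EB\<^esub>, \<zero>\<^bsub>AF\<^esub>)"
  "(X, Y) \<oplus>\<^bsub>M\<^esub> (X', Y') = (X \<oplus>\<^bsub>EB\<^esub> X', Y \<oplus>\<^bsub>AF\<^esub> Y')" "c \<odot>\<^bsub>M\<^esub> (X, Y) = (c \<odot>\<^bsub>EB\<^esub> X, c \<odot>\<^bsub>AF\<^esub> Y)"
  "lact M Z (X, Y) = (lE.act Z X, lF.act Z Y)" "ract M (X, Y) Z = (rE.act X Z, rF.act Y Z)"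
  by (simp_all add: product_bimodule_def Let_def module.defs bimod.defs dsum_def
      lE.act_def lE.tcore_def lF.act_def lF.tcore_def rE.act_def rE.tcore_def rF.act_def rF.tcore_def)

lemmas mM = bm_module[OF bM]
interpretation M: Module.module k M by (rule mM)

text \<open>Maps of bimodules over \<open>A\<close> and over \<open>B\<close>, respectively. The
  remaining products b e and f a are the values of the two module twisting maps.\<close>

definition "iE e = (tns k E B e \<one>\<^bsub>B\<^esub>, \<zero>\<^bsub>AF\<^esub>)"
definition "iF f = (\<zero>\<^bsub>EB\<^esub>, tns k A F \<one>\<^bsub>A\<^esub> f)"
abbreviation "jA a \<equiv> a \<cdot> \<one>\<^bsub>B\<^esub>"
abbreviation "jB b \<equiv> \<one>\<^bsub>A\<^esub> \<cdot> b"

abbreviation lM (infixr "\<rhd>" 72) where "x \<rhd> m \<equiv> lact M x m"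
abbreviation rM (infixl "\<lhd>" 72) where "m \<lhd> x \<equiv> ract M m x"

lemma inl_lin: "linear_map k EB M (\<lambda>X. (X, \<zero>\<^bsub>AF\<^esub>))" by (rule linI) simp_all
lemma inr_lin: "linear_map k AF M (\<lambda>Y. (\<zero>\<^bsub>EB\<^esub>, Y))" by (rule linI) simp_all

lemma iE_lin: "linear_map k E M iE"
  unfolding iE_def by (intro lin_comp[OF inl_lin] bil_l[OF tns_bil[OF mE mB]] lin_id) simp
lemma iF_lin: "linear_map k F M iF"
  unfolding iF_def by (intro lin_comp[OF inr_lin] bil_r[OF tns_bil[OF mA mF]] lin_id) simp

lemma iE_closed [simp]: "e \<in> carrier E \<Longrightarrow> iE e \<in> carrier M" by (rule lin_closed[OF iE_lin])
lemma iF_closed [simp]: "f \<in> carrier F \<Longrightarrow> iF f \<in> carrier M" by (rule lin_closed[OF iF_lin])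

lemma act_zero:
  "Z \<in> carrier T \<Longrightarrow> lE.act Z \<zero>\<^bsub>EB\<^esub> = \<zero>\<^bsub>EB\<^esub>" "Z \<in> carrier T \<Longrightarrow> lF.act Z \<zero>\<^bsub>AF\<^esub> = \<zero>\<^bsub>AF\<^esub>"
  "Z \<in> carrier T \<Longrightarrow> rE.act \<zero>\<^bsub>EB\<^esub> Z = \<zero>\<^bsub>EB\<^esub>" "Z \<in> carrier T \<Longrightarrow> rF.act \<zero>\<^bsub>AF\<^esub> Z = \<zero>\<^bsub>AF\<^esub>"
  using lin_zero[OF mEB mEB bil_r[OF lE.act_bil lin_id]] lin_zero[OF mAF mAF bil_r[OF lF.act_bil lin_id]]
    lin_zero[OF mEB mEB bil_l[OF rE.act_bil lin_id]] lin_zero[OF mAF mAF bil_l[OF rF.act_bil lin_id]] by simp_all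

lemma lE_core_one: "V \<in> carrier EB \<Longrightarrow> lE.tcore \<one>\<^bsub>A\<^esub> \<one>\<^bsub>B\<^esub> V = V"
  by (rule tensor_ext[OF mE mB mEB lE.tcore_lin lin_id]) (simp_all add: lE.tcore_pure)
lemma rF_core_one: "V \<in> carrier AF \<Longrightarrow> rF.tcore \<one>\<^bsub>A\<^esub> \<one>\<^bsub>B\<^esub> V = V"
  by (rule tensor_ext[OF mA mF mAF rF.tcore_lin lin_id]) (simp_all add: rF.tcore_pure)

lemma iE_b: "e \<in> carrier E \<Longrightarrow> b \<in> carrier B \<Longrightarrow> iE e \<lhd> jB b = (tns k E B e b, \<zero>\<^bsub>AF\<^esub>)"
  by (simp add: iE_def rE.act_pure act_zero R_one rE.tcore_pure)
lemma iE_a: "e \<in> carrier E \<Longrightarrow> a \<in> carrier A \<Longrightarrow> iE e \<lhd> jA a = iE (ract E e a)"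
  by (simp add: iE_def rE.act_pure act_zero R_one rE.tcore_pure)
lemma a_iF: "f \<in> carrier F \<Longrightarrow> a \<in> carrier A \<Longrightarrow> jA a \<rhd> iF f = (\<zero>\<^bsub>EB\<^esub>, tns k A F a f)"
  by (simp add: iF_def lF.act_pure act_zero R_one lF.tcore_pure)
lemma b_iF: "f \<in> carrier F \<Longrightarrow> b \<in> carrier B \<Longrightarrow> jB b \<rhd> iF f = iF (lact F b f)"
  by (simp add: iF_def lF.act_pure act_zero R_one lF.tcore_pure)
lemma b_iE: "e \<in> carrier E \<Longrightarrow> b \<in> carrier B \<Longrightarrow> jB b \<rhd> iE e = (te b e, \<zero>\<^bsub>AF\<^esub>)"
  by (simp add: iE_def lE.act_pure act_zero lE_core_one)
lemma iF_a: "f \<in> carrier F \<Longrightarrow> a \<in> carrier A \<Longrightarrow> iF f \<lhd> jA a = (\<zero>\<^bsub>EB\<^esub>, tf f a)"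
  by (simp add: iF_def rF.act_pure act_zero rF_core_one)

text \<open>A module twisting map carries no condition at the unit by definition; here it is
  extracted from 1 m = m in the bimodule \<open>M\<close>, and in \<open>tf_one\<close> from m 1 =
  m.\<close>

lemma te_one: "e \<in> carrier E \<Longrightarrow> te \<one>\<^bsub>B\<^esub> e = tns k E B e \<one>\<^bsub>B\<^esub>"
  using bm_lact_one[OF bM, of "iE e"] b_iE[of e "\<one>\<^bsub>B\<^esub>"] iE_closed[of e] by (simp add: iE_def del: M_simps)
lemma tf_one: "f \<in> carrier F \<Longrightarrow> tf f \<one>\<^bsub>A\<^esub> = tns k A F \<one>\<^bsub>A\<^esub> f"
  using bm_ract_one[OF bM, of "iF f"] iF_a[of f "\<one>\<^bsub>A\<^esub>"] iF_closed[of f] by (simp add: iF_def del: M_simps)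

lemma a_iE: "e \<in> carrier E \<Longrightarrow> a \<in> carrier A \<Longrightarrow> jA a \<rhd> iE e = iE (lact E a e)"
  by (simp add: iE_def lE.act_pure act_zero te_one lE.tcore_pure)
lemma iF_b: "f \<in> carrier F \<Longrightarrow> b \<in> carrier B \<Longrightarrow> iF f \<lhd> jB b = iF (ract F f b)"
  by (simp add: iF_def rF.act_pure act_zero tf_one rF.tcore_pure)

text \<open>The second summand is tested on f a instead of on a \<otimes> f. These elements span
  because \<open>\<tau>FA\<close> is onto, and they exhibit \<open>M\<close> as generated by E and F
  under the right action.\<close>

lemma M_ext:
  assumes N: "Module.module k N" and h: "linear_map k M N h" and g: "linear_map k M N g"
    and e: "\<And>e b. e \<in> carrier E \<Longrightarrow> b \<in> carrier B \<Longrightarrow> h (iE e \<lhd> jB b) = g (iE e \<lhd> jB b)"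
    and f: "\<And>f a. f \<in> carrier F \<Longrightarrow> a \<in> carrier A \<Longrightarrow> h (iF f \<lhd> jA a) = g (iF f \<lhd> jA a)"
    and m: "m \<in> carrier M"
  shows "h m = g m"
proof -
  obtain X Y where XY: "m = (X, Y)" and X: "X \<in> carrier EB" and Y: "Y \<in> carrier AF" using m by auto
  have 1: "h (X, \<zero>\<^bsub>AF\<^esub>) = g (X, \<zero>\<^bsub>AF\<^esub>)"
    by (rule tensor_ext[OF mE mB N lin_comp[OF h inl_lin] lin_comp[OF g inl_lin] _ X])
      (use e in \<open>simp add: iE_b del: M_simps\<close>)
  obtain V where V: "V \<in> carrier (tensor k F A)" "Y = \<tau>FA V"
    using Y tauF_bij by (auto simp: bij_betw_def)
  have "h (\<zero>\<^bsub>EB\<^esub>, \<tau>FA V) = g (\<zero>\<^bsub>EB\<^esub>, \<tau>FA V)"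
    by (rule tensor_ext[OF mF mA N lin_comp[OF h lin_comp[OF inr_lin tauF_lin]] lin_comp[OF g lin_comp[OF inr_lin tauF_lin]] _ V(1)])
      (use f in \<open>simp add: iF_a del: M_simps\<close>)
  then show ?thesis
    using 1 X Y lin_add[OF h, of "(X, \<zero>\<^bsub>AF\<^esub>)" "(\<zero>\<^bsub>EB\<^esub>, Y)"] lin_add[OF g, of "(X, \<zero>\<^bsub>AF\<^esub>)" "(\<zero>\<^bsub>EB\<^esub>, Y)"]
    by (simp add: XY V(2))
qed

text \<open>The version on plain pure tensors, the form in which the formulas for \<xi> are
  given.\<close>

lemma M_ext':
  assumes N: "Module.module k N" and h: "linear_map k M N h" and g: "linear_map k M N g"
    and e: "\<And>e b. e \<in> carrier E \<Longrightarrow> b \<in> carrier B \<Longrightarrow> h (tns k E B e b, \<zero>\<^bsub>AF\<^esub>) = g (tns k E B e b, \<zero>\<^bsub>AF\<^esub>)"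
    and f: "\<And>f a. f \<in> carrier F \<Longrightarrow> a \<in> carrier A \<Longrightarrow> h (\<zero>\<^bsub>EB\<^esub>, tns k A F a f) = g (\<zero>\<^bsub>EB\<^esub>, tns k A F a f)"
    and m: "m \<in> carrier M"
  shows "h m = g m"
proof -
  obtain X Y where XY: "m = (X, Y)" and X: "X \<in> carrier EB" and Y: "Y \<in> carrier AF" using m by auto
  have "h (X, \<zero>\<^bsub>AF\<^esub>) = g (X, \<zero>\<^bsub>AF\<^esub>)"
    by (rule tensor_ext[OF mE mB N lin_comp[OF h inl_lin] lin_comp[OF g inl_lin] _ X]) (rule e)
  moreover have "h (\<zero>\<^bsub>EB\<^esub>, Y) = g (\<zero>\<^bsub>EB\<^esub>, Y)"
    by (rule tensor_ext[OF mA mF N lin_comp[OF h inr_lin] lin_comp[OF g inr_lin] _ Y]) (rule f)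
  ultimately show ?thesis
    using X Y lin_add[OF h, of "(X, \<zero>\<^bsub>AF\<^esub>)" "(\<zero>\<^bsub>EB\<^esub>, Y)"] lin_add[OF g, of "(X, \<zero>\<^bsub>AF\<^esub>)" "(\<zero>\<^bsub>EB\<^esub>, Y)"]
    by (simp add: XY)
qed

text \<open>Bijectivity of \<open>R\<close> makes the products \<open>b a\<close> span \<open>A \<otimes>\<^sub>R B\<close>, too.\<close>

lemma D_ext_BA:
  assumes N: "Module.module k N" and h: "linear_map k T N h" and g: "linear_map k T N g"
    and ba: "\<And>b a. b \<in> carrier B \<Longrightarrow> a \<in> carrier A \<Longrightarrow> h (jB b \<otimes>\<^bsub>D\<^esub> jA a) = g (jB b \<otimes>\<^bsub>D\<^esub> jA a)"
    and x: "x \<in> carrier T"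
  shows "h x = g x"
proof -
  obtain V where V: "V \<in> carrier (tensor k B A)" "x = R V" using x R_bij by (auto simp: bij_betw_def)
  have "h (R V) = g (R V)"
    by (rule tensor_ext[OF mB mA N lin_comp[OF h R_lin] lin_comp[OF g R_lin] _ V(1)])
      (use ba in \<open>simp add: R_eq_mult\<close>)
  then show ?thesis by (simp add: V(2))
qed

lemma D_ext_AB:
  assumes N: "Module.module k N" and h: "linear_map k T N h" and g: "linear_map k T N g"
    and ab: "\<And>a b. a \<in> carrier A \<Longrightarrow> b \<in> carrier B \<Longrightarrow> h (jA a \<otimes>\<^bsub>D\<^esub> jB b) = g (jA a \<otimes>\<^bsub>D\<^esub> jB b)"
    and x: "x \<in> carrier T"
  shows "h x = g x"
  by (rule tensor_ext[OF mA mB N h g _ x]) (use ab in \<open>simp add: D_mult_simps\<close>)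

end

declare tensor_over_simps [simp del]

context calculus
begin

declare G_simps(7,8) [simp del]

lemma dD_one: "dD \<one>\<^bsub>D\<^esub> = \<zero>\<^bsub>O.T\<^esub>"
proof -
  have "\<one>\<^bsub>OmA\<^esub> \<bullet> \<zero>\<^bsub>OmB\<^esub> = \<zero>\<^bsub>O.T\<^esub>"
    using lin_zero[OF O.mB O.mT O.t_r[OF lin_id], of "\<one>\<^bsub>OmA\<^esub>"] by simp
  then show ?thesis using dD_b[of "\<one>\<^bsub>B\<^esub>"] by (simp add: OB.dd_one)
qed

lemma O_one_right: "X \<in> carrier O.T \<Longrightarrow> X \<otimes>\<^bsub>O.D\<^esub> (\<one>\<^bsub>OmA\<^esub> \<bullet> \<one>\<^bsub>OmB\<^esub>) = X"
  using O.D.r_one[of X] by simp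

lemma dD_deg: "X \<in> carrier T \<Longrightarrow> dD X \<in> dga_deg G 1"
  using dD_J_deg[of X "\<one>\<^bsub>D\<^esub>"] by (simp add: OA.iota_one OB.iota_one O_one_right)

lemma deg_carrier: "X \<in> dga_deg G 1 \<Longrightarrow> X \<in> carrier O.T"
  unfolding dga_deg_eq by (rule dspan_carrier)

lemma deg_left: "X \<in> dga_deg G 1 \<Longrightarrow> Z \<in> carrier T \<Longrightarrow> J Z \<otimes>\<^bsub>O.D\<^esub> X \<in> dga_deg G 1"
  unfolding dga_deg_eq by (rule dspan_left)

lemma deg_right: "X \<in> dga_deg G 1 \<Longrightarrow> Z \<in> carrier T \<Longrightarrow> X \<otimes>\<^bsub>O.D\<^esub> J Z \<in> dga_deg G 1"
  unfolding dga_deg_eq by (rule dspan_right)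

lemma deg1_A_one: "\<omega> \<in> dga_deg OmA 1 \<Longrightarrow> \<omega> \<bullet> \<one>\<^bsub>OmB\<^esub> \<in> dga_deg G 1"
  using deg1_pure_A[of \<omega> "\<one>\<^bsub>B\<^esub>"] by (simp add: OB.iota_one)

lemma deg1_B_one: "\<eta> \<in> dga_deg OmB 1 \<Longrightarrow> \<one>\<^bsub>OmA\<^esub> \<bullet> \<eta> \<in> dga_deg G 1"
  using deg1_pure_B[of \<eta> "\<one>\<^bsub>A\<^esub>"] by (simp add: OA.iota_one)

lemmas deg_simps [simp] = dD_deg deg_carrier deg_left deg_right deg1_A_one deg1_B_one deg1_pure_A deg1_pure_B dga_deg_add

lemma mOm: "Module.module k Om" by (rule bm_module[OF Om_bimodule])

lemma lin_Om: "linear_map k U O.T g \<Longrightarrow> (\<And>u. u \<in> carrier U \<Longrightarrow> g u \<in> dga_deg G 1) \<Longrightarrow> linear_map k U Om g"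
  by (auto simp: linear_map_def)

lemma Om_inc: "linear_map k Om O.T (\<lambda>x. x)"
  by (rule linI) simp_all

lemma dD_lin_Om: "linear_map k T Om dD"
  by (rule lin_Om[OF dD_lin]) simp

end

section \<open>The target of the connection and the images of the given connections\<close>

context product
begin

declare M_simps [simp del]

interpretation M: Module.module k M by (rule mM)

abbreviation "W \<equiv> tensor_over D M Om"
abbreviation "tw m \<theta> \<equiv> tns_over D M Om m \<theta>"
abbreviation lW (infixr "\<triangleright>" 72) where "x \<triangleright> w \<equiv> lact W x w"
abbreviation rW (infixl "\<triangleleft>" 72) where "w \<triangleleft> x \<equiv> ract W w x"

lemmas bW = tover_bimodule[OF D_algebra bM Om_bimodule]
lemmas mW = bm_module[OF bW]
lemmas tw_bil = tover_bil[OF D_algebra bM Om_bimodule]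

interpretation W: Module.module k W by (rule mW)

lemma lin_D: "linear_map k D N f = linear_map k T N f"
  by (simp add: linear_map_def)

lemma lM_bil: "bil k T M M (\<lambda>x m. x \<rhd> m)" using lact_bil[OF bM] by (simp add: bil_def lin_D)
lemma rM_bil: "bil k M T M (\<lambda>m x. m \<lhd> x)" using ract_bil[OF bM] by (simp add: bil_def lin_D)
lemma lW_bil: "bil k T W W (\<lambda>x m. x \<triangleright> m)" using lact_bil[OF bW] by (simp add: bil_def lin_D)
lemma rW_bil: "bil k W T W (\<lambda>m x. m \<triangleleft> x)" using ract_bil[OF bW] by (simp add: bil_def lin_D)

lemmas acts_closed [simp] = bil_closed[OF lM_bil] bil_closed[OF rM_bil] bil_closed[OF lW_bil] bil_closed[OF rW_bil]
lemmas lM_lin = bil_r[OF lM_bil] and rM_lin = bil_l[OF rM_bil]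
lemmas lW_lin = bil_r[OF lW_bil] and rW_lin = bil_l[OF rW_bil]
lemmas lM_lin' = bil_l[OF lM_bil] and rM_lin' = bil_r[OF rM_bil]
lemmas lW_lin' = bil_l[OF lW_bil] and rW_lin' = bil_r[OF rW_bil]
lemmas tw_l = bil_l[OF tw_bil] and tw_r = bil_r[OF tw_bil]

lemmas M_acts = bm_lact_mult[OF bM, unfolded D_simps] bm_ract_mult[OF bM, unfolded D_simps] bm_assoc[OF bM, unfolded D_simps]
lemmas W_acts = bm_lact_mult[OF bW, unfolded D_simps] bm_ract_mult[OF bW, unfolded D_simps] bm_assoc[OF bW, unfolded D_simps]
lemmas one_acts [simp] = bm_lact_one[OF bM, unfolded D_simps] bm_ract_one[OF bM, unfolded D_simps]
  bm_lact_one[OF bW, unfolded D_simps] bm_ract_one[OF bW, unfolded D_simps]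

lemma tw_closed [simp]: "m \<in> carrier M \<Longrightarrow> \<theta> \<in> dga_deg G 1 \<Longrightarrow> tw m \<theta> \<in> carrier W"
  using bil_closed[OF tw_bil] by simp

lemma tw_bal: "m \<in> carrier M \<Longrightarrow> x \<in> carrier T \<Longrightarrow> \<theta> \<in> dga_deg G 1 \<Longrightarrow> tw (m \<lhd> x) \<theta> = tw m (J x \<otimes>\<^bsub>O.D\<^esub> \<theta>)"
  using tover_bal[OF D_algebra bM Om_bimodule, of m x \<theta>] by simp

lemma lW_tw: "x \<in> carrier T \<Longrightarrow> x \<triangleright> tw m \<theta> = tw (x \<rhd> m) \<theta>"
  using lact_pure[OF D_algebra bM Om_bimodule, of x m \<theta>] by simp

lemma rW_tw: "x \<in> carrier T \<Longrightarrow> tw m \<theta> \<triangleleft> x = tw m (\<theta> \<otimes>\<^bsub>O.D\<^esub> J x)"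
  using ract_pure[OF D_algebra bM Om_bimodule, of x m \<theta>] by simp

lemma tw_add_r: "m \<in> carrier M \<Longrightarrow> \<theta> \<in> dga_deg G 1 \<Longrightarrow> \<theta>' \<in> dga_deg G 1 \<Longrightarrow>
   tw m (\<theta> \<oplus>\<^bsub>O.T\<^esub> \<theta>') = tw m \<theta> \<oplus>\<^bsub>W\<^esub> tw m \<theta>'"
  using lin_add[OF tw_r[OF lin_id], of m \<theta> \<theta>'] by simp

lemma W_add:
  "w \<in> carrier W \<Longrightarrow> w' \<in> carrier W \<Longrightarrow> x \<in> carrier T \<Longrightarrow> x \<triangleright> (w \<oplus>\<^bsub>W\<^esub> w') = x \<triangleright> w \<oplus>\<^bsub>W\<^esub> x \<triangleright> w'"
  "w \<in> carrier W \<Longrightarrow> w' \<in> carrier W \<Longrightarrow> x \<in> carrier T \<Longrightarrow> (w \<oplus>\<^bsub>W\<^esub> w') \<triangleleft> x = w \<triangleleft> x \<oplus>\<^bsub>W\<^esub> w' \<triangleleft> x"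
  using lin_add[OF lW_lin[OF lin_id]] lin_add[OF rW_lin[OF lin_id]] by simp_all

abbreviation "EO \<equiv> tensor_over A E OmA1"
abbreviation "FO \<equiv> tensor_over B F OmB1"
abbreviation "te1 e \<omega> \<equiv> tns_over A E OmA1 e \<omega>"
abbreviation "tf1 f \<eta> \<equiv> tns_over B F OmB1 f \<eta>"

lemmas mEO = tover_module[OF algA bE OA.Omega1_bimodule] and mFO = tover_module[OF algB bF OB.Omega1_bimodule]
lemmas te1_bil = tover_bil[OF algA bE OA.Omega1_bimodule] and tf1_bil = tover_bil[OF algB bF OB.Omega1_bimodule]
lemmas te1_bal = tover_bal[OF algA bE OA.Omega1_bimodule, unfolded one_forms_simps]
lemmas tf1_bal = tover_bal[OF algB bF OB.Omega1_bimodule, unfolded one_forms_simps]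
lemmas EO_ext = tover_ext[OF algA bE OA.Omega1_bimodule] and FO_ext = tover_ext[OF algB bF OB.Omega1_bimodule]
lemmas EO_tbind = tbind_tover[OF algA bE OA.Omega1_bimodule] and FO_tbind = tbind_tover[OF algB bF OB.Omega1_bimodule]
lemmas bEO = tover_bimodule[OF algA bE OA.Omega1_bimodule] and bFO = tover_bimodule[OF algB bF OB.Omega1_bimodule]

lemma te1_closed [simp]: "e \<in> carrier E \<Longrightarrow> \<omega> \<in> dga_deg OmA 1 \<Longrightarrow> te1 e \<omega> \<in> carrier EO"
  using bil_closed[OF te1_bil] by simp
lemma tf1_closed [simp]: "f \<in> carrier F \<Longrightarrow> \<eta> \<in> dga_deg OmB 1 \<Longrightarrow> tf1 f \<eta> \<in> carrier FO"
  using bil_closed[OF tf1_bil] by simp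

text \<open>The natural maps that carry the values of \<nabla>^E and \<nabla>^F into W. They are
  well defined because e a and f b can be formed inside \<open>M\<close> and moved across the tensor
  sign over \<open>D\<close>.\<close>

definition "kE u = tbind W u (\<lambda>e \<omega>. tw (iE e) (\<omega> \<bullet> \<one>\<^bsub>OmB\<^esub>))"
definition "kF u = tbind W u (\<lambda>f \<eta>. tw (iF f) (\<one>\<^bsub>OmA\<^esub> \<bullet> \<eta>))"

lemma kE_bil: "bil k E OmA1 W (\<lambda>e \<omega>. tw (iE e) (\<omega> \<bullet> \<one>\<^bsub>OmB\<^esub>))"
  by (intro bilI tw_l tw_r iE_lin lin_Om O.t_l incA) simp_all
lemma kF_bil: "bil k F OmB1 W (\<lambda>f \<eta>. tw (iF f) (\<one>\<^bsub>OmA\<^esub> \<bullet> \<eta>))"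
  by (intro bilI tw_l tw_r iF_lin lin_Om O.t_r incB) simp_all

lemma kE_bal: "e \<in> carrier E \<Longrightarrow> a \<in> carrier A \<Longrightarrow> \<omega> \<in> carrier OmA1 \<Longrightarrow>
   tw (iE (ract E e a)) (\<omega> \<bullet> \<one>\<^bsub>OmB\<^esub>) = tw (iE e) (lact OmA1 a \<omega> \<bullet> \<one>\<^bsub>OmB\<^esub>)"
  by (simp add: iE_a[symmetric] tw_bal OB.iota_one O.D_mult_simps)
lemma kF_bal: "f \<in> carrier F \<Longrightarrow> b \<in> carrier B \<Longrightarrow> \<eta> \<in> carrier OmB1 \<Longrightarrow>
   tw (iF (ract F f b)) (\<one>\<^bsub>OmA\<^esub> \<bullet> \<eta>) = tw (iF f) (\<one>\<^bsub>OmA\<^esub> \<bullet> lact OmB1 b \<eta>)"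
  by (simp add: iF_b[symmetric] tw_bal OA.iota_one O.D_mult_simps)

lemma kE_lin: "linear_map k EO W kE"
  unfolding kE_def by (rule tbind_over_lin[OF algA bE OA.Omega1_bimodule mW kE_bil kE_bal])
lemma kF_lin: "linear_map k FO W kF"
  unfolding kF_def by (rule tbind_over_lin[OF algB bF OB.Omega1_bimodule mW kF_bil kF_bal])
lemma kE_pure: "e \<in> carrier E \<Longrightarrow> \<omega> \<in> dga_deg OmA 1 \<Longrightarrow> kE (te1 e \<omega>) = tw (iE e) (\<omega> \<bullet> \<one>\<^bsub>OmB\<^esub>)"
  unfolding kE_def by (rule tbind_over_pure[OF algA bE OA.Omega1_bimodule mW kE_bil kE_bal]) simp_all
lemma kF_pure: "f \<in> carrier F \<Longrightarrow> \<eta> \<in> dga_deg OmB 1 \<Longrightarrow> kF (tf1 f \<eta>) = tw (iF f) (\<one>\<^bsub>OmA\<^esub> \<bullet> \<eta>)"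
  unfolding kF_def by (rule tbind_over_pure[OF algB bF OB.Omega1_bimodule mW kF_bil kF_bal]) simp_all

lemmas k_closed [simp] = lin_closed[OF kE_lin] lin_closed[OF kF_lin]

lemma nabE_lin: "linear_map k E EO nabE" and nabF_lin: "linear_map k F FO nabF"
  using bcE bcF by (simp_all add: bimodule_connection_def right_connection_def)
lemmas nab_closed [simp] = lin_closed[OF nabE_lin] lin_closed[OF nabF_lin]

definition "NE e = kE (nabE e)"
definition "NF f = kF (nabF f)"

lemma NE_lin: "linear_map k E W NE" unfolding NE_def by (rule lin_comp[OF kE_lin nabE_lin])
lemma NF_lin: "linear_map k F W NF" unfolding NF_def by (rule lin_comp[OF kF_lin nabF_lin])
lemmas NE_closed [simp] = lin_closed[OF NE_lin] and NF_closed [simp] = lin_closed[OF NF_lin]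

lemma kE_ract: "u \<in> carrier EO \<Longrightarrow> a \<in> carrier A \<Longrightarrow> kE (ract EO u a) = kE u \<triangleleft> jA a"
proof (rule EO_ext[OF mW])
  assume [simp]: "a \<in> carrier A"
  show "linear_map k EO W (\<lambda>u. kE (ract EO u a))"
    by (rule lin_comp[OF kE_lin ract_lin[OF algA bE OA.Omega1_bimodule]]) simp
  show "linear_map k EO W (\<lambda>u. kE u \<triangleleft> jA a)" by (intro rW_lin kE_lin) simp
qed (simp_all add: ract_pure[OF algA bE OA.Omega1_bimodule] kE_pure rW_tw O.D_mult_simps OB.iota_one)

lemma kF_ract: "u \<in> carrier FO \<Longrightarrow> b \<in> carrier B \<Longrightarrow> kF (ract FO u b) = kF u \<triangleleft> jB b"
proof (rule FO_ext[OF mW])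
  assume [simp]: "b \<in> carrier B"
  show "linear_map k FO W (\<lambda>u. kF (ract FO u b))"
    by (rule lin_comp[OF kF_lin ract_lin[OF algB bF OB.Omega1_bimodule]]) simp
  show "linear_map k FO W (\<lambda>u. kF u \<triangleleft> jB b)" by (intro rW_lin kF_lin) simp
qed (simp_all add: ract_pure[OF algB bF OB.Omega1_bimodule] kF_pure rW_tw O.D_mult_simps OA.iota_one)

lemma kE_lact: "u \<in> carrier EO \<Longrightarrow> a \<in> carrier A \<Longrightarrow> kE (lact EO a u) = jA a \<triangleright> kE u"
proof (rule EO_ext[OF mW])
  assume [simp]: "a \<in> carrier A"
  show "linear_map k EO W (\<lambda>u. kE (lact EO a u))"
    by (rule lin_comp[OF kE_lin lact_lin[OF algA bE OA.Omega1_bimodule]]) simp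
  show "linear_map k EO W (\<lambda>u. jA a \<triangleright> kE u)" by (intro lW_lin kE_lin) simp
qed (simp_all add: lact_pure[OF algA bE OA.Omega1_bimodule] kE_pure lW_tw a_iE)

lemma kF_lact: "u \<in> carrier FO \<Longrightarrow> b \<in> carrier B \<Longrightarrow> kF (lact FO b u) = jB b \<triangleright> kF u"
proof (rule FO_ext[OF mW])
  assume [simp]: "b \<in> carrier B"
  show "linear_map k FO W (\<lambda>u. kF (lact FO b u))"
    by (rule lin_comp[OF kF_lin lact_lin[OF algB bF OB.Omega1_bimodule]]) simp
  show "linear_map k FO W (\<lambda>u. jB b \<triangleright> kF u)" by (intro lW_lin kF_lin) simp
qed (simp_all add: lact_pure[OF algB bF OB.Omega1_bimodule] kF_pure lW_tw b_iF)

lemma NE_a: "e \<in> carrier E \<Longrightarrow> a \<in> carrier A \<Longrightarrow>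
   NE (ract E e a) = NE e \<triangleleft> jA a \<oplus>\<^bsub>W\<^esub> tw (iE e) (dD (jA a))"
proof -
  assume [simp]: "e \<in> carrier E" "a \<in> carrier A"
  have "nabE (ract E e a) = ract EO (nabE e) a \<oplus>\<^bsub>EO\<^esub> te1 e (OA.dd a)"
    using bcE by (simp add: bimodule_connection_def right_connection_def OA.diff_iota)
  moreover have "ract EO (nabE e) a \<in> carrier EO" using bm_ract_closed[OF bEO] by simp
  ultimately show ?thesis
    by (simp add: NE_def lin_add[OF kE_lin] kE_ract kE_pure OA.dd_deg dD_a)
qed

lemma NF_b: "f \<in> carrier F \<Longrightarrow> b \<in> carrier B \<Longrightarrow>
   NF (ract F f b) = NF f \<triangleleft> jB b \<oplus>\<^bsub>W\<^esub> tw (iF f) (dD (jB b))"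
proof -
  assume [simp]: "f \<in> carrier F" "b \<in> carrier B"
  have "nabF (ract F f b) = ract FO (nabF f) b \<oplus>\<^bsub>FO\<^esub> tf1 f (OB.dd b)"
    using bcF by (simp add: bimodule_connection_def right_connection_def OB.diff_iota)
  moreover have "ract FO (nabF f) b \<in> carrier FO" using bm_ract_closed[OF bFO] by simp
  ultimately show ?thesis
    by (simp add: NF_def lin_add[OF kF_lin] kF_ract kF_pure OB.dd_deg dD_b)
qed

abbreviation "phi a e \<equiv> \<phi> (tns_over A OmA1 E (OA.dd a) e)"
abbreviation "psi b f \<equiv> \<psi> (tns_over B OmB1 F (OB.dd b) f)"

lemma phi_bil: "bil k A E EO phi"
proof -
  note b = tover_bil[OF algA OA.Omega1_bimodule bE]
  have l: "linear_map k (tensor_over A OmA1 E) EO \<phi>"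
    using bcE by (simp add: bimodule_connection_def bimodule_hom_def)
  have "linear_map k A OmA1 OA.dd" using OA.dd_lin OA.dd_deg by (simp add: linear_map_def Pi_iff)
  then show ?thesis using OA.dd_deg by (intro bilI lin_comp[OF l] bil_l[OF b] bil_r[OF b] lin_id) simp_all
qed

lemma psi_bil: "bil k B F FO psi"
proof -
  note b = tover_bil[OF algB OB.Omega1_bimodule bF]
  have l: "linear_map k (tensor_over B OmB1 F) FO \<psi>"
    using bcF by (simp add: bimodule_connection_def bimodule_hom_def)
  have "linear_map k B OmB1 OB.dd" using OB.dd_lin OB.dd_deg by (simp add: linear_map_def Pi_iff)
  then show ?thesis using OB.dd_deg by (intro bilI lin_comp[OF l] bil_l[OF b] bil_r[OF b] lin_id) simp_all
qed

lemmas phi_closed [simp] = bil_closed[OF phi_bil] and psi_closed [simp] = bil_closed[OF psi_bil]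

lemma a_NE: "e \<in> carrier E \<Longrightarrow> a \<in> carrier A \<Longrightarrow> NE (lact E a e) = jA a \<triangleright> NE e \<oplus>\<^bsub>W\<^esub> kE (phi a e)"
proof -
  assume [simp]: "e \<in> carrier E" "a \<in> carrier A"
  have "nabE (lact E a e) = lact EO a (nabE e) \<oplus>\<^bsub>EO\<^esub> phi a e"
    using bcE by (simp add: bimodule_connection_def OA.diff_iota)
  moreover have "lact EO a (nabE e) \<in> carrier EO" using bm_lact_closed[OF bEO] by simp
  ultimately show ?thesis by (simp add: NE_def lin_add[OF kE_lin] kE_lact)
qed

lemma b_NF: "f \<in> carrier F \<Longrightarrow> b \<in> carrier B \<Longrightarrow> NF (lact F b f) = jB b \<triangleright> NF f \<oplus>\<^bsub>W\<^esub> kF (psi b f)"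
proof -
  assume [simp]: "f \<in> carrier F" "b \<in> carrier B"
  have "nabF (lact F b f) = lact FO b (nabF f) \<oplus>\<^bsub>FO\<^esub> psi b f"
    using bcF by (simp add: bimodule_connection_def OB.diff_iota)
  moreover have "lact FO b (nabF f) \<in> carrier FO" using bm_lact_closed[OF bFO] by simp
  ultimately show ?thesis by (simp add: NF_def lin_add[OF kF_lin] kF_lact)
qed

text \<open>The compatibility of \<open>\<nabla>\<^sup>E\<close> with \<open>\<tau>\<^bsub>B,E\<^esub>\<close>, read off in \<open>W\<close> through \<open>thE (u \<otimes> b) = kE u \<triangleleft> b\<close>.\<close>

definition "N1 X = tbind W X (\<lambda>e b. NE e \<triangleleft> jB b)"

lemma N1_bil: "bil k E B W (\<lambda>e b. NE e \<triangleleft> jB b)"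
  by (intro bilI rW_lin rW_lin' NE_lin t_r lin_id) simp_all
lemma N1_lin: "linear_map k EB W N1" unfolding N1_def by (rule tbind_lin[OF mE mB mW N1_bil])
lemma N1_pure: "e \<in> carrier E \<Longrightarrow> b \<in> carrier B \<Longrightarrow> N1 (tns k E B e b) = NE e \<triangleleft> jB b"
  unfolding N1_def by (rule tbind_pure[OF mE mB mW N1_bil])

abbreviation "WE \<equiv> tensor k EO B"
lemmas mWE = tensor_module[OF mEO mB]
lemmas we_l = bil_l[OF tns_bil[OF mEO mB]] and we_r = bil_r[OF tns_bil[OF mEO mB]]

definition "thE Z = tbind W Z (\<lambda>u b. kE u \<triangleleft> jB b)"
lemma thE_bil: "bil k EO B W (\<lambda>u b. kE u \<triangleleft> jB b)"
  by (intro bilI rW_lin rW_lin' kE_lin t_r lin_id) simp_all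
lemma thE_lin: "linear_map k WE W thE" unfolding thE_def by (rule tbind_lin[OF mEO mB mW thE_bil])
lemma thE_pure: "u \<in> carrier EO \<Longrightarrow> b \<in> carrier B \<Longrightarrow> thE (tns k EO B u b) = kE u \<triangleleft> jB b"
  unfolding thE_def by (rule tbind_pure[OF mEO mB mW thE_bil])

text \<open>\<open>Psi\<close> and \<open>Phi\<close> are the two inner sums on the right side of
  the condition on \<nabla>^E, made linear in their tensor arguments.\<close>

definition "Psi e Z = tbind WE Z (\<lambda>\<omega> b. tns k EO B (te1 e \<omega>) b)"
lemma Psi_bil0: "e \<in> carrier E \<Longrightarrow> bil k OmA1 B WE (\<lambda>\<omega> b. tns k EO B (te1 e \<omega>) b)"
  by (intro bilI we_l we_r bil_r[OF te1_bil] lin_id) simp_all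
lemma Psi_lin: "e \<in> carrier E \<Longrightarrow> linear_map k TL WE (Psi e)"
  unfolding Psi_def by (rule tbind_lin[OF mOA1 mB mWE Psi_bil0])
lemma Psi_lin': "Z \<in> carrier TL \<Longrightarrow> linear_map k E WE (\<lambda>e. Psi e Z)"
  unfolding Psi_def
  by (rule tbind_lin_param[OF mOA1 mB _ mWE mE Psi_bil0]) (simp_all add: we_l bil_l[OF te1_bil lin_id])
lemma Psi_pure: "e \<in> carrier E \<Longrightarrow> \<omega> \<in> dga_deg OmA 1 \<Longrightarrow> b \<in> carrier B \<Longrightarrow>
   Psi e (tns k OmA1 B \<omega> b) = tns k EO B (te1 e \<omega>) b"
  unfolding Psi_def by (rule tbind_pure[OF mOA1 mB mWE Psi_bil0]) simp_all

definition "Phi Y \<omega> = tbind WE Y (\<lambda>e b. Psi e (Rt_left k A B Rt b \<omega>))"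
lemma Phi_bil0: "\<omega> \<in> dga_deg OmA 1 \<Longrightarrow> bil k E B WE (\<lambda>e b. Psi e (Rt_left k A B Rt b \<omega>))"
  by (intro bilI Psi_lin' lin_comp[OF Psi_lin] bil_l[OF Rt_left_bil lin_id]) (simp_all add: Rt_left_closed)
lemma Phi_lin: "\<omega> \<in> dga_deg OmA 1 \<Longrightarrow> linear_map k EB WE (\<lambda>Y. Phi Y \<omega>)"
  unfolding Phi_def by (rule tbind_lin[OF mE mB mWE Phi_bil0])
lemma Phi_lin': "Y \<in> carrier EB \<Longrightarrow> linear_map k OmA1 WE (Phi Y)"
  unfolding Phi_def
  by (rule tbind_lin_param[OF mE mB _ mWE mOA1 Phi_bil0])
    (simp_all add: lin_comp[OF Psi_lin] bil_r[OF Rt_left_bil lin_id])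
lemma Phi_pure: "e \<in> carrier E \<Longrightarrow> \<omega> \<in> dga_deg OmA 1 \<Longrightarrow> b \<in> carrier B \<Longrightarrow>
   Phi (tns k E B e b) \<omega> = Psi e (Rt_left k A B Rt b \<omega>)"
  unfolding Phi_def by (rule tbind_pure[OF mE mB mWE Phi_bil0]) simp_all

lemma thE_Psi: "e \<in> carrier E \<Longrightarrow> Z \<in> carrier TL \<Longrightarrow> hl Z \<in> dga_deg G 1 \<and> thE (Psi e Z) = tw (iE e) (hl Z)"
proof -
  assume e [simp]: "e \<in> carrier E" and Z: "Z \<in> carrier TL"
  have d: "hl Z \<in> dga_deg G 1" if "Z \<in> carrier TL" for Z
    using that
  proof (induction rule: tensor_induct[OF mOA1 mB, consumes 1, case_names pure diff])
    case (diff X Y) then show ?case by (simp add: lin_diff[OF mTL O.mT hl_lin] dga_deg_diff)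
  qed (simp add: hl_pure)
  have "thE (Psi e Z) = tw (iE e) (hl Z)"
  proof (rule tensor_ext[OF mOA1 mB mW lin_comp[OF thE_lin Psi_lin] tw_r _ Z])
    show "linear_map k TL Om hl" by (rule lin_Om[OF hl_lin d])
  qed (simp_all add: Psi_pure thE_pure kE_pure hl_pure rW_tw OA.iota_one O.D_mult_simps)
  then show ?thesis using d[OF Z] by simp
qed

text \<open>In W the inner sums collapse: twisting \<omega> past b gives the product b \<omega>, and
  b crosses the tensor sign over \<open>D\<close> back to e.\<close>

lemma thE_Phi: "Y \<in> carrier EB \<Longrightarrow> \<omega> \<in> dga_deg OmA 1 \<Longrightarrow> thE (Phi Y \<omega>) = tw (Y, \<zero>\<^bsub>AF\<^esub>) (\<omega> \<bullet> \<one>\<^bsub>OmB\<^esub>)"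
proof (rule tensor_ext[OF mE mB mW])
  assume w [simp]: "\<omega> \<in> dga_deg OmA 1"
  show "linear_map k EB W (\<lambda>Y. thE (Phi Y \<omega>))" by (rule lin_comp[OF thE_lin Phi_lin]) simp
  show "linear_map k EB W (\<lambda>Y. tw (Y, \<zero>\<^bsub>AF\<^esub>) (\<omega> \<bullet> \<one>\<^bsub>OmB\<^esub>))" by (intro tw_l inl_lin) simp
  fix e b assume [simp]: "e \<in> carrier E" "b \<in> carrier B"
  show "thE (Phi (tns k E B e b) \<omega>) = tw (tns k E B e b, \<zero>\<^bsub>AF\<^esub>) (\<omega> \<bullet> \<one>\<^bsub>OmB\<^esub>)"
    using thE_Psi[of e "Rt_left k A B Rt b \<omega>"]
    by (simp add: Phi_pure Rt_left_closed hl_Rt_left iE_b[symmetric] tw_bal OA.iota_one)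
qed

lemma Psi_mulL: "e \<in> carrier E \<Longrightarrow> a \<in> carrier A \<Longrightarrow> Z \<in> carrier TL \<Longrightarrow> Psi (ract E e a) Z = Psi e (mulL a Z)"
  by (rule tensor_ext[OF mOA1 mB mWE Psi_lin lin_comp[OF Psi_lin mulL_lin]])
    (simp_all add: Psi_pure mulL_pure te1_bal)

text \<open>This is the balancing over \<open>A\<close> that allows the outer sum to be taken over a
  representative of \<nabla>^E e; it combines \<open>Rt_left_act\<close> with the balancing of E
  \<otimes> \<Omega>^1 A.\<close>

lemma Phi_ract:
  assumes Y: "Y \<in> carrier EB" and [simp]: "a \<in> carrier A" "\<omega> \<in> dga_deg OmA 1"
  shows "Phi (rE.act Y (jA a)) \<omega> = Phi Y (\<iota>A a \<otimes>\<^bsub>OmA\<^esub> \<omega>)"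
proof (rule tensor_ext[OF mE mB mWE _ _ _ Y])
  show "linear_map k EB WE (\<lambda>Y. Phi (rE.act Y (jA a)) \<omega>)"
    by (intro lin_comp[OF Phi_lin] bil_l[OF rE.act_bil lin_id]) simp_all
  show "linear_map k EB WE (\<lambda>Y. Phi Y (\<iota>A a \<otimes>\<^bsub>OmA\<^esub> \<omega>))" by (rule Phi_lin) simp
  fix e b assume [simp]: "e \<in> carrier E" "b \<in> carrier B"
  have "Phi (rE.tcore e \<one>\<^bsub>B\<^esub> V) \<omega> = Psi e (tbind TL V (\<lambda>a' b'. mulL a' (Rt_left k A B Rt b' \<omega>)))" if "V \<in> carrier T" for V
  proof (rule tensor_ext[OF mA mB mWE lin_comp[OF Phi_lin rE.tcore_lin] lin_comp[OF Psi_lin tbind_lin[OF mA mB mTL Rt_left_act_bil]] _ that])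
    fix a' b' assume [simp]: "a' \<in> carrier A" "b' \<in> carrier B"
    show "Phi (rE.tcore e \<one>\<^bsub>B\<^esub> (a' \<cdot> b')) \<omega> = Psi e (tbind TL (a' \<cdot> b') (\<lambda>a' b'. mulL a' (Rt_left k A B Rt b' \<omega>)))"
      by (simp add: rE.tcore_pure Phi_pure tbind_pure[OF mA mB mTL Rt_left_act_bil] Psi_mulL Rt_left_closed)
  qed simp_all
  then show "Phi (rE.act (tns k E B e b) (jA a)) \<omega> = Phi (tns k E B e b) (\<iota>A a \<otimes>\<^bsub>OmA\<^esub> \<omega>)"
    by (simp add: rE.act_pure Phi_pure Rt_left_act)
qed

text \<open>A left module twisting map is tied to the left action on E only. Its behaviour under the
  right action is the commutation of left and right actions on \<open>M\<close>: b (e a) = (b e)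
  a.\<close>

lemma te_ract: "e \<in> carrier E \<Longrightarrow> a \<in> carrier A \<Longrightarrow> b \<in> carrier B \<Longrightarrow> te b (ract E e a) = rE.act (te b e) (jA a)"
  using M_acts(3)[of "jB b" "jA a" "iE e"] b_iE[of "ract E e a" b] by (simp add: iE_a b_iE M_simps(6))

text \<open>The map \<open>thE\<close> is applied to the condition on \<nabla>^E: the left side
  turns into N(b e), the right side into b N(e).\<close>

lemma N1_te:
  assumes e [simp]: "e \<in> carrier E" and b [simp]: "b \<in> carrier B"
  shows "N1 (te b e) = jB b \<triangleright> NE e"
proof -
  let ?g = "\<lambda>e1 \<omega>. Phi (te b e1) \<omega>"
  have g: "bil k E OmA1 WE ?g"
    by (intro bilI Phi_lin' lin_comp[OF Phi_lin] bil_r[OF te_bil lin_id]) simp_all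
  have bal: "?g (ract E e1 a) \<omega> = ?g e1 (lact OmA1 a \<omega>)" if "e1 \<in> carrier E" "a \<in> carrier A" "\<omega> \<in> carrier OmA1" for e1 a \<omega>
    using that by (simp add: te_ract Phi_ract)
  have 1: "tbind WE (te b e) (\<lambda>e1 b1. tns k EO B (nabE e1) b1) = tbind WE (nabE e) ?g"
    using compatE[unfolded Let_def, rule_format, OF b e] by (simp add: Phi_def Psi_def)
  have 2: "thE (tbind WE (nabE e) ?g) = jB b \<triangleright> NE e"
  proof -
    have "thE (tbind WE u ?g) = jB b \<triangleright> kE u" if "u \<in> carrier EO" for u
    proof (rule EO_ext[OF mW _ _ _ that])
      show "linear_map k EO W (\<lambda>u. thE (tbind WE u ?g))"
        by (rule lin_comp[OF thE_lin tbind_over_lin[OF algA bE OA.Omega1_bimodule mWE g bal]])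
      show "linear_map k EO W (\<lambda>u. jB b \<triangleright> kE u)" by (intro lW_lin kE_lin) simp
      fix e1 \<omega> assume [simp]: "e1 \<in> carrier E" and "\<omega> \<in> carrier OmA1"
      then have [simp]: "\<omega> \<in> dga_deg OmA 1" by simp
      have "tbind WE (te1 e1 \<omega>) ?g = ?g e1 \<omega>"
        by (rule tbind_over_pure[OF algA bE OA.Omega1_bimodule mWE g bal]) simp_all
      then show "thE (tbind WE (te1 e1 \<omega>) ?g) = jB b \<triangleright> kE (te1 e1 \<omega>)"
        by (simp add: thE_Phi kE_pure lW_tw b_iE)
    qed
    then show ?thesis by (simp add: NE_def)
  qed
  have 3: "thE (tbind WE Y (\<lambda>e1 b1. tns k EO B (nabE e1) b1)) = N1 Y" if "Y \<in> carrier EB" for Y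
  proof -
    have bl: "bil k E B WE (\<lambda>e1 b1. tns k EO B (nabE e1) b1)"
      by (intro bilI we_l we_r nabE_lin lin_id) simp_all
    show ?thesis
      by (rule tensor_ext[OF mE mB mW lin_comp[OF thE_lin tbind_lin[OF mE mB mWE bl]] N1_lin _ that])
        (simp add: tbind_pure[OF mE mB mWE bl] thE_pure N1_pure NE_def)
  qed
  show ?thesis using 3[OF te_closed[OF b e]] unfolding 1 2 by (rule sym)
qed


section \<open>The condition on \<nabla>^F read in W\<close>

definition "N2 Y = tbind W Y (\<lambda>a f. jA a \<triangleright> NF f)"

lemma N2_bil: "bil k A F W (\<lambda>a f. jA a \<triangleright> NF f)"
  by (intro bilI lW_lin lW_lin' NF_lin t_l lin_id) simp_all
lemma N2_lin: "linear_map k AF W N2" unfolding N2_def by (rule tbind_lin[OF mA mF mW N2_bil])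
lemma N2_pure: "a \<in> carrier A \<Longrightarrow> f \<in> carrier F \<Longrightarrow> N2 (tns k A F a f) = jA a \<triangleright> NF f"
  unfolding N2_def by (rule tbind_pure[OF mA mF mW N2_bil])

abbreviation "WF \<equiv> tensor k A FO"
lemmas mWF = tensor_module[OF mA mFO]
lemmas wf_l = bil_l[OF tns_bil[OF mA mFO]] and wf_r = bil_r[OF tns_bil[OF mA mFO]]

definition "thF Z = tbind W Z (\<lambda>a u. jA a \<triangleright> kF u)"
lemma thF_bil: "bil k A FO W (\<lambda>a u. jA a \<triangleright> kF u)"
  by (intro bilI lW_lin lW_lin' kF_lin t_l lin_id) simp_all
lemma thF_lin: "linear_map k WF W thF" unfolding thF_def by (rule tbind_lin[OF mA mFO mW thF_bil])
lemma thF_pure: "u \<in> carrier FO \<Longrightarrow> a \<in> carrier A \<Longrightarrow> thF (tns k A FO a u) = jA a \<triangleright> kF u"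
  unfolding thF_def by (rule tbind_pure[OF mA mFO mW thF_bil])

text \<open>With \<open>Hh\<close>, the inner sums of the condition on \<nabla>^F: \<eta> is twisted
  past a first, and then f past the result.\<close>

definition "Kap Y \<eta> = tbind WF Y (\<lambda>a f. tns k A FO a (tf1 f \<eta>))"
lemma Kap_bil0: "\<eta> \<in> dga_deg OmB 1 \<Longrightarrow> bil k A F WF (\<lambda>a f. tns k A FO a (tf1 f \<eta>))"
  by (intro bilI wf_l wf_r bil_l[OF tf1_bil] lin_id) simp_all
lemma Kap_lin: "\<eta> \<in> dga_deg OmB 1 \<Longrightarrow> linear_map k AF WF (\<lambda>Y. Kap Y \<eta>)"
  unfolding Kap_def by (rule tbind_lin[OF mA mF mWF Kap_bil0])
lemma Kap_lin': "Y \<in> carrier AF \<Longrightarrow> linear_map k OmB1 WF (Kap Y)"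
  unfolding Kap_def
  by (rule tbind_lin_param[OF mA mF _ mWF mOB1 Kap_bil0]) (simp_all add: wf_r bil_r[OF tf1_bil lin_id])
lemma Kap_pure: "a \<in> carrier A \<Longrightarrow> f \<in> carrier F \<Longrightarrow> \<eta> \<in> dga_deg OmB 1 \<Longrightarrow>
   Kap (tns k A F a f) \<eta> = tns k A FO a (tf1 f \<eta>)"
  unfolding Kap_def by (rule tbind_pure[OF mA mF mWF Kap_bil0])

definition "Hh f Z = tbind WF Z (\<lambda>a \<eta>. Kap (tf f a) \<eta>)"
lemma Hh_bil0: "f \<in> carrier F \<Longrightarrow> bil k A OmB1 WF (\<lambda>a \<eta>. Kap (tf f a) \<eta>)"
  by (intro bilI Kap_lin' lin_comp[OF Kap_lin] bil_r[OF tf_bil lin_id]) simp_all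
lemma Hh_lin: "f \<in> carrier F \<Longrightarrow> linear_map k TR WF (Hh f)"
  unfolding Hh_def by (rule tbind_lin[OF mA mOB1 mWF Hh_bil0])
lemma Hh_lin': "Z \<in> carrier TR \<Longrightarrow> linear_map k F WF (\<lambda>f. Hh f Z)"
  unfolding Hh_def
  by (rule tbind_lin_param[OF mA mOB1 _ mWF mF Hh_bil0])
    (simp_all add: lin_comp[OF Kap_lin] bil_l[OF tf_bil lin_id])
lemma Hh_pure: "a \<in> carrier A \<Longrightarrow> f \<in> carrier F \<Longrightarrow> \<eta> \<in> dga_deg OmB 1 \<Longrightarrow>
   Hh f (tns k A OmB1 a \<eta>) = Kap (tf f a) \<eta>"
  unfolding Hh_def by (rule tbind_pure[OF mA mOB1 mWF Hh_bil0]) simp_all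

lemma thF_Kap: "Y \<in> carrier AF \<Longrightarrow> \<eta> \<in> dga_deg OmB 1 \<Longrightarrow> thF (Kap Y \<eta>) = tw (\<zero>\<^bsub>EB\<^esub>, Y) (\<one>\<^bsub>OmA\<^esub> \<bullet> \<eta>)"
proof (rule tensor_ext[OF mA mF mW])
  assume w [simp]: "\<eta> \<in> dga_deg OmB 1"
  show "linear_map k AF W (\<lambda>Y. thF (Kap Y \<eta>))" by (rule lin_comp[OF thF_lin Kap_lin]) simp
  show "linear_map k AF W (\<lambda>Y. tw (\<zero>\<^bsub>EB\<^esub>, Y) (\<one>\<^bsub>OmA\<^esub> \<bullet> \<eta>))" by (intro tw_l inr_lin) simp
qed (simp_all add: Kap_pure thF_pure kF_pure lW_tw a_iF)

lemma thF_Hh: "f \<in> carrier F \<Longrightarrow> Z \<in> carrier TR \<Longrightarrow> thF (Hh f Z) = tw (iF f) (hr Z)"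
proof -
  assume f [simp]: "f \<in> carrier F" and Z: "Z \<in> carrier TR"
  have d: "hr Z \<in> dga_deg G 1" if "Z \<in> carrier TR" for Z
    using that
  proof (induction rule: tensor_induct[OF mA mOB1, consumes 1, case_names pure diff])
    case (diff X Y) then show ?case by (simp add: lin_diff[OF mTR O.mT hr_lin] dga_deg_diff)
  qed (simp add: hr_pure)
  show "thF (Hh f Z) = tw (iF f) (hr Z)"
  proof (rule tensor_ext[OF mA mOB1 mW lin_comp[OF thF_lin Hh_lin] tw_r _ Z])
    show "linear_map k TR Om hr" by (rule lin_Om[OF hr_lin d])
    fix a \<eta> assume [simp]: "a \<in> carrier A" and "\<eta> \<in> carrier OmB1"
    then have [simp]: "\<eta> \<in> dga_deg OmB 1" by simp
    show "thF (Hh f (tns k A OmB1 a \<eta>)) = tw (iF f) (hr (tns k A OmB1 a \<eta>))"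
      by (simp add: Hh_pure thF_Kap hr_pure iF_a[symmetric] tw_bal OB.iota_one O.D_mult_simps)
  qed simp_all
qed

text \<open>Balancing over \<open>B\<close>. By the module axiom of \<open>\<tau>FA\<close>, moving
  f b past a moves b past a with \<open>R\<close> first, and \<open>mulR\<close> twists b past the
  first factor in the same way.\<close>

lemma Hh_mulR:
  assumes [simp]: "f \<in> carrier F" "b \<in> carrier B" and Z: "Z \<in> carrier TR"
  shows "Hh (ract F f b) Z = Hh f (mulR b Z)"
proof (rule tensor_ext[OF mA mOB1 mWF Hh_lin lin_comp[OF Hh_lin mulR_lin] _ Z])
  fix a \<eta> assume a [simp]: "a \<in> carrier A" and "\<eta> \<in> carrier OmB1"
  then have [simp]: "\<eta> \<in> dga_deg OmB 1" by simp
  have fb: "bil k A F AF (\<lambda>a2 f2. tns k A F a2 (ract F f2 b'))" if "b' \<in> carrier B" for b'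
    using that
    by (intro bilI bil_l[OF tns_bil[OF mA mF]] bil_r[OF tns_bil[OF mA mF]] bil_l[OF ract_bil[OF bF]] lin_id) simp_all
  \<comment> \<open>The element of \<open>B\<close> left behind by \<open>R\<close> acts on the
    twisted f; balancing over \<open>B\<close> hands it to \<eta>.\<close>
  have t: "Kap (tbind AF Y (\<lambda>a2 f2. tns k A F a2 (ract F f2 b'))) \<eta> = Kap Y (\<iota>B b' \<otimes>\<^bsub>OmB\<^esub> \<eta>)"
    if Y: "Y \<in> carrier AF" and b': "b' \<in> carrier B" for Y b'
  proof (rule tensor_ext[OF mA mF mWF lin_comp[OF Kap_lin tbind_lin[OF mA mF mAF fb[OF b']]] Kap_lin _ Y])
    fix a2 f2 assume [simp]: "a2 \<in> carrier A" "f2 \<in> carrier F"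
    show "Kap (tbind AF (tns k A F a2 f2) (\<lambda>a2 f2. tns k A F a2 (ract F f2 b'))) \<eta> =
        Kap (tns k A F a2 f2) (\<iota>B b' \<otimes>\<^bsub>OmB\<^esub> \<eta>)"
      using b' by (simp add: tbind_pure[OF mA mF mAF fb[OF b']] Kap_pure tf1_bal)
  qed (use b' in simp_all)
  have "tf (ract F f b) a = tbind AF (rr b a) (\<lambda>a1 b1. tbind AF (tf f a1) (\<lambda>a2 f2. tns k A F a2 (ract F f2 b1)))"
    using twF by (simp add: right_module_twisting_map_def)
  moreover have ob: "bil k A B AF (\<lambda>a1 b1. tbind AF (tf f a1) (\<lambda>a2 f2. tns k A F a2 (ract F f2 b1)))"
  proof (intro bilI)
    fix a1 assume [simp]: "a1 \<in> carrier A"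
    show "linear_map k B AF (\<lambda>b1. tbind AF (tf f a1) (\<lambda>a2 f2. tns k A F a2 (ract F f2 b1)))"
      by (rule tbind_lin_param[OF mA mF _ mAF mB fb])
        (simp_all add: bil_r[OF tns_bil[OF mA mF]] bil_r[OF ract_bil[OF bF] lin_id])
  next
    fix b1 assume [simp]: "b1 \<in> carrier B"
    show "linear_map k A AF (\<lambda>a1. tbind AF (tf f a1) (\<lambda>a2 f2. tns k A F a2 (ract F f2 b1)))"
      by (intro lin_comp[OF tbind_lin[OF mA mF mAF fb]] bil_r[OF tf_bil lin_id]) simp_all
  qed
  moreover have "Kap (tbind AF V (\<lambda>a1 b1. tbind AF (tf f a1) (\<lambda>a2 f2. tns k A F a2 (ract F f2 b1)))) \<eta> =
      Hh f (tbind TR V (\<lambda>a' b'. tns k A OmB1 a' (\<iota>B b' \<otimes>\<^bsub>OmB\<^esub> \<eta>)))" if V: "V \<in> carrier T" for V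
  proof (rule tensor_ext[OF mA mB mWF lin_comp[OF Kap_lin tbind_lin[OF mA mB mAF ob]]
        lin_comp[OF Hh_lin tbind_lin[OF mA mB mTR mulR_inner]] _ V])
    fix a1 b1 assume [simp]: "a1 \<in> carrier A" "b1 \<in> carrier B"
    show "Kap (tbind AF (a1 \<cdot> b1) (\<lambda>a1 b1. tbind AF (tf f a1) (\<lambda>a2 f2. tns k A F a2 (ract F f2 b1)))) \<eta> =
      Hh f (tbind TR (a1 \<cdot> b1) (\<lambda>a' b'. tns k A OmB1 a' (\<iota>B b' \<otimes>\<^bsub>OmB\<^esub> \<eta>)))"
      by (simp add: tbind_pure[OF mA mB mAF ob] tbind_pure[OF mA mB mTR mulR_inner] t Hh_pure)
  qed simp_all
  ultimately show "Hh (ract F f b) (tns k A OmB1 a \<eta>) = Hh f (mulR b (tns k A OmB1 a \<eta>))"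
    by (simp add: Hh_pure mulR_pure)
qed simp_all

text \<open>Here \<open>thF\<close> plays the role that \<open>thE\<close> has for E: it turns the
  condition on \<nabla>^F into N(f a) = N(f) a.\<close>

lemma N2_tf:
  assumes f [simp]: "f \<in> carrier F" and a [simp]: "a \<in> carrier A"
  shows "N2 (tf f a) = NF f \<triangleleft> jA a"
proof -
  let ?g = "\<lambda>f1 \<eta>. Hh f1 (Rt_right k A B Rt \<eta> a)"
  have g: "bil k F OmB1 WF ?g"
    by (intro bilI Hh_lin' lin_comp[OF Hh_lin] bil_l[OF Rt_right_bil lin_id]) (simp_all add: Rt_right_closed)
  have bal: "?g (ract F f1 b) \<eta> = ?g f1 (lact OmB1 b \<eta>)" if "f1 \<in> carrier F" "b \<in> carrier B" "\<eta> \<in> carrier OmB1" for f1 b \<eta>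
    using that by (simp add: Hh_mulR Rt_right_act Rt_right_closed)
  have 1: "tbind WF (tf f a) (\<lambda>a1 f1. tns k A FO a1 (nabF f1)) = tbind WF (nabF f) ?g"
    using compatF[unfolded Let_def, rule_format, OF f a] by (simp add: Hh_def Kap_def)
  have 2: "thF (tbind WF (nabF f) ?g) = NF f \<triangleleft> jA a"
  proof -
    have "thF (tbind WF u ?g) = kF u \<triangleleft> jA a" if "u \<in> carrier FO" for u
    proof (rule FO_ext[OF mW _ _ _ that])
      show "linear_map k FO W (\<lambda>u. thF (tbind WF u ?g))"
        by (rule lin_comp[OF thF_lin tbind_over_lin[OF algB bF OB.Omega1_bimodule mWF g bal]])
      show "linear_map k FO W (\<lambda>u. kF u \<triangleleft> jA a)" by (intro rW_lin kF_lin) simp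
      fix f1 \<eta> assume [simp]: "f1 \<in> carrier F" and "\<eta> \<in> carrier OmB1"
      then have [simp]: "\<eta> \<in> dga_deg OmB 1" by simp
      have "tbind WF (tf1 f1 \<eta>) ?g = ?g f1 \<eta>"
        by (rule tbind_over_pure[OF algB bF OB.Omega1_bimodule mWF g bal]) simp_all
      then show "thF (tbind WF (tf1 f1 \<eta>) ?g) = kF (tf1 f1 \<eta>) \<triangleleft> jA a"
        by (simp add: thF_Hh Rt_right_closed hr_Rt_right kF_pure rW_tw OB.iota_one)
    qed
    then show ?thesis by (simp add: NF_def)
  qed
  have 3: "thF (tbind WF Y (\<lambda>a1 f1. tns k A FO a1 (nabF f1))) = N2 Y" if "Y \<in> carrier AF" for Y
  proof -
    have bl: "bil k A F WF (\<lambda>a1 f1. tns k A FO a1 (nabF f1))"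
      by (intro bilI wf_l wf_r nabF_lin lin_id) simp_all
    show ?thesis
      by (rule tensor_ext[OF mA mF mW lin_comp[OF thF_lin tbind_lin[OF mA mF mWF bl]] N2_lin _ that])
        (simp add: tbind_pure[OF mA mF mWF bl] thF_pure N2_pure NF_def)
  qed
  show ?thesis using 3[OF tf_closed[OF f a]] unfolding 1 2 by (rule sym)
qed

end

section \<open>The Leibniz rule of the product connection\<close>

context product
begin

declare J_pure [simp del]

interpretation M: Module.module k M by (rule mM)
interpretation W: Module.module k W by (rule mW)

abbreviation "FA \<equiv> tensor k F A"
lemmas mFA = tensor_module[OF mF mA]
abbreviation "\<sigma> \<equiv> inv_into (carrier FA) \<tau>FA"

lemma sigma_tau [simp]: "V \<in> carrier FA \<Longrightarrow> \<sigma> (\<tau>FA V) = V"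
  using tauF_bij by (simp add: bij_betw_def)
lemma tau_sigma [simp]: "Y \<in> carrier AF \<Longrightarrow> \<tau>FA (\<sigma> Y) = Y"
  using tauF_bij by (auto simp: bij_betw_def f_inv_into_f)
lemma sigma_closed [simp]: "Y \<in> carrier AF \<Longrightarrow> \<sigma> Y \<in> carrier FA"
  using tauF_bij by (auto simp: bij_betw_def intro: inv_into_into)

lemma sigma_lin: "linear_map k AF FA \<sigma>"
proof (rule linI)
  interpret AF: Module.module k AF by (rule mAF)
  interpret FA: Module.module k FA by (rule mFA)
  have inj: "U = V" if "\<tau>FA U = \<tau>FA V" "U \<in> carrier FA" "V \<in> carrier FA" for U V
    using tauF_bij that by (auto simp: bij_betw_def dest: inj_onD)
  fix X assume X: "X \<in> carrier AF"
  { fix Y assume Y: "Y \<in> carrier AF"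
    show "\<sigma> (X \<oplus>\<^bsub>AF\<^esub> Y) = \<sigma> X \<oplus>\<^bsub>FA\<^esub> \<sigma> Y"
      by (rule inj) (use X Y in \<open>simp_all add: lin_add[OF tauF_lin]\<close>) }
  fix c assume c: "c \<in> carrier k"
  show "\<sigma> (c \<odot>\<^bsub>AF\<^esub> X) = c \<odot>\<^bsub>FA\<^esub> \<sigma> X"
    by (rule inj) (use X c in \<open>simp_all add: lin_smult[OF tauF_lin]\<close>)
qed simp

text \<open>\<open>L2\<close> is defined on F \<otimes> A, where an element reads f a and the
  coefficient to be differentiated stands on the right; on A \<otimes> F it is preceded by
  \<sigma>.\<close>

definition "L1 X = tbind W X (\<lambda>e b. tw (iE e) (dD (jB b)))"
definition "L2 V = tbind W V (\<lambda>f a. tw (iF f) (dD (jA a)))"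

lemma L1_bil: "bil k E B W (\<lambda>e b. tw (iE e) (dD (jB b)))"
  by (intro bilI tw_l tw_r iE_lin lin_comp[OF dD_lin_Om] t_r lin_id) simp_all
lemma L2_bil: "bil k F A W (\<lambda>f a. tw (iF f) (dD (jA a)))"
  by (intro bilI tw_l tw_r iF_lin lin_comp[OF dD_lin_Om] t_l lin_id) simp_all
lemma L1_lin: "linear_map k EB W L1" unfolding L1_def by (rule tbind_lin[OF mE mB mW L1_bil])
lemma L2_lin: "linear_map k FA W L2" unfolding L2_def by (rule tbind_lin[OF mF mA mW L2_bil])
lemma L1_pure: "e \<in> carrier E \<Longrightarrow> b \<in> carrier B \<Longrightarrow> L1 (tns k E B e b) = tw (iE e) (dD (jB b))"
  unfolding L1_def by (rule tbind_pure[OF mE mB mW L1_bil])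
lemma L2_pure: "f \<in> carrier F \<Longrightarrow> a \<in> carrier A \<Longrightarrow> L2 (tns k F A f a) = tw (iF f) (dD (jA a))"
  unfolding L2_def by (rule tbind_pure[OF mF mA mW L2_bil])

text \<open>The resulting \<open>c\<close> is the product connection with its nested sums replaced
  by linear maps; \<open>connection_eq\<close> identifies the two.\<close>

definition "N m = N1 (fst m) \<oplus>\<^bsub>W\<^esub> N2 (snd m)"
definition "L m = L1 (fst m) \<oplus>\<^bsub>W\<^esub> L2 (\<sigma> (snd m))"
definition "c m = N m \<oplus>\<^bsub>W\<^esub> L m"

lemma fst_lin: "linear_map k M EB fst" and snd_lin: "linear_map k M AF snd"
  by (auto intro!: linI simp: M_simps)

lemma N_lin: "linear_map k M W N"
  unfolding N_def by (intro lin_sum[OF mW] lin_comp[OF N1_lin] lin_comp[OF N2_lin] fst_lin snd_lin)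
lemma L_lin: "linear_map k M W L"
  unfolding L_def by (intro lin_sum[OF mW] lin_comp[OF L1_lin] lin_comp[OF L2_lin] lin_comp[OF sigma_lin] fst_lin snd_lin)
lemma c_lin: "linear_map k M W c"
  unfolding c_def by (intro lin_sum[OF mW] N_lin L_lin)
lemmas NLc_closed [simp] = lin_closed[OF N_lin] lin_closed[OF L_lin] lin_closed[OF c_lin]

lemma inl_values: "X \<in> carrier EB \<Longrightarrow> N (X, \<zero>\<^bsub>AF\<^esub>) = N1 X" "X \<in> carrier EB \<Longrightarrow> L (X, \<zero>\<^bsub>AF\<^esub>) = L1 X"
  using lin_zero[OF mAF mW N2_lin] lin_zero[OF mAF mW lin_comp[OF L2_lin sigma_lin]]
  by (simp_all add: N_def L_def lin_closed[OF N1_lin] lin_closed[OF L1_lin])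
lemma inr_values: "Y \<in> carrier AF \<Longrightarrow> N (\<zero>\<^bsub>EB\<^esub>, Y) = N2 Y" "Y \<in> carrier AF \<Longrightarrow> L (\<zero>\<^bsub>EB\<^esub>, Y) = L2 (\<sigma> Y)"
  using lin_zero[OF mEB mW N1_lin] lin_zero[OF mEB mW L1_lin]
  by (simp_all add: N_def L_def lin_closed[OF N2_lin] lin_closed[OF L2_lin])

lemma FA_closed [simp]: "f \<in> carrier F \<Longrightarrow> a \<in> carrier A \<Longrightarrow> tns k F A f a \<in> carrier FA"
  by (rule tns_closed[OF mF mA])

text \<open>The values on e b and a f hold by definition; those on b e and f a are the two
  compatibility conditions of the given connections.\<close>

lemma N_values:
  "e \<in> carrier E \<Longrightarrow> b \<in> carrier B \<Longrightarrow> N (iE e \<lhd> jB b) = NE e \<triangleleft> jB b"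
  "e \<in> carrier E \<Longrightarrow> b \<in> carrier B \<Longrightarrow> N (jB b \<rhd> iE e) = jB b \<triangleright> NE e"
  "f \<in> carrier F \<Longrightarrow> a \<in> carrier A \<Longrightarrow> N (iF f \<lhd> jA a) = NF f \<triangleleft> jA a"
  "f \<in> carrier F \<Longrightarrow> a \<in> carrier A \<Longrightarrow> N (jA a \<rhd> iF f) = jA a \<triangleright> NF f"
  by (simp_all add: iE_b b_iE iF_a a_iF inl_values inr_values N1_pure N1_te N2_tf N2_pure)

lemma L_values:
  "e \<in> carrier E \<Longrightarrow> b \<in> carrier B \<Longrightarrow> L (iE e \<lhd> jB b) = tw (iE e) (dD (jB b))"
  "f \<in> carrier F \<Longrightarrow> a \<in> carrier A \<Longrightarrow> L (iF f \<lhd> jA a) = tw (iF f) (dD (jA a))"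
  by (simp_all add: iE_b iF_a inl_values inr_values L1_pure L2_pure)

lemma c_values:
  "e \<in> carrier E \<Longrightarrow> b \<in> carrier B \<Longrightarrow> c (iE e \<lhd> jB b) = NE e \<triangleleft> jB b \<oplus>\<^bsub>W\<^esub> tw (iE e) (dD (jB b))"
  "f \<in> carrier F \<Longrightarrow> a \<in> carrier A \<Longrightarrow> c (iF f \<lhd> jA a) = NF f \<triangleleft> jA a \<oplus>\<^bsub>W\<^esub> tw (iF f) (dD (jA a))"
  by (simp_all add: c_def N_values L_values)

lemma tw_zero: "m \<in> carrier M \<Longrightarrow> tw m \<zero>\<^bsub>O.T\<^esub> = \<zero>\<^bsub>W\<^esub>"
  using lin_zero[OF mOm mW tw_r[OF lin_id]] by simp

text \<open>Since e = e 1 and d 1 = 0, no differential of a coefficient remains.\<close>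

lemma c_iE: "e \<in> carrier E \<Longrightarrow> c (iE e) = NE e"
  using c_values(1)[of e "\<one>\<^bsub>B\<^esub>"] by (simp add: dD_one[unfolded D_simps] tw_zero)
lemma c_iF: "f \<in> carrier F \<Longrightarrow> c (iF f) = NF f"
  using c_values(2)[of f "\<one>\<^bsub>A\<^esub>"] by (simp add: dD_one[unfolded D_simps] tw_zero)

text \<open>Elements of \<open>D\<close> are taken in the order a b: a is absorbed into E, where
  \<nabla>^E obeys the Leibniz rule, and the value on a product with b is then known.\<close>

lemma right_conn_E:
  assumes e [simp]: "e \<in> carrier E" and x: "x \<in> carrier T"
  shows "c (iE e \<lhd> x) = c (iE e) \<triangleleft> x \<oplus>\<^bsub>W\<^esub> tw (iE e) (dD x)"
proof (rule D_ext_AB[OF mW _ _ _ x])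
  show "linear_map k T W (\<lambda>x. c (iE e \<lhd> x))" by (intro lin_comp[OF c_lin] rM_lin' lin_id) simp
  show "linear_map k T W (\<lambda>x. c (iE e) \<triangleleft> x \<oplus>\<^bsub>W\<^esub> tw (iE e) (dD x))"
    by (intro lin_sum[OF mW] rW_lin' tw_r dD_lin_Om lin_id) simp_all
  fix a b assume [simp]: "a \<in> carrier A" "b \<in> carrier B"
  have "c (iE e \<lhd> (jA a \<otimes>\<^bsub>D\<^esub> jB b)) = NE (ract E e a) \<triangleleft> jB b \<oplus>\<^bsub>W\<^esub> tw (iE (ract E e a)) (dD (jB b))"
    by (simp add: M_acts iE_a c_values)
  also have "\<dots> = NE e \<triangleleft> jA a \<triangleleft> jB b \<oplus>\<^bsub>W\<^esub> (tw (iE e) (dD (jA a) \<otimes>\<^bsub>O.D\<^esub> J (jB b)) \<oplus>\<^bsub>W\<^esub> tw (iE e) (J (jA a) \<otimes>\<^bsub>O.D\<^esub> dD (jB b)))"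
    by (simp add: NE_a W_add rW_tw iE_a[symmetric] tw_bal W.a_assoc)
  also have "\<dots> = c (iE e) \<triangleleft> (jA a \<otimes>\<^bsub>D\<^esub> jB b) \<oplus>\<^bsub>W\<^esub> tw (iE e) (dD (jA a \<otimes>\<^bsub>D\<^esub> jB b))"
    by (simp add: c_iE W_acts dD_mult tw_add_r)
  finally show "c (iE e \<lhd> (jA a \<otimes>\<^bsub>D\<^esub> jB b)) = c (iE e) \<triangleleft> (jA a \<otimes>\<^bsub>D\<^esub> jB b) \<oplus>\<^bsub>W\<^esub> tw (iE e) (dD (jA a \<otimes>\<^bsub>D\<^esub> jB b))" .
qed

text \<open>On F the order must be b a: now b is absorbed, and the value on f a is the known one.
  Such products span \<open>D\<close> because \<open>R\<close> is onto.\<close>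

lemma right_conn_F:
  assumes f [simp]: "f \<in> carrier F" and x: "x \<in> carrier T"
  shows "c (iF f \<lhd> x) = c (iF f) \<triangleleft> x \<oplus>\<^bsub>W\<^esub> tw (iF f) (dD x)"
proof (rule D_ext_BA[OF mW _ _ _ x])
  show "linear_map k T W (\<lambda>x. c (iF f \<lhd> x))" by (intro lin_comp[OF c_lin] rM_lin' lin_id) simp
  show "linear_map k T W (\<lambda>x. c (iF f) \<triangleleft> x \<oplus>\<^bsub>W\<^esub> tw (iF f) (dD x))"
    by (intro lin_sum[OF mW] rW_lin' tw_r dD_lin_Om lin_id) simp_all
  fix a b assume [simp]: "a \<in> carrier A" "b \<in> carrier B"
  have "c (iF f \<lhd> (jB b \<otimes>\<^bsub>D\<^esub> jA a)) = NF (ract F f b) \<triangleleft> jA a \<oplus>\<^bsub>W\<^esub> tw (iF (ract F f b)) (dD (jA a))"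
    by (simp add: M_acts iF_b c_values)
  also have "\<dots> = NF f \<triangleleft> jB b \<triangleleft> jA a \<oplus>\<^bsub>W\<^esub> (tw (iF f) (dD (jB b) \<otimes>\<^bsub>O.D\<^esub> J (jA a)) \<oplus>\<^bsub>W\<^esub> tw (iF f) (J (jB b) \<otimes>\<^bsub>O.D\<^esub> dD (jA a)))"
    by (simp add: NF_b W_add rW_tw iF_b[symmetric] tw_bal W.a_assoc)
  also have "\<dots> = c (iF f) \<triangleleft> (jB b \<otimes>\<^bsub>D\<^esub> jA a) \<oplus>\<^bsub>W\<^esub> tw (iF f) (dD (jB b \<otimes>\<^bsub>D\<^esub> jA a))"
    by (simp add: c_iF W_acts dD_mult tw_add_r)
  finally show "c (iF f \<lhd> (jB b \<otimes>\<^bsub>D\<^esub> jA a)) = c (iF f) \<triangleleft> (jB b \<otimes>\<^bsub>D\<^esub> jA a) \<oplus>\<^bsub>W\<^esub> tw (iF f) (dD (jB b \<otimes>\<^bsub>D\<^esub> jA a))" .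
qed

lemma right_conn:
  assumes m: "m \<in> carrier M" and x [simp]: "x \<in> carrier T"
  shows "c (m \<lhd> x) = c m \<triangleleft> x \<oplus>\<^bsub>W\<^esub> tw m (dD x)"
proof (rule M_ext[OF mW _ _ _ _ m])
  show "linear_map k M W (\<lambda>m. c (m \<lhd> x))" by (intro lin_comp[OF c_lin] rM_lin lin_id) simp
  show "linear_map k M W (\<lambda>m. c m \<triangleleft> x \<oplus>\<^bsub>W\<^esub> tw m (dD x))"
    by (intro lin_sum[OF mW] rW_lin c_lin tw_l lin_id) simp_all
  \<comment> \<open>If the rule holds at n for all elements of \<open>D\<close>, it holds at n y: it
    is used for y x and for y, and d(y x) is expanded by the Leibniz rule.\<close>
  have g: "c (n \<lhd> y \<lhd> x) = c (n \<lhd> y) \<triangleleft> x \<oplus>\<^bsub>W\<^esub> tw (n \<lhd> y) (dD x)"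
    if n [simp]: "n \<in> carrier M" and y [simp]: "y \<in> carrier T"
      and r: "\<And>z. z \<in> carrier T \<Longrightarrow> c (n \<lhd> z) = c n \<triangleleft> z \<oplus>\<^bsub>W\<^esub> tw n (dD z)" for n y
    using r[of "y \<otimes>\<^bsub>D\<^esub> x"] by (simp add: M_acts r W_acts W_add dD_mult tw_add_r rW_tw tw_bal W.a_assoc)
  show "c (iE e \<lhd> jB b \<lhd> x) = c (iE e \<lhd> jB b) \<triangleleft> x \<oplus>\<^bsub>W\<^esub> tw (iE e \<lhd> jB b) (dD x)"
    if "e \<in> carrier E" "b \<in> carrier B" for e b using that by (intro g right_conn_E) simp_all
  show "c (iF f \<lhd> jA a \<lhd> x) = c (iF f \<lhd> jA a) \<triangleleft> x \<oplus>\<^bsub>W\<^esub> tw (iF f \<lhd> jA a) (dD x)"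
    if "f \<in> carrier F" "a \<in> carrier A" for f a using that by (intro g right_conn_F) simp_all
qed

section \<open>The failure of left linearity as a derivation\<close>

definition "dl x m = c (x \<rhd> m) \<ominus>\<^bsub>W\<^esub> x \<triangleright> c m"

lemma dl_bil: "bil k T M W dl"
  unfolding dl_def
  by (intro bilI lin_difference[OF mW] lin_comp[OF c_lin] lM_lin lM_lin' lW_lin lW_lin' c_lin lin_id) simp_all
lemmas dl_closed [simp] = bil_closed[OF dl_bil]
lemmas dl_r = bil_r[OF dl_bil] and dl_l = bil_l[OF dl_bil]

lemma c_left: "x \<in> carrier T \<Longrightarrow> m \<in> carrier M \<Longrightarrow> c (x \<rhd> m) = x \<triangleright> c m \<oplus>\<^bsub>W\<^esub> dl x m"
proof -
  assume "x \<in> carrier T" "m \<in> carrier M"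
  then have cl: "c (x \<rhd> m) \<in> carrier W" "x \<triangleright> c m \<in> carrier W" by simp_all
  then show ?thesis by (simp add: dl_def W.minus_eq W.a_comm[of "c (x \<rhd> m)"] W.a_assoc[symmetric] W.r_neg)
qed

lemma cancel_left: "u \<oplus>\<^bsub>W\<^esub> v = u \<oplus>\<^bsub>W\<^esub> w \<Longrightarrow> u \<in> carrier W \<Longrightarrow> v \<in> carrier W \<Longrightarrow> w \<in> carrier W \<Longrightarrow> v = w"
  by simp

text \<open>The value of the connection at x m y is computed by removing x first or y first. The
  terms with d y agree because x acts on the left factor of m \<otimes> d y, and cancelling them
  leaves the claim.\<close>

lemma dl_right: "x \<in> carrier T \<Longrightarrow> y \<in> carrier T \<Longrightarrow> m \<in> carrier M \<Longrightarrow> dl x (m \<lhd> y) = dl x m \<triangleleft> y"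
proof -
  assume [simp]: "x \<in> carrier T" "y \<in> carrier T" "m \<in> carrier M"
  have "c (x \<rhd> (m \<lhd> y)) = x \<triangleright> (c m \<triangleleft> y) \<oplus>\<^bsub>W\<^esub> x \<triangleright> tw m (dD y) \<oplus>\<^bsub>W\<^esub> dl x (m \<lhd> y)"
    by (simp add: c_left right_conn W_add)
  moreover have "c (x \<rhd> (m \<lhd> y)) = c ((x \<rhd> m) \<lhd> y)" by (simp add: M_acts)
  moreover have "c ((x \<rhd> m) \<lhd> y) = x \<triangleright> (c m \<triangleleft> y) \<oplus>\<^bsub>W\<^esub> x \<triangleright> tw m (dD y) \<oplus>\<^bsub>W\<^esub> dl x m \<triangleleft> y"
    by (simp only: right_conn acts_closed \<open>x \<in> carrier T\<close> \<open>y \<in> carrier T\<close> \<open>m \<in> carrier M\<close>)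
      (simp add: c_left W_add lW_tw W_acts W.a_ac)
  ultimately have "x \<triangleright> (c m \<triangleleft> y) \<oplus>\<^bsub>W\<^esub> x \<triangleright> tw m (dD y) \<oplus>\<^bsub>W\<^esub> dl x (m \<lhd> y) = x \<triangleright> (c m \<triangleleft> y) \<oplus>\<^bsub>W\<^esub> x \<triangleright> tw m (dD y) \<oplus>\<^bsub>W\<^esub> dl x m \<triangleleft> y"
    by simp
  then show ?thesis by (rule cancel_left) simp_all
qed

text \<open>The element x y is pulled out of the connection at once, or x first and y
  afterwards.\<close>

lemma dl_mult: "x \<in> carrier T \<Longrightarrow> y \<in> carrier T \<Longrightarrow> m \<in> carrier M \<Longrightarrow>
   dl (x \<otimes>\<^bsub>D\<^esub> y) m = dl x (y \<rhd> m) \<oplus>\<^bsub>W\<^esub> x \<triangleright> dl y m"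
proof -
  assume [simp]: "x \<in> carrier T" "y \<in> carrier T" "m \<in> carrier M"
  have "x \<triangleright> (y \<triangleright> c m) \<oplus>\<^bsub>W\<^esub> dl (x \<otimes>\<^bsub>D\<^esub> y) m = c ((x \<otimes>\<^bsub>D\<^esub> y) \<rhd> m)"
    by (simp only: c_left D_closed \<open>x \<in> carrier T\<close> \<open>y \<in> carrier T\<close> \<open>m \<in> carrier M\<close>) (simp add: W_acts)
  also have "\<dots> = c (x \<rhd> (y \<rhd> m))" by (simp add: M_acts)
  also have "\<dots> = x \<triangleright> (y \<triangleright> c m) \<oplus>\<^bsub>W\<^esub> (dl x (y \<rhd> m) \<oplus>\<^bsub>W\<^esub> x \<triangleright> dl y m)"
    by (simp add: c_left W_add W.a_ac)
  finally show ?thesis by (rule cancel_left) simp_all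
qed

text \<open>At b e and a f the part N is left linear, so only L remains. At a e and b f the product
  stays in E or F, and the left rules of the given connections supply \<phi> and \<psi>.\<close>

lemma dl_values:
  "e \<in> carrier E \<Longrightarrow> b \<in> carrier B \<Longrightarrow> dl (jB b) (iE e) = L (jB b \<rhd> iE e)"
  "f \<in> carrier F \<Longrightarrow> a \<in> carrier A \<Longrightarrow> dl (jA a) (iF f) = L (jA a \<rhd> iF f)"
  "e \<in> carrier E \<Longrightarrow> a \<in> carrier A \<Longrightarrow> dl (jA a) (iE e) = kE (phi a e)"
  "f \<in> carrier F \<Longrightarrow> b \<in> carrier B \<Longrightarrow> dl (jB b) (iF f) = kF (psi b f)"
proof -
  { assume [simp]: "e \<in> carrier E" "b \<in> carrier B"
    have "jB b \<triangleright> NE e \<oplus>\<^bsub>W\<^esub> dl (jB b) (iE e) = c (jB b \<rhd> iE e)" by (simp add: c_left c_iE)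
    also have "\<dots> = jB b \<triangleright> NE e \<oplus>\<^bsub>W\<^esub> L (jB b \<rhd> iE e)" by (simp add: c_def N_values)
    finally have "jB b \<triangleright> NE e \<oplus>\<^bsub>W\<^esub> dl (jB b) (iE e) = jB b \<triangleright> NE e \<oplus>\<^bsub>W\<^esub> L (jB b \<rhd> iE e)" .
    then show "dl (jB b) (iE e) = L (jB b \<rhd> iE e)" by (rule cancel_left) simp_all }
  { assume [simp]: "f \<in> carrier F" "a \<in> carrier A"
    have "jA a \<triangleright> NF f \<oplus>\<^bsub>W\<^esub> dl (jA a) (iF f) = c (jA a \<rhd> iF f)" by (simp add: c_left c_iF)
    also have "\<dots> = jA a \<triangleright> NF f \<oplus>\<^bsub>W\<^esub> L (jA a \<rhd> iF f)" by (simp add: c_def N_values)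
    finally have "jA a \<triangleright> NF f \<oplus>\<^bsub>W\<^esub> dl (jA a) (iF f) = jA a \<triangleright> NF f \<oplus>\<^bsub>W\<^esub> L (jA a \<rhd> iF f)" .
    then show "dl (jA a) (iF f) = L (jA a \<rhd> iF f)" by (rule cancel_left) simp_all }
  { assume [simp]: "e \<in> carrier E" "a \<in> carrier A"
    have "jA a \<triangleright> NE e \<oplus>\<^bsub>W\<^esub> dl (jA a) (iE e) = jA a \<triangleright> NE e \<oplus>\<^bsub>W\<^esub> kE (phi a e)"
      using c_left[of "jA a" "iE e"] by (simp add: c_iE a_iE a_NE)
    then show "dl (jA a) (iE e) = kE (phi a e)" by (rule cancel_left) simp_all }
  { assume [simp]: "f \<in> carrier F" "b \<in> carrier B"
    have "jB b \<triangleright> NF f \<oplus>\<^bsub>W\<^esub> dl (jB b) (iF f) = jB b \<triangleright> NF f \<oplus>\<^bsub>W\<^esub> kF (psi b f)"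
      using c_left[of "jB b" "iF f"] by (simp add: c_iF b_iF b_NF)
    then show "dl (jB b) (iF f) = kF (psi b f)" by (rule cancel_left) simp_all }
qed

text \<open>The contributions of d a and of d b to \<delta>(x) m for x a sum of products a b,
  according to \<delta>(a b) m = \<delta>(a) (b m) + a \<delta>(b) m. That \<delta> respects the
  exchange of d b and a means that \<delta>(b) (a m) is the second contribution at x = b a.\<close>

definition "sA m x = tbind W x (\<lambda>a b. dl (jA a) (jB b \<rhd> m))"
definition "sB m x = tbind W x (\<lambda>a b. jA a \<triangleright> dl (jB b) m)"

lemma sA_bil: "m \<in> carrier M \<Longrightarrow> bil k A B W (\<lambda>a b. dl (jA a) (jB b \<rhd> m))"
  by (intro bilI dl_r dl_l lM_lin' t_l t_r lin_id) simp_all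
lemma sB_bil: "m \<in> carrier M \<Longrightarrow> bil k A B W (\<lambda>a b. jA a \<triangleright> dl (jB b) m)"
  by (intro bilI lW_lin lW_lin' dl_l t_l t_r lin_id) simp_all
lemma sA_lin: "m \<in> carrier M \<Longrightarrow> linear_map k T W (sA m)"
  unfolding sA_def by (rule tbind_lin[OF mA mB mW sA_bil])
lemma sB_lin: "m \<in> carrier M \<Longrightarrow> linear_map k T W (sB m)"
  unfolding sB_def by (rule tbind_lin[OF mA mB mW sB_bil])
lemma sA_pure: "m \<in> carrier M \<Longrightarrow> a \<in> carrier A \<Longrightarrow> b \<in> carrier B \<Longrightarrow> sA m (a \<cdot> b) = dl (jA a) (jB b \<rhd> m)"
  unfolding sA_def by (rule tbind_pure[OF mA mB mW sA_bil])
lemma sB_pure: "m \<in> carrier M \<Longrightarrow> a \<in> carrier A \<Longrightarrow> b \<in> carrier B \<Longrightarrow> sB m (a \<cdot> b) = jA a \<triangleright> dl (jB b) m"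
  unfolding sB_def by (rule tbind_pure[OF mA mB mW sB_bil])
lemma sB_lin_arg: "x \<in> carrier T \<Longrightarrow> linear_map k M W (\<lambda>m. sB m x)"
  unfolding sB_def
  by (rule tbind_lin_param[OF mA mB _ mW mM sB_bil]) (simp_all add: lW_lin dl_r lin_id)
lemmas s_closed [simp] = lin_closed[OF sA_lin] lin_closed[OF sB_lin]

lemma AB: "a \<in> carrier A \<Longrightarrow> b \<in> carrier B \<Longrightarrow> jA a \<otimes>\<^bsub>D\<^esub> jB b = a \<cdot> b"
  by (simp add: D_mult_simps)

lemma sA_sB:
  assumes m [simp]: "m \<in> carrier M" and x: "x \<in> carrier T"
  shows "dl x m = sA m x \<oplus>\<^bsub>W\<^esub> sB m x"
proof (rule tensor_ext[OF mA mB mW dl_l[OF lin_id m] lin_sum[OF mW sA_lin[OF m] sB_lin[OF m]] _ x])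
  fix a b assume ab [simp]: "a \<in> carrier A" "b \<in> carrier B"
  show "dl (a \<cdot> b) m = sA m (a \<cdot> b) \<oplus>\<^bsub>W\<^esub> sB m (a \<cdot> b)"
    using dl_mult[of "jA a" "jB b" m] by (simp add: sA_pure sB_pure AB)
qed

text \<open>In e b only b is differentiated, and left multiplication by a changes e alone. On the
  other summand the same holds for f a and left multiplication by b.\<close>

lemma L_left_a: "X \<in> carrier EB \<Longrightarrow> a \<in> carrier A \<Longrightarrow> L (jA a \<rhd> (X, \<zero>\<^bsub>AF\<^esub>)) = jA a \<triangleright> L (X, \<zero>\<^bsub>AF\<^esub>)"
proof (rule tensor_ext[OF mE mB mW])
  assume [simp]: "a \<in> carrier A"
  show "linear_map k EB W (\<lambda>X. L (jA a \<rhd> (X, \<zero>\<^bsub>AF\<^esub>)))" by (intro lin_comp[OF L_lin] lM_lin inl_lin) simp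
  show "linear_map k EB W (\<lambda>X. jA a \<triangleright> L (X, \<zero>\<^bsub>AF\<^esub>))" by (intro lW_lin lin_comp[OF L_lin] inl_lin) simp
  fix e b assume [simp]: "e \<in> carrier E" "b \<in> carrier B"
  have "L (jA a \<rhd> (iE e \<lhd> jB b)) = L (iE (lact E a e) \<lhd> jB b)"
    by (simp add: M_acts(3)[symmetric] a_iE)
  then show "L (jA a \<rhd> (tns k E B e b, \<zero>\<^bsub>AF\<^esub>)) = jA a \<triangleright> L (tns k E B e b, \<zero>\<^bsub>AF\<^esub>)"
    by (simp add: L_values lW_tw a_iE flip: iE_b)
qed

lemma L_left_b: "Y \<in> carrier AF \<Longrightarrow> b \<in> carrier B \<Longrightarrow> L (jB b \<rhd> (\<zero>\<^bsub>EB\<^esub>, Y)) = jB b \<triangleright> L (\<zero>\<^bsub>EB\<^esub>, Y)"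
proof -
  assume Y: "Y \<in> carrier AF" and b [simp]: "b \<in> carrier B"
  have "L (jB b \<rhd> (\<zero>\<^bsub>EB\<^esub>, \<tau>FA V)) = jB b \<triangleright> L (\<zero>\<^bsub>EB\<^esub>, \<tau>FA V)" if V: "V \<in> carrier FA" for V
  proof (rule tensor_ext[OF mF mA mW _ _ _ V])
    show "linear_map k FA W (\<lambda>V. L (jB b \<rhd> (\<zero>\<^bsub>EB\<^esub>, \<tau>FA V)))" by (intro lin_comp[OF L_lin] lM_lin lin_comp[OF inr_lin] tauF_lin) simp
    show "linear_map k FA W (\<lambda>V. jB b \<triangleright> L (\<zero>\<^bsub>EB\<^esub>, \<tau>FA V))" by (intro lW_lin lin_comp[OF L_lin] lin_comp[OF inr_lin] tauF_lin) simp
    fix f a assume [simp]: "f \<in> carrier F" "a \<in> carrier A"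
    have "L (jB b \<rhd> (iF f \<lhd> jA a)) = L (iF (lact F b f) \<lhd> jA a)"
      by (simp add: M_acts(3)[symmetric] b_iF)
    then show "L (jB b \<rhd> (\<zero>\<^bsub>EB\<^esub>, tf f a)) = jB b \<triangleright> L (\<zero>\<^bsub>EB\<^esub>, tf f a)"
      by (simp add: L_values lW_tw b_iF flip: iF_a)
  qed
  from this[of "\<sigma> Y"] Y show ?thesis by simp
qed

text \<open>On e the B-contribution at x is L(x e), because \<delta>(b) e = L(b e) and L commutes
  with a on this summand. At x = b a this is L(b (a e)), which is \<delta>(b) (a e) since a e lies
  in E.\<close>

lemma rel_E: "e \<in> carrier E \<Longrightarrow> a \<in> carrier A \<Longrightarrow> b \<in> carrier B \<Longrightarrow> dl (jB b) (jA a \<rhd> iE e) = sB (iE e) (jB b \<otimes>\<^bsub>D\<^esub> jA a)"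
proof -
  assume e [simp]: "e \<in> carrier E" and [simp]: "a \<in> carrier A" "b \<in> carrier B"
  have "sB (iE e) x = L (x \<rhd> iE e)" if "x \<in> carrier T" for x
  proof (rule tensor_ext[OF mA mB mW sB_lin _ _ that])
    show "linear_map k T W (\<lambda>x. L (x \<rhd> iE e))" by (intro lin_comp[OF L_lin] lM_lin' lin_id) simp
    fix a b assume [simp]: "a \<in> carrier A" "b \<in> carrier B"
    have "L ((a \<cdot> b) \<rhd> iE e) = L (jA a \<rhd> (jB b \<rhd> iE e))" by (simp add: AB[of a b, symmetric] M_acts)
    then show "sB (iE e) (a \<cdot> b) = L ((a \<cdot> b) \<rhd> iE e)"
      by (simp add: sB_pure dl_values L_left_a b_iE)
  qed simp
  then show ?thesis by (simp add: a_iE dl_values M_acts)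
qed

text \<open>On f it is the A-contribution that equals L(x f). At x = b a it is b L(a f) = b
  \<delta>(a) f, and this is also the term by which \<delta>(b a) f exceeds \<delta>(b) (a f). Hence
  the B-contribution is \<delta>(b) (a f), although \<psi> enters both sides.\<close>

lemma rel_F: "f \<in> carrier F \<Longrightarrow> a \<in> carrier A \<Longrightarrow> b \<in> carrier B \<Longrightarrow> dl (jB b) (jA a \<rhd> iF f) = sB (iF f) (jB b \<otimes>\<^bsub>D\<^esub> jA a)"
proof -
  assume f [simp]: "f \<in> carrier F" and [simp]: "a \<in> carrier A" "b \<in> carrier B"
  have s: "sA (iF f) x = L (x \<rhd> iF f)" if "x \<in> carrier T" for x
  proof (rule tensor_ext[OF mA mB mW sA_lin _ _ that])
    show "linear_map k T W (\<lambda>x. L (x \<rhd> iF f))" by (intro lin_comp[OF L_lin] lM_lin' lin_id) simp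
    fix a b assume [simp]: "a \<in> carrier A" "b \<in> carrier B"
    have "L ((a \<cdot> b) \<rhd> iF f) = L (jA a \<rhd> (jB b \<rhd> iF f))" by (simp add: AB[of a b, symmetric] M_acts)
    then show "sA (iF f) (a \<cdot> b) = L ((a \<cdot> b) \<rhd> iF f)"
      by (simp add: sA_pure dl_values b_iF)
  qed simp
  let ?x = "jB b \<otimes>\<^bsub>D\<^esub> jA a"
  have "sA (iF f) ?x = jB b \<triangleright> dl (jA a) (iF f)"
    by (simp add: s M_acts dl_values) (simp add: a_iF L_left_b)
  then have "jB b \<triangleright> dl (jA a) (iF f) \<oplus>\<^bsub>W\<^esub> dl (jB b) (jA a \<rhd> iF f) = jB b \<triangleright> dl (jA a) (iF f) \<oplus>\<^bsub>W\<^esub> sB (iF f) ?x"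
    using sA_sB[of "iF f" ?x] by (simp add: dl_mult W.a_comm)
  then show ?thesis by (rule cancel_left) simp_all
qed

lemma sB_right:
  assumes [simp]: "m \<in> carrier M" "y \<in> carrier T" and x: "x \<in> carrier T"
  shows "sB (m \<lhd> y) x = sB m x \<triangleleft> y"
  by (rule tensor_ext[OF mA mB mW sB_lin rW_lin[OF sB_lin] _ x]) (simp_all add: sB_pure dl_right W_acts)

text \<open>Both sides are compatible with the right action, under which E and F generate
  \<open>M\<close>.\<close>

lemma rel:
  assumes m: "m \<in> carrier M" and [simp]: "a \<in> carrier A" "b \<in> carrier B"
  shows "dl (jB b) (jA a \<rhd> m) = sB m (jB b \<otimes>\<^bsub>D\<^esub> jA a)"
proof (rule M_ext[OF mW _ _ _ _ m])
  show "linear_map k M W (\<lambda>m. dl (jB b) (jA a \<rhd> m))" by (intro dl_r lM_lin lin_id) simp_all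
  show "linear_map k M W (\<lambda>m. sB m (jB b \<otimes>\<^bsub>D\<^esub> jA a))" by (rule sB_lin_arg) simp
  show "dl (jB b) (jA a \<rhd> (iE e \<lhd> jB b')) = sB (iE e \<lhd> jB b') (jB b \<otimes>\<^bsub>D\<^esub> jA a)"
    if "e \<in> carrier E" "b' \<in> carrier B" for e b'
    using that by (simp add: M_acts(3)[symmetric] dl_right rel_E sB_right)
  show "dl (jB b) (jA a \<rhd> (iF f \<lhd> jA a')) = sB (iF f \<lhd> jA a') (jB b \<otimes>\<^bsub>D\<^esub> jA a)"
    if "f \<in> carrier F" "a' \<in> carrier A" for f a'
    using that by (simp add: M_acts(3)[symmetric] dl_right rel_F sB_right)
qed

text \<open>The first defining sum is N1 + L1 and the second is N2 + L2 after \<sigma>, so the two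
  decompositions of the connection differ only in the order of four terms.\<close>

lemma connection_eq: "m \<in> carrier M \<Longrightarrow> product_connection k A B R Rt E F \<tau>FA \<tau>BE nabE nabF m = c m"
proof -
  assume "m \<in> carrier M"
  then obtain X Y where m: "m = (X, Y)" and X: "X \<in> carrier EB" and Y: "Y \<in> carrier AF" by (auto simp: M_simps)
  have 1: "tbind W (nabE e) (\<lambda>e' \<omega>. tw (iE e') (\<omega> \<bullet> \<iota>B b)) = NE e \<triangleleft> jB b"
    if [simp]: "e \<in> carrier E" "b \<in> carrier B" for e b
    unfolding NE_def
    by (rule EO_tbind[OF mW rW_lin[OF kE_lin]]) (simp_all add: kE_pure rW_tw J_pure O.D_mult_simps OA.iota_one)
  have 2: "tbind W (nabF f) (\<lambda>f' \<eta>. tw (\<zero>\<^bsub>EB\<^esub>, tns k A F a f') (\<one>\<^bsub>OmA\<^esub> \<bullet> \<eta>)) = jA a \<triangleright> NF f"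
    if [simp]: "f \<in> carrier F" "a \<in> carrier A" for f a
    unfolding NF_def
    by (rule FO_tbind[OF mW lW_lin[OF kF_lin]]) (simp_all add: kF_pure lW_tw a_iF)
  have 3: "tbind W V (\<lambda>f' a'. tw (iF f') (dga_diff OmA (\<iota>A a') \<bullet> \<one>\<^bsub>OmB\<^esub>)) = L2 V" if "V \<in> carrier FA" for V
    by (rule tbind_tensor[OF mF mA mW L2_lin _ that]) (simp add: OA.diff_iota L2_pure dD_a)
  have a: "tbind W X (\<lambda>e b. tbind W (nabE e) (\<lambda>e' \<omega>. tw (iE e') (\<omega> \<bullet> \<iota>B b)) \<oplus>\<^bsub>W\<^esub>
      tw (iE e) (\<one>\<^bsub>OmA\<^esub> \<bullet> dga_diff OmB (\<iota>B b))) = N1 X \<oplus>\<^bsub>W\<^esub> L1 X"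
    by (rule tbind_tensor[OF mE mB mW lin_sum[OF mW N1_lin L1_lin] _ X])
      (simp add: 1 N1_pure L1_pure OB.diff_iota dD_b)
  have b: "tbind W Y (\<lambda>a f. tbind W (nabF f) (\<lambda>f' \<eta>. tw (\<zero>\<^bsub>EB\<^esub>, tns k A F a f') (\<one>\<^bsub>OmA\<^esub> \<bullet> \<eta>)) \<oplus>\<^bsub>W\<^esub>
      tbind W (\<sigma> (tns k A F a f)) (\<lambda>f' a'. tw (iF f') (dga_diff OmA (\<iota>A a') \<bullet> \<one>\<^bsub>OmB\<^esub>))) = N2 Y \<oplus>\<^bsub>W\<^esub> L2 (\<sigma> Y)"
    by (rule tbind_tensor[OF mA mF mW lin_sum[OF mW N2_lin lin_comp[OF L2_lin sigma_lin]] _ Y])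
      (simp add: 2 3 N2_pure)
  show ?thesis
    unfolding product_connection_def Let_def m
    using a b X Y lin_closed[OF N1_lin] lin_closed[OF N2_lin] lin_closed[OF L1_lin] lin_closed[OF L2_lin]
    by (simp add: iE_def iF_def c_def N_def L_def W.a_ac)
qed

end

section \<open>Existence and uniqueness of \<open>\<xi>\<close>\<close>

context product
begin

interpretation M: Module.module k M by (rule mM)
interpretation W: Module.module k W by (rule mW)
interpretation OT: Module.module k O.T by (rule O.mT)

abbreviation "MW \<equiv> dsum M W"
lemmas mMW = dsum_module[OF mM mW]

text \<open>A derivation \<open>\<delta>\<close> acting from \<open>M\<close> to \<open>W\<close> makes \<open>M \<oplus> W\<close> a module over the universal calculus, a form
  \<open>d x\<close> acting as the nilpotent matrix \<open>(0, 0; \<delta> x, 0)\<close>.\<close>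

definition "rfn j a v = (j a \<rhd> fst v, j a \<triangleright> snd v)"
definition "rdf j a v = (\<zero>\<^bsub>M\<^esub>, dl (j a) (fst v))"

text \<open>Restricting \<delta> along an algebra map into \<open>D\<close> covers \<open>A\<close>
  and \<open>B\<close> alike. The Leibniz relation is \<open>dl_mult\<close>; the other conditions
  express linearity, unitality and associativity of the actions.\<close>

lemma nilpotent_rep:
  fixes C :: "('k, 'c) module"
  assumes C: "k_algebra k C" and j: "linear_map k C T j"
    and jm: "\<And>a b. a \<in> carrier C \<Longrightarrow> b \<in> carrier C \<Longrightarrow> j (a \<otimes>\<^bsub>C\<^esub> b) = j a \<otimes>\<^bsub>D\<^esub> j b" and j1: "j \<one>\<^bsub>C\<^esub> = \<one>\<^bsub>D\<^esub>"
  shows "omega_rep k C MW (rfn j) (rdf j)"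
proof (rule omega.omega_repI[OF omega.intro[OF C]])
  interpret C: ring C by (rule k_algebraD(1)[OF C])
  note jc [simp] = lin_closed[OF j]
  show "Module.module k MW" by (rule mMW)
  fix a assume a: "a \<in> carrier C"
  show "linear_map k MW MW (rfn j a)"
    unfolding rfn_def using a by (intro lin_pair lM_lin lW_lin lin_fst[OF lin_id] lin_snd[OF lin_id]) simp_all
  show "linear_map k MW MW (rdf j a)"
    unfolding rdf_def using a by (intro lin_pair lin_null[OF mM] dl_r lin_fst[OF lin_id]) simp_all
next
  note jc [simp] = lin_closed[OF j]
  fix a b x assume ab [simp]: "a \<in> carrier C" "b \<in> carrier C" and "x \<in> carrier MW"
  then obtain m w where x [simp]: "x = (m, w)" "m \<in> carrier M" "w \<in> carrier W" by auto
  show "rfn j (a \<oplus>\<^bsub>C\<^esub> b) x = rfn j a x \<oplus>\<^bsub>MW\<^esub> rfn j b x"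
    by (simp add: rfn_def lin_add[OF j] lin_add[OF lM_lin'[OF lin_id]] lin_add[OF lW_lin'[OF lin_id]])
  show "rdf j (a \<oplus>\<^bsub>C\<^esub> b) x = rdf j a x \<oplus>\<^bsub>MW\<^esub> rdf j b x"
    by (simp add: rdf_def lin_add[OF j] lin_add[OF dl_l[OF lin_id]])
  show "rfn j (a \<otimes>\<^bsub>C\<^esub> b) x = rfn j a (rfn j b x)"
    by (simp add: rfn_def jm M_acts W_acts)
  show "rdf j (a \<otimes>\<^bsub>C\<^esub> b) x = rdf j a (rfn j b x) \<oplus>\<^bsub>MW\<^esub> rfn j a (rdf j b x)"
    by (simp add: rfn_def rdf_def jm dl_mult lin_zero[OF mM mM lM_lin[OF lin_id]])
next
  note jc [simp] = lin_closed[OF j]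
  interpret C: ring C by (rule k_algebraD(1)[OF C])
  fix z x assume z: "z \<in> carrier k" and "x \<in> carrier MW"
  then obtain m w where x [simp]: "x = (m, w)" "m \<in> carrier M" "w \<in> carrier W" by auto
  have "j (z \<odot>\<^bsub>C\<^esub> \<one>\<^bsub>C\<^esub>) = z \<odot>\<^bsub>T\<^esub> \<one>\<^bsub>D\<^esub>" using lin_smult[OF j z C.one_closed] by (simp add: j1)
  then show "rfn j (z \<odot>\<^bsub>C\<^esub> \<one>\<^bsub>C\<^esub>) x = z \<odot>\<^bsub>MW\<^esub> x"
    using z by (simp add: rfn_def lin_smult[OF lM_lin'[OF lin_id]] lin_smult[OF lW_lin'[OF lin_id]])
next
  note jc [simp] = lin_closed[OF j]
  fix z a x assume z: "z \<in> carrier k" "a \<in> carrier C" and "x \<in> carrier MW"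
  then obtain m w where x [simp]: "x = (m, w)" "m \<in> carrier M" "w \<in> carrier W" by auto
  show "rdf j (z \<odot>\<^bsub>C\<^esub> a) x = z \<odot>\<^bsub>MW\<^esub> rdf j a x"
    using z by (simp add: rdf_def lin_smult[OF j] lin_smult[OF dl_l[OF lin_id]])
qed

lemma jA_mult: "a \<in> carrier A \<Longrightarrow> b \<in> carrier A \<Longrightarrow> jA (a \<otimes>\<^bsub>A\<^esub> b) = jA a \<otimes>\<^bsub>D\<^esub> jA b"
  and jB_mult: "b1 \<in> carrier B \<Longrightarrow> b2 \<in> carrier B \<Longrightarrow> jB (b1 \<otimes>\<^bsub>B\<^esub> b2) = jB b1 \<otimes>\<^bsub>D\<^esub> jB b2"
  by (simp_all add: D_mult_simps)

sublocale rA: omega_rep k A MW "rfn jA" "rdf jA"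
  by (rule nilpotent_rep[OF algA t_l[OF lin_id] jA_mult]) simp_all
sublocale rB: omega_rep k B MW "rfn jB" "rdf jB"
  by (rule nilpotent_rep[OF algB t_r[OF lin_id] jB_mult]) simp_all

text \<open>A form \<omega> \<otimes> \<eta> acts on (m, 0) through \<eta> and then \<omega>. The
  W-component is zero in degree 0, and in degree 1 it is the value sought. Working with all forms
  avoids splitting one-forms into their two summands.\<close>

definition "ev \<omega> \<eta> m = snd (rA.rep \<omega> (rB.rep \<eta> (m, \<zero>\<^bsub>W\<^esub>)))"
definition "xi0 \<theta> m = tbind W \<theta> (\<lambda>\<omega> \<eta>. ev \<omega> \<eta> m)"

lemma MW_in [simp]: "m \<in> carrier M \<Longrightarrow> (m, \<zero>\<^bsub>W\<^esub>) \<in> carrier MW" by simp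

lemma rB_closed: "\<eta> \<in> carrier OmB \<Longrightarrow> m \<in> carrier M \<Longrightarrow> rB.rep \<eta> (m, \<zero>\<^bsub>W\<^esub>) \<in> carrier MW"
  using bil_closed[OF rB.rep_bil _ MW_in] .

lemma ev_bil: "m \<in> carrier M \<Longrightarrow> bil k OmA OmB W (\<lambda>\<omega> \<eta>. ev \<omega> \<eta> m)"
  unfolding ev_def
  by (intro bilI lin_snd[of _ _ M] bil_r[OF rA.rep_bil] bil_l[OF rA.rep_bil] bil_l[OF rB.rep_bil] lin_id rB_closed MW_in)
lemma ev_lin: "\<omega> \<in> carrier OmA \<Longrightarrow> \<eta> \<in> carrier OmB \<Longrightarrow> linear_map k M W (ev \<omega> \<eta>)"
  unfolding ev_def
  by (intro lin_snd[of _ _ M] bil_r[OF rA.rep_bil] bil_r[OF rB.rep_bil] lin_pair lin_id lin_null[OF mW])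

lemma xi0_lin: "m \<in> carrier M \<Longrightarrow> linear_map k O.T W (\<lambda>\<theta>. xi0 \<theta> m)"
  unfolding xi0_def by (rule tbind_lin[OF O.mA O.mB mW ev_bil])
lemma xi0_lin': "\<theta> \<in> carrier O.T \<Longrightarrow> linear_map k M W (xi0 \<theta>)"
  unfolding xi0_def by (rule tbind_lin_param[OF O.mA O.mB _ mW mM ev_bil ev_lin])
lemma xi0_pure: "m \<in> carrier M \<Longrightarrow> \<omega> \<in> carrier OmA \<Longrightarrow> \<eta> \<in> carrier OmB \<Longrightarrow> xi0 (\<omega> \<bullet> \<eta>) m = ev \<omega> \<eta> m"
  unfolding xi0_def by (rule tbind_pure[OF O.mA O.mB mW ev_bil])

lemma acts_zero [simp]: "x \<in> carrier T \<Longrightarrow> x \<rhd> \<zero>\<^bsub>M\<^esub> = \<zero>\<^bsub>M\<^esub>" "x \<in> carrier T \<Longrightarrow> x \<triangleright> \<zero>\<^bsub>W\<^esub> = \<zero>\<^bsub>W\<^esub>"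
  using lin_zero[OF mM mM lM_lin[OF lin_id]] lin_zero[OF mW mW lW_lin[OF lin_id]] by simp_all

lemma ev_values:
  "m \<in> carrier M \<Longrightarrow> a \<in> carrier A \<Longrightarrow> a' \<in> carrier A \<Longrightarrow> b \<in> carrier B \<Longrightarrow>
    ev (OA.dd a \<otimes>\<^bsub>OmA\<^esub> \<iota>A a') (\<iota>B b) m = dl (jA a) (jA a' \<rhd> jB b \<rhd> m)"
  "m \<in> carrier M \<Longrightarrow> a \<in> carrier A \<Longrightarrow> b \<in> carrier B \<Longrightarrow> b' \<in> carrier B \<Longrightarrow>
    ev (\<iota>A a) (OB.dd b \<otimes>\<^bsub>OmB\<^esub> \<iota>B b') m = jA a \<triangleright> dl (jB b) (jB b' \<rhd> m)"
  by (simp_all add: ev_def rB.rep_iota rA.rep_dd_iota rB.rep_dd_iota rA.rep_iota rfn_def rdf_def)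

text \<open>For Z = R(b \<otimes> a') this and \<open>xi0_second\<close> evaluate the two terms of
  (d(a b)) a' b' in the order A before B.\<close>

lemma xi0_first:
  assumes [simp]: "m \<in> carrier M" "a \<in> carrier A" "b' \<in> carrier B" and Z: "Z \<in> carrier T"
  shows "xi0 (P a \<otimes>\<^bsub>O.D\<^esub> (J Z \<otimes>\<^bsub>O.D\<^esub> q b')) m = dl (jA a) (Z \<rhd> jB b' \<rhd> m)"
proof (rule tensor_ext[OF mA mB mW _ _ _ Z])
  show "linear_map k T W (\<lambda>Z. xi0 (P a \<otimes>\<^bsub>O.D\<^esub> (J Z \<otimes>\<^bsub>O.D\<^esub> q b')) m)"
    by (intro lin_comp[OF xi0_lin] lin_comp[OF O.D_mult_lin_right] lin_comp[OF O.D_mult_lin_left] J_lin) simp_all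
  show "linear_map k T W (\<lambda>Z. dl (jA a) (Z \<rhd> jB b' \<rhd> m))" by (intro dl_r lM_lin' lin_id) simp_all
  fix a1 b1 assume [simp]: "a1 \<in> carrier A" "b1 \<in> carrier B"
  have "P a \<otimes>\<^bsub>O.D\<^esub> (J (a1 \<cdot> b1) \<otimes>\<^bsub>O.D\<^esub> q b') = (OA.dd a \<otimes>\<^bsub>OmA\<^esub> \<iota>A a1) \<bullet> \<iota>B (b1 \<otimes>\<^bsub>B\<^esub> b')"
    by (simp add: J_pure O.D_mult_simps OB.iota_mult)
  then show "xi0 (P a \<otimes>\<^bsub>O.D\<^esub> (J (a1 \<cdot> b1) \<otimes>\<^bsub>O.D\<^esub> q b')) m = dl (jA a) ((a1 \<cdot> b1) \<rhd> jB b' \<rhd> m)"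
    by (simp add: xi0_pure ev_values jB_mult M_acts flip: AB[of a1 b1])
qed

lemma xi0_second:
  assumes [simp]: "m \<in> carrier M" "a \<in> carrier A" "b' \<in> carrier B" and Z: "Z \<in> carrier T"
  shows "xi0 (p a \<otimes>\<^bsub>O.D\<^esub> (d2 Z \<otimes>\<^bsub>O.D\<^esub> q b')) m = jA a \<triangleright> sB (jB b' \<rhd> m) Z"
proof (rule tensor_ext[OF mA mB mW _ _ _ Z])
  show "linear_map k T W (\<lambda>Z. xi0 (p a \<otimes>\<^bsub>O.D\<^esub> (d2 Z \<otimes>\<^bsub>O.D\<^esub> q b')) m)"
    by (intro lin_comp[OF xi0_lin] lin_comp[OF O.D_mult_lin_right] lin_comp[OF O.D_mult_lin_left] d2_lin) simp_all
  show "linear_map k T W (\<lambda>Z. jA a \<triangleright> sB (jB b' \<rhd> m) Z)" by (intro lW_lin sB_lin) simp_all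
  fix a1 b1 assume [simp]: "a1 \<in> carrier A" "b1 \<in> carrier B"
  have "p a \<otimes>\<^bsub>O.D\<^esub> (d2 (a1 \<cdot> b1) \<otimes>\<^bsub>O.D\<^esub> q b') = \<iota>A (a \<otimes>\<^bsub>A\<^esub> a1) \<bullet> (OB.dd b1 \<otimes>\<^bsub>OmB\<^esub> \<iota>B b')"
    by (simp add: O.D_mult_simps OA.iota_mult)
  then show "xi0 (p a \<otimes>\<^bsub>O.D\<^esub> (d2 (a1 \<cdot> b1) \<otimes>\<^bsub>O.D\<^esub> q b')) m = jA a \<triangleright> sB (jB b' \<rhd> m) (a1 \<cdot> b1)"
    by (simp add: xi0_pure ev_values jA_mult W_acts sB_pure)
qed

lemma dD_J_pure:
  assumes [simp]: "a \<in> carrier A" "b \<in> carrier B" "a' \<in> carrier A" "b' \<in> carrier B"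
  shows "dD (a \<cdot> b) \<otimes>\<^bsub>O.D\<^esub> J (a' \<cdot> b') = P a \<otimes>\<^bsub>O.D\<^esub> (J (rr b a') \<otimes>\<^bsub>O.D\<^esub> q b') \<oplus>\<^bsub>O.T\<^esub> p a \<otimes>\<^bsub>O.D\<^esub> (d2 (rr b a') \<otimes>\<^bsub>O.D\<^esub> q b')"
proof -
  have "dD (a \<cdot> b) \<otimes>\<^bsub>O.D\<^esub> J (a' \<cdot> b') = (P a \<otimes>\<^bsub>O.D\<^esub> q b \<oplus>\<^bsub>O.T\<^esub> p a \<otimes>\<^bsub>O.D\<^esub> Q b) \<otimes>\<^bsub>O.D\<^esub> (p a' \<otimes>\<^bsub>O.D\<^esub> q b')"
    by (simp add: O.D_mult_simps dD_pure J_pure)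
  also have "\<dots> = P a \<otimes>\<^bsub>O.D\<^esub> ((q b \<otimes>\<^bsub>O.D\<^esub> p a') \<otimes>\<^bsub>O.D\<^esub> q b') \<oplus>\<^bsub>O.T\<^esub> p a \<otimes>\<^bsub>O.D\<^esub> ((Q b \<otimes>\<^bsub>O.D\<^esub> p a') \<otimes>\<^bsub>O.D\<^esub> q b')"
    by (simp add: O.D_l_distr O.D_assoc)
  finally show ?thesis by (simp add: q_p Q_p)
qed

text \<open>The value is computed in the order A before B, where (d b) a' has become the B-part of
  d(b a'). By \<open>rel\<close> that part acts as \<delta>(b) a', and the Leibniz rule of \<delta>
  reassembles \<delta>(a b). This single formula yields balancing and bilinearity.\<close>

lemma xi0_gen:
  assumes m [simp]: "m \<in> carrier M" and x: "x \<in> carrier T" and y: "y \<in> carrier T"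
  shows "xi0 (dD x \<otimes>\<^bsub>O.D\<^esub> J y) m = dl x (y \<rhd> m)"
proof (rule tensor_ext[OF mA mB mW _ _ _ x])
  show "linear_map k T W (\<lambda>x. xi0 (dD x \<otimes>\<^bsub>O.D\<^esub> J y) m)"
    using y by (intro lin_comp[OF xi0_lin] lin_comp[OF O.D_mult_lin_left] dD_lin) simp_all
  show "linear_map k T W (\<lambda>x. dl x (y \<rhd> m))" using y by (intro dl_l lin_id) simp
  fix a b assume [simp]: "a \<in> carrier A" "b \<in> carrier B"
  show "xi0 (dD (a \<cdot> b) \<otimes>\<^bsub>O.D\<^esub> J y) m = dl (a \<cdot> b) (y \<rhd> m)"
  proof (rule tensor_ext[OF mA mB mW _ _ _ y])
    show "linear_map k T W (\<lambda>y. xi0 (dD (a \<cdot> b) \<otimes>\<^bsub>O.D\<^esub> J y) m)"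
      by (intro lin_comp[OF xi0_lin] lin_comp[OF O.D_mult_lin_right] J_lin) simp_all
    show "linear_map k T W (\<lambda>y. dl (a \<cdot> b) (y \<rhd> m))" by (intro dl_r lM_lin' lin_id) simp_all
    fix a' b' assume [simp]: "a' \<in> carrier A" "b' \<in> carrier B"
    have "xi0 (dD (a \<cdot> b) \<otimes>\<^bsub>O.D\<^esub> J (a' \<cdot> b')) m =
       dl (jA a) (rr b a' \<rhd> jB b' \<rhd> m) \<oplus>\<^bsub>W\<^esub> jA a \<triangleright> sB (jB b' \<rhd> m) (rr b a')"
      by (simp add: dD_J_pure lin_add[OF xi0_lin] xi0_first xi0_second)
    also have "\<dots> = dl (jA a) (jB b \<rhd> jA a' \<rhd> jB b' \<rhd> m) \<oplus>\<^bsub>W\<^esub> jA a \<triangleright> dl (jB b) (jA a' \<rhd> jB b' \<rhd> m)"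
      by (simp add: rel M_acts flip: R_eq_mult)
    also have "\<dots> = dl (jA a \<otimes>\<^bsub>D\<^esub> jB b) ((jA a' \<otimes>\<^bsub>D\<^esub> jB b') \<rhd> m)" by (simp add: dl_mult M_acts)
    finally show "xi0 (dD (a \<cdot> b) \<otimes>\<^bsub>O.D\<^esub> J (a' \<cdot> b')) m = dl (a \<cdot> b) ((a' \<cdot> b') \<rhd> m)" by (simp add: AB)
  qed
qed

text \<open>One-forms are spanned by (d x) y, by \<open>dga_deg_eq\<close>.\<close>

lemma Om_ext:
  assumes H: "Module.module k H" and h: "linear_map k Om H h" and g: "linear_map k Om H g"
    and eq: "\<And>x y. x \<in> carrier T \<Longrightarrow> y \<in> carrier T \<Longrightarrow> h (dD x \<otimes>\<^bsub>O.D\<^esub> J y) = g (dD x \<otimes>\<^bsub>O.D\<^esub> J y)"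
    and \<theta>: "\<theta> \<in> dga_deg G 1"
  shows "h \<theta> = g \<theta>"
proof -
  interpret H: Module.module k H by (rule H)
  \<comment> \<open>The difference is formed in the ambient tensor product; a map given only on
    one-forms respects it by additivity, as the difference is again a one-form.\<close>
  have sub: "l (\<theta>1 \<ominus>\<^bsub>O.T\<^esub> \<theta>2) = l \<theta>1 \<ominus>\<^bsub>H\<^esub> l \<theta>2"
    if l: "linear_map k Om H l" and d: "\<theta>1 \<in> dga_deg G 1" "\<theta>2 \<in> dga_deg G 1" for l \<theta>1 \<theta>2
  proof -
    have dd: "\<theta>1 \<ominus>\<^bsub>O.T\<^esub> \<theta>2 \<in> dga_deg G 1" using d by (rule dga_deg_diff)
    have "\<theta>1 \<ominus>\<^bsub>O.T\<^esub> \<theta>2 \<oplus>\<^bsub>O.T\<^esub> \<theta>2 = \<theta>1" using d by (simp add: OT.minus_eq OT.a_assoc OT.l_neg)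
    then have "l \<theta>1 = l (\<theta>1 \<ominus>\<^bsub>O.T\<^esub> \<theta>2) \<oplus>\<^bsub>H\<^esub> l \<theta>2"
      using lin_add[OF l, of "\<theta>1 \<ominus>\<^bsub>O.T\<^esub> \<theta>2" \<theta>2] dd d by simp
    then show ?thesis using lin_closed[OF l] dd d by (simp add: H.minus_eq H.a_assoc H.r_neg)
  qed
  from \<theta> have "\<theta> \<in> dspan" by (simp add: dga_deg_eq)
  then have "\<theta> \<in> dga_deg G 1 \<and> h \<theta> = g \<theta>"
  proof (induction rule: adspan.induct)
    case zero
    show ?case using lin_zero[OF mOm H h] lin_zero[OF mOm H g] adspan.zero[of O.T] by (simp add: dga_deg_eq)
  next
    case (gen \<theta>) then show ?case using eq by (auto simp: dga_deg_eq intro: dgen)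
  next
    case (diff x y) then show ?case using sub[OF h] sub[OF g] dga_deg_diff by simp
  qed
  then show ?thesis by simp
qed

lemma xi0_bil: "bil k Om M W xi0"
  by (intro bilI xi0_lin' lin_comp[OF xi0_lin Om_inc]) simp_all

lemma mult_Om_left: "z \<in> carrier T \<Longrightarrow> linear_map k Om Om (\<lambda>\<theta>. J z \<otimes>\<^bsub>O.D\<^esub> \<theta>)"
  by (rule lin_Om[OF lin_comp[OF O.D_mult_lin_right Om_inc]]) simp_all
lemma mult_Om_right: "z \<in> carrier T \<Longrightarrow> linear_map k Om Om (\<lambda>\<theta>. \<theta> \<otimes>\<^bsub>O.D\<^esub> J z)"
  by (rule lin_Om[OF lin_comp[OF O.D_mult_lin_left Om_inc]]) simp_all

text \<open>On the spanning forms this is the associativity of (d x) y z.\<close>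

lemma xi0_bal: "\<theta> \<in> dga_deg G 1 \<Longrightarrow> z \<in> carrier T \<Longrightarrow> m \<in> carrier M \<Longrightarrow> xi0 (\<theta> \<otimes>\<^bsub>O.D\<^esub> J z) m = xi0 \<theta> (z \<rhd> m)"
proof (rule Om_ext[OF mW])
  assume [simp]: "z \<in> carrier T" "m \<in> carrier M"
  show "linear_map k Om W (\<lambda>\<theta>. xi0 (\<theta> \<otimes>\<^bsub>O.D\<^esub> J z) m)" "linear_map k Om W (\<lambda>\<theta>. xi0 \<theta> (z \<rhd> m))"
    by (simp_all add: bil_l[OF xi0_bil mult_Om_right] bil_l[OF xi0_bil lin_id])
  fix x y assume [simp]: "x \<in> carrier T" "y \<in> carrier T"
  have "dD x \<otimes>\<^bsub>O.D\<^esub> J y \<otimes>\<^bsub>O.D\<^esub> J z = dD x \<otimes>\<^bsub>O.D\<^esub> J (y \<otimes>\<^bsub>D\<^esub> z)" by (simp add: O.D_assoc J_mult)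
  then show "xi0 (dD x \<otimes>\<^bsub>O.D\<^esub> J y \<otimes>\<^bsub>O.D\<^esub> J z) m = xi0 (dD x \<otimes>\<^bsub>O.D\<^esub> J y) (z \<rhd> m)"
    by (simp add: xi0_gen M_acts)
qed

text \<open>The form z (d x) y equals d(z x) y - (d z) x y, and \<delta> satisfies the matching
  Leibniz rule.\<close>

lemma xi0_left: "\<theta> \<in> dga_deg G 1 \<Longrightarrow> z \<in> carrier T \<Longrightarrow> m \<in> carrier M \<Longrightarrow> xi0 (J z \<otimes>\<^bsub>O.D\<^esub> \<theta>) m = z \<triangleright> xi0 \<theta> m"
proof (rule Om_ext[OF mW])
  assume [simp]: "z \<in> carrier T" "m \<in> carrier M"
  show "linear_map k Om W (\<lambda>\<theta>. xi0 (J z \<otimes>\<^bsub>O.D\<^esub> \<theta>) m)" "linear_map k Om W (\<lambda>\<theta>. z \<triangleright> xi0 \<theta> m)"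
    by (simp_all add: bil_l[OF xi0_bil mult_Om_left] lW_lin bil_l[OF xi0_bil lin_id])
  fix x y assume [simp]: "x \<in> carrier T" "y \<in> carrier T"
  have r: "u \<oplus>\<^bsub>W\<^esub> v \<ominus>\<^bsub>W\<^esub> u = v" if "u \<in> carrier W" "v \<in> carrier W" for u v
    using that by (simp add: W.minus_eq W.a_comm[of u v] W.a_assoc W.r_neg)
  show "xi0 (J z \<otimes>\<^bsub>O.D\<^esub> (dD x \<otimes>\<^bsub>O.D\<^esub> J y)) m = z \<triangleright> xi0 (dD x \<otimes>\<^bsub>O.D\<^esub> J y) m"
    by (simp add: Leibniz_left lin_diff[OF O.mT mW xi0_lin] xi0_gen dl_mult M_acts r)
qed

lemma xi0_right: "\<theta> \<in> dga_deg G 1 \<Longrightarrow> z \<in> carrier T \<Longrightarrow> m \<in> carrier M \<Longrightarrow> xi0 \<theta> (m \<lhd> z) = xi0 \<theta> m \<triangleleft> z"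
proof (rule Om_ext[OF mW])
  assume [simp]: "z \<in> carrier T" "m \<in> carrier M"
  show "linear_map k Om W (\<lambda>\<theta>. xi0 \<theta> (m \<lhd> z))" "linear_map k Om W (\<lambda>\<theta>. xi0 \<theta> m \<triangleleft> z)"
    by (simp_all add: rW_lin bil_l[OF xi0_bil lin_id])
  fix x y assume [simp]: "x \<in> carrier T" "y \<in> carrier T"
  show "xi0 (dD x \<otimes>\<^bsub>O.D\<^esub> J y) (m \<lhd> z) = xi0 (dD x \<otimes>\<^bsub>O.D\<^esub> J y) m \<triangleleft> z"
    by (simp add: xi0_gen dl_right flip: M_acts(3))
qed

section \<open>The induced bimodule map on the tensor product over \<open>D\<close>\<close>

abbreviation "V \<equiv> tensor_over D Om M"
abbreviation "dm \<theta> m \<equiv> tns_over D Om M \<theta> m"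
lemmas mV = tover_module[OF D_algebra Om_bimodule bM] and dm_bil = tover_bil[OF D_algebra Om_bimodule bM]
lemmas V_ext = tover_ext[OF D_algebra Om_bimodule bM]

definition "xi U = tbind W U xi0"

lemma xi_lin: "linear_map k V W xi"
  unfolding xi_def
  by (rule tbind_over_lin[OF D_algebra Om_bimodule bM mW xi0_bil]) (simp add: xi0_bal)
lemma xi_pure: "\<theta> \<in> dga_deg G 1 \<Longrightarrow> m \<in> carrier M \<Longrightarrow> xi (dm \<theta> m) = xi0 \<theta> m"
  unfolding xi_def
  by (rule tbind_over_pure[OF D_algebra Om_bimodule bM mW xi0_bil]) (simp_all add: xi0_bal)

lemma xi_hom: "bimodule_hom k D V W xi"
  unfolding bimodule_hom_def
proof (intro conjI ballI xi_lin)
  fix x U assume "x \<in> carrier D" and U: "U \<in> carrier V"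
  then have x [simp]: "x \<in> carrier T" by simp
  note act = lact_pure[OF D_algebra Om_bimodule bM] ract_pure[OF D_algebra Om_bimodule bM]
  note actl = lact_lin[OF D_algebra Om_bimodule bM] ract_lin[OF D_algebra Om_bimodule bM]
  show "xi (lact V x U) = x \<triangleright> xi U"
    by (rule V_ext[OF mW lin_comp[OF xi_lin actl(1)] lW_lin[OF xi_lin] _ U])
      (simp_all add: act xi_pure xi0_left)
  show "xi (ract V U x) = xi U \<triangleleft> x"
    by (rule V_ext[OF mW lin_comp[OF xi_lin actl(2)] rW_lin[OF xi_lin] _ U])
      (simp_all add: act xi_pure xi0_right)
qed

lemma xi0_dD: "x \<in> carrier T \<Longrightarrow> m \<in> carrier M \<Longrightarrow> xi0 (dD x) m = dl x m"
  using xi0_gen[of m x "\<one>\<^bsub>D\<^esub>"] by (simp add: J_pure OA.iota_one OB.iota_one O_one_right)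

lemma xi_connection: "x \<in> carrier T \<Longrightarrow> m \<in> carrier M \<Longrightarrow> c (x \<rhd> m) = x \<triangleright> c m \<oplus>\<^bsub>W\<^esub> xi (dm (dD x) m)"
  by (simp add: xi_pure xi0_dD c_left)

section \<open>Agreement with the four formulas\<close>

lemma form_A: "a \<in> carrier A \<Longrightarrow> b \<in> carrier B \<Longrightarrow> OA.dd a \<bullet> \<iota>B b = dD (jA a) \<otimes>\<^bsub>O.D\<^esub> J (jB b)"
  by (simp add: dD_a J_pure O.D_mult_simps OA.iota_one)
lemma form_B: "a \<in> carrier A \<Longrightarrow> b \<in> carrier B \<Longrightarrow> \<iota>A a \<bullet> OB.dd b = J (jA a) \<otimes>\<^bsub>O.D\<^esub> dD (jB b)"
  by (simp add: dD_b J_pure O.D_mult_simps OB.iota_one)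

lemma xi_form_A: "a \<in> carrier A \<Longrightarrow> b \<in> carrier B \<Longrightarrow> m \<in> carrier M \<Longrightarrow> xi (dm (OA.dd a \<bullet> \<iota>B b) m) = dl (jA a) (jB b \<rhd> m)"
  by (simp add: form_A xi_pure xi0_gen)
lemma xi_form_B: "a \<in> carrier A \<Longrightarrow> b \<in> carrier B \<Longrightarrow> m \<in> carrier M \<Longrightarrow> xi (dm (\<iota>A a \<bullet> OB.dd b) m) = jA a \<triangleright> dl (jB b) m"
  by (simp add: form_B xi_pure xi0_left xi0_dD)

lemma kE_tbind: "u \<in> carrier EO \<Longrightarrow> b \<in> carrier B \<Longrightarrow> tbind W u (\<lambda>e \<omega>. tw (iE e) (\<omega> \<bullet> \<iota>B b)) = kE u \<triangleleft> jB b"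
  by (rule EO_tbind[OF mW rW_lin[OF kE_lin]]) (simp_all add: kE_pure rW_tw J_pure O.D_mult_simps OA.iota_one)
lemma kF_tbind: "u \<in> carrier FO \<Longrightarrow> a \<in> carrier A \<Longrightarrow> tbind W u (\<lambda>f \<eta>. tw (\<zero>\<^bsub>EB\<^esub>, tns k A F a f) (\<one>\<^bsub>OmA\<^esub> \<bullet> \<eta>)) = jA a \<triangleright> kF u"
  by (rule FO_tbind[OF mW lW_lin[OF kF_lin]]) (simp_all add: kF_pure lW_tw a_iF)

text \<open>By right linearity b is pulled out of \<delta>(\<alpha>) (\<beta> e b). The twisting map
  writes \<beta> e with the element of E in front, and on that element \<delta>(\<alpha>) is given
  by \<phi>.\<close>

lemma xi11:
  assumes [simp]: "\<alpha> \<in> carrier A" "\<beta> \<in> carrier B" "e \<in> carrier E" "b \<in> carrier B"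
  shows "xi (dm (OA.dd \<alpha> \<bullet> \<iota>B \<beta>) (tns k E B e b, \<zero>\<^bsub>AF\<^esub>)) =
    tbind W (te \<beta> e) (\<lambda>e' \<beta>'. tbind W (phi \<alpha> e') (\<lambda>e'' \<omega>. tw (iE e'') (\<omega> \<bullet> \<iota>B (\<beta>' \<otimes>\<^bsub>B\<^esub> b))))"
proof -
  have "tbind W (te \<beta> e) (\<lambda>e' \<beta>'. tbind W (phi \<alpha> e') (\<lambda>e'' \<omega>. tw (iE e'') (\<omega> \<bullet> \<iota>B (\<beta>' \<otimes>\<^bsub>B\<^esub> b)))) =
      dl (jA \<alpha>) (te \<beta> e, \<zero>\<^bsub>AF\<^esub>) \<triangleleft> jB b"
  proof (rule tbind_tensor[OF mE mB mW])
    show "linear_map k EB W (\<lambda>Y. dl (jA \<alpha>) (Y, \<zero>\<^bsub>AF\<^esub>) \<triangleleft> jB b)" by (intro rW_lin dl_r inl_lin) simp_all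
    fix e' \<beta>' assume [simp]: "e' \<in> carrier E" "\<beta>' \<in> carrier B"
    show "tbind W (phi \<alpha> e') (\<lambda>e'' \<omega>. tw (iE e'') (\<omega> \<bullet> \<iota>B (\<beta>' \<otimes>\<^bsub>B\<^esub> b))) = dl (jA \<alpha>) (tns k E B e' \<beta>', \<zero>\<^bsub>AF\<^esub>) \<triangleleft> jB b"
      by (simp add: kE_tbind dl_right dl_values jB_mult W_acts flip: iE_b)
  qed simp
  also have "\<dots> = dl (jA \<alpha>) (jB \<beta> \<rhd> (iE e \<lhd> jB b))"
    by (simp add: M_acts(3)[symmetric] dl_right b_iE[symmetric])
  finally show ?thesis by (simp add: iE_b[symmetric] xi_form_A)
qed

text \<open>Here \<delta>(\<beta>) e = L(\<beta> e) differentiates the coefficients that the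
  twisting map leaves on the right; b and \<alpha> act from outside.\<close>

lemma xi12:
  assumes [simp]: "\<alpha> \<in> carrier A" "\<beta> \<in> carrier B" "e \<in> carrier E" "b \<in> carrier B"
  shows "xi (dm (\<iota>A \<alpha> \<bullet> OB.dd \<beta>) (tns k E B e b, \<zero>\<^bsub>AF\<^esub>)) =
    tbind W (te \<beta> e) (\<lambda>e' \<beta>'. tw (iE (lact E \<alpha> e')) (\<one>\<^bsub>OmA\<^esub> \<bullet> (dga_diff OmB (\<iota>B \<beta>') \<otimes>\<^bsub>OmB\<^esub> \<iota>B b)))"
proof -
  have "tbind W (te \<beta> e) (\<lambda>e' \<beta>'. tw (iE (lact E \<alpha> e')) (\<one>\<^bsub>OmA\<^esub> \<bullet> (dga_diff OmB (\<iota>B \<beta>') \<otimes>\<^bsub>OmB\<^esub> \<iota>B b))) =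
      jA \<alpha> \<triangleright> (L (te \<beta> e, \<zero>\<^bsub>AF\<^esub>) \<triangleleft> jB b)"
  proof (rule tbind_tensor[OF mE mB mW])
    show "linear_map k EB W (\<lambda>Y. jA \<alpha> \<triangleright> (L (Y, \<zero>\<^bsub>AF\<^esub>) \<triangleleft> jB b))" by (intro lW_lin rW_lin lin_comp[OF L_lin] inl_lin) simp_all
    fix e' \<beta>' assume [simp]: "e' \<in> carrier E" "\<beta>' \<in> carrier B"
    have "\<one>\<^bsub>OmA\<^esub> \<bullet> (OB.dd \<beta>' \<otimes>\<^bsub>OmB\<^esub> \<iota>B b) = dD (jB \<beta>') \<otimes>\<^bsub>O.D\<^esub> J (jB b)"
      by (simp add: dD_b J_pure OA.iota_one O.D_mult_simps)
    then show "tw (iE (lact E \<alpha> e')) (\<one>\<^bsub>OmA\<^esub> \<bullet> (dga_diff OmB (\<iota>B \<beta>') \<otimes>\<^bsub>OmB\<^esub> \<iota>B b)) = jA \<alpha> \<triangleright> (L (tns k E B e' \<beta>', \<zero>\<^bsub>AF\<^esub>) \<triangleleft> jB b)"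
      by (simp add: L_values rW_tw lW_tw a_iE OB.diff_iota flip: iE_b)
  qed simp
  also have "\<dots> = jA \<alpha> \<triangleright> dl (jB \<beta>) (iE e \<lhd> jB b)"
    by (simp add: dl_right dl_values b_iE)
  finally show ?thesis by (simp add: iE_b[symmetric] xi_form_B)
qed

text \<open>The first \<sigma> writes a f with the element of F in front, so that its coefficient
  can be pulled out on the right. The second \<sigma> comes from L, which differentiates right
  coefficients and therefore needs \<alpha> moved to the right of \<beta> f.\<close>

lemma xi21:
  assumes [simp]: "\<alpha> \<in> carrier A" "\<beta> \<in> carrier B" "a \<in> carrier A" "f \<in> carrier F"
  shows "xi (dm (OA.dd \<alpha> \<bullet> \<iota>B \<beta>) (\<zero>\<^bsub>EB\<^esub>, tns k A F a f)) =
    tbind W (\<sigma> (tns k A F a f)) (\<lambda>f' a'. tbind W (\<sigma> (tns k A F \<alpha> (lact F \<beta> f'))) (\<lambda>f'' \<alpha>'.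
      tw (iF f'') ((dga_diff OmA (\<iota>A \<alpha>') \<otimes>\<^bsub>OmA\<^esub> \<iota>A a') \<bullet> \<one>\<^bsub>OmB\<^esub>)))"
proof -
  have 1: "tbind W U (\<lambda>f'' \<alpha>'. tw (iF f'') ((dga_diff OmA (\<iota>A \<alpha>') \<otimes>\<^bsub>OmA\<^esub> \<iota>A a') \<bullet> \<one>\<^bsub>OmB\<^esub>)) = L2 U \<triangleleft> jA a'"
    if U: "U \<in> carrier FA" and [simp]: "a' \<in> carrier A" for U a'
  proof (rule tbind_tensor[OF mF mA mW rW_lin[OF L2_lin] _ U])
    fix f'' \<alpha>' assume [simp]: "f'' \<in> carrier F" "\<alpha>' \<in> carrier A"
    have "(OA.dd \<alpha>' \<otimes>\<^bsub>OmA\<^esub> \<iota>A a') \<bullet> \<one>\<^bsub>OmB\<^esub> = dD (jA \<alpha>') \<otimes>\<^bsub>O.D\<^esub> J (jA a')"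
      by (simp add: dD_a J_pure OB.iota_one O.D_mult_simps)
    then show "tw (iF f'') ((dga_diff OmA (\<iota>A \<alpha>') \<otimes>\<^bsub>OmA\<^esub> \<iota>A a') \<bullet> \<one>\<^bsub>OmB\<^esub>) = L2 (tns k F A f'' \<alpha>') \<triangleleft> jA a'"
      by (simp add: L2_pure rW_tw OA.diff_iota)
  qed simp
  have "tbind W (\<sigma> (tns k A F a f)) (\<lambda>f' a'. tbind W (\<sigma> (tns k A F \<alpha> (lact F \<beta> f'))) (\<lambda>f'' \<alpha>'.
      tw (iF f'') ((dga_diff OmA (\<iota>A \<alpha>') \<otimes>\<^bsub>OmA\<^esub> \<iota>A a') \<bullet> \<one>\<^bsub>OmB\<^esub>))) =
      dl (jA \<alpha>) (jB \<beta> \<rhd> (\<zero>\<^bsub>EB\<^esub>, \<tau>FA (\<sigma> (tns k A F a f))))"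
  proof (rule tbind_tensor[OF mF mA mW])
    show "linear_map k FA W (\<lambda>U. dl (jA \<alpha>) (jB \<beta> \<rhd> (\<zero>\<^bsub>EB\<^esub>, \<tau>FA U)))"
      by (intro dl_r lM_lin lin_comp[OF inr_lin] tauF_lin) simp_all
    fix f' a' assume [simp]: "f' \<in> carrier F" "a' \<in> carrier A"
    have "dl (jA \<alpha>) (jB \<beta> \<rhd> (iF f' \<lhd> jA a')) = L (jA \<alpha> \<rhd> iF (lact F \<beta> f')) \<triangleleft> jA a'"
      by (simp add: M_acts(3)[symmetric] dl_right b_iF dl_values)
    then show "tbind W (\<sigma> (tns k A F \<alpha> (lact F \<beta> f'))) (\<lambda>f'' \<alpha>'.
        tw (iF f'') ((dga_diff OmA (\<iota>A \<alpha>') \<otimes>\<^bsub>OmA\<^esub> \<iota>A a') \<bullet> \<one>\<^bsub>OmB\<^esub>)) = dl (jA \<alpha>) (jB \<beta> \<rhd> (\<zero>\<^bsub>EB\<^esub>, tf f' a'))"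
      by (simp add: 1 iF_a a_iF inr_values)
  qed simp
  then show ?thesis by (simp add: xi_form_A flip: a_iF)
qed

text \<open>The relation \<open>rel\<close> turns \<delta>(\<beta>) (a f) into a sum of a'
  \<delta>(\<beta>') f over R(\<beta> \<otimes> a), and on f each \<delta>(\<beta>') is given by
  \<psi>.\<close>

lemma xi22:
  assumes [simp]: "\<alpha> \<in> carrier A" "\<beta> \<in> carrier B" "a \<in> carrier A" "f \<in> carrier F"
  shows "xi (dm (\<iota>A \<alpha> \<bullet> OB.dd \<beta>) (\<zero>\<^bsub>EB\<^esub>, tns k A F a f)) =
    tbind W (rr \<beta> a) (\<lambda>a' \<beta>'. tbind W (\<psi> (tns_over B OmB1 F (dga_diff OmB (\<iota>B \<beta>')) f)) (\<lambda>f' \<eta>. tw (\<zero>\<^bsub>EB\<^esub>, tns k A F (\<alpha> \<otimes>\<^bsub>A\<^esub> a') f') (\<one>\<^bsub>OmA\<^esub> \<bullet> \<eta>)))"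
proof -
  have "tbind W (rr \<beta> a) (\<lambda>a' \<beta>'. tbind W (\<psi> (tns_over B OmB1 F (dga_diff OmB (\<iota>B \<beta>')) f)) (\<lambda>f' \<eta>. tw (\<zero>\<^bsub>EB\<^esub>, tns k A F (\<alpha> \<otimes>\<^bsub>A\<^esub> a') f') (\<one>\<^bsub>OmA\<^esub> \<bullet> \<eta>))) =
      jA \<alpha> \<triangleright> sB (iF f) (rr \<beta> a)"
    by (rule tbind_tensor[OF mA mB mW lW_lin[OF sB_lin]])
      (simp_all add: OB.diff_iota kF_tbind jA_mult W_acts sB_pure dl_values)
  also have "\<dots> = jA \<alpha> \<triangleright> dl (jB \<beta>) (jA a \<rhd> iF f)" by (simp add: rel flip: R_eq_mult)
  finally show ?thesis by (simp add: a_iF[symmetric] xi_form_B)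
qed

lemma xi_is_product_xi: "is_product_xi k A B R Rt E F \<tau>FA \<tau>BE \<phi> \<psi> xi"
  unfolding is_product_xi_def Let_def
  by (intro conjI ballI xi_lin; simp only: OA.diff_iota OB.diff_iota xi11 xi12 xi21 xi22 iE_def iF_def)

lemma form_deg [simp]: "a \<in> carrier A \<Longrightarrow> b \<in> carrier B \<Longrightarrow> OA.dd a \<bullet> \<iota>B b \<in> dga_deg G 1"
  "a \<in> carrier A \<Longrightarrow> b \<in> carrier B \<Longrightarrow> \<iota>A a \<bullet> OB.dd b \<in> dga_deg G 1"
  by (simp_all add: OA.dd_deg OB.dd_deg)

text \<open>The formulas fix the map on (d a) b \<otimes> m and a (d b) \<otimes> m, hence on all d
  x \<otimes> m. Balancing over \<open>D\<close>, which rewrites (d x) y \<otimes> m as d x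
  \<otimes> y m, reaches everything else.\<close>

lemma xi_unique:
  assumes "is_product_xi k A B R Rt E F \<tau>FA \<tau>BE \<phi> \<psi> \<xi>" and U: "U \<in> carrier V"
  shows "\<xi> U = xi U"
proof -
  have x: "is_product_xi k A B R Rt E F \<tau>FA \<tau>BE \<phi> \<psi> xi" by (rule xi_is_product_xi)
  note x1 = assms(1)[unfolded is_product_xi_def Let_def] and x2 = x[unfolded is_product_xi_def Let_def]
  have l: "linear_map k V W \<xi>" using x1 by blast
  have f11: "\<xi> (dm (OA.dd \<alpha> \<bullet> \<iota>B \<beta>) (tns k E B e b, \<zero>\<^bsub>AF\<^esub>)) = xi (dm (OA.dd \<alpha> \<bullet> \<iota>B \<beta>) (tns k E B e b, \<zero>\<^bsub>AF\<^esub>))"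
    and f12: "\<xi> (dm (\<iota>A \<alpha> \<bullet> OB.dd \<beta>) (tns k E B e b, \<zero>\<^bsub>AF\<^esub>)) = xi (dm (\<iota>A \<alpha> \<bullet> OB.dd \<beta>) (tns k E B e b, \<zero>\<^bsub>AF\<^esub>))"
    if "\<alpha> \<in> carrier A" "\<beta> \<in> carrier B" "e \<in> carrier E" "b \<in> carrier B" for \<alpha> \<beta> e b
    using x1 x2 that by (simp_all only: OA.diff_iota[symmetric] OB.diff_iota[symmetric])
  have f21: "\<xi> (dm (OA.dd \<alpha> \<bullet> \<iota>B \<beta>) (\<zero>\<^bsub>EB\<^esub>, tns k A F a f)) = xi (dm (OA.dd \<alpha> \<bullet> \<iota>B \<beta>) (\<zero>\<^bsub>EB\<^esub>, tns k A F a f))"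
    and f22: "\<xi> (dm (\<iota>A \<alpha> \<bullet> OB.dd \<beta>) (\<zero>\<^bsub>EB\<^esub>, tns k A F a f)) = xi (dm (\<iota>A \<alpha> \<bullet> OB.dd \<beta>) (\<zero>\<^bsub>EB\<^esub>, tns k A F a f))"
    if "\<alpha> \<in> carrier A" "\<beta> \<in> carrier B" "a \<in> carrier A" "f \<in> carrier F" for \<alpha> \<beta> a f
    using x1 x2 that by (simp_all only: OA.diff_iota[symmetric] OB.diff_iota[symmetric])
  have dml: "linear_map k M W (\<lambda>m. h (dm \<theta> m))" if "linear_map k V W h" "\<theta> \<in> dga_deg G 1" for h \<theta>
    using that by (intro lin_comp[OF that(1)] bil_r[OF dm_bil lin_id]) simp
  have dmr: "linear_map k Om W (\<lambda>\<theta>. h (dm \<theta> m))" if "linear_map k V W h" "m \<in> carrier M" for h m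
    using that by (intro lin_comp[OF that(1)] bil_l[OF dm_bil lin_id])
  have p: "\<xi> (dm (dD x) m) = xi (dm (dD x) m)" if x: "x \<in> carrier T" and m: "m \<in> carrier M" for x m
  proof (rule tensor_ext[OF mA mB mW lin_comp[OF dmr[OF l m] dD_lin_Om] lin_comp[OF dmr[OF xi_lin m] dD_lin_Om] _ x])
    fix a b assume ab [simp]: "a \<in> carrier A" "b \<in> carrier B"
    have "\<xi> (dm (OA.dd a \<bullet> \<iota>B b) m) = xi (dm (OA.dd a \<bullet> \<iota>B b) m)"
      by (rule M_ext'[OF mW dml[OF l] dml[OF xi_lin] _ _ m]) (simp_all add: f11 f21)
    moreover have "\<xi> (dm (\<iota>A a \<bullet> OB.dd b) m) = xi (dm (\<iota>A a \<bullet> OB.dd b) m)"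
      by (rule M_ext'[OF mW dml[OF l] dml[OF xi_lin] _ _ m]) (simp_all add: f12 f22)
    ultimately show "\<xi> (dm (dD (a \<cdot> b)) m) = xi (dm (dD (a \<cdot> b)) m)"
      using lin_add[OF dmr[OF l m], of "OA.dd a \<bullet> \<iota>B b" "\<iota>A a \<bullet> OB.dd b"]
        lin_add[OF dmr[OF xi_lin m], of "OA.dd a \<bullet> \<iota>B b" "\<iota>A a \<bullet> OB.dd b"] by (simp add: dD_pure)
  qed
  show ?thesis
  proof (rule V_ext[OF mW l xi_lin _ U])
    fix \<theta> m assume "\<theta> \<in> carrier Om" and m [simp]: "m \<in> carrier M"
    then have \<theta>: "\<theta> \<in> dga_deg G 1" by simp
    show "\<xi> (dm \<theta> m) = xi (dm \<theta> m)"
    proof (rule Om_ext[OF mW dmr[OF l m] dmr[OF xi_lin m] _ \<theta>])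
      fix x y assume [simp]: "x \<in> carrier T" "y \<in> carrier T"
      have "dm (dD x \<otimes>\<^bsub>O.D\<^esub> J y) m = dm (dD x) (y \<rhd> m)"
        using tover_bal[OF D_algebra Om_bimodule bM, of "dD x" y m] by simp
      then show "\<xi> (dm (dD x \<otimes>\<^bsub>O.D\<^esub> J y) m) = xi (dm (dD x \<otimes>\<^bsub>O.D\<^esub> J y) m)" by (simp add: p)
    qed
  qed
qed

text \<open>As functions the given \<xi> and \<open>xi\<close> may differ outside the carrier, and
  so may the two forms of the connection; each property is therefore transferred by pointwise
  equality on it.\<close>

lemma product_bimodule_connection:
  assumes \<xi>: "is_product_xi k A B R Rt E F \<tau>FA \<tau>BE \<phi> \<psi> \<xi>"
  shows "bimodule_connection k D G J M (product_connection k A B R Rt E F \<tau>FA \<tau>BE nabE nabF) \<xi>"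
proof -
  let ?c = "product_connection k A B R Rt E F \<tau>FA \<tau>BE nabE nabF"
  note u = xi_unique[OF \<xi>]
  have V: "lact V x U \<in> carrier V" "ract V U x \<in> carrier V" if "x \<in> carrier T" "U \<in> carrier V" for x U
    using bm_lact_closed[OF tover_bimodule[OF D_algebra Om_bimodule bM]]
      bm_ract_closed[OF tover_bimodule[OF D_algebra Om_bimodule bM]] that by simp_all
  have dmc: "dm (dD x) m \<in> carrier V" if "x \<in> carrier T" "m \<in> carrier M" for x m
    using bil_closed[OF dm_bil, of "dD x" m] that by simp
  show ?thesis
    unfolding bimodule_connection_def right_connection_def
  proof (intro conjI ballI)
    show "linear_map k M W ?c" by (rule lin_cong[OF c_lin mM]) (simp add: connection_eq)
    show "?c (m \<lhd> x) = ?c m \<triangleleft> x \<oplus>\<^bsub>W\<^esub> tw m (dga_diff G (J x))" if "m \<in> carrier M" "x \<in> carrier D" for m x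
      using that by (simp add: connection_eq right_conn flip: dD_def)
    show "bimodule_hom k D V W \<xi>"
      unfolding bimodule_hom_def
    proof (intro conjI ballI)
      show "linear_map k V W \<xi>" by (rule lin_cong[OF xi_lin mV]) (simp add: u)
      fix x U assume "x \<in> carrier D" "U \<in> carrier V"
      then show "\<xi> (lact V x U) = x \<triangleright> \<xi> U" "\<xi> (ract V U x) = \<xi> U \<triangleleft> x"
        using xi_hom by (simp_all add: u V bimodule_hom_def)
    qed
    show "?c (x \<rhd> m) = x \<triangleright> ?c m \<oplus>\<^bsub>W\<^esub> \<xi> (dm (dga_diff G (J x)) m)" if "x \<in> carrier D" "m \<in> carrier M" for m x
      using that by (simp add: connection_eq xi_connection u dmc flip: dD_def)
  qed
qed

end

theorem theorem4p3:
  fixes k :: "'k ring"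
    and A :: "('k, 'a) module" and B :: "('k, 'b) module"
    and E :: "('k, 'a, 'e) bimod" and F :: "('k, 'b, 'f) bimod"
    and nabE :: "'e \<Rightarrow> ('e, 'a forms) tens" and nabF :: "'f \<Rightarrow> ('f, 'b forms) tens"
    and \<phi> :: "('a forms, 'e) tens \<Rightarrow> ('e, 'a forms) tens"
    and \<psi> :: "('b forms, 'f) tens \<Rightarrow> ('f, 'b forms) tens"
    and R :: "('b, 'a) tens \<Rightarrow> ('a, 'b) tens"
    and Rt :: "('b forms, 'a forms) tens \<Rightarrow> ('a forms, 'b forms) tens"
    and \<tau>FA :: "('f, 'a) tens \<Rightarrow> ('a, 'f) tens"
    and \<tau>BE :: "('b, 'e) tens \<Rightarrow> ('e, 'b) tens"
  assumes "field k" and "k_algebra k A" and "k_algebra k B"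
    and "bimodule k A E" and "bimodule_connection k A (Omega k A) (iota k A) E nabE \<phi>"
    and "bimodule k B F" and "bimodule_connection k B (Omega k B) (iota k B) F nabF \<psi>"
    and "twisting_map k A B R" and "bij_betw R (carrier (tensor k B A)) (carrier (tensor k A B))"
    and "extended_twisting_map k A B R Rt"
    and "right_module_twisting_map k A B R F \<tau>FA"
    and "bij_betw \<tau>FA (carrier (tensor k F A)) (carrier (tensor k A F))"
    and "\<forall>f \<in> carrier F. \<forall>a \<in> carrier A.
      (let F\<Omega> = tensor_over B F (Omega1 k B); W = tensor k A F\<Omega> in
        tbind W (\<tau>FA (tns k F A f a)) (\<lambda>a1 f1. tns k A F\<Omega> a1 (nabF f1)) =
        tbind W (nabF f) (\<lambda>f1 \<eta>.
        tbind W (Rt_right k A B Rt \<eta> a) (\<lambda>a1 \<eta>1.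
        tbind W (\<tau>FA (tns k F A f1 a1)) (\<lambda>a2 f2.
          tns k A F\<Omega> a2 (tns_over B F (Omega1 k B) f2 \<eta>1)))))"
    and "left_module_twisting_map k A B R E \<tau>BE"
    and "\<forall>b \<in> carrier B. \<forall>e \<in> carrier E.
      (let E\<Omega> = tensor_over A E (Omega1 k A); W = tensor k E\<Omega> B in
        tbind W (\<tau>BE (tns k B E b e)) (\<lambda>e1 b1. tns k E\<Omega> B (nabE e1) b1) =
        tbind W (nabE e) (\<lambda>e1 \<omega>.
        tbind W (\<tau>BE (tns k B E b e1)) (\<lambda>e2 b1.
        tbind W (Rt_left k A B Rt b1 \<omega>) (\<lambda>\<omega>1 b2.
          tns k E\<Omega> B (tns_over A E (Omega1 k A) e2 \<omega>1) b2))))"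
    and "bimodule k (twisted_tensor k A B R) (product_bimodule k A B R E F \<tau>FA \<tau>BE)"
    and "\<forall>b \<in> carrier B. \<forall>\<omega> \<in> carrier (Omega1 k A). \<forall>e \<in> carrier E.
      (let E\<Omega> = tensor_over A E (Omega1 k A); W = tensor k E\<Omega> B in
        tbind W (Rt_left k A B Rt b \<omega>) (\<lambda>\<omega>1 b1.
        tbind W (\<tau>BE (tns k B E b1 e)) (\<lambda>e1 b2.
          tns k E\<Omega> B (\<phi> (tns_over A (Omega1 k A) E \<omega>1 e1)) b2)) =
        tbind W (\<phi> (tns_over A (Omega1 k A) E \<omega> e)) (\<lambda>e1 \<omega>1.
        tbind W (\<tau>BE (tns k B E b e1)) (\<lambda>e2 b1.
        tbind W (Rt_left k A B Rt b1 \<omega>1) (\<lambda>\<omega>2 b2.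
          tns k E\<Omega> B (tns_over A E (Omega1 k A) e2 \<omega>2) b2))))"
    and "\<forall>\<eta> \<in> carrier (Omega1 k B). \<forall>f \<in> carrier F. \<forall>a \<in> carrier A.
      (let F\<Omega> = tensor_over B F (Omega1 k B); W = tensor k A F\<Omega> in
        tbind W (\<tau>FA (tns k F A f a)) (\<lambda>a1 f1.
        tbind W (Rt_right k A B Rt \<eta> a1) (\<lambda>a2 \<eta>1.
          tns k A F\<Omega> a2 (\<psi> (tns_over B (Omega1 k B) F \<eta>1 f1)))) =
        tbind W (\<psi> (tns_over B (Omega1 k B) F \<eta> f)) (\<lambda>f1 \<eta>1.
        tbind W (Rt_right k A B Rt \<eta>1 a) (\<lambda>a1 \<eta>2.
        tbind W (\<tau>FA (tns k F A f1 a1)) (\<lambda>a2 f2.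
          tns k A F\<Omega> a2 (tns_over B F (Omega1 k B) f2 \<eta>2)))))"
  shows "(\<exists>\<xi>. is_product_xi k A B R Rt E F \<tau>FA \<tau>BE \<phi> \<psi> \<xi>) \<and>
    (\<forall>\<xi>. is_product_xi k A B R Rt E F \<tau>FA \<tau>BE \<phi> \<psi> \<xi> \<longrightarrow>
      bimodule_connection k (twisted_tensor k A B R) (twisted_calculus k A B Rt) (twisted_iota k A B)
        (product_bimodule k A B R E F \<tau>FA \<tau>BE)
        (product_connection k A B R Rt E F \<tau>FA \<tau>BE nabE nabF) \<xi>)"
proof -
  have p: "product k A B R Rt E F nabE nabF \<phi> \<psi> \<tau>FA \<tau>BE"
    by (intro product.intro calculus.intro twist.intro calculus_axioms.intro product_axioms.intro) (rule assms)+
  show ?thesis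
    using product.xi_is_product_xi[OF p] product.product_bimodule_connection[OF p] by blast
qed

end
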